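(* Suppose that $\mathbb{P}$ is admissible and that there is a non-random constant $c_0>0$ with $\mathbb{P}[\omega_t(x,y)\ge c_0]=1$ for every $(x,y)\in E_d$ and $t\in\mathbb{R}$. (i) There exists $C<\infty$ such that for any $(0,x)\in E_d$, $y,y'\in\mathbb{Z}^d$ and $t\ge 1$, $$\mathbb{E}\big[|\nabla^1_x p^\omega_{0,t}(y,y')|^2\big]^{1/2}\le C\,t^{-(d+1)/2}.$$ Moreover, the same estimate holds if $\nabla^1_x p^\omega_{0,t}(y,y')$ is replaced by $\nabla^2_x p^\omega_{0,t}(y,y')$. (ii) There exists $C'<\infty$ such that for any $p\in[1,2]$, $(0,x)\in E_d$, $y\in\mathbb{Z}^d$ and $t\ge1$, $$\Big(\sum_{y'\in\mathbb{Z}^d}\mathbb{E}\big[|\nabla^1_x p^\omega_{0,t}(y,y')|^p\big]\Big)^{1/p}\le C'\,t^{-(1+d(1-1/p))/2}.$$ Moreover, the same estimate holds if $\nabla^1_x p^\omega_{0,t}(y,y')$ is replaced by $\nabla^2_x p^\omega_{0,t}(y,y')$. (iii) With the constant $C'$ (chosen so that both (ii) and (iii) hold), for any $(0,x),(0,x')\in E_d$, $y,y'\in\mathbb{Z}^d$ and $t\ge1$, $$\big|\nabla^2_x\nabla^2_{x'}\,\bar p_{0,t}(y,y')\big|\le C'\,t^{-(d+2)/2}\qquad\text{and}\qquad \mathbb{E}\big[|\nabla^1_{-x}\nabla^2_{x'}\,p^\omega_{0,t}(y,y')|\big]\le C'\,t^{-(d+2)/2}.$$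
   Context: Setting. Let $d\ge 1$, let $|\cdot|$ be the graph distance on $\mathbb{Z}^d$ (the $\ell^1$-distance), $E_d=\{(x,y):x,y\in\mathbb{Z}^d,\ |x-y|=1\}$ (oriented nearest-neighbour bonds), and write $x\sim y$ if $(x,y)\in E_d$. Let $\Omega=(0,\infty)^{\mathbb{R}\times E_d}$ with Borel $\sigma$-algebra $\mathcal{F}$; its elements are families $\omega=\{\omega_t(e): e\in E_d, t\in\mathbb{R}\}$ of time-dependent conductances, and $\omega_t(x,y)=0$ if $(x,y)\notin E_d$. Time-space shifts: $(\tau_{s,z}\omega)_t(x,y)=\omega_{t+s}(x+z,y+z)$ for $(s,z)\in\mathbb{R}\times\mathbb{Z}^d$. A probability measure $\mathbb{P}$ on $(\Omega,\mathcal{F})$ (expectation $\mathbb{E}$) is called admissible if: (i) $\mathbb{P}$ is stationary and ergodic with respect to the time-space shifts $\{\tau_{s,z}\}$; (ii) $\mathbb{P}[\omega_t(x,y)=\omega_t(y,x)\ \forall t\in\mathbb{R}]=1$ for all $(x,y)\in E_d$; (iii) $\mathbb{E}[\omega_t(e)]<\infty$ for all $e\in E_d$, $t\in\mathbb{R}$; (iv) for every $A\in\mathcal{F}$ the map $(\omega,t,x)\mapsto \mathbf 1_A(\tau_{t,x}\omega)$ is jointly measurable with respect to $\mathcal{F}\otimes\mathcal{B}(\mathbb{R})\otimes\mathcal{P}(\mathbb{Z}^d)$. Process. For fixed $\omega$, $X=(X_t)_{t\ge s}$ under $\mathrm{P}^\omega_{s,x}$ (expectation $\mathrm{E}^\omega_{s,x}$)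 is the time-inhomogeneous continuous-time Markov chain (variable speed random walk) started at time $s$ in $x\in\mathbb{Z}^d$ with time-dependent generator $(\mathcal{L}^\omega_t f)(x)=\sum_{y\sim x}\omega_t(x,y)(f(y)-f(x))$: if it arrives in $z$ at time $r$, its next jump time $J$ satisfies $\mathrm{P}(J>t)=\exp(-\int_r^t\mu^\omega_u(z)\,du)$, where $\mu^\omega_u(z)=\sum_{y\sim z}\omega_u(z,y)$, and given $J$ it jumps to $y$ with probability $\omega_J(z,y)/\mu^\omega_J(z)$. For admissible $\mathbb{P}$, for $\mathbb{P}$-a.e. $\omega$ the rates are locally integrable in time and the process does not explode. Heat kernels: $p^\omega_{s,t}(x,y)=\mathrm{P}^\omega_{s,x}[X_t=y]$ and $\bar p_{s,t}(x,y)=\mathbb{E}[p^\omega_{s,t}(x,y)]$ for $s\le t$. Discrete derivatives. For $f:\mathbb{Z}^d\to\mathbb{R}$ and $(0,x)\in E_d$, $\nabla_x f(y)=f(x+y)-f(y)$. For $f:\mathbb{Z}^d\times\mathbb{Z}^d\to\mathbb{R}$, $\nabla^1_x$ and $\nabla^2_x$ denote $\nabla_x$ acting on the first, respectively second, variable (the superscript is not an order of differentiation). Thus $\nabla^2_x\nabla^2_{x'}f(y,y')=f(y,x+x'+y')-f(y,x+y')-f(y,x'+y')+f(y,y')$ and $\nabla^1_x\nabla^2_{x'}f(y,y')=f(x+y,x'+y')-f(y,x'+y')-f(x+y,y')+f(y,y')$. *)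

theory Defs
  imports "HOL-Probability.Probability"
begin

section \<open>The lattice and the space of environments\<close>

type_synonym 'd site = "int ^ 'd"

definition l1_dist :: "'d::finite site \<Rightarrow> 'd site \<Rightarrow> int" where
  "l1_dist x y = (\<Sum>i\<in>UNIV. \<bar>x $ i - y $ i\<bar>)"

definition nbr :: "'d::finite site \<Rightarrow> 'd site \<Rightarrow> bool" where
  "nbr x y \<longleftrightarrow> l1_dist x y = 1"

type_synonym 'd env = "real \<Rightarrow> 'd site \<Rightarrow> 'd site \<Rightarrow> real"

text \<open>
  Conductances are extended by zero off the nearest-neighbour bonds, so that \<open>Env\<close> is
  homeomorphic to the product space of all positive functions on (times, bonds). The Borel
  sigma-algebra on the function type is that of the product topology over the uncountable index
  set; it is strictly larger than the product sigma-algebra and contains, for instance, the event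
  that the conductances are symmetric at all times.
\<close>

definition Env :: "'d::finite env set" where
  "Env = {\<omega>. \<forall>t x y. if nbr x y then 0 < \<omega> t x y else \<omega> t x y = 0}"

definition env_shift :: "real \<Rightarrow> 'd::finite site \<Rightarrow> 'd env \<Rightarrow> 'd env" where
  "env_shift s z \<omega> = (\<lambda>t x y. \<omega> (t + s) (x + z) (y + z))"

text \<open>
  The measure is carried by \<^term>\<open>space P\<close>, a shift-invariant set of environments
  with the trace of the Borel sigma-algebra. The choice \<^prop>\<open>space P = Env\<close> is allowed, but on
  it the joint measurability requirement can never hold: the section of the event
  \<open>\<omega> 0 x y > 1\<close> at a fixed environment is \<open>{t. \<omega> t x y > 1}\<close>, which is an arbitrary
  subset of the real line.
\<close>

definition admissible :: "'d::finite env measure \<Rightarrow> bool" where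
  "admissible P \<longleftrightarrow>
     prob_space P \<and>
     space P \<subseteq> Env \<and>
     sets P = sets (restrict_space borel (space P)) \<and>
     (\<forall>s z. env_shift s z \<in> measurable P P \<and> distr P P (env_shift s z) = P) \<and>
     (\<forall>A\<in>sets P. (\<forall>s z. env_shift s z -` A \<inter> space P = A) \<longrightarrow> measure P A = 0 \<or> measure P A = 1) \<and>
     (\<forall>x y. nbr x y \<longrightarrow> (AE \<omega> in P. \<forall>t. \<omega> t x y = \<omega> t y x)) \<and>
     (\<forall>x y t. nbr x y \<longrightarrow> integrable P (\<lambda>\<omega>. \<omega> t x y)) \<and>
     (\<forall>A\<in>sets P. (\<lambda>(\<omega>, t, x). indicator A (env_shift t x \<omega>) :: real)
        \<in> borel_measurable (P \<Otimes>\<^sub>M (borel \<Otimes>\<^sub>M count_space UNIV)))"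


section \<open>The variable speed random walk\<close>

definition total_rate :: "'d::finite env \<Rightarrow> real \<Rightarrow> 'd site \<Rightarrow> real" where
  "total_rate \<omega> t x = (\<Sum>y | nbr x y. \<omega> t x y)"

text \<open>
  Divergence of the integrated rates means that the walk almost surely leaves every site, i.e.
  that all jump times are finite.
\<close>

definition regular_env :: "'d::finite env \<Rightarrow> bool" where
  "regular_env \<omega> \<longleftrightarrow>
     (\<forall>x y. (\<lambda>t. \<omega> t x y) \<in> borel_measurable borel) \<and>
     (\<forall>x r t. set_integrable lborel {r..t} (\<lambda>u. total_rate \<omega> u x)) \<and>
     (\<forall>x r. filterlim (\<lambda>t. LBINT u:{r..t}. total_rate \<omega> u x) at_top at_top)"

text \<open>
  Law of the next jump time after an arrival in \<open>z\<close> at time \<open>r\<close>, given by its distribution function.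
  For \<open>t < r\<close> the integral is over the empty set, so there is no mass before \<open>r\<close>.
\<close>

definition jump_time_law :: "'d::finite env \<Rightarrow> real \<Rightarrow> 'd site \<Rightarrow> real measure" where
  "jump_time_law \<omega> r z = interval_measure (\<lambda>t. 1 - exp (- (LBINT u:{r..t}. total_rate \<omega> u z)))"

definition jump_target :: "'d::finite env \<Rightarrow> real \<Rightarrow> 'd site \<Rightarrow> 'd site pmf" where
  "jump_target \<omega> u z = embed_pmf (\<lambda>y. \<omega> u z y / total_rate \<omega> u z)"

text \<open>
  States are pairs of an arrival time and a site. Outside the regular environments, which form a
  null set, the process is frozen in its initial state by convention.
\<close>

abbreviation states :: "(real \<times> 'd::finite site) measure" where
  "states \<equiv> borel \<Otimes>\<^sub>M count_space UNIV"

definition jump_kernel :: "'d::finite env \<Rightarrow> real \<times> 'd site \<Rightarrow> (real \<times> 'd site) measure" where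
  "jump_kernel \<omega> = (\<lambda>(r, z).
     if regular_env \<omega>
     then jump_time_law \<omega> r z \<bind>
       (\<lambda>u. distr (measure_pmf (jump_target \<omega> u z)) states (\<lambda>y. (u, y)))
     else return states (r, z))"

fun step_kernel ::
  "'d::finite env \<Rightarrow> real \<Rightarrow> 'd site \<Rightarrow> nat \<Rightarrow> (nat \<Rightarrow> real \<times> 'd site) \<Rightarrow> (real \<times> 'd site) measure" where
  "step_kernel \<omega> s x 0 h = return states (s, x)"
| "step_kernel \<omega> s x (Suc n) h = jump_kernel \<omega> (h n)"

text \<open>
  The law of the sequence of arrival times and visited sites, by the Ionescu-Tulcea theorem.
\<close>

definition walk_law :: "'d::finite env \<Rightarrow> real \<Rightarrow> 'd site \<Rightarrow> (nat \<Rightarrow> real \<times> 'd site) measure" where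
  "walk_law \<omega> s x = projective_family.lim UNIV
     (Ionescu_Tulcea.CI (step_kernel \<omega> s x) (\<lambda>_. states)) (\<lambda>_. states)"

text \<open>The event \<open>X\<^sub>t = y\<close>; after an explosion the walk is nowhere.\<close>

definition walk_at :: "(nat \<Rightarrow> real \<times> 'd::finite site) \<Rightarrow> real \<Rightarrow> 'd site \<Rightarrow> bool" where
  "walk_at h t y \<longleftrightarrow> (\<exists>n. fst (h n) \<le> t \<and> t < fst (h (Suc n)) \<and> snd (h n) = y)"

definition heat_kernel ::
  "'d::finite env \<Rightarrow> real \<Rightarrow> real \<Rightarrow> 'd site \<Rightarrow> 'd site \<Rightarrow> real" where
  "heat_kernel \<omega> s t x y = measure (walk_law \<omega> s x) {h \<in> space (walk_law \<omega> s x). walk_at h t y}"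

definition annealed_kernel ::
  "'d::finite env measure \<Rightarrow> real \<Rightarrow> real \<Rightarrow> 'd site \<Rightarrow> 'd site \<Rightarrow> real" where
  "annealed_kernel P s t x y = (\<integral>\<omega>. heat_kernel \<omega> s t x y \<partial>P)"


section \<open>Discrete derivatives\<close>

definition grad :: "'d::finite site \<Rightarrow> ('d site \<Rightarrow> real) \<Rightarrow> 'd site \<Rightarrow> real" where
  "grad x f y = f (x + y) - f y"

definition grad1 ::
  "'d::finite site \<Rightarrow> ('d site \<Rightarrow> 'd site \<Rightarrow> real) \<Rightarrow> 'd site \<Rightarrow> 'd site \<Rightarrow> real" where
  "grad1 x f y y' = grad x (\<lambda>z. f z y') y"

definition grad2 ::
  "'d::finite site \<Rightarrow> ('d site \<Rightarrow> 'd site \<Rightarrow> real) \<Rightarrow> 'd site \<Rightarrow> 'd site \<Rightarrow> real" where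
  "grad2 x f y y' = grad x (\<lambda>z. f y z) y'"


section \<open>The walk is well defined\<close>

text \<open>
  The jump times and jump targets have the prescribed laws, and the kernels satisfy the
  hypotheses of the Ionescu-Tulcea theorem.
\<close>

lemma finite_nbr: "finite {y. nbr x y}"
proof -
  let ?S = "\<lambda>k. {x $ k - 1 .. x $ k + 1}"
  have "{y. nbr x y} \<subseteq> vec_lambda ` (Pi UNIV ?S)"
  proof
    fix y assume "y \<in> {y. nbr x y}"
    then have s: "(\<Sum>i\<in>UNIV. \<bar>x $ i - y $ i\<bar>) = 1" by (simp add: nbr_def l1_dist_def)
    have "y $ k \<in> ?S k" for k
    proof -
      have "\<bar>x $ k - y $ k\<bar> \<le> (\<Sum>i\<in>UNIV. \<bar>x $ i - y $ i\<bar>)"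
        by (rule member_le_sum) auto
      then show ?thesis using s by auto
    qed
    then have "y = vec_lambda (\<lambda>k. y $ k)" "(\<lambda>k. y $ k) \<in> Pi UNIV ?S" by auto
    then show "y \<in> vec_lambda ` (Pi UNIV ?S)" by blast
  qed
  moreover have "finite (Pi UNIV ?S)"
    using finite_PiE[of UNIV ?S] by (simp add: PiE_UNIV_domain)
  ultimately show ?thesis by (meson finite_imageI finite_subset)
qed

lemma nbr_axis: "nbr x (x + axis i 1)"
proof -
  have "(\<Sum>j\<in>UNIV. \<bar>x $ j - (x + axis i 1) $ j\<bar>) = (\<Sum>j\<in>UNIV. if j = i then 1 else 0)"
    by (intro sum.cong) (auto simp: axis_def)
  then show ?thesis by (simp add: nbr_def l1_dist_def)
qed

lemma total_rate_pos:
  assumes "\<omega> \<in> Env"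
  shows "0 < total_rate \<omega> t x"
  unfolding total_rate_def
proof (rule sum_pos[OF finite_nbr])
  show "{y. nbr x y} \<noteq> {}" using nbr_axis by blast
  show "\<And>i. i \<in> {y. nbr x y} \<Longrightarrow> 0 < \<omega> t x i" using assms by (auto simp: Env_def)
qed

lemma nn_integral_jump_target:
  assumes "\<omega> \<in> Env"
  shows "(\<integral>\<^sup>+ y. ennreal (\<omega> t x y / total_rate \<omega> t x) \<partial>count_space UNIV) = 1"
proof -
  have nn: "0 \<le> \<omega> t x y" for y using assms unfolding Env_def by (smt (verit) mem_Collect_eq)
  have z: "\<not> nbr x y \<Longrightarrow> \<omega> t x y = 0" for y using assms unfolding Env_def by auto
  have pos: "0 < total_rate \<omega> t x" by (rule total_rate_pos[OF assms])
  have "(\<integral>\<^sup>+ y. ennreal (\<omega> t x y / total_rate \<omega> t x) \<partial>count_space UNIV)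
     = (\<Sum>y | nbr x y. ennreal (\<omega> t x y / total_rate \<omega> t x))"
    by (rule nn_integral_count_space') (use finite_nbr z in auto)
  also have "\<dots> = ennreal (\<Sum>y | nbr x y. \<omega> t x y / total_rate \<omega> t x)"
    by (rule sum_ennreal) (use nn pos in auto)
  also have "\<dots> = 1" using pos by (simp add: sum_divide_distrib[symmetric] total_rate_def[symmetric])
  finally show ?thesis .
qed

lemma pmf_jump_target:
  assumes "\<omega> \<in> Env"
  shows "pmf (jump_target \<omega> u z) y = \<omega> u z y / total_rate \<omega> u z"
  unfolding jump_target_def
proof (rule pmf_embed_pmf)
  show "0 \<le> \<omega> u z x / total_rate \<omega> u z" for x
    using assms total_rate_pos[OF assms, of u z] unfolding Env_def
    by (smt (verit) mem_Collect_eq divide_nonneg_pos)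
qed (rule nn_integral_jump_target[OF assms])

lemma set_integral_real_empty[simp]: "(LBINT u:{}. (f u::real)) = 0"
  by (simp add: set_lebesgue_integral_def)

lemma integrated_rate_add:
  assumes r: "regular_env \<omega>" and e: "\<omega> \<in> Env" and ab: "a \<le> b" "b \<le> c"
  shows "(LBINT u:{a..c}. total_rate \<omega> u z) = (LBINT u:{a..b}. total_rate \<omega> u z) + (LBINT u:{b..c}. total_rate \<omega> u z)"
proof -
  have si: "set_integrable lborel {r..t} (\<lambda>u. total_rate \<omega> u z)" for r t using r by (auto simp: regular_env_def)
  have "interval_lebesgue_integrable lborel (ereal r) (ereal t) (\<lambda>u. total_rate \<omega> u z)" for r t
  proof -
    have "set_integrable lborel {min r t<..<max r t} (\<lambda>u. total_rate \<omega> u z)"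
      by (rule set_integrable_subset[OF si[of "min r t" "max r t"]]) auto
    then show ?thesis by (auto simp: interval_lebesgue_integrable_def einterval_eq split: if_splits intro: set_integrable_subset[OF si])
  qed
  then have "(LBINT u=ereal a..ereal b. total_rate \<omega> u z) + (LBINT u=ereal b..ereal c. total_rate \<omega> u z) = (LBINT u=ereal a..ereal c. total_rate \<omega> u z)"
    by (intro interval_integral_sum) (auto simp: min_def max_def)
  then show ?thesis using ab by (simp add: interval_integral_Icc)
qed

lemma integrated_rate_nonneg:
  assumes e: "\<omega> \<in> Env" shows "0 \<le> (LBINT u:{a..b}. total_rate \<omega> u z)"
  unfolding set_lebesgue_integral_def
  by (intro Bochner_Integration.integral_nonneg) (use total_rate_pos[OF e] in \<open>auto simp: indicator_def less_imp_le\<close>)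

lemma integrated_rate_mono:
  assumes r: "regular_env \<omega>" and e: "\<omega> \<in> Env" and ab: "b \<le> c"
  shows "(LBINT u:{a..b}. total_rate \<omega> u z) \<le> (LBINT u:{a..c}. total_rate \<omega> u z)"
proof (cases "a \<le> b")
  case True
  show ?thesis using integrated_rate_add[OF r e True ab] integrated_rate_nonneg[OF e, of b c z] by simp
next
  case False then show ?thesis using integrated_rate_nonneg[OF e, of a c z] by simp
qed

lemma integrated_rate_antimono:
  assumes r: "regular_env \<omega>" and e: "\<omega> \<in> Env" and ab: "b \<le> c"
  shows "(LBINT u:{c..a}. total_rate \<omega> u z) \<le> (LBINT u:{b..a}. total_rate \<omega> u z)"
proof (cases "c \<le> a")
  case True
  show ?thesis using integrated_rate_add[OF r e ab True, of z] integrated_rate_nonneg[OF e, of b c z] by simp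
next
  case False then show ?thesis using integrated_rate_nonneg[OF e, of b a z] by simp
qed

lemma integrated_rate_right_cont:
  assumes r: "regular_env \<omega>" and e: "\<omega> \<in> Env"
  shows "continuous (at_right a) (\<lambda>t. LBINT u:{r..t}. total_rate \<omega> u z)"
proof -
  have si: "set_integrable lborel {r..t} (\<lambda>u. total_rate \<omega> u z)" for r t using r by (auto simp: regular_env_def)
  have hi: "(\<lambda>u. total_rate \<omega> u z) integrable_on {r..t}" for r t
    using set_borel_integral_eq_integral[OF si] by blast
  have eq: "(LBINT u:{r..t}. total_rate \<omega> u z) = integral {r..t} (\<lambda>u. total_rate \<omega> u z)" for t
    using set_borel_integral_eq_integral[OF si] by blast
  show ?thesis
  proof (cases "a < r")
    case True
    have "((\<lambda>t. LBINT u:{r..t}. total_rate \<omega> u z) \<longlongrightarrow> 0) (at_right a)"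
      by (rule tendsto_eventually) (use True in \<open>auto simp: eventually_at_right[OF True] intro!: exI[of _ r]\<close>)
    then show ?thesis using True by (simp add: continuous_within)
  next
    case False
    have "continuous_on {r..a+1} (\<lambda>t. integral {r..t} (\<lambda>u. total_rate \<omega> u z))"
      by (rule indefinite_integral_continuous_1[OF hi])
    then have "continuous (at a within {r..a+1}) (\<lambda>t. integral {r..t} (\<lambda>u. total_rate \<omega> u z))"
      using False by (auto simp: continuous_on_eq_continuous_within)
    then have "continuous (at a within {a..a+1}) (\<lambda>t. integral {r..t} (\<lambda>u. total_rate \<omega> u z))"
      by (rule continuous_within_subset) (use False in auto)
    moreover have "at a within {a..a+1} = at_right a"
      by (rule at_within_Icc_at_right) simp
    ultimately show ?thesis by (simp add: eq)
  qed
qed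

lemma jump_time_cdf:
  assumes r: "regular_env \<omega>" and e: "\<omega> \<in> Env"
  shows "\<And>x y. x \<le> y \<Longrightarrow> 1 - exp (- (LBINT u:{r..x}. total_rate \<omega> u z)) \<le> 1 - exp (- (LBINT u:{r..y}. total_rate \<omega> u z))"
    "\<And>a. continuous (at_right a) (\<lambda>t. 1 - exp (- (LBINT u:{r..t}. total_rate \<omega> u z)))"
    "((\<lambda>t. 1 - exp (- (LBINT u:{r..t}. total_rate \<omega> u z))) \<longlongrightarrow> 0) at_bot"
    "((\<lambda>t. 1 - exp (- (LBINT u:{r..t}. total_rate \<omega> u z))) \<longlongrightarrow> 1) at_top"
proof -
  show "x \<le> y \<Longrightarrow> 1 - exp (- (LBINT u:{r..x}. total_rate \<omega> u z)) \<le> 1 - exp (- (LBINT u:{r..y}. total_rate \<omega> u z))" for x y using integrated_rate_mono[OF r e, of x y r z] by simp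
  show "continuous (at_right a) (\<lambda>t. 1 - exp (- (LBINT u:{r..t}. total_rate \<omega> u z)))" for a
    by (intro continuous_intros integrated_rate_right_cont[OF r e])
  show "((\<lambda>t. 1 - exp (- (LBINT u:{r..t}. total_rate \<omega> u z))) \<longlongrightarrow> 0) at_bot"
    by (rule tendsto_eventually) (auto simp: eventually_at_bot_linorder intro!: exI[of _ "r - 1"])
  have "filterlim (\<lambda>t. LBINT u:{r..t}. total_rate \<omega> u z) at_top at_top"
    using r by (auto simp: regular_env_def)
  then have "((\<lambda>t. exp (- (LBINT u:{r..t}. total_rate \<omega> u z))) \<longlongrightarrow> 0) at_top"
    by (intro filterlim_compose[OF exp_at_bot] filterlim_compose[OF filterlim_uminus_at_bot_at_top])
  from tendsto_diff[OF tendsto_const[of 1] this] show "((\<lambda>t. 1 - exp (- (LBINT u:{r..t}. total_rate \<omega> u z))) \<longlongrightarrow> 1) at_top" by simp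
qed

lemma prob_space_jump_time_law:
  assumes "regular_env \<omega>" "\<omega> \<in> Env"
  shows "prob_space (jump_time_law \<omega> r z)"
proof -
  interpret real_distribution "jump_time_law \<omega> r z"
    unfolding jump_time_law_def
    by (rule real_distribution_interval_measure) (use jump_time_cdf[OF assms] in auto)
  show ?thesis by unfold_locales
qed

lemma jump_time_law_tail:
  assumes "regular_env \<omega>" "\<omega> \<in> Env"
  shows "measure (jump_time_law \<omega> r z) {t<..} = exp (- (LBINT u:{r..t}. total_rate \<omega> u z))"
proof -
  interpret prob_space "jump_time_law \<omega> r z" by (rule prob_space_jump_time_law[OF assms])
  have "measure (jump_time_law \<omega> r z) {..t} = 1 - exp (- (LBINT u:{r..t}. total_rate \<omega> u z))"
    unfolding jump_time_law_def by (rule measure_interval_measure_Iic) (use jump_time_cdf[OF assms] in auto)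
  moreover have "{t<..} = space (jump_time_law \<omega> r z) - {..t}" by (auto simp: jump_time_law_def)
  ultimately show ?thesis using prob_compl[of "{..t}"] by (simp add: jump_time_law_def)
qed

lemma measurable_jump_time_law:
  assumes "regular_env \<omega>" "\<omega> \<in> Env"
  shows "(\<lambda>r. jump_time_law \<omega> r z) \<in> borel \<rightarrow>\<^sub>M prob_algebra borel"
proof (rule measurable_prob_algebra_generated[where \<Omega>=UNIV and G="range (\<lambda>a::real. {..a})"])
  show "sets borel = sigma_sets UNIV (range (\<lambda>a::real. {..a}))" by (subst borel_eq_atMost) simp
  show "Int_stable (range (\<lambda>a::real. {..a}))" by (auto simp: Int_stable_def min_def intro!: exI[of _ "min _ _"])
  show "prob_space (jump_time_law \<omega> a z)" for a by (rule prob_space_jump_time_law[OF assms])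
  show "sets (jump_time_law \<omega> a z) = sets borel" for a by (simp add: jump_time_law_def)
  fix A assume "A \<in> range (\<lambda>a::real. {..a})"
  then obtain t where A: "A = {..t}" by auto
  have "emeasure (jump_time_law \<omega> a z) A = 1 - exp (- (LBINT u:{a..t}. total_rate \<omega> u z))" for a
    unfolding A jump_time_law_def by (rule emeasure_interval_measure_Iic) (use jump_time_cdf[OF assms] in auto)
  moreover have "(\<lambda>a. ennreal (1 - exp (- (LBINT u:{a..t}. total_rate \<omega> u z)))) \<in> borel_measurable borel"
  proof -
    have "(\<lambda>a. - (LBINT u:{a..t}. total_rate \<omega> u z)) \<in> borel_measurable borel"
      by (rule borel_measurable_mono) (use integrated_rate_antimono[OF assms] in \<open>auto simp: mono_def\<close>)
    then show ?thesis by measurable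
  qed
  ultimately show "(\<lambda>a. emeasure (jump_time_law \<omega> a z) A) \<in> borel_measurable borel" by simp
qed auto

lemma measurable_jump_target:
  assumes r: "regular_env \<omega>" and e: "\<omega> \<in> Env"
  shows "(\<lambda>u. measure_pmf (jump_target \<omega> u z)) \<in> borel \<rightarrow>\<^sub>M prob_algebra (count_space UNIV)"
proof (rule measurable_prob_algebraI)
  show "prob_space (measure_pmf (jump_target \<omega> u z))" for u by (rule measure_pmf.prob_space_axioms)
  have m[measurable]: "(\<lambda>t. \<omega> t x y) \<in> borel_measurable borel" for x y using r by (auto simp: regular_env_def)
  have [measurable]: "(\<lambda>u. pmf (jump_target \<omega> u z) y) \<in> borel_measurable borel" for y
    unfolding pmf_jump_target[OF e] total_rate_def by measurable
  show "(\<lambda>u. measure_pmf (jump_target \<omega> u z)) \<in> borel \<rightarrow>\<^sub>M subprob_algebra (count_space UNIV)"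
  proof (rule measurable_subprob_algebra)
    show "subprob_space (measure_pmf (jump_target \<omega> u z))" for u
      by (simp add: measure_pmf.prob_space_axioms prob_space_imp_subprob_space)
    fix A :: "'a site set"
    have "emeasure (measure_pmf (jump_target \<omega> u z)) A = (\<Sum>y\<in>{y. nbr z y} \<inter> A. ennreal (pmf (jump_target \<omega> u z) y))" for u
    proof -
      have "emeasure (measure_pmf (jump_target \<omega> u z)) A = (\<integral>\<^sup>+y. ennreal (pmf (jump_target \<omega> u z) y) \<partial>count_space A)"
        by (simp add: nn_integral_pmf)
      also have "\<dots> = (\<Sum>y\<in>{y. nbr z y} \<inter> A. ennreal (pmf (jump_target \<omega> u z) y))"
        by (rule nn_integral_count_space')
          (use finite_nbr[of z] e in \<open>auto simp: pmf_jump_target[OF e] Env_def\<close>)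
      finally show ?thesis .
    qed
    then show "(\<lambda>u. emeasure (measure_pmf (jump_target \<omega> u z)) A) \<in> borel_measurable borel" by simp
  qed simp
qed

lemma measurable_jump_kernel:
  assumes e: "\<omega> \<in> Env"
  shows "jump_kernel \<omega> \<in> states \<rightarrow>\<^sub>M prob_algebra states"
proof (cases "regular_env \<omega>")
  case r: True
  have "(\<lambda>x. jump_kernel \<omega> (fst x, snd x)) \<in> states \<rightarrow>\<^sub>M prob_algebra states"
  proof (rule measurable_compose_countable'[where I=UNIV and g=snd and f="\<lambda>z x. jump_kernel \<omega> (fst x, z)"])
    fix z
    have [measurable]: "(\<lambda>u. measure_pmf (jump_target \<omega> u z)) \<in> borel \<rightarrow>\<^sub>M prob_algebra (count_space UNIV)"
      by (rule measurable_jump_target[OF r e])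
    have [measurable]: "(\<lambda>r. jump_time_law \<omega> r z) \<in> borel \<rightarrow>\<^sub>M prob_algebra borel"
      by (rule measurable_jump_time_law[OF r e])
    have [measurable]: "(\<lambda>u. distr (measure_pmf (jump_target \<omega> u z)) states (\<lambda>y. (u, y))) \<in> borel \<rightarrow>\<^sub>M prob_algebra states"
      by (rule measurable_distr_prob_space2[where M="count_space UNIV"]) measurable
    have "(\<lambda>x. jump_time_law \<omega> (fst x) z \<bind> (\<lambda>u. distr (measure_pmf (jump_target \<omega> u z)) states (\<lambda>y. (u, y)))) \<in> states \<rightarrow>\<^sub>M prob_algebra states"
      by (rule measurable_bind_prob_space[where N=borel]) measurable
    then show "(\<lambda>x. jump_kernel \<omega> (fst x, z)) \<in> states \<rightarrow>\<^sub>M prob_algebra states"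
      using r by (simp add: jump_kernel_def)
  qed auto
  then show ?thesis by simp
next
  case False
  then have "jump_kernel \<omega> = return states" by (auto simp: jump_kernel_def fun_eq_iff)
  then show ?thesis by simp
qed

lemma Ionescu_Tulcea_step_kernel:
  assumes e: "\<omega> \<in> Env"
  shows "Ionescu_Tulcea (step_kernel \<omega> s x) (\<lambda>_. states)"
proof -
  have *: "step_kernel \<omega> s x i \<in> PiM {0..<i} (\<lambda>_. states) \<rightarrow>\<^sub>M prob_algebra states" for i
  proof (cases i)
    case 0
    then have "step_kernel \<omega> s x i = (\<lambda>_. return states (s, x))" by auto
    moreover have "return states (s, x) \<in> space (prob_algebra states)"
      by (simp add: space_prob_algebra prob_space_return space_pair_measure)
    ultimately show ?thesis by simp
  next
    case (Suc n)
    then have "step_kernel \<omega> s x i = (\<lambda>h. jump_kernel \<omega> (h n))" by auto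
    moreover have "(\<lambda>h. jump_kernel \<omega> (h n)) \<in> PiM {0..<i} (\<lambda>_. states) \<rightarrow>\<^sub>M prob_algebra states"
      by (rule measurable_compose[OF _ measurable_jump_kernel[OF e]]) (auto intro!: measurable_component_singleton simp: Suc)
    ultimately show ?thesis by simp
  qed
  show ?thesis
  proof (rule Ionescu_Tulcea.intro)
    show "step_kernel \<omega> s x i \<in> PiM {0..<i} (\<lambda>_. states) \<rightarrow>\<^sub>M subprob_algebra states" for i
      by (rule measurable_prob_algebraD[OF *])
    fix i and h :: "nat \<Rightarrow> real \<times> 'a site" assume h: "h \<in> space (PiM {0..<i} (\<lambda>_. states))"
    show "prob_space (step_kernel \<omega> s x i h)"
      using measurable_space[OF * h] by (simp add: space_prob_algebra)
  qed
qed

end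

theory Submission
  imports Defs
begin

text \<open>
  The walk has symmetric rates, bounded below by \<open>c0\<close>. Nash's inequality and the energy identity give,
  in almost every fixed environment, the on-diagonal decay
  \<open>(\<Sum>y. (p s t x y)\<^sup>2) \<le> C (t - s) powr (- d / 2)\<close> (\<open>energy_decay\<close>). The energy identity also says
  that the Dirichlet form, integrated over the time interval \<open>[t / 2, t]\<close>, is at most the energy at
  time \<open>t / 2\<close>; by ellipticity it is at least \<open>c0\<close> times the sum over \<open>y\<close> of the squared gradients of the kernel
  in its end point. Averaged over times in \<open>[t / 2, t]\<close>, this sum is thus of order
  \<open>t powr (- 1 - d / 2)\<close>. In a fixed environment such an average says nothing about the single
  time \<open>t\<close>, but the expectation of the sum is nonincreasing in time: by the Chapman-Kolmogorov equation the
  kernel over a long time is an average of kernels over a shorter and later time, and stationarity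
  makes these equal in law to the kernel started from the origin at time zero (\<open>grad_sum_mono\<close>,
  \<open>square_grad_sum_bound\<close>).

  The counterpart for absolute values, with the order \<open>t powr (- 1 / 2)\<close>, has the same structure, with
  Nash's entropy argument in the role of the energy identity. The entropy produced during
  \<open>[t / 2, t]\<close> bounds the time integral of the Fisher information, and up to constants it is bounded by the
  logarithm of the first moment at time \<open>t\<close> divided by \<open>sqrt t\<close>. Conversely, Young's inequality bounds
  the growth of the first moment by the Fisher information and by the mean total rate, which does
  not depend on time. Because of the logarithm this circle closes: the first moment is of order
  \<open>sqrt t\<close> (\<open>mean_moment_diffusive\<close>), the entropy production is bounded, and the absolute
  gradients are of the stated order (\<open>abs_grad_sum_bound\<close>).

  Everything else follows from these two gradient sums and the on-diagonal decay. Exponents between 1 and 2 are interpolated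
  (\<open>powr_grad_sum_decay\<close>). Cutting the time interval in its midpoint gives a bound at a single end
  point by Cauchy-Schwarz (\<open>square_grad_pointwise\<close>), and writes a mixed derivative as a sum of
  products of a gradient in the starting point and a gradient in the end point
  (\<open>mixed_grad_decay\<close>). Gradients in the starting point are gradients in the end point for the
  rates run backwards in time, which satisfy the same hypotheses (\<open>reversed\<close>, \<open>p_reversed\<close>).
  Finally, the averaged kernel depends only on the difference of its arguments, so
  its second derivative in the end point is the expectation of a mixed derivative
  (\<open>mixed_grad_estimate\<close>).

  The heat kernel, given through the jump chain, is expanded in the number of jumps
  (\<open>heat_kernel_eq_kern\<close>). This expansion yields the Chapman-Kolmogorov equation, the behaviour under
  time reversal, and the forward equation integrated over time. As the rates are merely
  measurable in time, nonlinear functions of the kernel are differentiated along the forward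
  equation by a chain rule for absolutely continuous functions (\<open>ac_chain_rule\<close>).
\<close>



section \<open>From the walk to iterated jump kernels\<close>

text \<open>
  A projective limit agrees with the finite products of kernels on functions of finitely many
  coordinates; this reduces expectations under the law of the walk to iterated kernels.
\<close>

lemma walk_law_prefix:
  fixes \<omega> :: "'d::finite env"
  assumes e: "\<omega> \<in> Env" and f[measurable]: "f \<in> borel_measurable (PiM {0..<m} (\<lambda>_. states))"
  shows "(\<integral>\<^sup>+h. f (restrict h {0..<m}) \<partial>walk_law \<omega> s x)
    = (\<integral>\<^sup>+h. f h \<partial>Ionescu_Tulcea.C (step_kernel \<omega> s x) (\<lambda>_. states) 0 m (\<lambda>_. undefined))"
proof -
  interpret IT: Ionescu_Tulcea "step_kernel \<omega> s x" "\<lambda>_. states"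
    by (rule Ionescu_Tulcea_step_kernel[OF e])
  have up: "IT.up_to {0..<m} = m"
    using IT.up_to_iff_Ico[of "{0..<m}"] by (metis antisym order_refl finite_atLeastLessThan atLeastLessThan_subset_iff bot_nat_0.extremum_uniqueI not_le bot_nat_0.extremum)
  have "IT.CI {0..<m} = IT.C 0 m (\<lambda>_. undefined)"
    unfolding IT.CI_def up using IT.distr_C[of m m "\<lambda>_. undefined" 0] by (simp add: space_PiM)
  then have d: "distr IT.PF.lim (PiM {0..<m} (\<lambda>_. states)) (\<lambda>x. restrict x {0..<m}) = IT.C 0 m (\<lambda>_. undefined)"
    using IT.distr_lim[of "{0..<m}"] by simp
  show ?thesis
    unfolding walk_law_def d[symmetric]
    by (subst nn_integral_distr) (auto intro!: measurable_restrict measurable_component_singleton simp: measurable_cong_sets[OF IT.PF.sets_lim])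
qed

lemma sets_walk_law: "\<omega> \<in> Env \<Longrightarrow> sets (walk_law \<omega> s x) = sets (PiM UNIV (\<lambda>_. states))"
proof -
  assume e: "\<omega> \<in> Env"
  interpret IT: Ionescu_Tulcea "step_kernel \<omega> s x" "\<lambda>_. states"
    by (rule Ionescu_Tulcea_step_kernel[OF e])
  show ?thesis by (simp add: walk_law_def)
qed

lemma space_walk_law: "\<omega> \<in> Env \<Longrightarrow> space (walk_law \<omega> s x) = UNIV"
  by (subst sets_eq_imp_space_eq[OF sets_walk_law]) (auto simp: space_PiM space_pair_measure)

lemma nn_integral_walk_law_initial:
  fixes \<omega> :: "'d::finite env"
  assumes e: "\<omega> \<in> Env" and g[measurable]: "g \<in> borel_measurable states"
  shows "(\<integral>\<^sup>+h. g (h 0) \<partial>walk_law \<omega> s x) = g (s, x)"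
proof -
  interpret IT: Ionescu_Tulcea "step_kernel \<omega> s x" "\<lambda>_. states"
    by (rule Ionescu_Tulcea_step_kernel[OF e])
  have "(\<integral>\<^sup>+h. g (h 0) \<partial>walk_law \<omega> s x) = (\<integral>\<^sup>+h. g ((restrict h {0..<Suc 0}) 0) \<partial>walk_law \<omega> s x)" by simp
  also have "\<dots> = (\<integral>\<^sup>+h. g (h 0) \<partial>IT.C 0 (Suc 0) (\<lambda>_. undefined))"
    by (rule walk_law_prefix[OF e]) measurable
  also have "\<dots> = (\<integral>\<^sup>+h. g (h 0) \<partial>IT.eP 0 (\<lambda>_. undefined))"
    using bind_return[OF IT.measurable_eP[of 0], of "\<lambda>_. undefined"] by (simp add: space_PiM)
  also have "\<dots> = g (s, x)"
    by (subst IT.nn_integral_eP) (auto simp: space_PiM space_pair_measure nn_integral_return)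
  finally show ?thesis .
qed

text \<open>
  The Markov property of the jump chain: the kernel that adds the last coordinate depends on
  the past only through the coordinate before it.
\<close>

lemma nn_integral_walk_law_step:
  fixes \<omega> :: "'d::finite env"
  assumes e: "\<omega> \<in> Env" and f[measurable]: "f \<in> borel_measurable (states \<Otimes>\<^sub>M states)"
  shows "(\<integral>\<^sup>+h. f (h n, h (Suc n)) \<partial>walk_law \<omega> s x)
    = (\<integral>\<^sup>+h. (\<integral>\<^sup>+b. f (h n, b) \<partial>jump_kernel \<omega> (h n)) \<partial>walk_law \<omega> s x)"
proof -
  interpret IT: Ionescu_Tulcea "step_kernel \<omega> s x" "\<lambda>_. states"
    by (rule Ionescu_Tulcea_step_kernel[OF e])
  have mj[measurable]: "jump_kernel \<omega> \<in> states \<rightarrow>\<^sub>M subprob_algebra states"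
    by (rule measurable_prob_algebraD[OF measurable_jump_kernel[OF e]])
  let ?u = "\<lambda>_. undefined"
  let ?f' = "\<lambda>h. (\<integral>\<^sup>+b. f (h n, b) \<partial>jump_kernel \<omega> (h n))"
  have m2: "(\<lambda>h. f (h n, h (Suc n))) \<in> borel_measurable (PiM {0..<Suc (Suc n)} (\<lambda>_. states))"
    by measurable
  have mh: "(\<lambda>h. h n) \<in> PiM {0..<Suc n} (\<lambda>_. states) \<rightarrow>\<^sub>M states" by measurable
  have m1: "?f' \<in> borel_measurable (PiM {0..<Suc n} (\<lambda>_. states))"
    by (rule nn_integral_measurable_subprob_algebra2[where N=states])
       (use mh in \<open>measurable\<close>)
  have "(\<integral>\<^sup>+h. f (h n, h (Suc n)) \<partial>walk_law \<omega> s x)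
     = (\<integral>\<^sup>+h. f (restrict h {0..<Suc (Suc n)} n, restrict h {0..<Suc (Suc n)} (Suc n)) \<partial>walk_law \<omega> s x)" by simp
  also have "\<dots> = (\<integral>\<^sup>+h. f (h n, h (Suc n)) \<partial>IT.C 0 (Suc (Suc n)) ?u)"
    by (rule walk_law_prefix[OF e m2])
  also have "\<dots> = (\<integral>\<^sup>+h. (\<integral>\<^sup>+h'. f (h' n, h' (Suc n)) \<partial>IT.eP (Suc n) h) \<partial>IT.C 0 (Suc n) ?u)"
    apply (subst IT.C.simps(2))
    apply (subst nn_integral_bind[where B="PiM {0..<Suc (Suc n)} (\<lambda>_. states)"])
      apply (rule m2)
     apply (subst measurable_cong_sets[OF IT.sets_C refl])
      apply (simp add: space_PiM)
     apply (use IT.measurable_eP[of "Suc n"] in simp)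
    apply simp
    done
  also have "\<dots> = (\<integral>\<^sup>+h. ?f' h \<partial>IT.C 0 (Suc n) ?u)"
  proof (rule nn_integral_cong)
    fix h assume "h \<in> space (IT.C 0 (Suc n) ?u)"
    then have h: "h \<in> space (PiM {0..<Suc n} (\<lambda>_. states))"
      by (subst (asm) IT.space_C) (auto simp: space_PiM)
    show "(\<integral>\<^sup>+h'. f (h' n, h' (Suc n)) \<partial>IT.eP (Suc n) h) = ?f' h"
      by (subst IT.nn_integral_eP[OF h m2]) simp
  qed
  also have "\<dots> = (\<integral>\<^sup>+h. ?f' (restrict h {0..<Suc n}) \<partial>walk_law \<omega> s x)"
    by (rule walk_law_prefix[OF e m1, symmetric])
  finally show ?thesis by simp
qed

definition jump_op :: "'d::finite env \<Rightarrow> (real \<times> 'd site \<Rightarrow> ennreal) \<Rightarrow> real \<times> 'd site \<Rightarrow> ennreal" where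
  "jump_op \<omega> g b = (\<integral>\<^sup>+c. g c \<partial>jump_kernel \<omega> b)"

lemma measurable_jump_op:
  assumes e: "\<omega> \<in> Env" and g[measurable]: "g \<in> borel_measurable states"
  shows "jump_op \<omega> g \<in> borel_measurable states"
proof -
  have mj[measurable]: "jump_kernel \<omega> \<in> states \<rightarrow>\<^sub>M subprob_algebra states"
    by (rule measurable_prob_algebraD[OF measurable_jump_kernel[OF e]])
  show ?thesis unfolding jump_op_def
    by (rule nn_integral_measurable_subprob_algebra2[where N=states]) measurable
qed

lemma nn_integral_walk_law_component:
  fixes \<omega> :: "'d::finite env"
  assumes e: "\<omega> \<in> Env" and g: "g \<in> borel_measurable states"
  shows "(\<integral>\<^sup>+h. g (h n) \<partial>walk_law \<omega> s x) = (jump_op \<omega> ^^ n) g (s, x)"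
  using g
proof (induction n arbitrary: g)
  case 0 then show ?case using nn_integral_walk_law_initial[OF e] by simp
next
  case (Suc n)
  note [measurable] = Suc.prems
  have "(\<integral>\<^sup>+h. g (h (Suc n)) \<partial>walk_law \<omega> s x) = (\<integral>\<^sup>+h. jump_op \<omega> g (h n) \<partial>walk_law \<omega> s x)"
    using nn_integral_walk_law_step[OF e, where f="\<lambda>(b, c). g c" and n=n and s=s and x=x] by (simp add: jump_op_def)
  also have "\<dots> = (jump_op \<omega> ^^ n) (jump_op \<omega> g) (s, x)"
    by (rule Suc.IH[OF measurable_jump_op[OF e Suc.prems]])
  finally show ?case by (simp add: funpow_swap1)
qed

text \<open>
  Integrated against the law of the \<open>n\<close>-th state, this weight gives the probability that the walk
  is in \<open>y\<close> at time \<open>t\<close> after exactly \<open>n\<close> jumps.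
\<close>

definition stay_weight :: "'d::finite env \<Rightarrow> real \<Rightarrow> 'd site \<Rightarrow> real \<times> 'd site \<Rightarrow> ennreal" where
  "stay_weight \<omega> t y b = indicator {c. fst c \<le> t \<and> snd c = y} b * emeasure (jump_kernel \<omega> b) {c. t < fst c}"

lemma sets_states_Collect [measurable]:
  "{c. fst c \<le> t \<and> snd c = y} \<in> sets states"
  "{c. t < fst c} \<in> sets states"
proof -
  have "{c \<in> space states. fst c \<le> t \<and> snd c = y} \<in> sets states" by measurable
  then show "{c. fst c \<le> t \<and> snd c = y} \<in> sets states" by (simp add: space_pair_measure)
  have "{c \<in> space states. t < fst c} \<in> sets states" by measurable
  then show "{c. t < fst c} \<in> sets states" by (simp add: space_pair_measure)
qed

lemma measurable_stay_weight:
  assumes e: "\<omega> \<in> Env" shows "stay_weight \<omega> t y \<in> borel_measurable states"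
proof -
  have mj[measurable]: "jump_kernel \<omega> \<in> states \<rightarrow>\<^sub>M subprob_algebra states"
    by (rule measurable_prob_algebraD[OF measurable_jump_kernel[OF e]])
  have "(\<lambda>b. emeasure (jump_kernel \<omega> b) {c. t < fst c}) \<in> borel_measurable states"
    by (rule measurable_emeasure_kernel[OF mj]) measurable
  then show ?thesis unfolding stay_weight_def by measurable
qed

lemma emeasure_jump_interval:
  fixes \<omega> :: "'d::finite env"
  assumes e: "\<omega> \<in> Env"
  shows "{h. fst (h n) \<le> t \<and> t < fst (h (Suc n)) \<and> snd (h n) = y} \<in> sets (walk_law \<omega> s x)" (is "?E \<in> _")
    and "emeasure (walk_law \<omega> s x) {h. fst (h n) \<le> t \<and> t < fst (h (Suc n)) \<and> snd (h n) = y}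
      = (jump_op \<omega> ^^ n) (stay_weight \<omega> t y) (s, x)"
proof -
  note [measurable_cong] = sets_walk_law[OF e]
  have mn[measurable]: "(\<lambda>h. h n) \<in> walk_law \<omega> s x \<rightarrow>\<^sub>M states" for n
    by (subst measurable_cong_sets[OF sets_walk_law[OF e] refl]) measurable
  have "{h \<in> space (walk_law \<omega> s x). fst (h n) \<le> t \<and> t < fst (h (Suc n)) \<and> snd (h n) = y} \<in> sets (walk_law \<omega> s x)"
    by measurable
  then show E: "?E \<in> sets (walk_law \<omega> s x)" by (simp add: space_walk_law[OF e])
  let ?f = "\<lambda>(b, c). indicator {c. fst c \<le> t \<and> snd c = y} b * indicator {c. t < fst c} c :: ennreal"
  have "emeasure (walk_law \<omega> s x) ?E = (\<integral>\<^sup>+h. ?f (h n, h (Suc n)) \<partial>walk_law \<omega> s x)"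
    by (subst nn_integral_indicator[symmetric, OF E]) (auto intro!: nn_integral_cong split: split_indicator)
  also have "\<dots> = (\<integral>\<^sup>+h. (\<integral>\<^sup>+c. ?f (h n, c) \<partial>jump_kernel \<omega> (h n)) \<partial>walk_law \<omega> s x)"
    by (rule nn_integral_walk_law_step[OF e]) measurable
  also have "\<dots> = (\<integral>\<^sup>+h. stay_weight \<omega> t y (h n) \<partial>walk_law \<omega> s x)"
  proof (rule nn_integral_cong)
    fix h
    have s: "sets (jump_kernel \<omega> (h n)) = sets states"
      using measurable_space[OF measurable_jump_kernel[OF e], of "h n"] by (simp add: space_prob_algebra space_pair_measure)
    have [measurable]: "{c. t < fst c} \<in> sets (jump_kernel \<omega> (h n))" unfolding s by measurable
    show "(\<integral>\<^sup>+c. ?f (h n, c) \<partial>jump_kernel \<omega> (h n)) = stay_weight \<omega> t y (h n)"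
      by (simp add: stay_weight_def nn_integral_cmult)
  qed
  also have "\<dots> = (jump_op \<omega> ^^ n) (stay_weight \<omega> t y) (s, x)"
    by (rule nn_integral_walk_law_component[OF e measurable_stay_weight[OF e]])
  finally show "emeasure (walk_law \<omega> s x) ?E = (jump_op \<omega> ^^ n) (stay_weight \<omega> t y) (s, x)" .
qed

text \<open>
  The distribution function of the jump time vanishes up to the arrival time.
\<close>

lemma AE_jump_kernel_later:
  fixes \<omega> :: "'d::finite env"
  assumes e: "\<omega> \<in> Env" shows "AE c in jump_kernel \<omega> b. fst b \<le> fst c"
proof (cases "regular_env \<omega>")
  case r: True
  obtain r0 z where b: "b = (r0, z)" by (cases b)
  have "emeasure (jump_time_law \<omega> r0 z) {..r0} = 1 - exp (- (LBINT u:{r0..r0}. total_rate \<omega> u z))"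
    unfolding jump_time_law_def by (rule emeasure_interval_measure_Iic) (use jump_time_cdf[OF r e] in auto)
  also have "\<dots> = 0" 
  proof -
    have "(LBINT u:{r0..r0}. total_rate \<omega> u z) = 0"
      unfolding set_lebesgue_integral_def
      by (rule integral_eq_zero_AE) (use AE_lborel_singleton[of r0] in \<open>eventually_elim, auto\<close>)
    then show ?thesis by simp
  qed
  finally have n0: "emeasure (jump_time_law \<omega> r0 z) {..r0} = 0" .
  have ae: "AE u in jump_time_law \<omega> r0 z. r0 \<le> u"
    by (rule AE_I[OF _ n0]) (auto simp: jump_time_law_def)
  have m1: "(\<lambda>u. measure_pmf (jump_target \<omega> u z)) \<in> borel \<rightarrow>\<^sub>M prob_algebra (count_space UNIV)"
    by (rule measurable_jump_target[OF r e])
  have m2: "(\<lambda>u. distr (measure_pmf (jump_target \<omega> u z)) states (\<lambda>y. (u, y))) \<in> borel \<rightarrow>\<^sub>M subprob_algebra states"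
    by (rule measurable_prob_algebraD, rule measurable_distr_prob_space2[where M="count_space UNIV"]) (use m1 in measurable)
  have "{c \<in> space states. r0 \<le> fst c} \<in> sets (states :: (real \<times> 'd site) measure)" by measurable
  then have m4: "{c. r0 \<le> fst c} \<in> sets (states :: (real \<times> 'd site) measure)" by (simp add: space_pair_measure)
  have m3: "(\<lambda>u. distr (measure_pmf (jump_target \<omega> u z)) states (\<lambda>y. (u, y))) \<in> jump_time_law \<omega> r0 z \<rightarrow>\<^sub>M subprob_algebra states"
    using m2 by (subst measurable_cong_sets[of _ borel]) (auto simp: jump_time_law_def)
  have "(AE c in (jump_time_law \<omega> r0 z \<bind> (\<lambda>u. distr (measure_pmf (jump_target \<omega> u z)) states (\<lambda>y. (u, y)))). r0 \<le> fst c)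
    \<longleftrightarrow> (AE u in jump_time_law \<omega> r0 z. AE c in distr (measure_pmf (jump_target \<omega> u z)) states (\<lambda>y. (u, y)). r0 \<le> fst c)"
    by (rule AE_bind[OF m3]) measurable
  moreover have "AE u in jump_time_law \<omega> r0 z. AE c in distr (measure_pmf (jump_target \<omega> u z)) states (\<lambda>y. (u, y)). r0 \<le> fst c"
    using ae by eventually_elim (subst AE_distr_iff; use m4 in \<open>auto simp: space_pair_measure\<close>)
  ultimately have "AE c in (jump_time_law \<omega> r0 z \<bind> (\<lambda>u. distr (measure_pmf (jump_target \<omega> u z)) states (\<lambda>y. (u, y)))). r0 \<le> fst c"
    by blast
  moreover have eq: "jump_kernel \<omega> (r0, z) = jump_time_law \<omega> r0 z \<bind> (\<lambda>u. distr (measure_pmf (jump_target \<omega> u z)) states (\<lambda>y. (u, y)))"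
    using r b by (simp add: jump_kernel_def)
  ultimately show ?thesis unfolding b fst_conv eq by blast
next
  case False
  then have eq: "jump_kernel \<omega> b = return states b" by (cases b) (simp add: jump_kernel_def)
  have "{c \<in> space states. fst b \<le> fst c} \<in> sets (states :: (real \<times> 'd site) measure)" by measurable
  then show ?thesis unfolding eq by (subst AE_return) (auto simp: space_pair_measure pred_def)
qed

text \<open>
  After its \<open>n\<close>-th jump the walk sits at the arrival site during a half-open time interval. Since
  the arrival times almost surely do not decrease, the intervals of different \<open>n\<close> are disjoint, and
  the probabilities add up.
\<close>

lemma heat_kernel_eq_suminf:
  fixes \<omega> :: "'d::finite env"
  assumes e: "\<omega> \<in> Env"
  shows "ennreal (heat_kernel \<omega> s t x y) = (\<Sum>n. (jump_op \<omega> ^^ n) (stay_weight \<omega> t y) (s, x))"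
proof -
  interpret IT: Ionescu_Tulcea "step_kernel \<omega> s x" "\<lambda>_. states"
    by (rule Ionescu_Tulcea_step_kernel[OF e])
  define M where "M = walk_law \<omega> s x"
  have spM: "space M = UNIV" by (simp add: M_def space_walk_law[OF e])
  have setsM: "sets M = sets (PiM UNIV (\<lambda>_. states))" by (simp add: M_def sets_walk_law[OF e])
  have mn[measurable]: "(\<lambda>h. h n) \<in> M \<rightarrow>\<^sub>M states" for n
    by (subst measurable_cong_sets[OF setsM refl]) measurable
  have pM: "emeasure M (space M) = 1"
    using nn_integral_walk_law_initial[OF e, of "\<lambda>_. 1" s x] by (simp add: M_def)
  interpret M: prob_space M by (rule prob_spaceI[OF pM])
  define E where "E n = {h. fst (h n) \<le> t \<and> t < fst (h (Suc n)) \<and> snd (h n) = y}" for n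
  have sE[measurable]: "E n \<in> sets M" for n unfolding E_def M_def by (rule emeasure_jump_interval(1)[OF e])
  define G where "G = {h \<in> space M. \<forall>n. fst (h n) \<le> fst (h (Suc n))}"
  have [measurable]: "(\<lambda>h. fst (h n)) \<in> borel_measurable M" for n by measurable
  have [measurable]: "Measurable.pred M (\<lambda>h. fst (h n) \<le> fst (h (Suc n)))" for n
    unfolding pred_def by (rule borel_measurable_le) simp_all
  have sG[measurable]: "G \<in> sets M" unfolding G_def by measurable
  have "AE h in M. fst (h n) \<le> fst (h (Suc n))" for n
  proof -
    let ?f = "\<lambda>(b::real \<times> 'd site, c::real \<times> 'd site). indicator {p. fst (snd p) < fst (fst p)} (b, c) :: ennreal"
    have mf: "?f \<in> borel_measurable (states \<Otimes>\<^sub>M states)"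
    proof -
      have "{p \<in> space (states \<Otimes>\<^sub>M states). fst (snd p) < fst (fst p)} \<in> sets (states \<Otimes>\<^sub>M (states :: (real \<times> 'd site) measure))" by measurable
      then have "{p. fst (snd p) < fst (fst p)} \<in> sets (states \<Otimes>\<^sub>M (states :: (real \<times> 'd site) measure))" by (simp add: space_pair_measure)
      then show ?thesis by simp
    qed
    have "(\<integral>\<^sup>+h. ?f (h n, h (Suc n)) \<partial>M) = (\<integral>\<^sup>+h. (\<integral>\<^sup>+c. ?f (h n, c) \<partial>jump_kernel \<omega> (h n)) \<partial>M)"
      unfolding M_def by (rule nn_integral_walk_law_step[OF e mf])
    also have "\<dots> = (\<integral>\<^sup>+h. (\<integral>\<^sup>+c. 0 \<partial>jump_kernel \<omega> (h n)) \<partial>M)"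
    proof (rule nn_integral_cong, rule nn_integral_cong_AE)
      fix h :: "nat \<Rightarrow> real \<times> 'd site" show "AE c in jump_kernel \<omega> (h n). ?f (h n, c) = 0"
        using AE_jump_kernel_later[OF e, of "h n"] by eventually_elim (auto split: split_indicator)
    qed
    finally have "(\<integral>\<^sup>+h. ?f (h n, h (Suc n)) \<partial>M) = 0" by simp
    moreover have "(\<lambda>h. ?f (h n, h (Suc n))) \<in> borel_measurable M"
      by (rule measurable_compose[OF _ mf]) measurable
    ultimately have "AE h in M. ?f (h n, h (Suc n)) = 0"
      by (subst (asm) nn_integral_0_iff_AE) auto
    then show ?thesis by eventually_elim (auto split: split_indicator_asm)
  qed
  then have aeG: "AE h in M. h \<in> G" unfolding G_def by (simp add: AE_all_countable spM)
  have mono: "fst (h i) \<le> fst (h j)" if "h \<in> G" "i \<le> j" for h i j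
    using lift_Suc_mono_le[of "\<lambda>n. fst (h n)" i j] that by (auto simp: G_def)
  have dis: "disjoint_family (\<lambda>n. E n \<inter> G)"
    unfolding disjoint_family_on_def
  proof (intro ballI impI)
    have *: "E m \<inter> G \<inter> (E n \<inter> G) = {}" if "m < n" for m n
      using mono[of _ "Suc m" n] that by (auto simp: E_def) fastforce
    fix m n :: nat assume "m \<noteq> n" then show "E m \<inter> G \<inter> (E n \<inter> G) = {}"
      using *[of m n] *[of n m] by (cases "m < n") auto
  qed
  have "ennreal (heat_kernel \<omega> s t x y) = emeasure M (\<Union>n. E n)"
    unfolding heat_kernel_def M_def[symmetric] M.emeasure_eq_measure[symmetric]
    by (rule arg_cong[where f="emeasure M"]) (auto simp: walk_at_def E_def spM)
  also have "\<dots> = emeasure M (\<Union>n. E n \<inter> G)"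
    by (rule emeasure_eq_AE) (use aeG in auto)
  also have "\<dots> = (\<Sum>n. emeasure M (E n \<inter> G))"
    by (rule suminf_emeasure[symmetric]) (use dis in auto)
  also have "\<dots> = (\<Sum>n. emeasure M (E n))"
    by (intro suminf_cong emeasure_eq_AE) (use aeG in auto)
  also have "\<dots> = (\<Sum>n. (jump_op \<omega> ^^ n) (stay_weight \<omega> t y) (s, x))"
    unfolding E_def M_def by (intro suminf_cong emeasure_jump_interval(2)[OF e])
  finally show ?thesis .
qed


section \<open>Sums over countable types\<close>

text \<open>
  Sums over sites and over numbers of jumps are integrals over counting measures with values in
  \<open>ennreal\<close>: they always exist, and Tonelli's theorem applies to all of them.
\<close>

abbreviation esum :: "('a \<Rightarrow> ennreal) \<Rightarrow> ennreal" (binder \<open>\<Sigma>\<^sup>+\<close> 10) where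
  "esum f \<equiv> nn_integral (count_space UNIV) f"

lemma nn_integral_esum:
  fixes f :: "'i::countable \<Rightarrow> 'a \<Rightarrow> ennreal"
  assumes "\<And>i. f i \<in> borel_measurable M"
  shows "(\<integral>\<^sup>+x. (\<Sigma>\<^sup>+i. f i x) \<partial>M) = (\<Sigma>\<^sup>+i. \<integral>\<^sup>+x. f i x \<partial>M)"
  by (rule nn_integral_count_space_nn_integral) (use assms in auto)

lemma esum_commute:
  fixes f :: "'i::countable \<Rightarrow> 'j \<Rightarrow> ennreal"
  shows "(\<Sigma>\<^sup>+i. \<Sigma>\<^sup>+j. f i j) = (\<Sigma>\<^sup>+j. \<Sigma>\<^sup>+i. f i j)"
  by (rule nn_integral_esum[symmetric]) auto

lemma measurable_esum [measurable (raw)]: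
  fixes f :: "'i::countable \<Rightarrow> 'a \<Rightarrow> ennreal"
  assumes f: "\<And>i. f i \<in> borel_measurable M"
  shows "(\<lambda>x. \<Sigma>\<^sup>+i. f i x) \<in> borel_measurable M"
proof -
  have "(\<lambda>x. \<Sigma>\<^sup>+i. f i x) = (\<lambda>x. \<Sum>n. if n \<in> range (to_nat :: 'i \<Rightarrow> nat) then f (from_nat n) x else 0)"
  proof
    fix x
    have "(\<Sigma>\<^sup>+i. f i x) = (\<integral>\<^sup>+n. f (from_nat n) x \<partial>count_space (range (to_nat :: 'i \<Rightarrow> nat)))"
      by (subst nn_integral_bij_count_space[symmetric, of to_nat UNIV]) (auto simp: bij_betw_def)
    also have "\<dots> = (\<integral>\<^sup>+n. (if n \<in> range (to_nat :: 'i \<Rightarrow> nat) then f (from_nat n) x else 0) \<partial>count_space UNIV)"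
      by (subst nn_integral_count_space_indicator) (auto intro!: nn_integral_cong split: split_indicator)
    finally show "(\<Sigma>\<^sup>+i. f i x) = (\<Sum>n. if n \<in> range (to_nat :: 'i \<Rightarrow> nat) then f (from_nat n) x else 0)"
      by (simp add: nn_integral_count_space_nat)
  qed
  then show ?thesis using f by simp
qed

lemma esum_shift:
  fixes c :: "'a::ab_group_add"
  shows "(\<Sigma>\<^sup>+z. f (z + c)) = (\<Sigma>\<^sup>+z. f z)" "(\<Sigma>\<^sup>+z. f (c + z)) = (\<Sigma>\<^sup>+z. f z)"
    "(\<Sigma>\<^sup>+z. f (z - c)) = (\<Sigma>\<^sup>+z. f z)" "(\<Sigma>\<^sup>+z. f (c - z)) = (\<Sigma>\<^sup>+z. f z)" "(\<Sigma>\<^sup>+z. f (- z)) = (\<Sigma>\<^sup>+z. f z)"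
proof -
  have "bij (\<lambda>z. z + c)" by (rule o_bij[of "\<lambda>z. z - c"]) (auto simp: fun_eq_iff)
  from nn_integral_bij_count_space[OF this, of f] show 1: "(\<Sigma>\<^sup>+z. f (z + c)) = (\<Sigma>\<^sup>+z. f z)" .
  then show "(\<Sigma>\<^sup>+z. f (c + z)) = (\<Sigma>\<^sup>+z. f z)" by (simp add: add.commute)
  have "bij (\<lambda>z. z - c)" by (rule o_bij[of "\<lambda>z. z + c"]) (auto simp: fun_eq_iff)
  from nn_integral_bij_count_space[OF this, of f] show "(\<Sigma>\<^sup>+z. f (z - c)) = (\<Sigma>\<^sup>+z. f z)" .
  have "bij (\<lambda>z. c - z)" by (rule o_bij[of "\<lambda>z. c - z"]) (auto simp: fun_eq_iff)
  from nn_integral_bij_count_space[OF this, of f] show "(\<Sigma>\<^sup>+z. f (c - z)) = (\<Sigma>\<^sup>+z. f z)" .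
  have "bij (uminus :: 'a \<Rightarrow> 'a)" by (rule o_bij[of uminus]) (auto simp: fun_eq_iff)
  from nn_integral_bij_count_space[OF this, of f] show "(\<Sigma>\<^sup>+z. f (- z)) = (\<Sigma>\<^sup>+z. f z)" .
qed

lemma esum_delta:
  "(\<Sigma>\<^sup>+z. (if z = x then f z else 0)) = f x" "(\<Sigma>\<^sup>+z. (if x = z then f z else 0)) = f x"
proof -
  have "(\<Sigma>\<^sup>+z. (if z = x then f z else 0)) = (\<Sum>z\<in>{x}. (if z = x then f z else 0))"
    by (rule nn_integral_count_space') auto
  then show "(\<Sigma>\<^sup>+z. (if z = x then f z else 0)) = f x" by simp
  then show "(\<Sigma>\<^sup>+z. (if x = z then f z else 0)) = f x" by (simp add: eq_commute)
qed

lemma esum_delta_mult: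
  "(\<Sigma>\<^sup>+z. f z * (if z = x then g z else 0)) = f x * g x" "(\<Sigma>\<^sup>+z. f z * (if x = z then g z else 0)) = f x * g x"
  "(\<Sigma>\<^sup>+z. (if z = x then g z else 0) * f z) = g x * f x" "(\<Sigma>\<^sup>+z. (if x = z then g z else 0) * f z) = g x * f x"
  using esum_delta[of x "\<lambda>z. f z * g z"] esum_delta[of x "\<lambda>z. g z * f z"]
  by (auto simp: if_distrib[of "\<lambda>c. _ * c"] if_distrib[of "\<lambda>c. c * _"] cong: if_cong)

lemma esum_cmult: "(\<Sigma>\<^sup>+z. c * f z) = c * (\<Sigma>\<^sup>+z. f z)" "(\<Sigma>\<^sup>+z. f z * c) = (\<Sigma>\<^sup>+z. f z) * c"
  by (simp_all add: nn_integral_cmult nn_integral_multc)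

lemma esum_add: "(\<Sigma>\<^sup>+z. f z + g z) = (\<Sigma>\<^sup>+z. f z) + (\<Sigma>\<^sup>+z. g z)"
  by (simp add: nn_integral_add)

lemma esum_convolution:
  fixes c d :: "nat \<Rightarrow> ennreal"
  shows "(\<Sigma>\<^sup>+n. \<Sum>i\<le>n. c i * d (n - i)) = (\<Sigma>\<^sup>+n. c n) * (\<Sigma>\<^sup>+n. d n)"
proof -
  have "(\<Sum>i\<le>n. c i * d (n - i)) = (\<Sigma>\<^sup>+i. c i * (if i \<le> n then d (n - i) else 0))" for n
  proof -
    have "(\<Sigma>\<^sup>+i. c i * (if i \<le> n then d (n - i) else 0)) = (\<Sum>i\<le>n. c i * (if i \<le> n then d (n - i) else 0))"
      by (rule nn_integral_count_space') auto
    then show ?thesis by simp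
  qed
  then have "(\<Sigma>\<^sup>+n. \<Sum>i\<le>n. c i * d (n - i)) = (\<Sigma>\<^sup>+i. \<Sigma>\<^sup>+n. c i * (if i \<le> n then d (n - i) else 0))"
    by (subst esum_commute) simp
  also have "\<dots> = (\<Sigma>\<^sup>+i. c i * (\<Sigma>\<^sup>+n. (if i \<le> n then d (n - i) else 0)))" by (simp add: esum_cmult)
  also have "\<dots> = (\<Sigma>\<^sup>+i. c i * (\<Sigma>\<^sup>+n. d n))"
  proof (rule nn_integral_cong, rule arg_cong[where f="\<lambda>x. _ * x"])
    fix i :: nat
    have b: "bij_betw (\<lambda>n. n + i) UNIV {i..}"
      by (rule bij_betwI[where g="\<lambda>n. n - i"]) auto
    have "(\<Sigma>\<^sup>+n. d n) = (\<integral>\<^sup>+n. d (n - i) \<partial>count_space {i..})"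
      using nn_integral_bij_count_space[OF b, of "\<lambda>n. d (n - i)"] by simp
    also have "\<dots> = (\<Sigma>\<^sup>+n. (if i \<le> n then d (n - i) else 0))"
      by (subst nn_integral_count_space_indicator) (auto intro!: nn_integral_cong split: split_indicator)
    finally show "(\<Sigma>\<^sup>+n. (if i \<le> n then d (n - i) else 0)) = (\<Sigma>\<^sup>+n. d n)" by simp
  qed
  finally show ?thesis by (simp add: esum_cmult)
qed


section \<open>A chain rule for absolutely continuous functions\<close>

text \<open>
  Cut the interval at the points where \<open>G\<close> has gained an \<open>n\<close>-th part of its total increment \<open>g\<close>. On each
  piece \<open>D\<close> changes by at most \<open>K * (g / n)\<^sup>2\<close>, hence by at most \<open>K * g\<^sup>2 / n\<close> altogether, and this tends to
  zero.
\<close>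

lemma const_of_quadratic_increments:
  fixes D G :: "real \<Rightarrow> real"
  assumes st: "s \<le> t" and cont: "continuous_on {s..t} G"
    and mono: "\<And>a b. s \<le> a \<Longrightarrow> a \<le> b \<Longrightarrow> b \<le> t \<Longrightarrow> G a \<le> G b"
    and D: "\<And>a b. s \<le> a \<Longrightarrow> a \<le> b \<Longrightarrow> b \<le> t \<Longrightarrow> \<bar>D b - D a\<bar> \<le> K * (G b - G a)\<^sup>2"
  shows "D t = D s"
proof -
  define g where "g = G t - G s"
  have g: "0 \<le> g" using mono[of s t] st by (simp add: g_def)
  have Gt: "G t = G s + g" by (simp add: g_def)
  have bound: "\<bar>D t - D s\<bar> \<le> K * g\<^sup>2 / real n" if n: "n > 0" for n :: nat
  proof -
    have "\<exists>v. s \<le> v \<and> v \<le> t \<and> G v = G s + real k / real n * g" if "k \<le> n" for k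
    proof (rule IVT')
      show "G s \<le> G s + real k / real n * g" using g by simp
      have "real k / real n \<le> 1" using that n by simp
      from mult_right_mono[OF this g] show "G s + real k / real n * g \<le> G t" unfolding Gt by linarith
    qed (fact st, fact cont)
    then have "\<forall>k\<in>{..n}. \<exists>v. s \<le> v \<and> v \<le> t \<and> G v = G s + real k / real n * g" by blast
    from bchoice[OF this] obtain v where v': "\<forall>k\<in>{..n}. s \<le> v k \<and> v k \<le> t \<and> G (v k) = G s + real k / real n * g"
      by (rule exE)
    have v: "s \<le> v k \<and> v k \<le> t \<and> G (v k) = G s + real k / real n * g" if "k \<le> n" for k
      using bspec[OF v', of k] that by simp
    \<comment> \<open>Equal values of \<open>G\<close> force equal values of \<open>D\<close>, whatever the order of the points.\<close>
    have eq: "D a = D b" if "s \<le> a" "a \<le> t" "s \<le> b" "b \<le> t" "G a = G b" for a b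
    proof -
      have z: "K * (G b - G a)\<^sup>2 = 0" "K * (G a - G b)\<^sup>2 = 0" using that(5) by simp_all
      show ?thesis
      proof (cases "a \<le> b")
        case True
        from D[OF that(1) True that(4)] show ?thesis unfolding z by simp
      next
        case False
        then have "b \<le> a" by simp
        from D[OF that(3) this that(2)] show ?thesis unfolding z by simp
      qed
    qed
    have step: "\<bar>D (v (Suc k)) - D (v k)\<bar> \<le> K * (g / real n)\<^sup>2" if "Suc k \<le> n" for k
    proof -
      have "G (v (Suc k)) - G (v k) = (real (Suc k) / real n - real k / real n) * g"
        using v[of k] v[of "Suc k"] that unfolding left_diff_distrib by linarith
      also have "real (Suc k) / real n - real k / real n = 1 / real n" by (simp add: diff_divide_distrib[symmetric])
      finally have d: "G (v (Suc k)) - G (v k) = g / real n" by simp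
      show ?thesis
      proof (cases "v k \<le> v (Suc k)")
        case True
        have "s \<le> v k" "v (Suc k) \<le> t" using v[of k] v[of "Suc k"] that by auto
        from D[OF this(1) True this(2)] show ?thesis unfolding d .
      next
        case False
        then have "G (v (Suc k)) \<le> G (v k)" using mono[of "v (Suc k)" "v k"] v[of k] v[of "Suc k"] that by simp
        then have z: "g / real n = 0" using d divide_nonneg_nonneg[OF g, of "real n"] by linarith
        have e: "D (v (Suc k)) = D (v k)"
          using v[of k] v[of "Suc k"] that d z by (intro eq) linarith+
        show ?thesis unfolding z e by simp
      qed
    qed
    have "\<bar>D (v k) - D (v 0)\<bar> \<le> real k * (K * (g / real n)\<^sup>2)" if "k \<le> n" for k
      using that
    proof (induction k)
      case (Suc k)
      then have "\<bar>D (v k) - D (v 0)\<bar> \<le> real k * (K * (g / real n)\<^sup>2)" "\<bar>D (v (Suc k)) - D (v k)\<bar> \<le> K * (g / real n)\<^sup>2"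
        using step[of k] by auto
      then show ?case unfolding of_nat_Suc distrib_right mult_1_left by linarith
    qed simp
    from this[of n] have "\<bar>D (v n) - D (v 0)\<bar> \<le> K * g\<^sup>2 / real n"
      using n by (simp add: power_divide power2_eq_square)
    moreover have "D (v n) = D t" using v[of n] n st Gt by (intro eq) auto
    moreover have "D (v 0) = D s" using v[of 0] st by (intro eq) auto
    ultimately show ?thesis by simp
  qed
  have "(\<lambda>n. K * g\<^sup>2 / real n) \<longlonglongrightarrow> 0" by (rule lim_const_over_n)
  then have "\<bar>D t - D s\<bar> \<le> 0"
    by (rule tendsto_lowerbound) (auto intro!: eventually_sequentiallyI[of 1] bound)
  then show ?thesis by simp
qed

text \<open>
  The function \<open>q\<close> need not be differentiable at any given time. The defect
  \<open>\<phi> (q v) - (LBINT u:{s..v}. \<phi>' (q u) * q' u)\<close> changes, by the mean value theorem and the Lipschitz bound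
  on \<open>\<phi>'\<close>, at most by a multiple of the squared integral of \<open>\<bar>q'\<bar>\<close>, and is therefore constant.
\<close>

lemma ac_chain_rule:
  fixes q q' \<phi> \<phi>' :: "real \<Rightarrow> real"
  assumes st: "s \<le> t"
    and int: "set_integrable lborel {s..t} q'"
    and q: "\<And>v. s \<le> v \<Longrightarrow> v \<le> t \<Longrightarrow> q v = q s + (LBINT u:{s..v}. q' u)"
    and range: "\<And>v. s \<le> v \<Longrightarrow> v \<le> t \<Longrightarrow> q v \<in> {lo..hi}"
    and der: "\<And>x. x \<in> {lo..hi} \<Longrightarrow> (\<phi> has_real_derivative \<phi>' x) (at x within {lo..hi})"
    and lip: "\<And>x y. x \<in> {lo..hi} \<Longrightarrow> y \<in> {lo..hi} \<Longrightarrow> \<bar>\<phi>' x - \<phi>' y\<bar> \<le> L * \<bar>x - y\<bar>"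
  shows "set_integrable lborel {s..t} (\<lambda>u. \<phi>' (q u) * q' u)"
    and "(LBINT u:{s..t}. \<phi>' (q u) * q' u) = \<phi> (q t) - \<phi> (q s)"
proof -
  have L: "0 \<le> L" if "lo < hi" using lip[of lo hi] that
    by (smt (verit) atLeastAtMost_iff mult_neg_pos zero_less_mult_iff)
  have L0: "\<exists>L\<ge>0. \<forall>x\<in>{lo..hi}. \<forall>y\<in>{lo..hi}. \<bar>\<phi>' x - \<phi>' y\<bar> \<le> L * \<bar>x - y\<bar>"
  proof (cases "lo < hi")
    case True then show ?thesis using L lip by blast
  next
    case False
    then have xy: "x = y" if "x \<in> {lo..hi}" "y \<in> {lo..hi}" for x y using that by auto
    show ?thesis
    proof (intro exI[of _ 0] conjI ballI)
      fix x y assume "x \<in> {lo..hi}" "y \<in> {lo..hi}"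
      then have "x = y" by (rule xy)
      then show "\<bar>\<phi>' x - \<phi>' y\<bar> \<le> 0 * \<bar>x - y\<bar>" by simp
    qed simp
  qed
  then obtain L where L: "0 \<le> L" and lip: "\<And>x y. x \<in> {lo..hi} \<Longrightarrow> y \<in> {lo..hi} \<Longrightarrow> \<bar>\<phi>' x - \<phi>' y\<bar> \<le> L * \<bar>x - y\<bar>"
    by blast
  have intA: "set_integrable lborel {a..b} q'" if "s \<le> a" "b \<le> t" for a b
    by (rule set_integrable_subset[OF int]) (use that in auto)
  have hk: "q' integrable_on {a..b}" "(LBINT u:{a..b}. q' u) = integral {a..b} q'"
    "(\<lambda>u. \<bar>q' u\<bar>) integrable_on {a..b}" if "s \<le> a" "b \<le> t" for a b
    using set_borel_integral_eq_integral[OF intA[OF that]] set_borel_integral_eq_integral[OF set_integrable_abs[OF intA[OF that]]]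
    by auto
  have qd: "q b - q a = integral {a..b} q'" if "s \<le> a" "a \<le> b" "b \<le> t" for a b
    using q[of a] q[of b] that hk(2)[of s a] hk(2)[of s b]
      Henstock_Kurzweil_Integration.integral_combine[of s a b q'] hk(1)[of s b] by auto
  define G where "G v = integral {s..v} (\<lambda>u. \<bar>q' u\<bar>)" for v
  have Gd: "G b - G a = integral {a..b} (\<lambda>u. \<bar>q' u\<bar>)" if "s \<le> a" "a \<le> b" "b \<le> t" for a b
    using that Henstock_Kurzweil_Integration.integral_combine[of s a b "\<lambda>u. \<bar>q' u\<bar>"] hk(3)[of s b] by (auto simp: G_def)
  have qG: "\<bar>q b - q a\<bar> \<le> G b - G a" if "s \<le> a" "a \<le> b" "b \<le> t" for a b
    unfolding qd[OF that] Gd[OF that]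
    using integral_norm_bound_integral[OF hk(1)[of a b] hk(3)[of a b]] that by auto
  have contG: "continuous_on {s..t} G" unfolding G_def
    by (rule indefinite_integral_continuous_1) (use hk(3)[of s t] in auto)
  have contq: "continuous_on {s..t} q"
  proof (rule continuous_on_cong[THEN iffD1, OF refl])
    show "continuous_on {s..t} (\<lambda>v. q s + integral {s..v} q')"
      by (intro continuous_intros indefinite_integral_continuous_1 hk(1)) auto
    show "x \<in> {s..t} \<Longrightarrow> q s + integral {s..x} q' = q x" for x using qd[of s x] by auto
  qed
  have cont\<phi>': "continuous_on {lo..hi} \<phi>'"
    by (rule lipschitz_on_continuous_on[of L])
      (use L lip in \<open>auto simp: lipschitz_on_def dist_real_def\<close>)
  have contc: "continuous_on {s..t} (\<lambda>u. \<phi>' (q u))"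
    by (rule continuous_on_compose2[OF cont\<phi>' contq]) (use range in auto)
  obtain B where B: "\<And>u. u \<in> {s..t} \<Longrightarrow> \<bar>\<phi>' (q u)\<bar> \<le> B"
  proof -
    have "compact ((\<lambda>u. \<phi>' (q u)) ` {s..t})" by (rule compact_continuous_image[OF contc]) auto
    then obtain B where "\<forall>x\<in>(\<lambda>u. \<phi>' (q u)) ` {s..t}. norm x \<le> B"
      using compact_imp_bounded bounded_iff by blast
    then show ?thesis using that[of B] by auto
  qed
  show intc: "set_integrable lborel {s..t} (\<lambda>u. \<phi>' (q u) * q' u)"
    unfolding set_integrable_def
  proof (rule Bochner_Integration.integrable_bound)
    show "integrable lborel (\<lambda>u. B * (indicator {s..t} u *\<^sub>R q' u))"
      using int unfolding set_integrable_def by (rule integrable_mult_right)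
    have "(\<lambda>u. indicator {s..t} u *\<^sub>R \<phi>' (q u)) \<in> borel_measurable lborel"
      using borel_measurable_continuous_on_indicator[OF _ contc] by simp
    moreover have "(\<lambda>u. indicator {s..t} u *\<^sub>R q' u) \<in> borel_measurable lborel"
      using int unfolding set_integrable_def by (rule borel_measurable_integrable)
    ultimately have "(\<lambda>u. (indicator {s..t} u *\<^sub>R \<phi>' (q u)) * (indicator {s..t} u *\<^sub>R q' u)) \<in> borel_measurable lborel"
      by (rule borel_measurable_times)
    moreover have "(\<lambda>u. (indicator {s..t} u *\<^sub>R \<phi>' (q u)) * (indicator {s..t} u *\<^sub>R q' u)) = (\<lambda>u. indicator {s..t} u *\<^sub>R (\<phi>' (q u) * q' u))"
      by (auto split: split_indicator)
    ultimately show "(\<lambda>u. indicator {s..t} u *\<^sub>R (\<phi>' (q u) * q' u)) \<in> borel_measurable lborel" by simp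
    show "AE u in lborel. norm (indicator {s..t} u *\<^sub>R (\<phi>' (q u) * q' u)) \<le> norm (B * (indicator {s..t} u *\<^sub>R q' u))"
    proof (rule AE_I2)
      fix u show "norm (indicator {s..t} u *\<^sub>R (\<phi>' (q u) * q' u)) \<le> norm (B * (indicator {s..t} u *\<^sub>R q' u))"
      proof (cases "u \<in> {s..t}")
        case True
        then have "\<bar>\<phi>' (q u)\<bar> \<le> \<bar>B\<bar>" using B[OF True] by linarith
        then show ?thesis using True by (auto simp: abs_mult intro: mult_right_mono)
      qed simp
    qed
  qed
  let ?h = "\<lambda>u. \<phi>' (q u) * q' u"
  have hkc: "?h integrable_on {a..b}" "(LBINT u:{a..b}. ?h u) = integral {a..b} ?h" if "s \<le> a" "b \<le> t" for a b
    using set_borel_integral_eq_integral[OF set_integrable_subset[OF intc, of "{a..b}"]] that by auto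
  define D where "D v = \<phi> (q v) - integral {s..v} ?h" for v
  have "D t = D s"
  proof (rule const_of_quadratic_increments[OF st contG])
    fix a b assume ab: "s \<le> a" "a \<le> b" "b \<le> t"
    show "G a \<le> G b" using qG[OF ab] by linarith
    have "\<exists>x\<in>{lo..hi}. \<bar>x - q a\<bar> \<le> \<bar>q b - q a\<bar> \<and> \<phi> (q b) - \<phi> (q a) = \<phi>' x * (q b - q a)"
    proof -
      have qa: "q a \<in> {lo..hi}" "q b \<in> {lo..hi}" using range[of a] range[of b] ab by auto
      consider "q a < q b" | "q b < q a" | "q a = q b" by linarith
      then show ?thesis
      proof cases
        case 1
        have "\<exists>x\<in>{q a<..<q b}. \<phi> (q b) - \<phi> (q a) = (\<lambda>h. \<phi>' x * h) (q b - q a)"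
        proof (rule mvt_simple[OF 1])
          fix x assume "q a \<le> x" "x \<le> q b"
          then have "x \<in> {lo..hi}" using qa by auto
          from der[OF this] show "(\<phi> has_derivative (*) (\<phi>' x)) (at x within {q a..q b})"
            unfolding has_field_derivative_def by (rule has_derivative_subset) (use qa in auto)
        qed
        then obtain x where x: "x \<in> {q a<..<q b}" "\<phi> (q b) - \<phi> (q a) = \<phi>' x * (q b - q a)" by auto
        show ?thesis by (rule bexI[of _ x]) (use qa x in auto)
      next
        case 2
        have "\<exists>x\<in>{q b<..<q a}. \<phi> (q a) - \<phi> (q b) = (\<lambda>h. \<phi>' x * h) (q a - q b)"
        proof (rule mvt_simple[OF 2])
          fix x assume "q b \<le> x" "x \<le> q a"
          then have "x \<in> {lo..hi}" using qa by auto
          from der[OF this] show "(\<phi> has_derivative (*) (\<phi>' x)) (at x within {q b..q a})"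
            unfolding has_field_derivative_def by (rule has_derivative_subset) (use qa in auto)
        qed
        then obtain x where x: "x \<in> {q b<..<q a}" "\<phi> (q a) - \<phi> (q b) = \<phi>' x * (q a - q b)" by auto
        then have "\<phi> (q b) - \<phi> (q a) = \<phi>' x * (q b - q a)" unfolding right_diff_distrib by linarith
        then show ?thesis by (intro bexI[of _ x]) (use qa x in auto)
      next
        case 3 then show ?thesis using qa by (intro bexI[of _ "q a"]) auto
      qed
    qed
    then obtain x where x: "x \<in> {lo..hi}" "\<bar>x - q a\<bar> \<le> \<bar>q b - q a\<bar>" "\<phi> (q b) - \<phi> (q a) = \<phi>' x * (q b - q a)" by auto
    have qa: "q a \<in> {lo..hi}" using range[of a] ab by auto
    let ?g = "G b - G a"
    have g: "0 \<le> ?g" using qG[OF ab] by linarith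
    have "\<bar>\<phi>' x - \<phi>' (q a)\<bar> \<le> L * ?g"
      using lip[OF x(1) qa] x(2) qG[OF ab] L by (meson mult_left_mono order_trans)
    then have e1: "\<bar>(\<phi>' x - \<phi>' (q a)) * (q b - q a)\<bar> \<le> (L * ?g) * ?g"
      unfolding abs_mult by (intro mult_mono) (use qG[OF ab] L g in auto)
    have e2: "\<bar>integral {a..b} (\<lambda>u. ?h u - \<phi>' (q a) * q' u)\<bar> \<le> integral {a..b} (\<lambda>u. L * ?g * \<bar>q' u\<bar>)"
      unfolding real_norm_def[symmetric]
    proof (rule integral_norm_bound_integral)
      show "(\<lambda>u. ?h u - \<phi>' (q a) * q' u) integrable_on {a..b}"
        by (intro integrable_diff integrable_on_mult_right hkc(1) hk(1)) (use ab in auto)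
      show "(\<lambda>u. L * ?g * norm (q' u)) integrable_on {a..b}"
        unfolding real_norm_def by (intro integrable_on_mult_right hk(3)) (use ab in auto)
      fix u assume u: "u \<in> {a..b}"
      have "\<bar>\<phi>' (q u) - \<phi>' (q a)\<bar> \<le> L * \<bar>q u - q a\<bar>" using lip[of "q u" "q a"] range[of u] range[of a] u ab by auto
      also have "\<dots> \<le> L * ?g"
      proof (rule mult_left_mono[OF _ L])
        have "\<bar>q u - q a\<bar> \<le> G u - G a" using qG[of a u] u ab by auto
        also have "\<dots> \<le> ?g" using qG[of u b] u ab by auto
        finally show "\<bar>q u - q a\<bar> \<le> ?g" .
      qed
      finally have "\<bar>\<phi>' (q u) - \<phi>' (q a)\<bar> * \<bar>q' u\<bar> \<le> L * ?g * \<bar>q' u\<bar>" by (rule mult_right_mono) simp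
      then show "norm (?h u - \<phi>' (q a) * q' u) \<le> L * ?g * norm (q' u)"
        by (simp add: abs_mult[symmetric] left_diff_distrib)
    qed
    have "integral {a..b} (\<lambda>u. ?h u - \<phi>' (q a) * q' u) = integral {a..b} ?h - \<phi>' (q a) * (q b - q a)"
      using hkc(1)[of a b] hk(1)[of a b] ab qd[OF ab]
      by (subst Henstock_Kurzweil_Integration.integral_diff) (auto intro: integrable_on_mult_right)
    moreover have "integral {a..b} (\<lambda>u. L * ?g * \<bar>q' u\<bar>) = L * ?g * ?g"
      using Gd[OF ab] by simp
    moreover have "D b - D a = \<phi> (q b) - \<phi> (q a) - integral {a..b} ?h"
      unfolding D_def using Henstock_Kurzweil_Integration.integral_combine[of s a b ?h] hkc(1)[of s b] ab by auto
    moreover have "\<phi> (q b) - \<phi> (q a) = (\<phi>' x - \<phi>' (q a)) * (q b - q a) + \<phi>' (q a) * (q b - q a)"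
      using x(3) by (simp add: algebra_simps)
    ultimately have "\<bar>D b - D a\<bar> \<le> L * ?g * ?g + L * ?g * ?g"
      using e1 e2 by linarith
    then show "\<bar>D b - D a\<bar> \<le> (2 * L) * ?g\<^sup>2" by (simp add: power2_eq_square algebra_simps)
  qed
  then show "(LBINT u:{s..t}. ?h u) = \<phi> (q t) - \<phi> (q s)"
    using hkc(2)[of s t] by (simp add: D_def)
qed

text \<open>
  Gains \<open>r\<close> and losses \<open>m\<close> are kept apart and the losses stand on the left. In this form the
  identities at single sites can be summed over all sites before anything is known about convergence.
\<close>

lemma ac_chain_rule_ennreal:
  fixes q r m \<phi> \<phi>' :: "real \<Rightarrow> real"
  assumes st: "s \<le> t"
    and [measurable]: "r \<in> borel_measurable borel" "m \<in> borel_measurable borel" "q \<in> borel_measurable borel" "\<phi>' \<in> borel_measurable borel"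
    and nn: "\<And>u. 0 \<le> r u" "\<And>u. 0 \<le> m u"
    and fin: "(\<integral>\<^sup>+u. indicator {s..t} u * ennreal (r u) \<partial>lborel) < \<infinity>" "(\<integral>\<^sup>+u. indicator {s..t} u * ennreal (m u) \<partial>lborel) < \<infinity>"
    and q: "\<And>v. s \<le> v \<Longrightarrow> v \<le> t \<Longrightarrow> ennreal (q v) + (\<integral>\<^sup>+u. indicator {s..v} u * ennreal (m u) \<partial>lborel)
        = ennreal (q s) + (\<integral>\<^sup>+u. indicator {s..v} u * ennreal (r u) \<partial>lborel)"
    and range: "\<And>v. 0 \<le> q v" "\<And>v. q v \<le> hi"
    and der: "\<And>x. x \<in> {0..hi} \<Longrightarrow> (\<phi> has_real_derivative \<phi>' x) (at x within {0..hi})"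
    and lip: "\<And>x y. x \<in> {0..hi} \<Longrightarrow> y \<in> {0..hi} \<Longrightarrow> \<bar>\<phi>' x - \<phi>' y\<bar> \<le> L * \<bar>x - y\<bar>"
    and nn\<phi>: "\<And>x. x \<in> {0..hi} \<Longrightarrow> 0 \<le> \<phi> x" "\<And>x. x \<in> {0..hi} \<Longrightarrow> 0 \<le> \<phi>' x" "\<And>x. x \<in> {0..hi} \<Longrightarrow> \<phi>' x \<le> B"
  shows "ennreal (\<phi> (q t)) + (\<integral>\<^sup>+u. indicator {s..t} u * (ennreal (\<phi>' (q u)) * ennreal (m u)) \<partial>lborel)
        = ennreal (\<phi> (q s)) + (\<integral>\<^sup>+u. indicator {s..t} u * (ennreal (\<phi>' (q u)) * ennreal (r u)) \<partial>lborel)"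
proof -
  have fin': "(\<integral>\<^sup>+u. indicator {s..v} u * ennreal (f u) \<partial>lborel) < \<infinity>"
    if "(\<integral>\<^sup>+u. indicator {s..t} u * ennreal (f u) \<partial>lborel) < \<infinity>" "v \<le> t" for f :: "real \<Rightarrow> real" and v
    by (rule le_less_trans[OF nn_integral_mono that(1)]) (use that(2) in \<open>auto split: split_indicator\<close>)
  have int: "set_integrable lborel {s..v} f" and val: "ennreal (LBINT u:{s..v}. f u) = (\<integral>\<^sup>+u. indicator {s..v} u * ennreal (f u) \<partial>lborel)"
    and ge: "0 \<le> (LBINT u:{s..v}. f u)"
    if "(\<integral>\<^sup>+u. indicator {s..v} u * ennreal (f u) \<partial>lborel) < \<infinity>" "f \<in> borel_measurable borel" "\<And>u. 0 \<le> f u" for f v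
  proof -
    note [measurable] = that(2)
    have e: "(\<integral>\<^sup>+u. ennreal (indicator {s..v} u *\<^sub>R f u) \<partial>lborel) = (\<integral>\<^sup>+u. indicator {s..v} u * ennreal (f u) \<partial>lborel)"
      by (auto intro!: nn_integral_cong split: split_indicator)
    show i: "set_integrable lborel {s..v} f" unfolding set_integrable_def
      by (rule integrableI_nonneg) (use that e in \<open>auto intro!: mult_nonneg_nonneg simp: top.not_eq_extremum\<close>)
    show "ennreal (LBINT u:{s..v}. f u) = (\<integral>\<^sup>+u. indicator {s..v} u * ennreal (f u) \<partial>lborel)"
      unfolding set_lebesgue_integral_def e[symmetric]
      by (rule nn_integral_eq_integral[symmetric]) (use i that in \<open>auto simp: set_integrable_def\<close>)
    show "0 \<le> (LBINT u:{s..v}. f u)" unfolding set_lebesgue_integral_def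
      by (rule Bochner_Integration.integral_nonneg) (use that in auto)
  qed
  note m_meas = \<open>m \<in> borel_measurable borel\<close> and r_meas = \<open>r \<in> borel_measurable borel\<close>
  have rng: "q v \<in> {0..hi}" for v using range by auto
  have i: "set_integrable lborel {s..t} (\<lambda>u. r u - m u)"
    by (rule set_integral_diff(1)[OF int int]) (use fin nn in auto)
  have inc: "q v = q s + (LBINT u:{s..v}. r u - m u)" if v: "s \<le> v" "v \<le> t" for v
  proof -
    note R = fin'[OF fin(1) v(2)] and M = fin'[OF fin(2) v(2)]
    have "(LBINT u:{s..v}. r u - m u) = (LBINT u:{s..v}. r u) - (LBINT u:{s..v}. m u)"
      by (rule set_integral_diff(2)[OF int int]) (use R M nn in auto)
    moreover have "ennreal (q v + (LBINT u:{s..v}. m u)) = ennreal (q s + (LBINT u:{s..v}. r u))"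
      using q[OF v] val[OF M m_meas nn(2)] val[OF R r_meas nn(1)] ge[OF M m_meas nn(2)] ge[OF R r_meas nn(1)] range
      by (simp add: ennreal_plus)
    then have "q v + (LBINT u:{s..v}. m u) = q s + (LBINT u:{s..v}. r u)"
      using ge[OF M m_meas nn(2)] ge[OF R r_meas nn(1)] range by (subst (asm) ennreal_inj) auto
    ultimately show "q v = q s + (LBINT u:{s..v}. r u - m u)" by linarith
  qed
  note cc = ac_chain_rule(2)[OF st i inc rng der lip]
  have B: "0 \<le> B" using nn\<phi>[OF rng[of s]] by linarith
  have finB: "(\<integral>\<^sup>+u. indicator {s..t} u * ennreal (\<phi>' (q u) * f u) \<partial>lborel) < \<infinity>"
    if f[measurable]: "f \<in> borel_measurable borel" and n: "\<And>u. 0 \<le> f u" and fi: "(\<integral>\<^sup>+u. indicator {s..t} u * ennreal (f u) \<partial>lborel) < \<infinity>" for f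
  proof -
    have "(\<integral>\<^sup>+u. indicator {s..t} u * ennreal (\<phi>' (q u) * f u) \<partial>lborel) \<le> (\<integral>\<^sup>+u. ennreal B * (indicator {s..t} u * ennreal (f u)) \<partial>lborel)"
      using nn\<phi>(3)[OF rng] nn\<phi>(2)[OF rng] n B
      by (intro nn_integral_mono) (auto split: split_indicator simp: ennreal_mult[symmetric] intro!: ennreal_leI mult_right_mono)
    also have "\<dots> = ennreal B * (\<integral>\<^sup>+u. indicator {s..t} u * ennreal (f u) \<partial>lborel)" by (rule nn_integral_cmult) measurable
    also have "\<dots> < \<infinity>" using fi by (simp add: ennreal_mult_less_top)
    finally show ?thesis .
  qed
  have nnf: "0 \<le> \<phi>' (q u) * r u" "0 \<le> \<phi>' (q u) * m u" for u using nn\<phi>(2)[OF rng[of u]] nn by auto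
  have mm: "(\<lambda>u. \<phi>' (q u) * r u) \<in> borel_measurable borel" "(\<lambda>u. \<phi>' (q u) * m u) \<in> borel_measurable borel" by measurable
  note FR = finB[OF r_meas nn(1) fin(1)] and FM = finB[OF m_meas nn(2) fin(2)]
  have "(LBINT u:{s..t}. \<phi>' (q u) * r u - \<phi>' (q u) * m u) = (LBINT u:{s..t}. \<phi>' (q u) * r u) - (LBINT u:{s..t}. \<phi>' (q u) * m u)"
    by (rule set_integral_diff(2)[OF int int]) (use FR FM mm nnf in auto)
  then have "\<phi> (q t) + (LBINT u:{s..t}. \<phi>' (q u) * m u) = \<phi> (q s) + (LBINT u:{s..t}. \<phi>' (q u) * r u)"
    using cc by (simp add: right_diff_distrib)
  then have "ennreal (\<phi> (q t)) + ennreal (LBINT u:{s..t}. \<phi>' (q u) * m u) = ennreal (\<phi> (q s)) + ennreal (LBINT u:{s..t}. \<phi>' (q u) * r u)"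
    using nn\<phi>(1)[OF rng[of s]] nn\<phi>(1)[OF rng[of t]] ge[OF FM mm(2) nnf(2)] ge[OF FR mm(1) nnf(1)]
    by (simp add: ennreal_plus[symmetric] del: ennreal_plus)
  then show ?thesis
    unfolding val[OF FM mm(2) nnf(2)] val[OF FR mm(1) nnf(1)]
    using nn\<phi>(2)[OF rng] nn by (simp add: ennreal_mult)
qed

lemma esum_sum: "(\<Sigma>\<^sup>+z. \<Sum>i\<in>I. f i z) = (\<Sum>i\<in>I. \<Sigma>\<^sup>+z. f i z)"
  by (rule nn_integral_sum) auto


section \<open>Jump expansion of the heat kernel in a fixed environment\<close>

definition hazard :: "'d::finite env \<Rightarrow> real \<Rightarrow> real \<Rightarrow> 'd site \<Rightarrow> real" where
  "hazard a s t x = (LBINT u:{s..t}. total_rate a u x)"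

definition survival :: "'d::finite env \<Rightarrow> real \<Rightarrow> real \<Rightarrow> 'd site \<Rightarrow> ennreal" where
  "survival a s t x = ennreal (exp (- hazard a s t x))"

text \<open>
  \<open>njump a n s t x y\<close> is the probability of going from \<open>x\<close> at time \<open>s\<close> to \<open>y\<close> at time \<open>t\<close> with exactly
  \<open>n\<close> jumps, expanded at the first jump.
\<close>

fun njump :: "'d::finite env \<Rightarrow> nat \<Rightarrow> real \<Rightarrow> real \<Rightarrow> 'd site \<Rightarrow> 'd site \<Rightarrow> ennreal" where
  "njump a 0 s t x y = (if x = y then survival a s t x else 0)"
| "njump a (Suc n) s t x y =
     (\<integral>\<^sup>+u. indicator {s..t} u * (survival a s u x * (\<Sigma>\<^sup>+z. ennreal (a u x z) * njump a n u t z y)) \<partial>lborel)"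

definition kern :: "'d::finite env \<Rightarrow> real \<Rightarrow> real \<Rightarrow> 'd site \<Rightarrow> 'd site \<Rightarrow> ennreal" where
  "kern a s t x y = (\<Sigma>\<^sup>+n. njump a n s t x y)"

lemma indicator_Icc_eq: "(indicator {s..t} u :: 'a::zero_neq_one) = (if s \<le> u \<and> u \<le> t then 1 else 0)"
  by (auto simp: indicator_def)

lemma nbr_commute: "nbr x y = nbr y x"
  by (simp add: nbr_def l1_dist_def abs_minus_commute)

text \<open>
  Exchanging expectations over the environment with time integrals requires joint measurability in the
  environment and in time.
\<close>

lemma measurable_hazard_joint:
  fixes w :: "'m \<Rightarrow> 'd::finite env"
  assumes w: "\<And>x y. (\<lambda>p. w (fst p) (snd p) x y) \<in> borel_measurable (M \<Otimes>\<^sub>M borel)"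
  shows "(\<lambda>p. hazard (w (fst p)) (fst (snd p)) (snd (snd p)) x) \<in> borel_measurable (M \<Otimes>\<^sub>M (borel \<Otimes>\<^sub>M borel))"
proof -
  have [measurable]: "(\<lambda>q. w (fst (fst q)) (snd q) x y) \<in> borel_measurable ((M \<Otimes>\<^sub>M (borel \<Otimes>\<^sub>M borel)) \<Otimes>\<^sub>M lborel)" for y
    by (rule measurable_compose[of "\<lambda>q. (fst (fst q), snd q)" _ "M \<Otimes>\<^sub>M borel", OF _ w, simplified]) measurable
  show ?thesis
    unfolding hazard_def set_lebesgue_integral_def total_rate_def indicator_Icc_eq
    by (rule lborel.borel_measurable_lebesgue_integral) measurable
qed

lemma measurable_njump_joint:
  fixes w :: "'m \<Rightarrow> 'd::finite env"
  assumes w: "\<And>x y. (\<lambda>p. w (fst p) (snd p) x y) \<in> borel_measurable (M \<Otimes>\<^sub>M borel)"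
  shows "(\<lambda>p. njump (w (fst p)) n (fst (snd p)) (snd (snd p)) x y) \<in> borel_measurable (M \<Otimes>\<^sub>M (borel \<Otimes>\<^sub>M borel))"
proof (induction n arbitrary: x y)
  case 0
  have [measurable]: "(\<lambda>p. hazard (w (fst p)) (fst (snd p)) (snd (snd p)) x) \<in> borel_measurable (M \<Otimes>\<^sub>M (borel \<Otimes>\<^sub>M borel))" for x
    by (rule measurable_hazard_joint[OF w])
  show ?case unfolding njump.simps survival_def by measurable
next
  case (Suc n)
  let ?N = "(M \<Otimes>\<^sub>M (borel \<Otimes>\<^sub>M borel)) \<Otimes>\<^sub>M (lborel :: real measure)"
  have [measurable]: "(\<lambda>q. w (fst (fst q)) (snd q) x y) \<in> borel_measurable ?N" for y
    by (rule measurable_compose[of "\<lambda>q. (fst (fst q), snd q)" _ "M \<Otimes>\<^sub>M borel", OF _ w, simplified]) measurable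
  have [measurable]: "(\<lambda>q. hazard (w (fst (fst q))) (fst (snd (fst q))) (snd q) x) \<in> borel_measurable ?N"
    by (rule measurable_compose[of "\<lambda>q. (fst (fst q), (fst (snd (fst q)), snd q))" _ "M \<Otimes>\<^sub>M (borel \<Otimes>\<^sub>M borel)", OF _ measurable_hazard_joint[OF w], simplified]) measurable
  have [measurable]: "(\<lambda>q. njump (w (fst (fst q))) n (snd q) (snd (snd (fst q))) z y) \<in> borel_measurable ?N" for z
    by (rule measurable_compose[of "\<lambda>q. (fst (fst q), (snd q, snd (snd (fst q))))" _ "M \<Otimes>\<^sub>M (borel \<Otimes>\<^sub>M borel)", OF _ Suc.IH, simplified]) measurable
  show ?case
    unfolding njump.simps survival_def indicator_Icc_eq
    by (rule lborel.borel_measurable_nn_integral) measurable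
qed

lemma measurable_kern_joint:
  fixes w :: "'m \<Rightarrow> 'd::finite env"
  assumes w: "\<And>x y. (\<lambda>p. w (fst p) (snd p) x y) \<in> borel_measurable (M \<Otimes>\<^sub>M borel)"
  shows "(\<lambda>p. kern (w (fst p)) (fst (snd p)) (snd (snd p)) x y) \<in> borel_measurable (M \<Otimes>\<^sub>M (borel \<Otimes>\<^sub>M borel))"
  unfolding kern_def using measurable_njump_joint[OF w] by measurable

lemma exp_nonpos_lipschitz:
  fixes x y :: real assumes "x \<le> 0" "y \<le> 0" shows "\<bar>exp x - exp y\<bar> \<le> \<bar>x - y\<bar>"
proof -
  have *: "exp x - exp y \<le> x - y" if "y \<le> x" "x \<le> 0" for x y :: real
  proof -
    have "exp x - exp y = exp x * (1 - exp (y - x))" by (simp add: exp_diff right_diff_distrib)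
    also have "\<dots> \<le> 1 * (1 - exp (y - x))" using that by (intro mult_right_mono) auto
    also have "\<dots> \<le> x - y" using exp_ge_add_one_self[of "y - x"] by (simp add: algebra_simps)
    finally show ?thesis .
  qed
  show ?thesis using *[of x y] *[of y x] assms by (cases "y \<le> x") (auto simp: abs_if)
qed

locale regular_rates =
  fixes a :: "'d::finite env"
  assumes env: "a \<in> Env" and reg: "regular_env a"
begin

lemma rate_nonneg: "0 \<le> a t x y"
  using env unfolding Env_def by (smt (verit) mem_Collect_eq)

lemma measurable_rate [measurable]: "(\<lambda>t. a t x y) \<in> borel_measurable borel"
  using reg by (auto simp: regular_env_def)

lemma measurable_total_rate [measurable]: "(\<lambda>t. total_rate a t x) \<in> borel_measurable borel"
  unfolding total_rate_def by measurable

lemma total_rate_nonneg: "0 \<le> total_rate a t x"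
  using total_rate_pos[OF env] by (simp add: less_imp_le)

lemma set_integrable_total_rate: "set_integrable lborel {s..t} (\<lambda>u. total_rate a u x)"
  using reg by (auto simp: regular_env_def)

lemma measurable_rate_unit: "(\<lambda>p. (\<lambda>_. a) (fst p) (snd p) x y) \<in> borel_measurable (count_space (UNIV::unit set) \<Otimes>\<^sub>M borel)"
  by measurable

lemma measurable_hazard [measurable (raw)]:
  assumes "f \<in> borel_measurable M" "g \<in> borel_measurable M"
  shows "(\<lambda>p. hazard a (f p) (g p) x) \<in> borel_measurable M"
  using measurable_compose[of "\<lambda>p. ((), (f p, g p))" M "count_space UNIV \<Otimes>\<^sub>M (borel \<Otimes>\<^sub>M borel)",
      OF _ measurable_hazard_joint[of "\<lambda>_. a", OF measurable_rate_unit]] assms by simp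

lemma measurable_survival [measurable (raw)]:
  assumes "f \<in> borel_measurable M" "g \<in> borel_measurable M"
  shows "(\<lambda>p. survival a (f p) (g p) x) \<in> borel_measurable M"
  unfolding survival_def using assms by measurable

lemma measurable_njump [measurable (raw)]:
  assumes "f \<in> borel_measurable M" "g \<in> borel_measurable M"
  shows "(\<lambda>p. njump a n (f p) (g p) x y) \<in> borel_measurable M"
  using measurable_compose[of "\<lambda>p. ((), (f p, g p))" M "count_space UNIV \<Otimes>\<^sub>M (borel \<Otimes>\<^sub>M borel)",
      OF _ measurable_njump_joint[of "\<lambda>_. a", OF measurable_rate_unit]] assms by simp

lemma measurable_kern [measurable (raw)]:
  assumes "f \<in> borel_measurable M" "g \<in> borel_measurable M"
  shows "(\<lambda>p. kern a (f p) (g p) x y) \<in> borel_measurable M"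
  unfolding kern_def using assms by measurable

lemma hazard_nonneg: "0 \<le> hazard a s t x"
  unfolding hazard_def by (rule integrated_rate_nonneg[OF env])

lemma hazard_add: "s \<le> u \<Longrightarrow> u \<le> t \<Longrightarrow> hazard a s t x = hazard a s u x + hazard a u t x"
  unfolding hazard_def by (rule integrated_rate_add[OF reg env])

lemma hazard_refl: "hazard a s s x = 0"
  unfolding hazard_def set_lebesgue_integral_def
  by (rule integral_eq_zero_AE) (use AE_lborel_singleton[of s] in \<open>eventually_elim, auto\<close>)

lemma survival_mult: "s \<le> u \<Longrightarrow> u \<le> t \<Longrightarrow> survival a s t x = survival a s u x * survival a u t x"
  unfolding survival_def by (simp add: hazard_add[of s u t] exp_add ennreal_mult[symmetric] exp_diff[symmetric] exp_minus field_simps flip: exp_add)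

lemma survival_refl: "survival a s s x = 1"
  by (simp add: survival_def hazard_refl)

lemma esum_rate: "(\<Sigma>\<^sup>+z. ennreal (a u x z)) = ennreal (total_rate a u x)"
proof -
  have "(\<Sigma>\<^sup>+z. ennreal (a u x z)) = (\<Sum>z | nbr x z. ennreal (a u x z))"
    by (rule nn_integral_count_space') (use env finite_nbr in \<open>auto simp: Env_def\<close>)
  then show ?thesis unfolding total_rate_def by (simp add: rate_nonneg sum_ennreal)
qed

text \<open>
  The fundamental theorem of calculus for the survival probability, as a function of the final and
  of the initial time.
\<close>

lemma exp_hazard_integral:
  assumes st: "s \<le> t"
  shows "(\<integral>\<^sup>+u. indicator {s..t} u * (ennreal (total_rate a u x) * survival a s u x) \<partial>lborel) + survival a s t x = 1"
    and "(\<integral>\<^sup>+u. indicator {s..t} u * (ennreal (total_rate a u x) * survival a u t x) \<partial>lborel) + survival a s t x = 1"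
proof -
  let ?H = "hazard a s t x"
  have *: "(\<integral>\<^sup>+u. indicator {s..t} u * ennreal (\<phi>' (hazard a s u x) * total_rate a u x) \<partial>lborel) = ennreal (\<phi> ?H - \<phi> 0)"
    if der: "\<And>y. y \<in> {0..?H} \<Longrightarrow> (\<phi> has_real_derivative \<phi>' y) (at y within {0..?H})"
    and lip: "\<And>y z. y \<in> {0..?H} \<Longrightarrow> z \<in> {0..?H} \<Longrightarrow> \<bar>\<phi>' y - \<phi>' z\<bar> \<le> 1 * \<bar>y - z\<bar>"
    and nn: "\<And>y. 0 \<le> \<phi>' y" for \<phi> \<phi>' :: "real \<Rightarrow> real"
  proof -
    have q: "hazard a s v x = hazard a s s x + (LBINT u:{s..v}. total_rate a u x)" for v
      by (simp add: hazard_refl) (simp add: hazard_def)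
    have r: "hazard a s v x \<in> {0..?H}" if "s \<le> v" "v \<le> t" for v
      using that hazard_add[OF that, of x] hazard_nonneg[of s v x] hazard_nonneg[of v t x] by auto
    note cc = ac_chain_rule[where q="\<lambda>v. hazard a s v x", OF st set_integrable_total_rate q r der lip]
    have "ennreal (\<phi> ?H - \<phi> 0) = ennreal (LBINT u:{s..t}. \<phi>' (hazard a s u x) * total_rate a u x)"
      using cc(2) by (simp add: hazard_refl)
    also have "\<dots> = (\<integral>\<^sup>+u. ennreal (indicator {s..t} u *\<^sub>R (\<phi>' (hazard a s u x) * total_rate a u x)) \<partial>lborel)"
      unfolding set_lebesgue_integral_def
      by (rule nn_integral_eq_integral[symmetric]) (use cc(1) nn total_rate_nonneg in \<open>auto simp: set_integrable_def\<close>)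
    finally show ?thesis by (auto intro!: nn_integral_cong split: split_indicator)
  qed
  have le1: "exp (- ?H) \<le> 1" using hazard_nonneg by simp
  have "(\<integral>\<^sup>+u. indicator {s..t} u * ennreal (exp (- hazard a s u x) * total_rate a u x) \<partial>lborel) = ennreal (- exp (- ?H) - (- exp (-0)))"
  proof (rule *)
    show "\<bar>exp (- y) - exp (- z)\<bar> \<le> 1 * \<bar>y - z\<bar>" if "y \<in> {0..?H}" "z \<in> {0..?H}" for y z
      using exp_nonpos_lipschitz[of "-y" "-z"] that by (auto simp: abs_minus_commute)
  qed (auto intro!: derivative_eq_intros)
  then show "(\<integral>\<^sup>+u. indicator {s..t} u * (ennreal (total_rate a u x) * survival a s u x) \<partial>lborel) + survival a s t x = 1"
    using le1 by (simp add: survival_def ennreal_mult mult.commute total_rate_nonneg ennreal_plus[symmetric] del: ennreal_plus)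
  have "(\<integral>\<^sup>+u. indicator {s..t} u * ennreal (exp (hazard a s u x - ?H) * total_rate a u x) \<partial>lborel) = ennreal (exp (?H - ?H) - exp (0 - ?H))"
  proof (rule *)
    show "\<bar>exp (y - ?H) - exp (z - ?H)\<bar> \<le> 1 * \<bar>y - z\<bar>" if "y \<in> {0..?H}" "z \<in> {0..?H}" for y z
      using exp_nonpos_lipschitz[of "y - ?H" "z - ?H"] that by auto
  qed (auto intro!: derivative_eq_intros)
  moreover have "(\<integral>\<^sup>+u. indicator {s..t} u * ennreal (exp (hazard a s u x - ?H) * total_rate a u x) \<partial>lborel)
     = (\<integral>\<^sup>+u. indicator {s..t} u * (ennreal (total_rate a u x) * survival a u t x) \<partial>lborel)"
  proof (rule nn_integral_cong)
    fix u show "indicator {s..t} u * ennreal (exp (hazard a s u x - ?H) * total_rate a u x)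
        = indicator {s..t} u * (ennreal (total_rate a u x) * survival a u t x)"
      using hazard_add[of s u t x] by (auto split: split_indicator simp: survival_def ennreal_mult total_rate_nonneg mult.commute)
  qed
  ultimately show "(\<integral>\<^sup>+u. indicator {s..t} u * (ennreal (total_rate a u x) * survival a u t x) \<partial>lborel) + survival a s t x = 1"
    using le1 by (simp add: survival_def ennreal_plus[symmetric] del: ennreal_plus)
qed

text \<open>
  By induction, all jumps after the first one have total weight at most one; the first jump and the
  survival have total weight exactly one.
\<close>

lemma njump_row_partial: "s \<le> t \<Longrightarrow> (\<Sum>i<n. \<Sigma>\<^sup>+y. njump a i s t x y) \<le> 1"
proof (induction n arbitrary: s x)
  case 0 then show ?case by simp
next
  case (Suc n)
  have "(\<Sum>i<Suc n. \<Sigma>\<^sup>+y. njump a i s t x y) = (\<Sigma>\<^sup>+y. njump a 0 s t x y) + (\<Sum>i<n. \<Sigma>\<^sup>+y. njump a (Suc i) s t x y)"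
    by (rule sum.lessThan_Suc_shift)
  also have "(\<Sigma>\<^sup>+y. njump a 0 s t x y) = survival a s t x"
    unfolding njump.simps by (rule esum_delta)
  also have "(\<Sum>i<n. \<Sigma>\<^sup>+y. njump a (Suc i) s t x y)
     = (\<integral>\<^sup>+u. indicator {s..t} u * (survival a s u x * (\<Sigma>\<^sup>+z. ennreal (a u x z) * (\<Sum>i<n. \<Sigma>\<^sup>+y. njump a i u t z y))) \<partial>lborel)"
  proof -
    have "(\<Sigma>\<^sup>+y. njump a (Suc i) s t x y)
      = (\<integral>\<^sup>+u. indicator {s..t} u * (survival a s u x * (\<Sigma>\<^sup>+z. ennreal (a u x z) * (\<Sigma>\<^sup>+y. njump a i u t z y))) \<partial>lborel)" for i
    proof -
      have "(\<Sigma>\<^sup>+y. njump a (Suc i) s t x y) = (\<integral>\<^sup>+u. (\<Sigma>\<^sup>+y. indicator {s..t} u * (survival a s u x * (\<Sigma>\<^sup>+z. ennreal (a u x z) * njump a i u t z y))) \<partial>lborel)"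
        unfolding njump.simps by (rule nn_integral_esum[symmetric]) measurable
      also have "\<dots> = (\<integral>\<^sup>+u. indicator {s..t} u * (survival a s u x * (\<Sigma>\<^sup>+z. ennreal (a u x z) * (\<Sigma>\<^sup>+y. njump a i u t z y))) \<partial>lborel)"
        by (subst esum_cmult(1)[symmetric])+ (simp add: esum_cmult(1) esum_commute[of "\<lambda>y z. _ y z"])
      finally show ?thesis .
    qed
    then have "(\<Sum>i<n. \<Sigma>\<^sup>+y. njump a (Suc i) s t x y)
      = (\<Sum>i<n. \<integral>\<^sup>+u. indicator {s..t} u * (survival a s u x * (\<Sigma>\<^sup>+z. ennreal (a u x z) * (\<Sigma>\<^sup>+y. njump a i u t z y))) \<partial>lborel)"
      by (simp only:)
    also have "\<dots> = (\<integral>\<^sup>+u. (\<Sum>i<n. indicator {s..t} u * (survival a s u x * (\<Sigma>\<^sup>+z. ennreal (a u x z) * (\<Sigma>\<^sup>+y. njump a i u t z y)))) \<partial>lborel)"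
      by (rule nn_integral_sum[symmetric]) measurable
    finally show ?thesis by (simp only: sum_distrib_left esum_sum)
  qed
  also have "\<dots> \<le> (\<integral>\<^sup>+u. indicator {s..t} u * (survival a s u x * (\<Sigma>\<^sup>+z. ennreal (a u x z) * 1)) \<partial>lborel)"
  proof (rule nn_integral_mono)
    fix u
    have "(\<Sigma>\<^sup>+z. ennreal (a u x z) * (\<Sum>i<n. \<Sigma>\<^sup>+y. njump a i u t z y)) \<le> (\<Sigma>\<^sup>+z. ennreal (a u x z) * 1)" if "u \<in> {s..t}"
      by (rule nn_integral_mono, rule mult_left_mono[OF Suc.IH]) (use that in auto)
    then show "indicator {s..t} u * (survival a s u x * (\<Sigma>\<^sup>+z. ennreal (a u x z) * (\<Sum>i<n. \<Sigma>\<^sup>+y. njump a i u t z y)))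
        \<le> indicator {s..t} u * (survival a s u x * (\<Sigma>\<^sup>+z. ennreal (a u x z) * 1))"
      by (cases "u \<in> {s..t}") (auto intro!: mult_left_mono simp del: mult_1_right)
  qed
  also have "\<dots> = (\<integral>\<^sup>+u. indicator {s..t} u * (ennreal (total_rate a u x) * survival a s u x) \<partial>lborel)"
    by (simp add: esum_rate mult.commute)
  finally show ?case using exp_hazard_integral(1)[OF Suc.prems, of x] by (simp add: add.commute add_mono)
qed

end

lemma esum_nat_shift:
  fixes d :: "nat \<Rightarrow> ennreal"
  shows "(\<Sigma>\<^sup>+n. d n) = d 0 + (\<Sigma>\<^sup>+n. d (Suc n))"
proof -
  have b: "bij_betw Suc UNIV {1..}"
    by (rule bij_betwI[where g="\<lambda>n. n - 1"]) auto
  have "(\<Sigma>\<^sup>+n. d (Suc n)) = (\<integral>\<^sup>+n. d n \<partial>count_space {1..})"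
    by (rule nn_integral_bij_count_space[OF b])
  also have "\<dots> = (\<Sigma>\<^sup>+n. (if 1 \<le> n then d n else 0))"
    by (subst nn_integral_count_space_indicator) (auto intro!: nn_integral_cong split: split_indicator)
  finally have "d 0 + (\<Sigma>\<^sup>+n. d (Suc n)) = (\<Sigma>\<^sup>+n. (if n = 0 then d n else 0)) + (\<Sigma>\<^sup>+n. (if 1 \<le> n then d n else 0))"
    by (simp add: esum_delta)
  also have "\<dots> = (\<Sigma>\<^sup>+n. d n)"
    by (subst esum_add[symmetric]) (auto intro!: nn_integral_cong)
  finally show ?thesis by simp
qed

context regular_rates
begin

text \<open>
  The definition expands at the first jump. The same iterated integral over all jump times, taken in
  another order by Tonelli's theorem, is an expansion at the last jump.
\<close>

lemma njump_forward:
  "njump a (Suc n) s t x y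
    = (\<integral>\<^sup>+u. indicator {s..t} u * ((\<Sigma>\<^sup>+z. njump a n s u x z * ennreal (a u z y)) * survival a u t y) \<partial>lborel)"
proof (induction n arbitrary: s x)
  case 0
  show ?case unfolding njump.simps esum_delta_mult
    by (simp add: mult_ac)
next
  case (Suc n)
  let ?P = "\<lambda>u v z w. survival a s u x * ennreal (a u x z) * njump a n u v z w * ennreal (a v w y) * survival a v t y"
  let ?M = "\<lambda>u v. (if s \<le> u \<and> u \<le> v \<and> v \<le> t then (\<Sigma>\<^sup>+z. \<Sigma>\<^sup>+w. ?P u v z w) else 0)"
  have "njump a (Suc (Suc n)) s t x y = (\<integral>\<^sup>+u. (\<integral>\<^sup>+v. ?M u v \<partial>lborel) \<partial>lborel)"
  proof (subst njump.simps, rule nn_integral_cong)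
    fix u :: real
    let ?F = "\<lambda>z v. indicator {u..t} v * ((\<Sigma>\<^sup>+w. njump a n u v z w * ennreal (a v w y)) * survival a v t y)"
    have "indicator {s..t} u * (survival a s u x * (\<Sigma>\<^sup>+z. ennreal (a u x z) * njump a (Suc n) u t z y))
      = indicator {s..t} u * (survival a s u x * (\<Sigma>\<^sup>+z. ennreal (a u x z) * (\<integral>\<^sup>+v. ?F z v \<partial>lborel)))"
      by (simp only: Suc.IH)
    also have "(\<Sigma>\<^sup>+z. ennreal (a u x z) * (\<integral>\<^sup>+v. ?F z v \<partial>lborel)) = (\<integral>\<^sup>+v. (\<Sigma>\<^sup>+z. ennreal (a u x z) * ?F z v) \<partial>lborel)"
      by (subst nn_integral_esum) (simp_all add: nn_integral_cmult)
    also have "indicator {s..t} u * (survival a s u x * (\<integral>\<^sup>+v. (\<Sigma>\<^sup>+z. ennreal (a u x z) * ?F z v) \<partial>lborel))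
      = (\<integral>\<^sup>+v. indicator {s..t} u * (survival a s u x * (\<Sigma>\<^sup>+z. ennreal (a u x z) * ?F z v)) \<partial>lborel)"
      by (simp add: nn_integral_cmult)
    also have "\<dots> = (\<integral>\<^sup>+v. ?M u v \<partial>lborel)"
    proof (rule nn_integral_cong)
      fix v
      show "indicator {s..t} u * (survival a s u x * (\<Sigma>\<^sup>+z. ennreal (a u x z) * ?F z v)) = ?M u v"
        by (auto split: split_indicator simp: esum_cmult[symmetric] mult_ac)
    qed
    finally show "indicator {s..t} u * (survival a s u x * (\<Sigma>\<^sup>+z. ennreal (a u x z) * njump a (Suc n) u t z y)) = (\<integral>\<^sup>+v. ?M u v \<partial>lborel)" .
  qed
  also have "\<dots> = (\<integral>\<^sup>+v. (\<integral>\<^sup>+u. ?M u v \<partial>lborel) \<partial>lborel)"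
    by (rule lborel_pair.Fubini') measurable
  also have "\<dots> = (\<integral>\<^sup>+v. indicator {s..t} v * ((\<Sigma>\<^sup>+w. njump a (Suc n) s v x w * ennreal (a v w y)) * survival a v t y) \<partial>lborel)"
  proof (rule nn_integral_cong)
    fix v :: real
    let ?F = "\<lambda>w u. indicator {s..v} u * (survival a s u x * (\<Sigma>\<^sup>+z. ennreal (a u x z) * njump a n u v z w))"
    have "indicator {s..t} v * ((\<Sigma>\<^sup>+w. njump a (Suc n) s v x w * ennreal (a v w y)) * survival a v t y)
      = indicator {s..t} v * ((\<Sigma>\<^sup>+w. (\<integral>\<^sup>+u. ?F w u \<partial>lborel) * ennreal (a v w y)) * survival a v t y)"
      by simp
    also have "(\<Sigma>\<^sup>+w. (\<integral>\<^sup>+u. ?F w u \<partial>lborel) * ennreal (a v w y)) = (\<integral>\<^sup>+u. (\<Sigma>\<^sup>+w. ?F w u * ennreal (a v w y)) \<partial>lborel)"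
      by (subst nn_integral_esum) (simp_all add: nn_integral_multc)
    also have "indicator {s..t} v * ((\<integral>\<^sup>+u. (\<Sigma>\<^sup>+w. ?F w u * ennreal (a v w y)) \<partial>lborel) * survival a v t y)
      = (\<integral>\<^sup>+u. indicator {s..t} v * ((\<Sigma>\<^sup>+w. ?F w u * ennreal (a v w y)) * survival a v t y) \<partial>lborel)"
      by (simp add: nn_integral_cmult nn_integral_multc)
    also have "\<dots> = (\<integral>\<^sup>+u. ?M u v \<partial>lborel)"
    proof (rule nn_integral_cong)
      fix u
      show "indicator {s..t} v * ((\<Sigma>\<^sup>+w. ?F w u * ennreal (a v w y)) * survival a v t y) = ?M u v"
        by (subst esum_commute) (auto split: split_indicator simp: esum_cmult[symmetric] mult_ac)
    qed
    finally show "(\<integral>\<^sup>+u. ?M u v \<partial>lborel) = indicator {s..t} v * ((\<Sigma>\<^sup>+w. njump a (Suc n) s v x w * ennreal (a v w y)) * survival a v t y)" by simp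
  qed
  finally show ?case .
qed

text \<open>
  The first jump happens either after time \<open>u\<close>, and then there is no jump before \<open>u\<close>, or before \<open>u\<close>, and then
  the remaining jumps are split at \<open>u\<close> by the induction hypothesis.
\<close>

lemma njump_Chapman_Kolmogorov:
  assumes su: "s \<le> u" and ut: "u \<le> t"
  shows "njump a n s t x y = (\<Sum>i\<le>n. \<Sigma>\<^sup>+z. njump a i s u x z * njump a (n - i) u t z y)"
  using su
proof (induction n arbitrary: s x)
  case 0
  then show ?case using survival_mult[OF 0 ut, of x] by (auto simp: esum_delta_mult)
next
  case (Suc n)
  let ?F = "\<lambda>v. survival a s v x * (\<Sigma>\<^sup>+z. ennreal (a v x z) * njump a n v t z y)"
  have "njump a (Suc n) s t x y = (\<integral>\<^sup>+v. indicator {s..u} v * ?F v + indicator {u..t} v * ?F v \<partial>lborel)"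
    unfolding njump.simps
    by (rule nn_integral_cong_AE, use AE_lborel_singleton[of u] in eventually_elim)
      (use Suc.prems ut in \<open>auto split: split_indicator\<close>)
  also have "\<dots> = (\<integral>\<^sup>+v. indicator {s..u} v * ?F v \<partial>lborel) + (\<integral>\<^sup>+v. indicator {u..t} v * ?F v \<partial>lborel)"
    by (rule nn_integral_add) measurable
  also have "(\<integral>\<^sup>+v. indicator {u..t} v * ?F v \<partial>lborel) = (\<Sigma>\<^sup>+z. njump a 0 s u x z * njump a (Suc n) u t z y)"
  proof -
    have "(\<integral>\<^sup>+v. indicator {u..t} v * ?F v \<partial>lborel)
      = (\<integral>\<^sup>+v. survival a s u x * (indicator {u..t} v * (survival a u v x * (\<Sigma>\<^sup>+z. ennreal (a v x z) * njump a n v t z y))) \<partial>lborel)"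
    proof (rule nn_integral_cong)
      fix v
      show "indicator {u..t} v * ?F v = survival a s u x * (indicator {u..t} v * (survival a u v x * (\<Sigma>\<^sup>+z. ennreal (a v x z) * njump a n v t z y)))"
      proof (cases "v \<in> {u..t}")
        case True
        then have "survival a s v x = survival a s u x * survival a u v x" by (intro survival_mult[OF Suc.prems]) auto
        then have "?F v = survival a s u x * (survival a u v x * (\<Sigma>\<^sup>+z. ennreal (a v x z) * njump a n v t z y))"
          by (simp only: mult.assoc)
        then show ?thesis using True by simp
      qed simp
    qed
    also have "\<dots> = survival a s u x * njump a (Suc n) u t x y"
      unfolding njump.simps by (rule nn_integral_cmult) measurable
    finally show ?thesis by (simp only: njump.simps(1) esum_delta_mult)
  qed
  also have "(\<integral>\<^sup>+v. indicator {s..u} v * ?F v \<partial>lborel) = (\<Sum>i\<le>n. \<Sigma>\<^sup>+z. njump a (Suc i) s u x z * njump a (n - i) u t z y)"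
  proof -
    have "(\<integral>\<^sup>+v. indicator {s..u} v * ?F v \<partial>lborel)
      = (\<integral>\<^sup>+v. (\<Sum>i\<le>n. \<Sigma>\<^sup>+w. indicator {s..u} v * (survival a s v x * (\<Sigma>\<^sup>+z. ennreal (a v x z) * njump a i v u z w)) * njump a (n - i) u t w y) \<partial>lborel)"
    proof (rule nn_integral_cong)
      fix v
      show "indicator {s..u} v * ?F v = (\<Sum>i\<le>n. \<Sigma>\<^sup>+w. indicator {s..u} v * (survival a s v x * (\<Sigma>\<^sup>+z. ennreal (a v x z) * njump a i v u z w)) * njump a (n - i) u t w y)"
      proof (cases "v \<in> {s..u}")
        case True
        then have "?F v = survival a s v x * (\<Sigma>\<^sup>+z. ennreal (a v x z) * (\<Sum>i\<le>n. \<Sigma>\<^sup>+w. njump a i v u z w * njump a (n - i) u t w y))"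
          by (subst Suc.IH) auto
        also have "\<dots> = (\<Sum>i\<le>n. \<Sigma>\<^sup>+z. \<Sigma>\<^sup>+w. survival a s v x * (ennreal (a v x z) * (njump a i v u z w * njump a (n - i) u t w y)))"
          by (simp only: sum_distrib_left esum_sum esum_cmult(1)[symmetric])
        also have "\<dots> = (\<Sum>i\<le>n. \<Sigma>\<^sup>+w. (survival a s v x * (\<Sigma>\<^sup>+z. ennreal (a v x z) * njump a i v u z w)) * njump a (n - i) u t w y)"
          by (subst esum_commute) (simp only: esum_cmult[symmetric] mult_ac)
        finally show ?thesis using True by simp
      qed simp
    qed
    also have "\<dots> = (\<Sum>i\<le>n. \<Sigma>\<^sup>+z. njump a (Suc i) s u x z * njump a (n - i) u t z y)"
    proof (subst nn_integral_sum)
      let ?G = "\<lambda>i w v. indicator {s..u} v * (survival a s v x * (\<Sigma>\<^sup>+z. ennreal (a v x z) * njump a i v u z w))"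
      show "(\<lambda>v. \<Sigma>\<^sup>+w. ?G i w v * njump a (n - i) u t w y) \<in> borel_measurable lborel" for i by measurable
      have "(\<integral>\<^sup>+v. (\<Sigma>\<^sup>+w. ?G i w v * njump a (n - i) u t w y) \<partial>lborel) = (\<Sigma>\<^sup>+z. njump a (Suc i) s u x z * njump a (n - i) u t z y)" for i
      proof -
        have *: "(\<integral>\<^sup>+v. ?G i w v * njump a (n - i) u t w y \<partial>lborel) = njump a (Suc i) s u x w * njump a (n - i) u t w y" for w
          unfolding njump.simps by (rule nn_integral_multc) measurable
        have "(\<integral>\<^sup>+v. (\<Sigma>\<^sup>+w. ?G i w v * njump a (n - i) u t w y) \<partial>lborel) = (\<Sigma>\<^sup>+w. \<integral>\<^sup>+v. ?G i w v * njump a (n - i) u t w y \<partial>lborel)"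
          by (rule nn_integral_esum) measurable
        then show ?thesis by (simp only: *)
      qed
      then show "(\<Sum>i\<le>n. \<integral>\<^sup>+v. (\<Sigma>\<^sup>+w. ?G i w v * njump a (n - i) u t w y) \<partial>lborel)
        = (\<Sum>i\<le>n. \<Sigma>\<^sup>+z. njump a (Suc i) s u x z * njump a (n - i) u t z y)" by (simp only:)
    qed
    finally show ?thesis .
  qed
  finally show ?case by (subst sum.atMost_Suc_shift) (simp add: add.commute del: njump.simps)
qed

lemma kern_Chapman_Kolmogorov:
  assumes "s \<le> u" "u \<le> t"
  shows "kern a s t x y = (\<Sigma>\<^sup>+z. kern a s u x z * kern a u t z y)"
proof -
  have "kern a s t x y = (\<Sigma>\<^sup>+z. \<Sigma>\<^sup>+n. \<Sum>i\<le>n. njump a i s u x z * njump a (n - i) u t z y)"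
    unfolding kern_def njump_Chapman_Kolmogorov[OF assms] by (simp only: esum_sum[symmetric]) (rule esum_commute)
  moreover have "(\<Sigma>\<^sup>+n. \<Sum>i\<le>n. njump a i s u x z * njump a (n - i) u t z y) = kern a s u x z * kern a u t z y" for z
    unfolding kern_def by (rule esum_convolution)
  ultimately show ?thesis by (simp only:)
qed

lemma kern_row_le_1: "s \<le> t \<Longrightarrow> (\<Sigma>\<^sup>+y. kern a s t x y) \<le> 1"
proof -
  assume st: "s \<le> t"
  have "(\<Sigma>\<^sup>+y. kern a s t x y) = (\<Sum>n. \<Sigma>\<^sup>+y. njump a n s t x y)"
    unfolding kern_def by (subst esum_commute) (rule nn_integral_count_space_nat)
  also have "\<dots> \<le> 1"
    unfolding suminf_eq_SUP by (rule SUP_least) (rule njump_row_partial[OF st])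
  finally show ?thesis .
qed

lemma kern_renewal:
  "kern a s t x y = (if x = y then survival a s t x else 0)
    + (\<integral>\<^sup>+u. indicator {s..t} u * ((\<Sigma>\<^sup>+z. kern a s u x z * ennreal (a u z y)) * survival a u t y) \<partial>lborel)"
proof -
  have "kern a s t x y = njump a 0 s t x y + (\<Sigma>\<^sup>+n. njump a (Suc n) s t x y)"
    unfolding kern_def by (rule esum_nat_shift)
  also have "(\<Sigma>\<^sup>+n. njump a (Suc n) s t x y)
     = (\<integral>\<^sup>+u. (\<Sigma>\<^sup>+n. indicator {s..t} u * ((\<Sigma>\<^sup>+z. njump a n s u x z * ennreal (a u z y)) * survival a u t y)) \<partial>lborel)"
    unfolding njump_forward by (rule nn_integral_esum[symmetric]) measurable
  also have "\<dots> = (\<integral>\<^sup>+u. indicator {s..t} u * ((\<Sigma>\<^sup>+z. kern a s u x z * ennreal (a u z y)) * survival a u t y) \<partial>lborel)"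
  proof (rule nn_integral_cong)
    fix u
    have "(\<Sigma>\<^sup>+n. \<Sigma>\<^sup>+z. njump a n s u x z * ennreal (a u z y)) = (\<Sigma>\<^sup>+z. kern a s u x z * ennreal (a u z y))"
      unfolding kern_def esum_cmult(2)[symmetric] by (rule esum_commute)
    then show "(\<Sigma>\<^sup>+n. indicator {s..t} u * ((\<Sigma>\<^sup>+z. njump a n s u x z * ennreal (a u z y)) * survival a u t y))
      = indicator {s..t} u * ((\<Sigma>\<^sup>+z. kern a s u x z * ennreal (a u z y)) * survival a u t y)"
      by (simp only: esum_cmult)
  qed
  finally show ?thesis by simp
qed

text \<open>
  The forward equation in integrated form: the mass that has left \<open>y\<close> up to time \<open>t\<close> is added on the left,
  so that all terms are nonnegative. It comes from the renewal equation at the last jump,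
  because a jump into \<open>y\<close> at time \<open>u\<close> is followed by a jump out of \<open>y\<close> before \<open>t\<close> unless the walk
  survives in \<open>y\<close>.
\<close>

lemma kern_forward:
  assumes st: "s \<le> t"
  shows "kern a s t x y + (\<integral>\<^sup>+u. indicator {s..t} u * (ennreal (total_rate a u y) * kern a s u x y) \<partial>lborel)
    = (if x = y then 1 else 0) + (\<integral>\<^sup>+u. indicator {s..t} u * (\<Sigma>\<^sup>+z. kern a s u x z * ennreal (a u z y)) \<partial>lborel)"
proof -
  let ?\<mu> = "\<lambda>v. ennreal (total_rate a v y)"
  let ?R = "\<lambda>u. (\<Sigma>\<^sup>+z. kern a s u x z * ennreal (a u z y))"
  let ?d = "if x = y then 1 else 0 :: ennreal"
  let ?M = "\<lambda>u v. (if s \<le> u \<and> u \<le> v \<and> v \<le> t then ?R u * (?\<mu> v * survival a u v y) else 0)"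
  have "(\<integral>\<^sup>+v. indicator {s..t} v * (?\<mu> v * kern a s v x y) \<partial>lborel)
    = (\<integral>\<^sup>+v. ?d * (indicator {s..t} v * (?\<mu> v * survival a s v y)) + (\<integral>\<^sup>+u. ?M u v \<partial>lborel) \<partial>lborel)"
  proof (rule nn_integral_cong)
    fix v
    have "indicator {s..t} v * (?\<mu> v * (\<integral>\<^sup>+u. indicator {s..v} u * (?R u * survival a u v y) \<partial>lborel))
      = (\<integral>\<^sup>+u. indicator {s..t} v * (?\<mu> v * (indicator {s..v} u * (?R u * survival a u v y))) \<partial>lborel)"
      by (simp add: nn_integral_cmult)
    also have "\<dots> = (\<integral>\<^sup>+u. ?M u v \<partial>lborel)"
      by (rule nn_integral_cong) (auto split: split_indicator simp: mult_ac)
    finally show "indicator {s..t} v * (?\<mu> v * kern a s v x y)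
        = ?d * (indicator {s..t} v * (?\<mu> v * survival a s v y)) + (\<integral>\<^sup>+u. ?M u v \<partial>lborel)"
      by (subst kern_renewal) (auto simp: distrib_left mult_ac)
  qed
  also have "\<dots> = ?d * (\<integral>\<^sup>+v. indicator {s..t} v * (?\<mu> v * survival a s v y) \<partial>lborel) + (\<integral>\<^sup>+v. (\<integral>\<^sup>+u. ?M u v \<partial>lborel) \<partial>lborel)"
  proof (subst nn_integral_add)
    show "(\<lambda>v. \<integral>\<^sup>+u. ?M u v \<partial>lborel) \<in> borel_measurable lborel"
      by (rule lborel.borel_measurable_nn_integral) measurable
    show "(\<lambda>v. ?d * (indicator {s..t} v * (?\<mu> v * survival a s v y))) \<in> borel_measurable lborel" by measurable
    have "(\<integral>\<^sup>+v. ?d * (indicator {s..t} v * (?\<mu> v * survival a s v y)) \<partial>lborel) = ?d * (\<integral>\<^sup>+v. indicator {s..t} v * (?\<mu> v * survival a s v y) \<partial>lborel)"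
      by (rule nn_integral_cmult) measurable
    then show "(\<integral>\<^sup>+v. ?d * (indicator {s..t} v * (?\<mu> v * survival a s v y)) \<partial>lborel) + (\<integral>\<^sup>+v. (\<integral>\<^sup>+u. ?M u v \<partial>lborel) \<partial>lborel)
      = ?d * (\<integral>\<^sup>+v. indicator {s..t} v * (?\<mu> v * survival a s v y) \<partial>lborel) + (\<integral>\<^sup>+v. (\<integral>\<^sup>+u. ?M u v \<partial>lborel) \<partial>lborel)"
      by (simp only:)
  qed
  also have "(\<integral>\<^sup>+v. (\<integral>\<^sup>+u. ?M u v \<partial>lborel) \<partial>lborel) = (\<integral>\<^sup>+u. (\<integral>\<^sup>+v. ?M u v \<partial>lborel) \<partial>lborel)"
    by (rule lborel_pair.Fubini'[symmetric]) measurable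
  also have "\<dots> = (\<integral>\<^sup>+u. indicator {s..t} u * (?R u * (\<integral>\<^sup>+v. indicator {u..t} v * (?\<mu> v * survival a u v y) \<partial>lborel)) \<partial>lborel)"
  proof (rule nn_integral_cong)
    fix u
    have "indicator {s..t} u * (?R u * (\<integral>\<^sup>+v. indicator {u..t} v * (?\<mu> v * survival a u v y) \<partial>lborel))
      = (\<integral>\<^sup>+v. indicator {s..t} u * (?R u * (indicator {u..t} v * (?\<mu> v * survival a u v y))) \<partial>lborel)"
      by (simp add: nn_integral_cmult)
    also have "\<dots> = (\<integral>\<^sup>+v. ?M u v \<partial>lborel)"
      by (rule nn_integral_cong) (auto split: split_indicator)
    finally show "(\<integral>\<^sup>+v. ?M u v \<partial>lborel) = indicator {s..t} u * (?R u * (\<integral>\<^sup>+v. indicator {u..t} v * (?\<mu> v * survival a u v y) \<partial>lborel))" by simp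
  qed
  finally have E: "(\<integral>\<^sup>+v. indicator {s..t} v * (?\<mu> v * kern a s v x y) \<partial>lborel)
    = ?d * (\<integral>\<^sup>+v. indicator {s..t} v * (?\<mu> v * survival a s v y) \<partial>lborel)
      + (\<integral>\<^sup>+u. indicator {s..t} u * (?R u * (\<integral>\<^sup>+v. indicator {u..t} v * (?\<mu> v * survival a u v y) \<partial>lborel)) \<partial>lborel)" .
  have m: "(\<lambda>u. \<integral>\<^sup>+v. indicator {u..t} v * (?\<mu> v * survival a u v y) \<partial>lborel) \<in> borel_measurable lborel"
    unfolding indicator_Icc_eq by (rule lborel.borel_measurable_nn_integral) measurable
  note [measurable] = m
  have "kern a s t x y + (\<integral>\<^sup>+v. indicator {s..t} v * (?\<mu> v * kern a s v x y) \<partial>lborel)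
    = ?d * ((\<integral>\<^sup>+v. indicator {s..t} v * (?\<mu> v * survival a s v y) \<partial>lborel) + survival a s t y)
      + ((\<integral>\<^sup>+u. indicator {s..t} u * (?R u * (\<integral>\<^sup>+v. indicator {u..t} v * (?\<mu> v * survival a u v y) \<partial>lborel)) \<partial>lborel)
         + (\<integral>\<^sup>+u. indicator {s..t} u * (?R u * survival a u t y) \<partial>lborel))"
    unfolding E by (subst kern_renewal) (auto simp: distrib_left ac_simps)
  also have "(\<integral>\<^sup>+u. indicator {s..t} u * (?R u * (\<integral>\<^sup>+v. indicator {u..t} v * (?\<mu> v * survival a u v y) \<partial>lborel)) \<partial>lborel)
         + (\<integral>\<^sup>+u. indicator {s..t} u * (?R u * survival a u t y) \<partial>lborel)
      = (\<integral>\<^sup>+u. indicator {s..t} u * (?R u * (\<integral>\<^sup>+v. indicator {u..t} v * (?\<mu> v * survival a u v y) \<partial>lborel)) + indicator {s..t} u * (?R u * survival a u t y) \<partial>lborel)"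
    by (rule nn_integral_add[symmetric]) measurable
  also have "\<dots> = (\<integral>\<^sup>+u. indicator {s..t} u * ?R u \<partial>lborel)"
  proof (rule nn_integral_cong)
    fix u
    have "?R u * (\<integral>\<^sup>+v. indicator {u..t} v * (?\<mu> v * survival a u v y) \<partial>lborel) + ?R u * survival a u t y = ?R u" if "u \<le> t"
      using exp_hazard_integral(1)[OF that, of y] by (simp add: distrib_left[symmetric])
    then show "indicator {s..t} u * (?R u * (\<integral>\<^sup>+v. indicator {u..t} v * (?\<mu> v * survival a u v y) \<partial>lborel)) + indicator {s..t} u * (?R u * survival a u t y)
      = indicator {s..t} u * ?R u"
      by (auto split: split_indicator)
  qed
  finally show ?thesis using exp_hazard_integral(1)[OF st, of y] by simp
qed

end

lemma nbr_add: "nbr (x + w) (y + w) = nbr x y"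
  by (simp add: nbr_def l1_dist_def)

lemma total_rate_env_shift: "total_rate (env_shift r w a) t x = total_rate a (t + r) (x + w)"
  unfolding total_rate_def env_shift_def
  by (rule sum.reindex_bij_witness[of _ "\<lambda>y. y - w" "\<lambda>y. y + w"])
    (use nbr_add[of x w] in \<open>auto simp: nbr_add, metis diff_add_cancel\<close>)

definition env_rev :: "'d::finite env \<Rightarrow> 'd env" where
  "env_rev a = (\<lambda>t. a (- t))"

context regular_rates
begin

lemma hazard_env_shift: "hazard (env_shift r w a) s t x = hazard a (s + r) (t + r) (x + w)"
proof -
  have "(LBINT u. indicator {s + r..t + r} u *\<^sub>R total_rate a u (x + w)) = (LBINT u. indicator {s + r..t + r} (r + 1 * u) *\<^sub>R total_rate a (r + 1 * u) (x + w))"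
    by (subst lborel_integral_real_affine[where c=1 and t=r]) auto
  also have "\<dots> = (LBINT u. indicator {s..t} u *\<^sub>R total_rate a (u + r) (x + w))"
    by (rule Bochner_Integration.integral_cong) (auto split: split_indicator simp: add.commute)
  finally show ?thesis unfolding hazard_def set_lebesgue_integral_def total_rate_env_shift by simp
qed

lemma njump_env_shift: "njump (env_shift r w a) n s t x y = njump a n (s + r) (t + r) (x + w) (y + w)"
proof (induction n arbitrary: s x)
  case 0 then show ?case by (simp add: survival_def hazard_env_shift)
next
  case (Suc n)
  let ?F = "\<lambda>u. indicator {s + r..t + r} u * (survival a (s + r) u (x + w) * (\<Sigma>\<^sup>+z. ennreal (a u (x + w) z) * njump a n u (t + r) z (y + w)))"
  have "njump (env_shift r w a) (Suc n) s t x y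
    = (\<integral>\<^sup>+u. indicator {s..t} u * (survival a (s + r) (u + r) (x + w) * (\<Sigma>\<^sup>+z. ennreal (a (u + r) (x + w) (z + w)) * njump a n (u + r) (t + r) (z + w) (y + w))) \<partial>lborel)"
  proof -
    have "env_shift r w a u x z = a (u + r) (x + w) (z + w)" for u z by (simp add: env_shift_def)
    then show ?thesis unfolding njump.simps Suc.IH survival_def hazard_env_shift by (simp only:)
  qed
  also have "\<dots> = (\<integral>\<^sup>+u. ?F (r + 1 * u) \<partial>lborel)"
  proof (rule nn_integral_cong)
    fix u :: real
    have "(\<Sigma>\<^sup>+z. ennreal (a (u + r) (x + w) (z + w)) * njump a n (u + r) (t + r) (z + w) (y + w))
      = (\<Sigma>\<^sup>+z. ennreal (a (u + r) (x + w) z) * njump a n (u + r) (t + r) z (y + w))"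
      by (rule esum_shift(1)[of "\<lambda>z. ennreal (a (u + r) (x + w) z) * njump a n (u + r) (t + r) z (y + w)"])
    then show "indicator {s..t} u * (survival a (s + r) (u + r) (x + w) * (\<Sigma>\<^sup>+z. ennreal (a (u + r) (x + w) (z + w)) * njump a n (u + r) (t + r) (z + w) (y + w))) = ?F (r + 1 * u)"
      by (auto split: split_indicator simp: add.commute)
  qed
  also have "\<dots> = njump a (Suc n) (s + r) (t + r) (x + w) (y + w)"
    unfolding njump.simps by (subst (2) nn_integral_real_affine[where c=1 and t=r]) auto
  finally show ?case .
qed

lemma kern_env_shift: "kern (env_shift r w a) s t x y = kern a (s + r) (t + r) (x + w) (y + w)"
  unfolding kern_def njump_env_shift ..

lemma hazard_env_rev: "hazard (env_rev a) (- t) (- s) x = hazard a s t x"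
proof -
  have "(LBINT u. indicator {s..t} u *\<^sub>R total_rate a u x) = (LBINT u. indicator {s..t} (0 + (-1) * u) *\<^sub>R total_rate a (0 + (-1) * u) x)"
    by (subst lborel_integral_real_affine[where c="-1" and t=0]) auto
  also have "\<dots> = (LBINT u. indicator {- t..- s} u *\<^sub>R total_rate (env_rev a) u x)"
    by (rule Bochner_Integration.integral_cong) (auto split: split_indicator simp: total_rate_def env_rev_def)
  finally show ?thesis unfolding hazard_def set_lebesgue_integral_def by simp
qed

text \<open>
  With symmetric rates, expanding at the first jump in reversed time is expanding at the last
  jump, so reversing time exchanges the two space arguments.
\<close>

lemma njump_env_rev:
  assumes rev: "regular_rates (env_rev a)" and sym: "\<And>t x y. a t x y = a t y x"
  shows "njump (env_rev a) n (- t) (- s) y x = njump a n s t x y"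
proof (induction n arbitrary: t y)
  case 0 then show ?case by (auto simp: survival_def hazard_env_rev)
next
  case (Suc n)
  interpret rev: regular_rates "env_rev a" by (rule rev)
  let ?F = "\<lambda>u. indicator {- t..- s} u * (survival (env_rev a) (- t) u y * (\<Sigma>\<^sup>+z. ennreal (env_rev a u y z) * njump (env_rev a) n u (- s) z x))"
  have "njump (env_rev a) (Suc n) (- t) (- s) y x = (\<integral>\<^sup>+u. ?F (0 + (-1) * u) \<partial>lborel)"
    unfolding njump.simps by (subst nn_integral_real_affine[where c="-1" and t=0]) auto
  also have "\<dots> = (\<integral>\<^sup>+u. indicator {s..t} u * ((\<Sigma>\<^sup>+z. njump a n s u x z * ennreal (a u z y)) * survival a u t y) \<partial>lborel)"
  proof (rule nn_integral_cong)
    fix u :: real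
    have "(\<Sigma>\<^sup>+z. ennreal (env_rev a (- u) y z) * njump (env_rev a) n (- u) (- s) z x) = (\<Sigma>\<^sup>+z. njump a n s u x z * ennreal (a u z y))"
      unfolding Suc.IH by (simp add: env_rev_def sym[of u y] mult.commute)
    moreover have "survival (env_rev a) (- t) (- u) y = survival a u t y" by (simp add: survival_def hazard_env_rev)
    ultimately show "?F (0 + (-1) * u) = indicator {s..t} u * ((\<Sigma>\<^sup>+z. njump a n s u x z * ennreal (a u z y)) * survival a u t y)"
      by (auto split: split_indicator simp: mult.commute)
  qed
  also have "\<dots> = njump a (Suc n) s t x y" by (rule njump_forward[symmetric])
  finally show ?case .
qed

lemma kern_env_rev:
  assumes "regular_rates (env_rev a)" "\<And>t x y. a t x y = a t y x"
  shows "kern (env_rev a) (- t) (- s) y x = kern a s t x y"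
  unfolding kern_def njump_env_rev[OF assms] ..

lemma jump_time_law_density:
  "jump_time_law a r z = density lborel (\<lambda>u. indicator {r..} u * (ennreal (total_rate a u z) * survival a r u z))" (is "_ = ?D")
proof (rule measure_eqI_generator_eq[where E="range (\<lambda>t::real. {..t})" and \<Omega>=UNIV and A="\<lambda>i. {..real i}"])
  show "Int_stable (range (\<lambda>a::real. {..a}))" by (auto simp: Int_stable_def min_def intro!: exI[of _ "min _ _"])
  have b: "sets borel = sigma_sets UNIV (range (\<lambda>a::real. {..a}))" by (subst borel_eq_atMost) simp
  then show "sets (jump_time_law a r z) = sigma_sets UNIV (range (\<lambda>a::real. {..a}))" by (simp add: jump_time_law_def)
  from b show "sets ?D = sigma_sets UNIV (range (\<lambda>a::real. {..a}))" by simp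
  show "(\<Union>i. {..real i}) = UNIV" using real_arch_simple by auto
  show "range (\<lambda>i. {..real i}) \<subseteq> range (\<lambda>t. {..t})" by auto
  interpret J: prob_space "jump_time_law a r z" by (rule prob_space_jump_time_law[OF reg env])
  show "emeasure (jump_time_law a r z) {..real i} \<noteq> \<infinity>" for i by simp
  fix X :: "real set" assume "X \<in> range (\<lambda>t. {..t})"
  then obtain t where X: "X = {..t}" by auto
  have l: "emeasure (jump_time_law a r z) X = 1 - exp (- hazard a r t z)"
    unfolding X jump_time_law_def hazard_def by (rule emeasure_interval_measure_Iic) (use jump_time_cdf[OF reg env] in auto)
  have "emeasure ?D X = (\<integral>\<^sup>+u. indicator {r..t} u * (ennreal (total_rate a u z) * survival a r u z) \<partial>lborel)"
    unfolding X by (subst emeasure_density) (auto intro!: nn_integral_cong split: split_indicator)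
  moreover have "\<dots> = 1 - exp (- hazard a r t z)"
  proof (cases "r \<le> t")
    case True
    have e: "exp (- hazard a r t z) \<le> 1" using hazard_nonneg by simp
    have "(\<integral>\<^sup>+u. indicator {r..t} u * (ennreal (total_rate a u z) * survival a r u z) \<partial>lborel) + survival a r t z - survival a r t z = 1 - survival a r t z"
      by (simp only: exp_hazard_integral(1)[OF True])
    then show ?thesis using e by (simp add: survival_def ennreal_minus ennreal_1[symmetric] del: ennreal_1)
  next
    case False
    then have "hazard a r t z = 0" unfolding hazard_def by simp
    then show ?thesis using False by simp
  qed
  ultimately show "emeasure (jump_time_law a r z) X = emeasure ?D X" using l by simp
qed auto

lemma jump_op_eq:
  assumes g[measurable]: "g \<in> borel_measurable states"
  shows "jump_op a g (r, z) = (\<integral>\<^sup>+u. indicator {r..} u * (survival a r u z * (\<Sigma>\<^sup>+y. ennreal (a u z y) * g (u, y))) \<partial>lborel)"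
proof -
  have m1[measurable]: "(\<lambda>u. measure_pmf (jump_target a u z)) \<in> borel \<rightarrow>\<^sub>M prob_algebra (count_space UNIV)"
    by (rule measurable_jump_target[OF reg env])
  have m2: "(\<lambda>u. distr (measure_pmf (jump_target a u z)) states (\<lambda>y. (u, y))) \<in> borel \<rightarrow>\<^sub>M subprob_algebra states"
    by (rule measurable_prob_algebraD, rule measurable_distr_prob_space2[where M="count_space UNIV"]) measurable
  have m3: "(\<lambda>u. distr (measure_pmf (jump_target a u z)) states (\<lambda>y. (u, y))) \<in> jump_time_law a r z \<rightarrow>\<^sub>M subprob_algebra states"
    using m2 by (subst measurable_cong_sets[of _ borel]) (auto simp: jump_time_law_def)
  have [measurable]: "(\<lambda>u. g (u, y)) \<in> borel_measurable borel" for y by measurable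
  have "jump_op a g (r, z) = (\<integral>\<^sup>+u. (\<integral>\<^sup>+c. g c \<partial>distr (measure_pmf (jump_target a u z)) states (\<lambda>y. (u, y))) \<partial>jump_time_law a r z)"
    unfolding jump_op_def using reg by (simp add: jump_kernel_def nn_integral_bind[OF g m3])
  also have "\<dots> = (\<integral>\<^sup>+u. (\<Sigma>\<^sup>+y. ennreal (a u z y / total_rate a u z) * g (u, y)) \<partial>jump_time_law a r z)"
  proof (rule nn_integral_cong)
    fix u
    have "(\<lambda>y. (u, y)) \<in> measure_pmf (jump_target a u z) \<rightarrow>\<^sub>M states"
      by (subst measurable_cong_sets[of _ "count_space UNIV"]) (auto simp: space_pair_measure)
    then have "(\<integral>\<^sup>+c. g c \<partial>distr (measure_pmf (jump_target a u z)) states (\<lambda>y. (u, y))) = (\<integral>\<^sup>+y. g (u, y) \<partial>measure_pmf (jump_target a u z))"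
      by (subst nn_integral_distr) auto
    then show "(\<integral>\<^sup>+c. g c \<partial>distr (measure_pmf (jump_target a u z)) states (\<lambda>y. (u, y))) = (\<Sigma>\<^sup>+y. ennreal (a u z y / total_rate a u z) * g (u, y))"
      by (simp add: nn_integral_measure_pmf pmf_jump_target[OF env])
  qed
  also have "\<dots> = (\<integral>\<^sup>+u. (indicator {r..} u * (ennreal (total_rate a u z) * survival a r u z)) * (\<Sigma>\<^sup>+y. ennreal (a u z y / total_rate a u z) * g (u, y)) \<partial>lborel)"
    unfolding jump_time_law_density by (rule nn_integral_density) measurable
  also have "\<dots> = (\<integral>\<^sup>+u. indicator {r..} u * (survival a r u z * (\<Sigma>\<^sup>+y. ennreal (a u z y) * g (u, y))) \<partial>lborel)"
  proof (rule nn_integral_cong)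
    fix u
    have "ennreal (total_rate a u z) * ennreal (a u z y / total_rate a u z) = ennreal (a u z y)" for y
      using total_rate_pos[OF env, of u z] rate_nonneg[of u z y]
      by (subst ennreal_mult[symmetric]) (auto intro!: divide_nonneg_nonneg)
    then have A: "ennreal (total_rate a u z) * (\<Sigma>\<^sup>+y. ennreal (a u z y / total_rate a u z) * g (u, y)) = (\<Sigma>\<^sup>+y. ennreal (a u z y) * g (u, y))"
      by (simp add: esum_cmult(1)[symmetric] mult.assoc[symmetric])
    show "(indicator {r..} u * (ennreal (total_rate a u z) * survival a r u z)) * (\<Sigma>\<^sup>+y. ennreal (a u z y / total_rate a u z) * g (u, y))
       = indicator {r..} u * (survival a r u z * (\<Sigma>\<^sup>+y. ennreal (a u z y) * g (u, y)))"
      unfolding A[symmetric] by (simp only: mult_ac)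
  qed
  finally show ?thesis .
qed

text \<open>
  Both sides satisfy the same recursion at the first jump; states with an arrival time after \<open>t\<close>
  have weight zero.
\<close>

lemma jump_op_power_eq_njump:
  "(jump_op a ^^ n) (stay_weight a t y) (r, z) = (if r \<le> t then njump a n r t z y else 0)"
proof (induction n arbitrary: r z)
  case 0
  have "emeasure (jump_kernel a (r, z)) {c. t < fst c} = survival a r t z" if "r \<le> t"
  proof -
    have "emeasure (jump_kernel a (r, z)) {c. t < fst c} = jump_op a (indicator {c. t < fst c}) (r, z)"
    proof -
      have "sets (jump_kernel a (r, z)) = sets states"
        using measurable_space[OF measurable_jump_kernel[OF env], of "(r, z)"] by (simp add: space_prob_algebra space_pair_measure)
      then have "{c. t < fst c} \<in> sets (jump_kernel a (r, z))" by simp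
      then show ?thesis by (simp add: jump_op_def)
    qed
    also have "\<dots> = (\<integral>\<^sup>+u. indicator {r..} u * (ennreal (total_rate a u z) * survival a r u z) * indicator {t<..} u \<partial>lborel)"
      by (subst jump_op_eq) (auto intro!: nn_integral_cong split: split_indicator simp: esum_rate mult.commute)
    also have "\<dots> = emeasure (jump_time_law a r z) {t<..}"
      unfolding jump_time_law_density by (rule emeasure_density[symmetric]) auto
    also have "\<dots> = survival a r t z"
    proof -
      interpret J: prob_space "jump_time_law a r z" by (rule prob_space_jump_time_law[OF reg env])
      show ?thesis unfolding J.emeasure_eq_measure jump_time_law_tail[OF reg env] survival_def hazard_def ..
    qed
    finally show ?thesis .
  qed
  then show ?case by (auto simp: stay_weight_def split: split_indicator)
next
  case (Suc n)
  let ?g = "(jump_op a ^^ n) (stay_weight a t y)"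
  have g: "?g \<in> borel_measurable states"
    by (induction n) (auto intro: measurable_jump_op[OF env] measurable_stay_weight[OF env])
  have "(jump_op a ^^ Suc n) (stay_weight a t y) (r, z) = (\<integral>\<^sup>+u. indicator {r..} u * (survival a r u z * (\<Sigma>\<^sup>+y'. ennreal (a u z y') * ?g (u, y'))) \<partial>lborel)"
    using jump_op_eq[OF g] by simp
  also have "\<dots> = (if r \<le> t then njump a (Suc n) r t z y else 0)"
    unfolding njump.simps Suc.IH by (auto intro!: nn_integral_cong nn_integral_zero' AE_I2 split: split_indicator)
  finally show ?case .
qed

lemma heat_kernel_eq_kern:
  assumes "s \<le> t" shows "ennreal (heat_kernel a s t x y) = kern a s t x y"
  using assms by (simp add: heat_kernel_eq_suminf[OF env] jump_op_power_eq_njump kern_def nn_integral_count_space_nat)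

end

text \<open>
  The frozen walk never jumps after time \<open>t\<close>, so by the definition of \<^const>\<open>walk_at\<close> it is nowhere.
\<close>

lemma heat_kernel_irregular:
  fixes a :: "'d::finite env"
  assumes env: "a \<in> Env" and irr: "\<not> regular_env a"
  shows "heat_kernel a s t x y = 0"
proof -
  have k: "jump_kernel a b = return states b" for b using irr by (cases b) (simp add: jump_kernel_def)
  have "stay_weight a t y = (\<lambda>_. 0)"
    by (auto simp: stay_weight_def k fun_eq_iff split: split_indicator)
  moreover have "jump_op a (\<lambda>_. 0) = (\<lambda>_. 0)" by (simp add: jump_op_def fun_eq_iff)
  then have "(jump_op a ^^ n) (\<lambda>_. 0) = (\<lambda>_. 0)" for n by (induction n) auto
  ultimately have "ennreal (heat_kernel a s t x y) = 0" using heat_kernel_eq_suminf[OF env, of s t x y] by simp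
  moreover have "0 \<le> heat_kernel a s t x y" by (simp add: heat_kernel_def)
  ultimately show ?thesis by simp
qed


section \<open>Dissipation in a fixed environment\<close>

lemma (in regular_rates) kern_le_1: "kern a s t x y \<le> 1"
proof (cases "s \<le> t")
  case True
  have "kern a s t x y = (\<Sigma>\<^sup>+z. (if z = y then kern a s t x z else 0))" by (rule esum_delta(1)[symmetric])
  also have "\<dots> \<le> (\<Sigma>\<^sup>+z. kern a s t x z)" by (rule nn_integral_mono) auto
  also have "\<dots> \<le> 1" by (rule kern_row_le_1[OF True])
  finally show ?thesis .
next
  case False
  then have "njump a (Suc n) s t x y = 0" for n by simp
  moreover have "hazard a s t x = 0" unfolding hazard_def using False by simp
  ultimately show ?thesis unfolding kern_def by (subst esum_nat_shift) (auto simp: survival_def)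
qed

lemma nn_integral_Icc_split:
  fixes f :: "real \<Rightarrow> ennreal"
  assumes [measurable]: "f \<in> borel_measurable borel" and "r \<le> s" "s \<le> t"
  shows "(\<integral>\<^sup>+u. indicator {r..t} u * f u \<partial>lborel)
    = (\<integral>\<^sup>+u. indicator {r..s} u * f u \<partial>lborel) + (\<integral>\<^sup>+u. indicator {s..t} u * f u \<partial>lborel)"
proof -
  have "(\<integral>\<^sup>+u. indicator {r..t} u * f u \<partial>lborel) = (\<integral>\<^sup>+u. indicator {r..s} u * f u + indicator {s..t} u * f u \<partial>lborel)"
    by (rule nn_integral_cong_AE, use AE_lborel_singleton[of s] in eventually_elim)
      (use assms in \<open>auto split: split_indicator\<close>)
  also have "\<dots> = (\<integral>\<^sup>+u. indicator {r..s} u * f u \<partial>lborel) + (\<integral>\<^sup>+u. indicator {s..t} u * f u \<partial>lborel)"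
    by (rule nn_integral_add) measurable
  finally show ?thesis .
qed

lemma esum_swap:
  fixes g h :: "'i::countable \<Rightarrow> 'i \<Rightarrow> ennreal"
  assumes "\<And>y z. g z y = h y z"
  shows "(\<Sigma>\<^sup>+y. \<Sigma>\<^sup>+z. g y z) = (\<Sigma>\<^sup>+y. \<Sigma>\<^sup>+z. h y z)"
  using esum_commute[of g] by (simp add: assms)

lemma esum2_add3:
  "(\<Sigma>\<^sup>+y. \<Sigma>\<^sup>+z. (A y z + B y z) + C y z) = (\<Sigma>\<^sup>+y. \<Sigma>\<^sup>+z. A y z) + (\<Sigma>\<^sup>+y. \<Sigma>\<^sup>+z. B y z) + (\<Sigma>\<^sup>+y. \<Sigma>\<^sup>+z. C y z)"
  by (simp add: nn_integral_add)

lemma ennreal_eq_sum3: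
  assumes "a + b = c + d + e" "0 \<le> a" "0 \<le> b" "0 \<le> c" "0 \<le> d" "0 \<le> e"
  shows "ennreal a + ennreal b = (ennreal c + ennreal d) + ennreal e"
  using assms by (simp add: ennreal_plus[symmetric] del: ennreal_plus)

text \<open>
  Summation by parts over the bonds: sum
  \<open>f y * q y + f z * q z = (f y - f z) * (q y - q z) + f y * q z + f z * q y\<close> over all ordered pairs. All terms
  are nonnegative, so the sums may be infinite.
\<close>

lemma esum_symmetrize:
  fixes f q :: "'a::countable \<Rightarrow> real" and c :: "'a \<Rightarrow> 'a \<Rightarrow> real"
  assumes nn: "\<And>y z. 0 \<le> c y z" "\<And>y. 0 \<le> f y" "\<And>y. 0 \<le> q y" and sym: "\<And>y z. c y z = c z y"
    and mono: "\<And>y z. 0 \<le> (f y - f z) * (q y - q z)"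
  shows "2 * (\<Sigma>\<^sup>+y. \<Sigma>\<^sup>+z. ennreal (c y z * (f y * q y)))
    = (\<Sigma>\<^sup>+y. \<Sigma>\<^sup>+z. ennreal (c y z * ((f y - f z) * (q y - q z)))) + 2 * (\<Sigma>\<^sup>+y. \<Sigma>\<^sup>+z. ennreal (c y z * (f y * q z)))"
proof -
  define A B C D E where "A y z = ennreal (c y z * (f y * q y))" and "B y z = ennreal (c y z * (f z * q z))"
    and "C y z = ennreal (c y z * ((f y - f z) * (q y - q z)))" and "D y z = ennreal (c y z * (f y * q z))"
    and "E y z = ennreal (c y z * (f z * q y))" for y z
  have pt: "A y z + B y z = (C y z + D y z) + E y z" for y z
    unfolding A_def B_def C_def D_def E_def
  proof (rule ennreal_eq_sum3)
    show "c y z * (f y * q y) + c y z * (f z * q z) = c y z * ((f y - f z) * (q y - q z)) + c y z * (f y * q z) + c y z * (f z * q y)"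
      by (simp add: algebra_simps)
  qed (use nn mono[of y z] in \<open>auto intro!: mult_nonneg_nonneg\<close>)
  have "(\<Sigma>\<^sup>+y. \<Sigma>\<^sup>+z. A y z) = (\<Sigma>\<^sup>+y. \<Sigma>\<^sup>+z. B y z)"
    by (rule esum_swap) (simp only: A_def B_def sym)
  then have 1: "2 * (\<Sigma>\<^sup>+y. \<Sigma>\<^sup>+z. A y z) = (\<Sigma>\<^sup>+y. \<Sigma>\<^sup>+z. A y z + B y z)"
    by (simp add: mult_2 esum_add)
  have "(\<Sigma>\<^sup>+y. \<Sigma>\<^sup>+z. E y z) = (\<Sigma>\<^sup>+y. \<Sigma>\<^sup>+z. D y z)"
    by (rule esum_swap) (simp only: D_def E_def sym)
  then have "(\<Sigma>\<^sup>+y. \<Sigma>\<^sup>+z. A y z + B y z) = (\<Sigma>\<^sup>+y. \<Sigma>\<^sup>+z. C y z) + 2 * (\<Sigma>\<^sup>+y. \<Sigma>\<^sup>+z. D y z)"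
    unfolding pt esum2_add3 by (simp add: mult_2 add.assoc)
  with 1 show ?thesis unfolding A_def C_def D_def by (rule trans)
qed

text \<open>
  The same summation by parts when \<open>f\<close> and \<open>q\<close> are not ordered alike, so that the
  product of their differences has no sign.
\<close>

lemma esum_symmetrize_le:
  fixes f q :: "'a::countable \<Rightarrow> real" and c :: "'a \<Rightarrow> 'a \<Rightarrow> real"
  assumes nn: "\<And>y z. 0 \<le> c y z" "\<And>y. 0 \<le> f y" "\<And>y. 0 \<le> q y" and sym: "\<And>y z. c y z = c z y"
  shows "2 * (\<Sigma>\<^sup>+y. \<Sigma>\<^sup>+z. ennreal (c y z * (f y * q z)))
    \<le> (\<Sigma>\<^sup>+y. \<Sigma>\<^sup>+z. ennreal (c y z * (\<bar>f y - f z\<bar> * \<bar>q y - q z\<bar>))) + 2 * (\<Sigma>\<^sup>+y. \<Sigma>\<^sup>+z. ennreal (c y z * (f y * q y)))"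
proof -
  define A B C D E where "A y z = ennreal (c y z * (f y * q y))" and "B y z = ennreal (c y z * (f z * q z))"
    and "C y z = ennreal (c y z * (\<bar>f y - f z\<bar> * \<bar>q y - q z\<bar>))" and "D y z = ennreal (c y z * (f y * q z))"
    and "E y z = ennreal (c y z * (f z * q y))" for y z
  have pt: "D y z + E y z \<le> (C y z + A y z) + B y z" for y z
  proof -
    have "- ((f y - f z) * (q y - q z)) \<le> \<bar>f y - f z\<bar> * \<bar>q y - q z\<bar>"
      unfolding abs_mult[symmetric] by linarith
    then have "f y * q z + f z * q y \<le> \<bar>f y - f z\<bar> * \<bar>q y - q z\<bar> + f y * q y + f z * q z"
      by (simp add: algebra_simps)
    from mult_left_mono[OF this nn(1)[of y z]] show ?thesis
      unfolding A_def B_def C_def D_def E_def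
      using nn by (simp add: ennreal_plus[symmetric] distrib_left del: ennreal_plus)
  qed
  have "(\<Sigma>\<^sup>+y. \<Sigma>\<^sup>+z. E y z) = (\<Sigma>\<^sup>+y. \<Sigma>\<^sup>+z. D y z)"
    by (rule esum_swap) (simp only: D_def E_def sym)
  then have "2 * (\<Sigma>\<^sup>+y. \<Sigma>\<^sup>+z. D y z) = (\<Sigma>\<^sup>+y. \<Sigma>\<^sup>+z. D y z + E y z)"
    by (simp add: mult_2 esum_add)
  also have "\<dots> \<le> (\<Sigma>\<^sup>+y. \<Sigma>\<^sup>+z. (C y z + A y z) + B y z)"
    by (intro nn_integral_mono pt)
  finally have 1: "2 * (\<Sigma>\<^sup>+y. \<Sigma>\<^sup>+z. D y z) \<le> (\<Sigma>\<^sup>+y. \<Sigma>\<^sup>+z. (C y z + A y z) + B y z)" .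
  have "(\<Sigma>\<^sup>+y. \<Sigma>\<^sup>+z. B y z) = (\<Sigma>\<^sup>+y. \<Sigma>\<^sup>+z. A y z)"
    by (rule esum_swap) (simp only: A_def B_def sym)
  then have "(\<Sigma>\<^sup>+y. \<Sigma>\<^sup>+z. (C y z + A y z) + B y z) = (\<Sigma>\<^sup>+y. \<Sigma>\<^sup>+z. C y z) + 2 * (\<Sigma>\<^sup>+y. \<Sigma>\<^sup>+z. A y z)"
    unfolding esum2_add3 by (simp add: mult_2 add.assoc)
  with 1 show ?thesis unfolding A_def C_def D_def by (rule ord_le_eq_trans)
qed

text \<open>
  A walk started from \<open>x\<close> at time \<open>s0\<close>. The last assumption bounds the expected number of
  jumps up to time \<open>T\<close>; it rules out explosion, and it is what allows cancelling gains
  and losses after summation over all sites.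
\<close>

locale active_walk = regular_rates a for a :: "'d::finite env" +
  fixes s0 :: real and x :: "'d site"
  assumes sym: "a t y z = a t z y"
    and activity: "(\<integral>\<^sup>+u. indicator {s0..T} u * (\<Sigma>\<^sup>+y. ennreal (total_rate a u y) * kern a s0 u x y) \<partial>lborel) < \<infinity>"
begin

definition q :: "real \<Rightarrow> 'd site \<Rightarrow> real" where
  "q t y = enn2real (kern a s0 t x y)"

lemma ennreal_q: "ennreal (q t y) = kern a s0 t x y"
  unfolding q_def using kern_le_1[of s0 t x y] by (intro ennreal_enn2real) (auto simp: less_top[symmetric] top_unique)

lemma q_nonneg: "0 \<le> q t y" by (simp add: q_def)

lemma q_le_1: "q t y \<le> 1"
  using kern_le_1[of s0 t x y] unfolding ennreal_q[symmetric] by simp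

lemma measurable_q [measurable]: "(\<lambda>t. q t y) \<in> borel_measurable borel"
  unfolding q_def by measurable

lemma esum_q_le_1: "s0 \<le> t \<Longrightarrow> (\<Sigma>\<^sup>+y. ennreal (q t y)) \<le> 1"
  unfolding ennreal_q by (rule kern_row_le_1)

definition inflow :: "real \<Rightarrow> 'd site \<Rightarrow> ennreal" where
  "inflow u y = (\<Sigma>\<^sup>+z. ennreal (a u y z * q u z))"

lemma inflow_le: "inflow u y \<le> ennreal (total_rate a u y)"
  unfolding inflow_def esum_rate[symmetric]
  by (intro nn_integral_mono ennreal_leI) (use q_le_1[of u] rate_nonneg in \<open>auto intro: mult_left_le\<close>)

lemma measurable_inflow [measurable]: "(\<lambda>u. inflow u y) \<in> borel_measurable borel"
  unfolding inflow_def by measurable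

lemma nn_integral_total_rate_finite: "(\<integral>\<^sup>+u. indicator {s..t} u * ennreal (total_rate a u y) \<partial>lborel) < \<infinity>"
proof -
  have "(\<integral>\<^sup>+u. ennreal (norm (indicator {s..t} u *\<^sub>R total_rate a u y)) \<partial>lborel) < \<infinity>"
    using set_integrable_total_rate[of s t y] unfolding set_integrable_def integrable_iff_bounded by blast
  moreover have "(\<lambda>u. ennreal (norm (indicator {s..t} u *\<^sub>R total_rate a u y))) = (\<lambda>u. indicator {s..t} u * ennreal (total_rate a u y))"
    using total_rate_nonneg by (auto simp: fun_eq_iff split: split_indicator)
  ultimately show ?thesis by simp
qed

text \<open>
  The difference of the forward equations up to \<open>t\<close> and up to \<open>s\<close>, which is meaningful because the rates
  at one site are locally integrable.
\<close>

lemma site_balance: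
  assumes "s0 \<le> s" "s \<le> t"
  shows "ennreal (q t y) + (\<integral>\<^sup>+u. indicator {s..t} u * ennreal (total_rate a u y * q u y) \<partial>lborel)
    = ennreal (q s y) + (\<integral>\<^sup>+u. indicator {s..t} u * inflow u y \<partial>lborel)"
proof -
  let ?o = "\<lambda>s t. \<integral>\<^sup>+u. indicator {s..t} u * ennreal (total_rate a u y * q u y) \<partial>lborel"
  let ?i = "\<lambda>s t. \<integral>\<^sup>+u. indicator {s..t} u * inflow u y \<partial>lborel"
  let ?d = "if x = y then 1 else 0 :: ennreal"
  have fw: "ennreal (q v y) + ?o s0 v = ?d + ?i s0 v" if "s0 \<le> v" for v
  proof -
    have "(\<Sigma>\<^sup>+z. kern a s0 u x z * ennreal (a u z y)) = inflow u y" for u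
      unfolding inflow_def ennreal_q[symmetric] sym[of u y]
      by (intro nn_integral_cong) (simp add: ennreal_mult rate_nonneg q_nonneg mult.commute)
    moreover have "ennreal (total_rate a u y) * kern a s0 u x y = ennreal (total_rate a u y * q u y)" for u
      unfolding ennreal_q[symmetric] by (simp add: ennreal_mult total_rate_nonneg q_nonneg)
    ultimately show ?thesis using kern_forward[OF that, of x y] unfolding ennreal_q[symmetric] by simp
  qed
  have fin: "?o s0 s < \<infinity>"
    by (rule le_less_trans[OF nn_integral_mono nn_integral_total_rate_finite[of s0 s y]])
      (use q_le_1 total_rate_nonneg in \<open>auto split: split_indicator intro!: ennreal_leI mult_left_le\<close>)
  have o: "?o s0 t = ?o s0 s + ?o s t" and i: "?i s0 t = ?i s0 s + ?i s t"
    using assms by (auto intro!: nn_integral_Icc_split)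
  have "?o s0 s + (ennreal (q t y) + ?o s t) = ennreal (q t y) + ?o s0 t" unfolding o by (simp add: ac_simps)
  also have "\<dots> = ?d + ?i s0 s + ?i s t" using fw[of t] assms unfolding i by (simp add: ac_simps)
  also have "\<dots> = ?o s0 s + (ennreal (q s y) + ?i s t)" using fw[of s] assms by (simp add: ac_simps)
  finally show ?thesis using fin by (simp only: ennreal_add_left_cancel) auto
qed

lemma site_chain_rule:
  fixes \<phi> \<phi>' :: "real \<Rightarrow> real"
  assumes st: "s0 \<le> s" "s \<le> t"
    and [measurable]: "\<phi>' \<in> borel_measurable borel"
    and der: "\<And>x. x \<in> {0..1} \<Longrightarrow> (\<phi> has_real_derivative \<phi>' x) (at x within {0..1})"
    and lip: "\<And>x y. x \<in> {0..1} \<Longrightarrow> y \<in> {0..1} \<Longrightarrow> \<bar>\<phi>' x - \<phi>' y\<bar> \<le> L * \<bar>x - y\<bar>"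
    and nn\<phi>: "\<And>x. x \<in> {0..1} \<Longrightarrow> 0 \<le> \<phi> x" "\<And>x. x \<in> {0..1} \<Longrightarrow> 0 \<le> \<phi>' x" "\<And>x. x \<in> {0..1} \<Longrightarrow> \<phi>' x \<le> B"
  shows "ennreal (\<phi> (q t y)) + (\<integral>\<^sup>+u. indicator {s..t} u * (ennreal (\<phi>' (q u y)) * ennreal (total_rate a u y * q u y)) \<partial>lborel)
    = ennreal (\<phi> (q s y)) + (\<integral>\<^sup>+u. indicator {s..t} u * (ennreal (\<phi>' (q u y)) * inflow u y) \<partial>lborel)"
proof -
  have inf: "ennreal (enn2real (inflow u y)) = inflow u y" for u
    using inflow_le[of u y] by (intro ennreal_enn2real) (auto simp: less_top[symmetric] top_unique)
  have fin: "(\<integral>\<^sup>+u. indicator {s..t} u * f u \<partial>lborel) < \<infinity>" if "\<And>u. f u \<le> ennreal (total_rate a u y)" for f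
    by (rule le_less_trans[OF nn_integral_mono nn_integral_total_rate_finite[of s t y]])
      (use that in \<open>auto split: split_indicator\<close>)
  have "ennreal (\<phi> (q t y)) + (\<integral>\<^sup>+u. indicator {s..t} u * (ennreal (\<phi>' (q u y)) * ennreal (total_rate a u y * q u y)) \<partial>lborel)
    = ennreal (\<phi> (q s y)) + (\<integral>\<^sup>+u. indicator {s..t} u * (ennreal (\<phi>' (q u y)) * ennreal (enn2real (inflow u y))) \<partial>lborel)"
  proof (rule ac_chain_rule_ennreal[where hi=1 and L=L and B=B and q="\<lambda>u. q u y"])
    show "(\<integral>\<^sup>+u. indicator {s..t} u * ennreal (enn2real (inflow u y)) \<partial>lborel) < \<infinity>"
      unfolding inf by (rule fin[OF inflow_le])
    show "(\<integral>\<^sup>+u. indicator {s..t} u * ennreal (total_rate a u y * q u y) \<partial>lborel) < \<infinity>"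
      by (rule fin) (use q_le_1 total_rate_nonneg in \<open>auto intro!: ennreal_leI mult_left_le\<close>)
    show "ennreal (q v y) + (\<integral>\<^sup>+u. indicator {s..v} u * ennreal (total_rate a u y * q u y) \<partial>lborel)
        = ennreal (q s y) + (\<integral>\<^sup>+u. indicator {s..v} u * ennreal (enn2real (inflow u y)) \<partial>lborel)" if "s \<le> v" "v \<le> t" for v
      unfolding inf by (rule site_balance[OF st(1) that(1)])
  qed (use st der lip nn\<phi> q_nonneg q_le_1 total_rate_nonneg in \<open>auto\<close>)
  then show ?thesis unfolding inf .
qed

lemma esum_outflow: "(\<Sigma>\<^sup>+y. ennreal (f y) * ennreal (total_rate a u y * q u y)) = (\<Sigma>\<^sup>+y. \<Sigma>\<^sup>+z. ennreal (a u y z * (f y * q u y)))"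
  if "\<And>y. 0 \<le> f y"
proof (rule nn_integral_cong)
  fix y
  have "(\<Sigma>\<^sup>+z. ennreal (a u y z * (f y * q u y))) = (\<Sigma>\<^sup>+z. ennreal (a u y z)) * ennreal (f y * q u y)"
    unfolding esum_cmult(2)[symmetric] using that by (intro nn_integral_cong) (simp add: ennreal_mult rate_nonneg q_nonneg)
  also have "\<dots> = ennreal (f y) * ennreal (total_rate a u y * q u y)"
    unfolding esum_rate using that by (simp add: ennreal_mult total_rate_nonneg q_nonneg mult_ac)
  finally show "ennreal (f y) * ennreal (total_rate a u y * q u y) = (\<Sigma>\<^sup>+z. ennreal (a u y z * (f y * q u y)))" by simp
qed

lemma esum_inflow: "(\<Sigma>\<^sup>+y. ennreal (f y) * inflow u y) = (\<Sigma>\<^sup>+y. \<Sigma>\<^sup>+z. ennreal (a u y z * (f y * q u z)))"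
  if "\<And>y. 0 \<le> f y"
  unfolding inflow_def esum_cmult(1)[symmetric] using that
  by (intro nn_integral_cong) (simp add: ennreal_mult rate_nonneg q_nonneg mult_ac)

lemma esum_inflow_total: "(\<Sigma>\<^sup>+y. inflow u y) = (\<Sigma>\<^sup>+y. ennreal (total_rate a u y * q u y))"
proof -
  have "(\<Sigma>\<^sup>+y. inflow u y) = (\<Sigma>\<^sup>+y. \<Sigma>\<^sup>+z. ennreal (a u z y * q u z))" unfolding inflow_def
    by (intro nn_integral_cong) (subst sym, rule refl)
  also have "\<dots> = (\<Sigma>\<^sup>+y. \<Sigma>\<^sup>+z. ennreal (a u y z * (1 * q u y)))" by (rule esum_swap) simp
  also have "\<dots> = (\<Sigma>\<^sup>+y. ennreal 1 * ennreal (total_rate a u y * q u y))"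
    by (rule esum_outflow[symmetric]) simp
  finally show ?thesis by simp
qed

lemma activity_q: "(\<integral>\<^sup>+u. indicator {s..t} u * (\<Sigma>\<^sup>+y. ennreal (total_rate a u y * q u y)) \<partial>lborel) < \<infinity>" if "s0 \<le> s"
proof -
  have *: "(\<Sigma>\<^sup>+y. ennreal (total_rate a u y * q u y)) = (\<Sigma>\<^sup>+y. ennreal (total_rate a u y) * kern a s0 u x y)" for u
    unfolding ennreal_q[symmetric] by (simp add: ennreal_mult total_rate_nonneg q_nonneg)
  show ?thesis unfolding *
    by (rule le_less_trans[OF nn_integral_mono activity[of t]]) (use that in \<open>auto split: split_indicator\<close>)
qed

lemma weighted_activity_finite:
  assumes "s0 \<le> s" and f: "\<And>u y. 0 \<le> f u y" "\<And>u y. f u y \<le> B"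
  shows "(\<integral>\<^sup>+u. indicator {s..t} u * (\<Sigma>\<^sup>+y. ennreal (f u y) * ennreal (total_rate a u y * q u y)) \<partial>lborel) < \<infinity>"
    and "(\<integral>\<^sup>+u. indicator {s..t} u * (\<Sigma>\<^sup>+y. ennreal (f u y) * inflow u y) \<partial>lborel) < \<infinity>"
proof -
  let ?I = "\<integral>\<^sup>+u. indicator {s..t} u * (\<Sigma>\<^sup>+y. ennreal (total_rate a u y * q u y)) \<partial>lborel"
  have fin: "ennreal B * ?I < \<infinity>" using activity_q[OF assms(1), of t] by (simp add: ennreal_mult_less_top)
  have e: "ennreal B * ?I = (\<integral>\<^sup>+u. ennreal B * (indicator {s..t} u * (\<Sigma>\<^sup>+y. ennreal (total_rate a u y * q u y))) \<partial>lborel)"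
    by (rule nn_integral_cmult[symmetric]) measurable
  have "(\<Sigma>\<^sup>+y. ennreal (f u y) * g y) \<le> ennreal B * (\<Sigma>\<^sup>+y. g y)" for g u
    unfolding esum_cmult(1)[symmetric] by (intro nn_integral_mono mult_right_mono ennreal_leI f) auto
  from this[of _ "\<lambda>y. ennreal (total_rate a _ y * q _ y)"] this[of _ "inflow _"]
  have le: "(\<Sigma>\<^sup>+y. ennreal (f u y) * ennreal (total_rate a u y * q u y)) \<le> ennreal B * (\<Sigma>\<^sup>+y. ennreal (total_rate a u y * q u y))"
      "(\<Sigma>\<^sup>+y. ennreal (f u y) * inflow u y) \<le> ennreal B * (\<Sigma>\<^sup>+y. ennreal (total_rate a u y * q u y))" for u
    by (auto simp: esum_inflow_total)
  show "(\<integral>\<^sup>+u. indicator {s..t} u * (\<Sigma>\<^sup>+y. ennreal (f u y) * ennreal (total_rate a u y * q u y)) \<partial>lborel) < \<infinity>"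
    by (rule le_less_trans[OF _ fin], unfold e, rule nn_integral_mono) (use le in \<open>auto split: split_indicator\<close>)
  show "(\<integral>\<^sup>+u. indicator {s..t} u * (\<Sigma>\<^sup>+y. ennreal (f u y) * inflow u y) \<partial>lborel) < \<infinity>"
    by (rule le_less_trans[OF _ fin], unfold e, rule nn_integral_mono) (use le in \<open>auto split: split_indicator\<close>)
qed

text \<open>
  In the sum of all balance equations, total gain and total loss both equal the expected number of
  jumps, which is finite and cancels.
\<close>

lemma mass_conserved:
  assumes "s0 \<le> t" shows "(\<Sigma>\<^sup>+y. ennreal (q t y)) = 1"
proof -
  have q0: "ennreal (q s0 y) = (if x = y then 1 else 0)" for y
  proof -
    have "kern a s0 s0 x y = (if x = y then 1 else 0)"
    proof -
      have "njump a (Suc n) s0 s0 x y = 0" for n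
        unfolding njump.simps by (rule nn_integral_zero') (use AE_lborel_singleton[of s0] in \<open>eventually_elim, auto split: split_indicator\<close>)
      then show ?thesis unfolding kern_def by (subst esum_nat_shift) (auto simp: survival_refl simp del: njump.simps(2))
    qed
    then show ?thesis unfolding ennreal_q .
  qed
  let ?A = "\<integral>\<^sup>+u. indicator {s0..t} u * (\<Sigma>\<^sup>+y. ennreal (total_rate a u y * q u y)) \<partial>lborel"
  have "(\<Sigma>\<^sup>+y. ennreal (q t y)) + ?A = (\<Sigma>\<^sup>+y. ennreal (q t y) + (\<integral>\<^sup>+u. indicator {s0..t} u * ennreal (total_rate a u y * q u y) \<partial>lborel))"
    unfolding esum_add by (subst nn_integral_esum[symmetric]) (auto simp: esum_cmult)
  also have "\<dots> = (\<Sigma>\<^sup>+y. ennreal (q s0 y) + (\<integral>\<^sup>+u. indicator {s0..t} u * inflow u y \<partial>lborel))"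
    by (simp only: site_balance[OF order_refl assms])
  also have "\<dots> = (\<Sigma>\<^sup>+y. ennreal (q s0 y)) + ?A"
    unfolding esum_add by (subst nn_integral_esum[symmetric]) (auto simp: esum_cmult esum_inflow_total)
  also have "(\<Sigma>\<^sup>+y. ennreal (q s0 y)) = 1" unfolding q0 by (rule esum_delta(2))
  finally have "?A + (\<Sigma>\<^sup>+y. ennreal (q t y)) = ?A + 1" by (simp only: add.commute)
  then show ?thesis using activity_q[OF order_refl, of t] by (simp only: ennreal_add_left_cancel) auto
qed

text \<open>
  Sum the chain rule over all sites and integrate by parts over the bonds. Since \<open>\<phi>'\<close> is bounded,
  the total gain is finite and cancels; since \<open>\<phi>'\<close> is monotone, the remaining bond terms are
  nonnegative.
\<close>

lemma dissipation:
  fixes \<phi> \<phi>' :: "real \<Rightarrow> real"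
  assumes st: "s0 \<le> s" "s \<le> t"
    and [measurable]: "\<phi>' \<in> borel_measurable borel"
    and der: "\<And>x. x \<in> {0..1} \<Longrightarrow> (\<phi> has_real_derivative \<phi>' x) (at x within {0..1})"
    and lip: "\<And>x y. x \<in> {0..1} \<Longrightarrow> y \<in> {0..1} \<Longrightarrow> \<bar>\<phi>' x - \<phi>' y\<bar> \<le> L * \<bar>x - y\<bar>"
    and nn\<phi>: "\<And>x. x \<in> {0..1} \<Longrightarrow> 0 \<le> \<phi> x" "\<And>x. x \<in> {0..1} \<Longrightarrow> 0 \<le> \<phi>' x" "\<And>x. x \<in> {0..1} \<Longrightarrow> \<phi>' x \<le> B"
    and mono: "\<And>x y. 0 \<le> x \<Longrightarrow> x \<le> y \<Longrightarrow> y \<le> 1 \<Longrightarrow> \<phi>' x \<le> \<phi>' y"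
  shows "2 * (\<Sigma>\<^sup>+y. ennreal (\<phi> (q t y)))
      + (\<integral>\<^sup>+u. indicator {s..t} u * (\<Sigma>\<^sup>+y. \<Sigma>\<^sup>+z. ennreal (a u y z * ((\<phi>' (q u y) - \<phi>' (q u z)) * (q u y - q u z)))) \<partial>lborel)
    = 2 * (\<Sigma>\<^sup>+y. ennreal (\<phi> (q s y)))" (is "2 * ?\<Phi> t + ?D = 2 * ?\<Phi> s")
proof -
  let ?O = "\<lambda>u. (\<Sigma>\<^sup>+y. ennreal (\<phi>' (q u y)) * ennreal (total_rate a u y * q u y))"
  let ?I = "\<lambda>u. (\<Sigma>\<^sup>+y. ennreal (\<phi>' (q u y)) * inflow u y)"
  let ?G = "\<lambda>u. (\<Sigma>\<^sup>+y. \<Sigma>\<^sup>+z. ennreal (a u y z * ((\<phi>' (q u y) - \<phi>' (q u z)) * (q u y - q u z))))"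
  let ?i = "\<lambda>f. \<integral>\<^sup>+u. indicator {s..t} u * f u \<partial>lborel"
  have q01: "q u y \<in> {0..1}" for u y using q_nonneg q_le_1 by auto
  have bal: "?\<Phi> t + ?i ?O = ?\<Phi> s + ?i ?I"
  proof -
    have "?\<Phi> t + ?i ?O = (\<Sigma>\<^sup>+y. ennreal (\<phi> (q t y)) + (\<integral>\<^sup>+u. indicator {s..t} u * (ennreal (\<phi>' (q u y)) * ennreal (total_rate a u y * q u y)) \<partial>lborel))"
      unfolding esum_add by (subst nn_integral_esum[symmetric]) (measurable, simp only: esum_cmult)
    also have "\<dots> = (\<Sigma>\<^sup>+y. ennreal (\<phi> (q s y)) + (\<integral>\<^sup>+u. indicator {s..t} u * (ennreal (\<phi>' (q u y)) * inflow u y) \<partial>lborel))"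
      by (simp only: site_chain_rule[OF st \<open>\<phi>' \<in> borel_measurable borel\<close> der lip nn\<phi>])
    also have "\<dots> = ?\<Phi> s + ?i ?I"
      unfolding esum_add by (subst nn_integral_esum[symmetric]) (measurable, simp only: esum_cmult)
    finally show ?thesis .
  qed
  have nnf: "0 \<le> \<phi>' (q u y)" for u y using nn\<phi>(2)[OF q01] .
  have mono': "0 \<le> (\<phi>' (q u y) - \<phi>' (q u z)) * (q u y - q u z)" for u y z
    using mono[of "q u y" "q u z"] mono[of "q u z" "q u y"] q01[of u y] q01[of u z]
    by (cases "q u y \<le> q u z") (auto intro: mult_nonpos_nonpos mult_nonneg_nonneg)
  have pw: "2 * ?O u = ?G u + 2 * ?I u" for u
    unfolding esum_outflow[of "\<lambda>y. \<phi>' (q u y)", OF nnf] esum_inflow[of "\<lambda>y. \<phi>' (q u y)", OF nnf]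
    by (rule esum_symmetrize) (use rate_nonneg q_nonneg nnf mono' sym in auto)
  have [measurable]: "?G \<in> borel_measurable borel" "?I \<in> borel_measurable borel" "?O \<in> borel_measurable borel" by measurable
  have "2 * ?i ?O = (\<integral>\<^sup>+u. 2 * (indicator {s..t} u * ?O u) \<partial>lborel)"
    by (rule nn_integral_cmult[symmetric]) measurable
  also have "\<dots> = (\<integral>\<^sup>+u. indicator {s..t} u * ?G u + 2 * (indicator {s..t} u * ?I u) \<partial>lborel)"
  proof (rule nn_integral_cong)
    fix u show "2 * (indicator {s..t} u * ?O u) = indicator {s..t} u * ?G u + 2 * (indicator {s..t} u * ?I u)"
      using pw[of u] by (cases "u \<in> {s..t}") simp_all
  qed
  also have "\<dots> = ?D + (\<integral>\<^sup>+u. 2 * (indicator {s..t} u * ?I u) \<partial>lborel)"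
    by (rule nn_integral_add) measurable
  also have "(\<integral>\<^sup>+u. 2 * (indicator {s..t} u * ?I u) \<partial>lborel) = 2 * ?i ?I"
    by (rule nn_integral_cmult) measurable
  finally have O: "2 * ?i ?O = ?D + 2 * ?i ?I" .
  have fin: "2 * ?i ?I < \<infinity>"
    using weighted_activity_finite(2)[OF st(1), of "\<lambda>u y. \<phi>' (q u y)" B t] nn\<phi>(3)[OF q01] nnf
    by (simp add: ennreal_mult_less_top)
  have "2 * ?i ?I + (2 * ?\<Phi> t + ?D) = 2 * (?\<Phi> t + ?i ?O)"
    unfolding distrib_left O by (simp only: ac_simps)
  also have "\<dots> = 2 * ?i ?I + 2 * ?\<Phi> s" unfolding bal distrib_left by (simp only: ac_simps)
  finally show ?thesis using fin by (simp only: ennreal_add_left_cancel) auto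
qed

text \<open>
  The balance equations summed against a fixed weight, for which the bond terms have no sign.
  Boundedness of the weight makes the total loss finite.
\<close>

lemma weighted_mass_growth:
  assumes st: "s0 \<le> s" "s \<le> t" and w: "\<And>y. 0 \<le> w y" "\<And>y. w y \<le> B"
  shows "2 * (\<Sigma>\<^sup>+y. ennreal (w y * q t y)) \<le> 2 * (\<Sigma>\<^sup>+y. ennreal (w y * q s y))
      + (\<integral>\<^sup>+u. indicator {s..t} u * (\<Sigma>\<^sup>+y. \<Sigma>\<^sup>+z. ennreal (a u y z * (\<bar>w y - w z\<bar> * \<bar>q u y - q u z\<bar>))) \<partial>lborel)"
    (is "2 * ?\<Phi> t \<le> 2 * ?\<Phi> s + ?D")
proof -
  let ?O = "\<lambda>u. (\<Sigma>\<^sup>+y. ennreal (w y) * ennreal (total_rate a u y * q u y))"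
  let ?I = "\<lambda>u. (\<Sigma>\<^sup>+y. ennreal (w y) * inflow u y)"
  let ?G = "\<lambda>u. (\<Sigma>\<^sup>+y. \<Sigma>\<^sup>+z. ennreal (a u y z * (\<bar>w y - w z\<bar> * \<bar>q u y - q u z\<bar>)))"
  let ?i = "\<lambda>f. \<integral>\<^sup>+u. indicator {s..t} u * f u \<partial>lborel"
  have [measurable]: "?G \<in> borel_measurable borel" "?I \<in> borel_measurable borel" "?O \<in> borel_measurable borel" by measurable
  have pull: "ennreal (w y) * (\<integral>\<^sup>+u. indicator {s..t} u * f u \<partial>lborel) = (\<integral>\<^sup>+u. indicator {s..t} u * (ennreal (w y) * f u) \<partial>lborel)"
    if [measurable]: "f \<in> borel_measurable borel" for f y
    by (subst nn_integral_cmult[symmetric]) (auto intro!: nn_integral_cong split: split_indicator)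
  have eq: "ennreal (w y * q v y) = ennreal (w y) * ennreal (q v y)" for v y
    using w q_nonneg by (simp add: ennreal_mult)
  have "?\<Phi> t + ?i ?O = (\<Sigma>\<^sup>+y. ennreal (w y) * ennreal (q t y) + (\<integral>\<^sup>+u. indicator {s..t} u * (ennreal (w y) * ennreal (total_rate a u y * q u y)) \<partial>lborel))"
    unfolding esum_add eq by (subst nn_integral_esum[symmetric]) (measurable, simp only: esum_cmult)
  also have "\<dots> = (\<Sigma>\<^sup>+y. ennreal (w y) * (ennreal (q t y) + (\<integral>\<^sup>+u. indicator {s..t} u * (ennreal (total_rate a u y * q u y)) \<partial>lborel)))"
    by (simp add: distrib_left pull)
  also have "\<dots> = (\<Sigma>\<^sup>+y. ennreal (w y) * (ennreal (q s y) + (\<integral>\<^sup>+u. indicator {s..t} u * inflow u y \<partial>lborel)))"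
    by (simp only: site_balance[OF st])
  also have "\<dots> = (\<Sigma>\<^sup>+y. ennreal (w y) * ennreal (q s y) + (\<integral>\<^sup>+u. indicator {s..t} u * (ennreal (w y) * inflow u y) \<partial>lborel))"
    by (simp add: distrib_left pull)
  also have "\<dots> = ?\<Phi> s + ?i ?I"
    unfolding esum_add eq by (subst nn_integral_esum[symmetric]) (measurable, simp only: esum_cmult)
  finally have bal: "?\<Phi> t + ?i ?O = ?\<Phi> s + ?i ?I" .
  have pw: "2 * ?I u \<le> ?G u + 2 * ?O u" for u
    unfolding esum_outflow[of w, OF w(1)] esum_inflow[of w, OF w(1)]
    by (rule esum_symmetrize_le) (use rate_nonneg q_nonneg w sym in auto)
  have "2 * ?i ?I = (\<integral>\<^sup>+u. 2 * (indicator {s..t} u * ?I u) \<partial>lborel)"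
    by (rule nn_integral_cmult[symmetric]) measurable
  also have "\<dots> \<le> (\<integral>\<^sup>+u. indicator {s..t} u * ?G u + 2 * (indicator {s..t} u * ?O u) \<partial>lborel)"
  proof (rule nn_integral_mono)
    fix u show "2 * (indicator {s..t} u * ?I u) \<le> indicator {s..t} u * ?G u + 2 * (indicator {s..t} u * ?O u)"
      using pw[of u] by (cases "u \<in> {s..t}") simp_all
  qed
  also have "\<dots> = ?D + (\<integral>\<^sup>+u. 2 * (indicator {s..t} u * ?O u) \<partial>lborel)"
    by (rule nn_integral_add) measurable
  also have "(\<integral>\<^sup>+u. 2 * (indicator {s..t} u * ?O u) \<partial>lborel) = 2 * ?i ?O"
    by (rule nn_integral_cmult) measurable
  finally have O: "2 * ?i ?I \<le> ?D + 2 * ?i ?O" .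
  have fin: "2 * ?i ?O < \<infinity>"
    using weighted_activity_finite(1)[OF st(1), of "\<lambda>u. w" B t] w by (simp add: ennreal_mult_less_top)
  have "2 * ?i ?O + 2 * ?\<Phi> t = 2 * (?\<Phi> t + ?i ?O)" unfolding distrib_left by (simp only: ac_simps)
  also have "\<dots> = 2 * ?\<Phi> s + 2 * ?i ?I" unfolding bal distrib_left ..
  also have "\<dots> \<le> 2 * ?\<Phi> s + (?D + 2 * ?i ?O)" using O by (rule add_left_mono)
  finally have "2 * ?i ?O + 2 * ?\<Phi> t \<le> 2 * ?i ?O + (2 * ?\<Phi> s + ?D)" by (simp only: ac_simps)
  then show ?thesis using fin by (subst (asm) ennreal_add_left_cancel_le) auto
qed

end


section \<open>Nash's inequality on the lattice\<close>

definition shift_energy :: "('d::finite site \<Rightarrow> real) \<Rightarrow> 'd site \<Rightarrow> ennreal" where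
  "shift_energy q v = (\<Sigma>\<^sup>+y. ennreal ((q (y + v) - q y)\<^sup>2))"

text \<open>
  Convexity of the square, \<open>(b + c)\<^sup>2 \<le> (1 + 1 / k) * b\<^sup>2 + (1 + k) * c\<^sup>2\<close>. For the sum of \<open>k\<close> unit steps and
  one more, these coefficients reproduce the constant of the Cauchy-Schwarz inequality.
\<close>

lemma shift_energy_add:
  assumes "0 < k"
  shows "shift_energy q (v + w) \<le> ennreal (1 + 1 / k) * shift_energy q v + ennreal (1 + k) * shift_energy q w"
proof -
  have sq: "(b + c)\<^sup>2 \<le> (1 + 1 / k) * b\<^sup>2 + (1 + k) * c\<^sup>2" for b c :: real
  proof -
    have "0 \<le> (b - k * c)\<^sup>2 / k" using assms by simp
    also have "\<dots> = (1 + 1 / k) * b\<^sup>2 + (1 + k) * c\<^sup>2 - (b + c)\<^sup>2"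
      using assms by (simp add: power2_eq_square field_simps)
    finally show ?thesis by simp
  qed
  have "shift_energy q (v + w) \<le> (\<Sigma>\<^sup>+y. ennreal (1 + 1 / k) * ennreal ((q ((y + w) + v) - q (y + w))\<^sup>2) + ennreal (1 + k) * ennreal ((q (y + w) - q y)\<^sup>2))"
    unfolding shift_energy_def
  proof (rule nn_integral_mono)
    fix y
    have "(q (y + (v + w)) - q y)\<^sup>2 \<le> (1 + 1 / k) * (q ((y + w) + v) - q (y + w))\<^sup>2 + (1 + k) * (q (y + w) - q y)\<^sup>2"
      using sq[of "q ((y + w) + v) - q (y + w)" "q (y + w) - q y"] by (simp add: ac_simps)
    then show "ennreal ((q (y + (v + w)) - q y)\<^sup>2) \<le> ennreal (1 + 1 / k) * ennreal ((q ((y + w) + v) - q (y + w))\<^sup>2) + ennreal (1 + k) * ennreal ((q (y + w) - q y)\<^sup>2)"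
      using assms by (simp add: ennreal_mult[symmetric] ennreal_plus[symmetric] ennreal_leI del: ennreal_plus)
  qed
  also have "\<dots> = ennreal (1 + 1 / k) * (\<Sigma>\<^sup>+y. ennreal ((q ((y + w) + v) - q (y + w))\<^sup>2)) + ennreal (1 + k) * shift_energy q w"
    unfolding shift_energy_def by (simp only: esum_add esum_cmult)
  also have "(\<Sigma>\<^sup>+y. ennreal ((q ((y + w) + v) - q (y + w))\<^sup>2)) = shift_energy q v"
    unfolding shift_energy_def by (rule esum_shift(1)[of "\<lambda>y. ennreal ((q (y + v) - q y)\<^sup>2)"])
  finally show ?thesis .
qed

lemma shift_energy_sum:
  assumes "finite J"
  shows "shift_energy q (\<Sum>j\<in>J. v j) \<le> of_nat (card J) * (\<Sum>j\<in>J. shift_energy q (v j))"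
  using assms
proof (induction J)
  case empty then show ?case by (simp add: shift_energy_def)
next
  case (insert j J)
  show ?case
  proof (cases "J = {}")
    case True then show ?thesis by simp
  next
    case False
    define k where "k = real (card J)"
    have k: "0 < k" using False insert by (simp add: k_def card_gt_0_iff)
    let ?S = "\<Sum>j\<in>J. shift_energy q (v j)"
    have "shift_energy q (\<Sum>j\<in>insert j J. v j) = shift_energy q ((\<Sum>j\<in>J. v j) + v j)"
      using insert by (simp add: add.commute)
    also have "\<dots> \<le> ennreal (1 + 1 / k) * shift_energy q (\<Sum>j\<in>J. v j) + ennreal (1 + k) * shift_energy q (v j)"
      by (rule shift_energy_add[OF k])
    also have "\<dots> \<le> ennreal (1 + 1 / k) * (ennreal k * ?S) + ennreal (1 + k) * shift_energy q (v j)"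
      using insert.IH by (intro add_right_mono mult_left_mono) (auto simp: k_def ennreal_of_nat_eq_real_of_nat)
    also have "ennreal (1 + 1 / k) * (ennreal k * ?S) = ennreal (1 + k) * ?S"
      using k by (simp add: mult.assoc[symmetric] ennreal_mult[symmetric] distrib_right add.commute)
    also have "ennreal (1 + k) * ?S + ennreal (1 + k) * shift_energy q (v j) = of_nat (card (insert j J)) * (\<Sum>j\<in>insert j J. shift_energy q (v j))"
      using insert by (simp add: k_def ennreal_of_nat_eq_real_of_nat distrib_left add.commute)
    finally show ?thesis .
  qed
qed

lemma bij_betw_vec_lambda: "bij_betw vec_lambda (PiE UNIV B) {y :: 'b ^ 'd::finite. \<forall>i. y $ i \<in> B i}"
  by (rule bij_betwI[where g="\<lambda>y i. y $ i"]) (auto simp: PiE_UNIV_domain)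

definition lattice_box :: "nat \<Rightarrow> 'd::finite site set" where
  "lattice_box r = {z. \<forall>i. z $ i \<in> {0..<int r}}"

lemma card_lattice_box: "card (lattice_box r :: 'd::finite site set) = r ^ CARD('d)"
  and finite_lattice_box: "finite (lattice_box r :: 'd::finite site set)"
proof -
  have b: "bij_betw vec_lambda (PiE UNIV (\<lambda>_::'d. {0..<int r})) (lattice_box r :: 'd site set)"
    unfolding lattice_box_def by (rule bij_betw_vec_lambda)
  from bij_betw_same_card[OF b] show "card (lattice_box r :: 'd::finite site set) = r ^ CARD('d)"
    by (simp add: card_PiE)
  from bij_betw_finite[OF b] show "finite (lattice_box r :: 'd::finite site set)" by (simp add: finite_PiE)
qed

definition axis_energy :: "('d::finite site \<Rightarrow> real) \<Rightarrow> ennreal" where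
  "axis_energy q = (\<Sum>i\<in>UNIV. shift_energy q (axis i 1))"

text \<open>
  A point of the box is a sum of at most \<open>d * r\<close> unit steps, at most \<open>r\<close> of them along each axis.
\<close>

lemma shift_energy_box:
  fixes z :: "'d::finite site"
  assumes z: "z \<in> lattice_box r"
  shows "shift_energy q z \<le> of_nat (CARD('d) * r * r) * axis_energy q"
proof -
  let ?J = "SIGMA i:UNIV. {..<nat (z $ i)}"
  have z0: "0 \<le> z $ i" "nat (z $ i) \<le> r" for i
  proof -
    have "0 \<le> z $ i \<and> z $ i < int r" using z by (auto simp: lattice_box_def)
    then show "0 \<le> z $ i" "nat (z $ i) \<le> r" by auto
  qed
  have "z = (\<Sum>i\<in>UNIV. \<Sum>l<nat (z $ i). axis i 1)"
  proof (rule vec_eq_iff[THEN iffD2], rule allI)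
    fix k
    have "(\<Sum>i\<in>UNIV. \<Sum>l<nat (z $ i). axis i 1 :: 'd site) $ k = (\<Sum>i\<in>UNIV. \<Sum>l<nat (z $ i). (axis i 1 :: 'd site) $ k)"
      by (simp only: sum_component)
    also have "\<dots> = (\<Sum>i\<in>UNIV. if i = k then z $ i else 0)"
      by (intro sum.cong) (use z0 in \<open>auto simp: axis_def\<close>)
    finally show "z $ k = (\<Sum>i\<in>UNIV. \<Sum>l<nat (z $ i). axis i 1 :: 'd site) $ k" by simp
  qed
  also have "\<dots> = (\<Sum>j\<in>?J. axis (fst j) 1)" by (subst sum.Sigma) (auto simp: case_prod_beta)
  finally have "shift_energy q z = shift_energy q (\<Sum>j\<in>?J. axis (fst j) 1)" by simp
  also have "\<dots> \<le> of_nat (card ?J) * (\<Sum>j\<in>?J. shift_energy q (axis (fst j) 1))"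
    by (rule shift_energy_sum) auto
  also have "(\<Sum>j\<in>?J. shift_energy q (axis (fst j) 1)) = (\<Sum>i\<in>UNIV. of_nat (nat (z $ i)) * shift_energy q (axis i 1))"
    by (subst sum.Sigma[symmetric, where B="\<lambda>i. {..<nat (z $ i)}" and g="\<lambda>i l. shift_energy q (axis i 1)", unfolded case_prod_beta]) auto
  also have "\<dots> \<le> (\<Sum>i\<in>UNIV. of_nat r * shift_energy q (axis i 1))"
    by (intro sum_mono mult_right_mono) (use z0 in \<open>auto simp: of_nat_le_iff\<close>)
  also have "\<dots> = of_nat r * axis_energy q" by (simp add: axis_energy_def sum_distrib_left)
  also have "of_nat (card ?J) * (of_nat r * axis_energy q) \<le> of_nat (CARD('d) * r) * (of_nat r * axis_energy q)"
  proof (rule mult_right_mono)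
    have "card ?J = (\<Sum>i\<in>(UNIV::'d set). nat (z $ i))" by simp
    also have "\<dots> \<le> CARD('d) * r" using sum_mono[of UNIV "\<lambda>i. nat (z $ i)" "\<lambda>_. r"] z0 by simp
    finally show "of_nat (card ?J) \<le> (of_nat (CARD('d) * r) :: ennreal)" by (rule of_nat_mono)
  qed simp
  finally show ?thesis by (simp add: mult.assoc mult_left_mono)
qed

text \<open>
  Averaging the identity \<open>2 q(y) q(y+z) + (q(y+z) - q(y))\<^sup>2 = q(y)\<^sup>2 + q(y+z)\<^sup>2\<close> over \<open>y\<close> and over
  translations \<open>z\<close> in a box: the correlation term is small because the translates of \<open>q\<close> over the
  box have total mass at most one at every point.
\<close>

lemma nash_inequality:
  fixes q :: "'d::finite site \<Rightarrow> real"
  assumes nn: "\<And>y. 0 \<le> q y" and mass: "(\<Sigma>\<^sup>+y. ennreal (q y)) \<le> 1"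
  shows "of_nat (r ^ CARD('d)) * (2 * (\<Sigma>\<^sup>+y. ennreal ((q y)\<^sup>2)))
    \<le> 2 + of_nat (r ^ CARD('d)) * (of_nat (CARD('d) * r * r) * axis_energy q)"
proof -
  let ?B = "lattice_box r :: 'd site set"
  let ?U = "\<Sigma>\<^sup>+y. ennreal ((q y)\<^sup>2)"
  have id: "2 * ?U = 2 * (\<Sigma>\<^sup>+y. ennreal (q y) * ennreal (q (y + z))) + shift_energy q z" for z
  proof -
    have "2 * ?U = ?U + (\<Sigma>\<^sup>+y. ennreal ((q (y + z))\<^sup>2))"
      using esum_shift(1)[of "\<lambda>y. ennreal ((q y)\<^sup>2)" z] by (simp add: mult_2)
    also have "\<dots> = (\<Sigma>\<^sup>+y. ennreal ((q y)\<^sup>2) + ennreal ((q (y + z))\<^sup>2))" by (rule esum_add[symmetric])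
    also have "\<dots> = (\<Sigma>\<^sup>+y. 2 * (ennreal (q y) * ennreal (q (y + z))) + ennreal ((q (y + z) - q y)\<^sup>2))"
    proof (rule nn_integral_cong)
      fix y
      have "(q y)\<^sup>2 + (q (y + z))\<^sup>2 = 2 * (q y * q (y + z)) + (q (y + z) - q y)\<^sup>2"
        by (simp add: power2_eq_square algebra_simps)
      then have "ennreal ((q y)\<^sup>2 + (q (y + z))\<^sup>2) = ennreal (2 * (q y * q (y + z)) + (q (y + z) - q y)\<^sup>2)" by simp
      then show "ennreal ((q y)\<^sup>2) + ennreal ((q (y + z))\<^sup>2) = 2 * (ennreal (q y) * ennreal (q (y + z))) + ennreal ((q (y + z) - q y)\<^sup>2)"
        using nn[of y] nn[of "y + z"] by (simp add: ennreal_mult)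
    qed
    finally show ?thesis by (simp only: esum_add esum_cmult shift_energy_def)
  qed
  have cor: "(\<Sum>z\<in>?B. \<Sigma>\<^sup>+y. ennreal (q y) * ennreal (q (y + z))) \<le> 1"
  proof -
    have "(\<Sum>z\<in>?B. \<Sigma>\<^sup>+y. ennreal (q y) * ennreal (q (y + z))) = (\<Sigma>\<^sup>+y. ennreal (q y) * (\<Sum>z\<in>?B. ennreal (q (y + z))))"
      by (simp only: esum_sum[symmetric] sum_distrib_left)
    also have "\<dots> \<le> (\<Sigma>\<^sup>+y. ennreal (q y) * 1)"
    proof (intro nn_integral_mono mult_left_mono)
      fix y
      have "(\<Sum>z\<in>?B. ennreal (q (y + z))) = (\<Sigma>\<^sup>+z. (if z \<in> ?B then ennreal (q (y + z)) else 0))"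
        by (subst nn_integral_count_space'[where A="?B"]) (auto simp: finite_lattice_box)
      also have "\<dots> \<le> (\<Sigma>\<^sup>+z. ennreal (q (y + z)))" by (rule nn_integral_mono) auto
      also have "\<dots> \<le> 1" using mass esum_shift(2)[of "\<lambda>z. ennreal (q z)" y] by simp
      finally show "(\<Sum>z\<in>?B. ennreal (q (y + z))) \<le> 1" .
    qed auto
    also have "\<dots> \<le> 1" using mass by simp
    finally show ?thesis .
  qed
  have "of_nat (r ^ CARD('d)) * (2 * ?U) = (\<Sum>z\<in>?B. 2 * ?U)" by (simp add: card_lattice_box)
  also have "\<dots> = 2 * (\<Sum>z\<in>?B. \<Sigma>\<^sup>+y. ennreal (q y) * ennreal (q (y + z))) + (\<Sum>z\<in>?B. shift_energy q z)"
    unfolding sum_distrib_left sum.distrib[symmetric] by (rule sum.cong[OF refl id])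
  also have "\<dots> \<le> 2 * 1 + (\<Sum>z\<in>?B. of_nat (CARD('d) * r * r) * axis_energy q)"
    by (intro add_mono mult_left_mono cor sum_mono shift_energy_box) auto
  finally show ?thesis by (simp add: card_lattice_box)
qed

lemma nn_integral_Icc_const: "s \<le> t \<Longrightarrow> (\<integral>\<^sup>+u. indicator {s..t} u * c \<partial>lborel) = c * ennreal (t - s)"
  by (subst nn_integral_multc) (auto simp: mult.commute)


section \<open>On-diagonal decay\<close>

definition decay_const :: "nat \<Rightarrow> real \<Rightarrow> real" where
  "decay_const d K = 2 * (2 * sqrt (K * 2 powr (real d / 2 + 2))) ^ d"

text \<open>
  The hypothesis is a differential inequality in integrated form, available at all length scales \<open>r\<close>. With
  \<open>r\<close> proportional to \<open>sqrt t\<close> it bounds \<open>V t * t powr (d / 2)\<close> by half of its value at time \<open>t / 2\<close> plus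
  a constant, and such a recursion stays bounded.
\<close>

lemma polynomial_decay:
  fixes V :: "real \<Rightarrow> real"
  assumes d: "d > 0" and K: "K > 0" and V: "\<And>t. 0 < t \<Longrightarrow> 0 \<le> V t" "\<And>t. 0 < t \<Longrightarrow> V t \<le> 1"
    and ineq: "\<And>s t r. 0 < s \<Longrightarrow> s \<le> t \<Longrightarrow> r \<ge> 1 \<Longrightarrow> (t - s) * (V t - 1 / real (r ^ d)) \<le> K * (real r)\<^sup>2 * (V s - V t)"
    and t: "0 < t"
  shows "V t \<le> decay_const d K * t powr (- real d / 2)"
proof -
  \<comment> \<open>for \<open>r\<close> close to \<open>sqrt (t / \<kappa>)\<close> the recursion from \<open>t / 2\<close> to \<open>t\<close> contracts by the factor one half\<close>
  define \<kappa> where "\<kappa> = K * 2 powr (real d / 2 + 2)"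
  have \<kappa>: "\<kappa> > 0" using K by (simp add: \<kappa>_def)
  define b where "b = (2 * sqrt \<kappa>) ^ d"
  have b: "0 \<le> b" by (simp add: b_def \<kappa> less_imp_le)
  have "V t * t powr (real d / 2) \<le> 2 * b" if "0 < t" "t < 2 ^ n * \<kappa>" for n t
    using that
  proof (induction n arbitrary: t)
    case (Suc n)
    show ?case
    proof (cases "t < \<kappa>")
      case True
      have "V t * t powr (real d / 2) \<le> 1 * \<kappa> powr (real d / 2)"
        using Suc.prems True V by (intro mult_mono powr_mono2) auto
      also have "\<kappa> powr (real d / 2) = (sqrt \<kappa>) ^ d"
        using \<kappa> by (simp add: powr_half_sqrt[symmetric] powr_realpow[symmetric] powr_powr)
      also have "1 * (sqrt \<kappa>) ^ d \<le> b" unfolding b_def using \<kappa> by (auto intro!: power_mono)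
      finally show ?thesis using b by linarith
    next
      case False
      define r where "r = nat \<lfloor>sqrt (t / \<kappa>)\<rfloor>"
      have s1: "1 \<le> sqrt (t / \<kappa>)" using False \<kappa> by simp
      then have r1: "r \<ge> 1" unfolding r_def by (simp add: le_nat_floor)
      have rle: "real r \<le> sqrt (t / \<kappa>)" unfolding r_def using s1 by simp
      have "sqrt (t / \<kappa>) < real r + 1" unfolding r_def using s1 by linarith
      then have rge: "sqrt (t / \<kappa>) \<le> 2 * real r" using r1 by (smt (verit) of_nat_1 of_nat_mono)
      have "(real r)\<^sup>2 \<le> t / \<kappa>" using rle s1 Suc.prems \<kappa> by (metis real_sqrt_le_iff real_sqrt_unique real_le_rsqrt of_nat_0_le_iff power2_eq_square real_sqrt_abs abs_of_nonneg)
      then have kr: "\<kappa> * (real r)\<^sup>2 \<le> t" using \<kappa> by (simp add: field_simps)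
      let ?p = "real d / 2"
      define Kr where "Kr = K * (real r)\<^sup>2"
      have Kr: "Kr > 0" using K r1 by (simp add: Kr_def)
      have "4 * 2 powr ?p * Kr \<le> t" using kr by (simp add: Kr_def \<kappa>_def powr_add mult_ac)
      then have th: "2 * 2 powr ?p * Kr \<le> t / 2" by simp
      have i: "t / 2 * (V t - 1 / real (r ^ d)) \<le> Kr * (V (t / 2) - V t)"
        using ineq[of "t / 2" t r] Suc.prems r1 by (simp add: Kr_def)
      \<comment> \<open>the two halves of the bound: the previous dyadic time, and the length scale \<open>r\<close>\<close>
      have "t / 2 * V t \<le> Kr * V (t / 2) + t / 2 * (1 / real (r ^ d))"
        using i mult_nonneg_nonneg[of Kr "V t"] Kr V(1)[of t] Suc.prems unfolding right_diff_distrib by linarith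
      then have i1: "V t \<le> Kr / (t / 2) * V (t / 2) + 1 / real (r ^ d)"
        using Suc.prems by (simp add: field_simps)
      have IH: "V (t / 2) * (t / 2) powr ?p \<le> 2 * b" using Suc.prems by (intro Suc.IH) auto
      have "V t * t powr ?p \<le> Kr / (t / 2) * V (t / 2) * t powr ?p + 1 / real (r ^ d) * t powr ?p"
        using mult_right_mono[OF i1, of "t powr ?p"] by (simp add: distrib_right)
      also have "t powr ?p = 2 powr ?p * (t / 2) powr ?p" using Suc.prems by (simp add: powr_mult[symmetric])
      also have "Kr / (t / 2) * V (t / 2) * (2 powr ?p * (t / 2) powr ?p) = (2 powr ?p * Kr / (t / 2)) * (V (t / 2) * (t / 2) powr ?p)"
        by simp
      also have "\<dots> \<le> (1 / 2) * (2 * b)"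
      proof (rule mult_mono[OF _ IH])
        show "2 powr ?p * Kr / (t / 2) \<le> 1 / 2" using th Suc.prems by (simp add: field_simps)
        show "0 \<le> V (t / 2) * (t / 2) powr ?p" using V(1)[of "t / 2"] Suc.prems by simp
      qed simp
      also have "1 / real (r ^ d) * (2 powr ?p * (t / 2) powr ?p) = (sqrt t / real r) ^ d"
      proof -
        have "2 powr ?p * (t / 2) powr ?p = t powr ?p" using Suc.prems by (simp add: powr_mult[symmetric])
        also have "\<dots> = (sqrt t) ^ d" using Suc.prems by (simp add: powr_half_sqrt[symmetric] powr_realpow[symmetric] powr_powr)
        finally show ?thesis by (simp add: power_divide)
      qed
      also have "(sqrt t / real r) ^ d \<le> b" unfolding b_def
      proof (rule power_mono)
        have "sqrt t = sqrt \<kappa> * sqrt (t / \<kappa>)" using \<kappa> by (simp add: real_sqrt_mult[symmetric])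
        also have "\<dots> \<le> sqrt \<kappa> * (2 * real r)" by (rule mult_left_mono[OF rge]) (use \<kappa> in simp)
        finally show "sqrt t / real r \<le> 2 * sqrt \<kappa>" using r1 by (simp add: field_simps)
      qed (use Suc.prems in simp)
      finally have "V t * (2 powr ?p * (t / 2) powr ?p) \<le> 2 * b" by simp
      moreover have "2 powr ?p * (t / 2) powr ?p = t powr ?p" using Suc.prems by (simp add: powr_mult[symmetric])
      ultimately show ?thesis by (simp only:)
    qed
  next
    case 0
    have "V t * t powr (real d / 2) \<le> 1 * \<kappa> powr (real d / 2)"
      using 0 V by (intro mult_mono powr_mono2) auto
    also have "\<kappa> powr (real d / 2) = (sqrt \<kappa>) ^ d"
      using \<kappa> by (simp add: powr_half_sqrt[symmetric] powr_realpow[symmetric] powr_powr)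
    also have "1 * (sqrt \<kappa>) ^ d \<le> b" unfolding b_def using \<kappa> by (auto intro!: power_mono)
    finally show ?case using b by linarith
  qed
  note * = this
  obtain n :: nat where "t / \<kappa> < 2 ^ n" using real_arch_pow[of 2 "t / \<kappa>"] by auto
  then have "t < 2 ^ n * \<kappa>" using \<kappa> by (simp add: field_simps)
  from *[OF t this] have "V t * t powr (real d / 2) \<le> decay_const d K"
    by (simp add: decay_const_def b_def \<kappa>_def)
  then have "V t * t powr (real d / 2) * t powr (- real d / 2) \<le> decay_const d K * t powr (- real d / 2)"
    by (rule mult_right_mono) simp
  then show ?thesis using t by (simp add: mult.assoc powr_add[symmetric])
qed

locale elliptic_walk = active_walk a s0 x for a :: "'d::finite env" and s0 x +
  fixes c0 :: real
  assumes c0: "c0 > 0" and ell: "AE u in lborel. \<forall>y z. nbr y z \<longrightarrow> c0 \<le> a u y z"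
begin

lemma bond_sum_le:
  fixes G :: "'d site \<Rightarrow> 'd site \<Rightarrow> real"
  assumes e: "nbr 0 e" and G: "\<And>y z. 0 \<le> G y z" and u: "\<forall>y z. nbr y z \<longrightarrow> c0 \<le> a u y z"
  shows "ennreal c0 * (\<Sigma>\<^sup>+y. ennreal (G y (y + e))) \<le> (\<Sigma>\<^sup>+y. \<Sigma>\<^sup>+z. ennreal (a u y z * G y z))"
  unfolding esum_cmult(1)[symmetric]
proof (rule nn_integral_mono)
  fix y
  have n: "nbr y (y + e)" using nbr_add[of 0 y e] e by (simp add: add.commute)
  have "ennreal c0 * ennreal (G y (y + e)) \<le> ennreal (a u y (y + e) * G y (y + e))"
    using n u c0 G by (simp add: ennreal_mult[symmetric] ennreal_leI mult_right_mono)
  also have "\<dots> = (\<Sigma>\<^sup>+z. (if z = y + e then ennreal (a u y z * G y z) else 0))" by (rule esum_delta(1)[symmetric])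
  also have "\<dots> \<le> (\<Sigma>\<^sup>+z. ennreal (a u y z * G y z))" by (rule nn_integral_mono) auto
  finally show "ennreal c0 * ennreal (G y (y + e)) \<le> (\<Sigma>\<^sup>+z. ennreal (a u y z * G y z))" .
qed

abbreviation dirichlet :: "real \<Rightarrow> ennreal" where
  "dirichlet u \<equiv> (\<Sigma>\<^sup>+y. \<Sigma>\<^sup>+z. ennreal (a u y z * (q u y - q u z)\<^sup>2))"

text \<open>
  The dissipation formula for \<open>\<phi> x = x\<^sup>2\<close>.
\<close>

lemma energy_identity:
  assumes "s0 \<le> s" "s \<le> t"
  shows "(\<Sigma>\<^sup>+y. ennreal ((q t y)\<^sup>2)) + (\<integral>\<^sup>+u. indicator {s..t} u * dirichlet u \<partial>lborel) = (\<Sigma>\<^sup>+y. ennreal ((q s y)\<^sup>2))"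
proof -
  have e: "(\<Sigma>\<^sup>+y. \<Sigma>\<^sup>+z. ennreal (a u y z * ((2 * q u y - 2 * q u z) * (q u y - q u z)))) = 2 * dirichlet u" for u
  proof -
    have "ennreal (a u y z * ((2 * q u y - 2 * q u z) * (q u y - q u z))) = 2 * ennreal (a u y z * (q u y - q u z)\<^sup>2)" for y z
    proof -
      have "a u y z * ((2 * q u y - 2 * q u z) * (q u y - q u z)) = 2 * (a u y z * (q u y - q u z)\<^sup>2)"
        by (simp add: power2_eq_square algebra_simps)
      then show ?thesis by (simp only:) (subst ennreal_mult, auto simp: rate_nonneg)
    qed
    then show ?thesis by (simp only: esum_cmult)
  qed
  have "2 * (\<Sigma>\<^sup>+y. ennreal ((q t y)\<^sup>2)) + (\<integral>\<^sup>+u. indicator {s..t} u * (2 * dirichlet u) \<partial>lborel) = 2 * (\<Sigma>\<^sup>+y. ennreal ((q s y)\<^sup>2))"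
    unfolding e[symmetric]
  proof (rule dissipation[OF assms, where L=2 and B=2])
    show "\<bar>2 * x - 2 * y\<bar> \<le> 2 * \<bar>x - y\<bar>" for x y :: real
    proof -
      have "2 * x - 2 * y = 2 * (x - y)" by simp
      then show ?thesis unfolding abs_mult[of 2 "x - y", symmetric] by (simp only: abs_mult abs_numeral order_refl)
    qed
  qed (auto intro!: derivative_eq_intros)
  moreover have "(\<integral>\<^sup>+u. indicator {s..t} u * (2 * dirichlet u) \<partial>lborel) = 2 * (\<integral>\<^sup>+u. indicator {s..t} u * dirichlet u \<partial>lborel)"
  proof -
    have "(\<integral>\<^sup>+u. indicator {s..t} u * (2 * dirichlet u) \<partial>lborel) = (\<integral>\<^sup>+u. 2 * (indicator {s..t} u * dirichlet u) \<partial>lborel)"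
      by (simp only: mult.left_commute)
    also have "\<dots> = 2 * (\<integral>\<^sup>+u. indicator {s..t} u * dirichlet u \<partial>lborel)" by (rule nn_integral_cmult) measurable
    finally show ?thesis .
  qed
  ultimately have "2 * ((\<Sigma>\<^sup>+y. ennreal ((q t y)\<^sup>2)) + (\<integral>\<^sup>+u. indicator {s..t} u * dirichlet u \<partial>lborel)) = 2 * (\<Sigma>\<^sup>+y. ennreal ((q s y)\<^sup>2))"
    by (simp only: distrib_left)
  then show ?thesis by (subst (asm) ennreal_mult_cancel_left) auto
qed

definition energy :: "real \<Rightarrow> real" where
  "energy t = enn2real (\<Sigma>\<^sup>+y. ennreal ((q t y)\<^sup>2))"

lemma energy_le_1: "s0 \<le> t \<Longrightarrow> (\<Sigma>\<^sup>+y. ennreal ((q t y)\<^sup>2)) \<le> 1"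
  by (rule order_trans[OF nn_integral_mono esum_q_le_1[of t]])
    (use q_nonneg q_le_1 in \<open>auto intro!: ennreal_leI simp: power2_eq_square mult_left_le\<close>)

lemma ennreal_energy: "s0 \<le> t \<Longrightarrow> ennreal (energy t) = (\<Sigma>\<^sup>+y. ennreal ((q t y)\<^sup>2))"
  unfolding energy_def using energy_le_1[of t] by (intro ennreal_enn2real) (auto simp: less_top[symmetric] top_unique)

text \<open>
  Nash's inequality at the times \<open>u\<close> in \<open>[s, t]\<close>, integrated: the energy at time \<open>u\<close> is at least the one at
  time \<open>t\<close>, and the gradient terms integrate to the energy lost, by the energy identity.
\<close>

lemma energy_decay:
  assumes "s0 < t"
  shows "(\<Sigma>\<^sup>+y. ennreal ((q t y)\<^sup>2)) \<le> ennreal (decay_const CARD('d) ((real CARD('d))\<^sup>2 / c0) * (t - s0) powr (- real CARD('d) / 2))"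
proof -
  let ?d = "CARD('d)"
  let ?K = "(real ?d)\<^sup>2 / c0"
  have "energy (s0 + (t - s0)) \<le> decay_const ?d ?K * (t - s0) powr (- real ?d / 2)"
  proof (rule polynomial_decay[where V="\<lambda>t. energy (s0 + t)"])
    show "?K > 0" using c0 by simp
    show "0 \<le> energy (s0 + t)" for t by (simp add: energy_def)
    show "energy (s0 + t) \<le> 1" if "0 < t" for t
      using energy_le_1[of "s0 + t"] that unfolding ennreal_energy[of "s0 + t", symmetric, OF less_imp_le, OF less_add_same_cancel1[THEN iffD2, OF that]] by simp
    fix s t :: real and r :: nat assume st: "0 < s" "s \<le> t" and r: "1 \<le> r"
    let ?s = "s0 + s" and ?t = "s0 + t"
    have st': "s0 \<le> ?s" "?s \<le> ?t" "s0 \<le> ?t" using st by auto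
    let ?N = "real (r ^ ?d)"
    have N: "0 < ?N" using r by simp
    let ?M = "?N * (real ?d * (real r)\<^sup>2 * real ?d)"
    define D where "D = enn2real (\<integral>\<^sup>+u. indicator {?s..?t} u * dirichlet u \<partial>lborel)"
    have id: "(\<Sigma>\<^sup>+y. ennreal ((q ?t y)\<^sup>2)) + (\<integral>\<^sup>+u. indicator {?s..?t} u * dirichlet u \<partial>lborel) = (\<Sigma>\<^sup>+y. ennreal ((q ?s y)\<^sup>2))"
      by (rule energy_identity[OF st'(1,2)])
    have "(\<integral>\<^sup>+u. indicator {?s..?t} u * dirichlet u \<partial>lborel) \<le> 1"
      using energy_le_1[OF st'(1)] unfolding id[symmetric] by (rule order_trans[rotated]) simp
    then have D: "ennreal D = (\<integral>\<^sup>+u. indicator {?s..?t} u * dirichlet u \<partial>lborel)"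
      unfolding D_def by (intro ennreal_enn2real) (auto simp: less_top[symmetric] top_unique)
    have D0: "0 \<le> D" by (simp add: D_def)
    have e0: "0 \<le> energy v" for v by (simp add: energy_def)
    have "ennreal (energy ?t + D) = ennreal (energy ?s)"
      using id unfolding D[symmetric] ennreal_energy[OF st'(1), symmetric] ennreal_energy[OF st'(3), symmetric] using e0 D0 by simp
    then have idr: "energy ?t + D = energy ?s" using e0 D0 by (subst (asm) ennreal_inj) auto
    have mono: "(\<Sigma>\<^sup>+y. ennreal ((q ?t y)\<^sup>2)) \<le> (\<Sigma>\<^sup>+y. ennreal ((q u y)\<^sup>2))" if "u \<in> {?s..?t}" for u
    proof -
      have "s0 \<le> u" "u \<le> ?t" using that st' by auto
      from energy_identity[OF this] show ?thesis unfolding le_iff_add by (blast intro: HOL.sym)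
    qed
    have ptw: "AE u in lborel. indicator {?s..?t} u * ennreal (c0 * (2 * ?N * energy ?t)) \<le> indicator {?s..?t} u * ennreal (2 * c0) + ennreal ?M * (indicator {?s..?t} u * dirichlet u)"
      using ell
    proof eventually_elim
      fix u assume u: "\<forall>y z. nbr y z \<longrightarrow> c0 \<le> a u y z"
      show "indicator {?s..?t} u * ennreal (c0 * (2 * ?N * energy ?t)) \<le> indicator {?s..?t} u * ennreal (2 * c0) + ennreal ?M * (indicator {?s..?t} u * dirichlet u)"
      proof (cases "u \<in> {?s..?t}")
        case True
        have se: "ennreal c0 * shift_energy (q u) (axis i 1) \<le> dirichlet u" for i
        proof -
          have "ennreal c0 * shift_energy (q u) (axis i 1) = ennreal c0 * (\<Sigma>\<^sup>+y. ennreal ((q u y - q u (y + axis i 1))\<^sup>2))"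
            unfolding shift_energy_def by (simp add: power2_commute)
          also have "\<dots> \<le> dirichlet u"
            by (rule bond_sum_le[where G="\<lambda>y z. (q u y - q u z)\<^sup>2"]) (use u nbr_axis[of 0 i] in auto)
          finally show ?thesis .
        qed
        have "ennreal c0 * axis_energy (q u) \<le> (\<Sum>i\<in>(UNIV::'d set). dirichlet u)"
          unfolding axis_energy_def sum_distrib_left by (intro sum_mono se)
        then have ae: "ennreal c0 * axis_energy (q u) \<le> of_nat ?d * dirichlet u" by simp
        have "ennreal (c0 * (2 * ?N * energy ?t)) = ennreal c0 * (of_nat (r ^ ?d) * (2 * (\<Sigma>\<^sup>+y. ennreal ((q ?t y)\<^sup>2))))"
          using c0 e0 by (simp add: ennreal_energy[OF st'(3), symmetric] ennreal_mult ennreal_of_nat_eq_real_of_nat mult_ac)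
        also have "\<dots> \<le> ennreal c0 * (of_nat (r ^ ?d) * (2 * (\<Sigma>\<^sup>+y. ennreal ((q u y)\<^sup>2))))"
          by (intro mult_left_mono mono[OF True]) auto
        also have "\<dots> \<le> ennreal c0 * (2 + of_nat (r ^ ?d) * (of_nat (?d * r * r) * axis_energy (q u)))"
          by (intro mult_left_mono nash_inequality) (use q_nonneg esum_q_le_1[of u] True st' in auto)
        also have "\<dots> = ennreal (2 * c0) + of_nat (r ^ ?d) * of_nat (?d * r * r) * (ennreal c0 * axis_energy (q u))"
          using c0 by (simp add: distrib_left ennreal_mult mult_ac)
        also have "\<dots> \<le> ennreal (2 * c0) + of_nat (r ^ ?d) * of_nat (?d * r * r) * (of_nat ?d * dirichlet u)"
          by (intro add_left_mono mult_left_mono ae) auto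
        also have "of_nat (r ^ ?d) * of_nat (?d * r * r) * (of_nat ?d * dirichlet u) = ennreal ?M * dirichlet u"
          unfolding mult.assoc[symmetric] by (simp add: ennreal_of_nat_eq_real_of_nat ennreal_mult[symmetric] power2_eq_square mult_ac)
        finally show ?thesis using True by simp
      qed simp
    qed
    have "ennreal (c0 * (2 * ?N * energy ?t)) * ennreal (t - s) = (\<integral>\<^sup>+u. indicator {?s..?t} u * ennreal (c0 * (2 * ?N * energy ?t)) \<partial>lborel)"
      using st by (subst nn_integral_Icc_const) auto
    also have "\<dots> \<le> (\<integral>\<^sup>+u. indicator {?s..?t} u * ennreal (2 * c0) + ennreal ?M * (indicator {?s..?t} u * dirichlet u) \<partial>lborel)"
      by (rule nn_integral_mono_AE[OF ptw])
    also have "\<dots> = (\<integral>\<^sup>+u. indicator {?s..?t} u * ennreal (2 * c0) \<partial>lborel) + (\<integral>\<^sup>+u. ennreal ?M * (indicator {?s..?t} u * dirichlet u) \<partial>lborel)"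
      by (rule nn_integral_add) measurable
    also have "\<dots> = ennreal (2 * c0) * ennreal (t - s) + ennreal ?M * ennreal D"
    proof -
      have "(\<integral>\<^sup>+u. ennreal ?M * (indicator {?s..?t} u * dirichlet u) \<partial>lborel) = ennreal ?M * ennreal D"
        unfolding D by (rule nn_integral_cmult) measurable
      then show ?thesis using st by (subst nn_integral_Icc_const) (auto simp only:, simp)
    qed
    finally have "ennreal (c0 * (2 * ?N * energy ?t) * (t - s)) \<le> ennreal (2 * c0 * (t - s) + ?M * D)"
      using c0 e0 st D0 by (simp add: ennreal_mult ennreal_plus)
    then have r1: "c0 * (2 * ?N * energy ?t) * (t - s) \<le> 2 * c0 * (t - s) + ?M * D"
      using c0 st D0 by (subst (asm) ennreal_le_iff) (auto intro!: add_nonneg_nonneg mult_nonneg_nonneg)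
    have "2 * c0 * ?N * ((t - s) * (energy ?t - 1 / ?N)) = c0 * (2 * ?N * energy ?t) * (t - s) - 2 * c0 * (t - s)"
      using N by (simp add: field_simps)
    also have "\<dots> \<le> ?M * D" using r1 by simp
    also have "\<dots> = 2 * c0 * ?N * (?K / 2 * (real r)\<^sup>2 * D)" using c0 by (simp add: field_simps power2_eq_square)
    finally have "(t - s) * (energy ?t - 1 / ?N) \<le> ?K / 2 * (real r)\<^sup>2 * D"
      by (rule mult_left_le_imp_le) (use c0 N in simp)
    also have "\<dots> \<le> ?K * (real r)\<^sup>2 * D"
    proof (intro mult_right_mono)
      have "0 \<le> ?K" using c0 by simp
      moreover have "k / 2 \<le> k" if "0 \<le> k" for k :: real using that by simp
      ultimately show "?K / 2 \<le> ?K" by blast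
    qed (use D0 in auto)
    finally show "(t - s) * (energy ?t - 1 / ?N) \<le> ?K * (real r)\<^sup>2 * (energy ?s - energy ?t)"
    proof -
      have "D = energy ?s - energy ?t" using idr by simp
      then show "(t - s) * (energy ?t - 1 / ?N) \<le> ?K * (real r)\<^sup>2 * D \<Longrightarrow> ?thesis" by (simp only:)
    qed
  qed (use assms in auto)
  then have "ennreal (energy t) \<le> ennreal (decay_const ?d ?K * (t - s0) powr (- real ?d / 2))"
    by (intro ennreal_leI) simp
  then show ?thesis using ennreal_energy[of t] assms by simp
qed

end


section \<open>Entropy and first moment in a fixed environment\<close>

text \<open>
  A regularisation of the entropy: up to linear terms and a bounded error it is
  \<open>x ln (x + \<epsilon>) - x ln \<epsilon>\<close>, but it is nonnegative, and its derivative \<open>ln (1 + x / \<epsilon>)\<close> is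
  bounded and Lipschitz near \<open>0\<close>.
\<close>

definition ent :: "real \<Rightarrow> real \<Rightarrow> real" where
  "ent \<epsilon> x = (x + \<epsilon>) * ln (1 + x / \<epsilon>) - x"

lemma ln_quotient_bounds:
  fixes x y \<epsilon> :: real assumes "\<epsilon> > 0" "0 \<le> y" "y \<le> x"
  shows "ln (1 + x / \<epsilon>) - ln (1 + y / \<epsilon>) \<le> (x - y) / \<epsilon>"
    and "(x - y) / (x + \<epsilon>) \<le> ln (1 + x / \<epsilon>) - ln (1 + y / \<epsilon>)"
proof -
  have X: "1 + x / \<epsilon> = (x + \<epsilon>) / \<epsilon>" "1 + y / \<epsilon> = (y + \<epsilon>) / \<epsilon>" using assms by (auto simp: field_simps)
  have p: "0 < x + \<epsilon>" "0 < y + \<epsilon>" using assms by auto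
  have "ln (1 + x / \<epsilon>) - ln (1 + y / \<epsilon>) = ln ((x + \<epsilon>) / (y + \<epsilon>))" unfolding X using p assms by (simp add: ln_div)
  also have "\<dots> \<le> (x + \<epsilon>) / (y + \<epsilon>) - 1" by (rule ln_le_minus_one) (use p in simp)
  also have "\<dots> = (x - y) / (y + \<epsilon>)" using p by (simp add: field_simps)
  also have "\<dots> \<le> (x - y) / \<epsilon>" by (rule divide_left_mono) (use assms p in auto)
  finally show "ln (1 + x / \<epsilon>) - ln (1 + y / \<epsilon>) \<le> (x - y) / \<epsilon>" .
  have "ln (1 + y / \<epsilon>) - ln (1 + x / \<epsilon>) = ln ((y + \<epsilon>) / (x + \<epsilon>))" unfolding X using p assms by (simp add: ln_div)
  also have "\<dots> \<le> (y + \<epsilon>) / (x + \<epsilon>) - 1" by (rule ln_le_minus_one) (use p in simp)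
  also have "\<dots> = - ((x - y) / (x + \<epsilon>))" using p by (simp add: field_simps)
  finally show "(x - y) / (x + \<epsilon>) \<le> ln (1 + x / \<epsilon>) - ln (1 + y / \<epsilon>)" by simp
qed

text \<open>
  Gibbs' inequality \<open>x * ln (w / x) \<le> w - x\<close>, where \<open>x\<close> is shifted by \<open>\<epsilon>\<close> inside the logarithm.
\<close>

lemma ent_lower:
  assumes "0 \<le> x" "0 < \<epsilon>" "0 < w"
  shows "x * ln (w / \<epsilon>) \<le> ent \<epsilon> x + w"
proof -
  have p: "0 < x + \<epsilon>" using assms by simp
  have l: "ln (1 + x / \<epsilon>) = ln ((x + \<epsilon>) / \<epsilon>)" using assms by (simp add: field_simps)
  have l0: "0 \<le> ln (1 + x / \<epsilon>)" using assms by simp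
  have "ln (w / \<epsilon>) - ln ((x + \<epsilon>) / \<epsilon>) = ln (w / (x + \<epsilon>))" using assms p by (simp add: ln_div)
  also have "\<dots> \<le> w / (x + \<epsilon>) - 1" by (rule ln_le_minus_one) (use assms p in simp)
  finally have "x * (ln (w / \<epsilon>) - ln (1 + x / \<epsilon>)) \<le> x * (w / (x + \<epsilon>) - 1)" unfolding l by (rule mult_left_mono) (rule assms)
  also have "\<dots> \<le> w - x"
  proof -
    have "x * w \<le> w * (x + \<epsilon>)" using assms by (simp add: algebra_simps)
    then have "x * w / (x + \<epsilon>) \<le> w" using p by (simp add: field_simps)
    then show ?thesis by (simp add: algebra_simps)
  qed
  finally have "x * ln (w / \<epsilon>) \<le> x * ln (1 + x / \<epsilon>) - x + w" by (simp add: algebra_simps)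
  also have "x * ln (1 + x / \<epsilon>) \<le> (x + \<epsilon>) * ln (1 + x / \<epsilon>)" using l0 assms by (intro mult_right_mono) auto
  finally show ?thesis by (simp add: ent_def)
qed

text \<open>
  By \<open>ln (x / B) \<le> x / B - 1\<close>. With a bound \<open>B\<close> on the energy, the quadratic terms sum to at most one.
\<close>

lemma ent_upper:
  assumes "0 \<le> x" "0 < \<epsilon>" "\<epsilon> \<le> B"
  shows "ent \<epsilon> x \<le> x\<^sup>2 / B + x * ln (B / \<epsilon>)"
proof -
  have p: "0 < x + \<epsilon>" "0 < B" using assms by auto
  have l: "ln (1 + x / \<epsilon>) = ln ((x + \<epsilon>) / \<epsilon>)" using assms by (simp add: field_simps)
  have "ln (1 + x / \<epsilon>) \<le> x / \<epsilon>" using assms by (intro ln_add_one_self_le_self) auto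
  then have "\<epsilon> * ln (1 + x / \<epsilon>) \<le> x" using assms by (simp add: field_simps)
  then have "ent \<epsilon> x \<le> x * ln (1 + x / \<epsilon>)" by (simp add: ent_def algebra_simps)
  also have "ln (1 + x / \<epsilon>) = ln ((x + \<epsilon>) / B) + ln (B / \<epsilon>)" unfolding l using p assms by (simp add: ln_div)
  also have "x * (ln ((x + \<epsilon>) / B) + ln (B / \<epsilon>)) \<le> x * (x / B + ln (B / \<epsilon>))"
  proof (intro mult_left_mono add_right_mono)
    have "ln ((x + \<epsilon>) / B) \<le> (x + \<epsilon>) / B - 1" by (rule ln_le_minus_one) (use p in simp)
    also have "\<dots> \<le> x / B" using assms p by (simp add: field_simps)
    finally show "ln ((x + \<epsilon>) / B) \<le> x / B" .
  qed (use assms in auto)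
  finally show ?thesis by (simp add: power2_eq_square algebra_simps)
qed

lemma ent_nonneg: "0 \<le> x \<Longrightarrow> 0 < \<epsilon> \<Longrightarrow> 0 \<le> ent \<epsilon> x"
  using ln_quotient_bounds(2)[of \<epsilon> 0 x] by (simp add: ent_def field_simps)

lemma ent_derivative:
  assumes "0 \<le> x" "0 < \<epsilon>"
  shows "(ent \<epsilon> has_real_derivative ln (1 + x / \<epsilon>)) (at x within S)"
proof -
  have p: "0 < 1 + x / \<epsilon>" using assms by (auto intro!: add_pos_nonneg)
  have 1: "((\<lambda>x. 1 + x / \<epsilon>) has_real_derivative 1 / \<epsilon>) (at x within S)"
    using assms by (auto intro!: derivative_eq_intros)
  have 2: "((\<lambda>x. ln (1 + x / \<epsilon>)) has_real_derivative 1 / (1 + x / \<epsilon>) * (1 / \<epsilon>)) (at x within S)"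
    by (rule DERIV_chain2[OF DERIV_ln_divide[OF p] 1])
  have 3: "((\<lambda>x. x + \<epsilon>) has_real_derivative 1) (at x within S)" by (auto intro!: derivative_eq_intros)
  have 4: "1 * ln (1 + x / \<epsilon>) + 1 / (1 + x / \<epsilon>) * (1 / \<epsilon>) * (x + \<epsilon>) - 1 = ln (1 + x / \<epsilon>)"
  proof -
    have "1 + x / \<epsilon> = (x + \<epsilon>) / \<epsilon>" "x + \<epsilon> \<noteq> 0" using assms by (auto simp: field_simps)
    then have e: "1 / (1 + x / \<epsilon>) * (1 / \<epsilon>) * (x + \<epsilon>) = 1" using assms by simp
    show ?thesis unfolding e by simp
  qed
  show ?thesis unfolding ent_def[abs_def]
    using DERIV_diff[OF DERIV_mult[OF 3 2] DERIV_ident] unfolding 4 .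
qed

lemma l1_dist_nonneg: "0 \<le> l1_dist x y"
  by (simp add: l1_dist_def sum_nonneg)

lemma l1_dist_triangle: "l1_dist x z \<le> l1_dist x y + l1_dist y z"
  unfolding l1_dist_def sum.distrib[symmetric] by (rule sum_mono) linarith

lemma l1_dist_commute: "l1_dist x y = l1_dist y x"
  by (simp add: l1_dist_def abs_minus_commute)

text \<open>
  A geometric series whose ratio \<open>\<rho> = exp (- 1 / m)\<close> satisfies \<open>\<rho> \<le> m * (1 - \<rho>)\<close>.
\<close>

lemma exp_abs_sum_le:
  fixes m :: real assumes m: "m \<ge> 1"
  shows "(\<Sum>k\<in>{- int n..int n}. exp (- real_of_int \<bar>k\<bar> / m)) \<le> 3 * m"
proof -
  define \<rho> where "\<rho> = exp (- 1 / m)"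
  have \<rho>: "0 < \<rho>" "\<rho> \<le> m * (1 - \<rho>)"
  proof -
    show "0 < \<rho>" by (simp add: \<rho>_def)
    have "1 + 1 / m \<le> exp (1 / m)" by (rule exp_ge_add_one_self)
    then have "(1 + 1 / m) * \<rho> \<le> exp (1 / m) * \<rho>" by (rule mult_right_mono) (simp add: \<rho>_def)
    also have "\<dots> = 1" by (simp add: \<rho>_def exp_add[symmetric])
    finally show "\<rho> \<le> m * (1 - \<rho>)" using m by (simp add: field_simps)
  qed
  have "(\<Sum>k\<in>{- int n..int n}. exp (- real_of_int \<bar>k\<bar> / m)) \<le> 1 + 2 * m * (1 - \<rho> ^ n)" for n
  proof (induction n)
    case (Suc n)
    have "{- int (Suc n)..int (Suc n)} = insert (int (Suc n)) (insert (- int (Suc n)) {- int n..int n})" by auto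
    moreover have "sum g (insert (int (Suc n)) (insert (- int (Suc n)) {- int n..int n})) = g (int (Suc n)) + (g (- int (Suc n)) + sum g {- int n..int n})" for g :: "int \<Rightarrow> real"
      by simp
    moreover have "real_of_int \<bar>int (Suc n)\<bar> = real (Suc n)" "real_of_int \<bar>- int (Suc n)\<bar> = real (Suc n)" by simp_all
    ultimately have "(\<Sum>k\<in>{- int (Suc n)..int (Suc n)}. exp (- real_of_int \<bar>k\<bar> / m))
      = 2 * exp (- real (Suc n) / m) + (\<Sum>k\<in>{- int n..int n}. exp (- real_of_int \<bar>k\<bar> / m))"
      by (simp only:)
    also have "exp (- real (Suc n) / m) = \<rho> * \<rho> ^ n"
      by (simp add: \<rho>_def exp_of_nat_mult[symmetric] exp_add[symmetric] add_divide_distrib diff_divide_distrib)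
    also have "2 * (\<rho> * \<rho> ^ n) \<le> 2 * (m * (1 - \<rho>) * \<rho> ^ n)"
      by (intro mult_left_mono mult_right_mono) (use \<rho> in auto)
    finally show ?case using Suc.IH by (simp add: algebra_simps)
  qed simp
  from this[of n] have "(\<Sum>k\<in>{- int n..int n}. exp (- real_of_int \<bar>k\<bar> / m)) \<le> 1 + 2 * m * 1"
  proof -
    have "2 * m * (1 - \<rho> ^ n) \<le> 2 * m * 1" using \<rho>(1) m by (intro mult_left_mono) auto
    then show ?thesis using \<open>(\<Sum>k\<in>{- int n..int n}. exp (- real_of_int \<bar>k\<bar> / m)) \<le> 1 + 2 * m * (1 - \<rho> ^ n)\<close> by linarith
  qed
  then show ?thesis using m by simp
qed

text \<open>
  The weight is a product over the coordinates, so its sum over a finite box is a power of a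
  one-dimensional sum; then the box exhausts the lattice.
\<close>

lemma exp_l1_dist_sum_le:
  fixes x :: "'d::finite site"
  assumes m: "m \<ge> 1"
  shows "(\<Sigma>\<^sup>+y. ennreal (exp (- real_of_int (l1_dist x y) / m))) \<le> ennreal ((3 * m) ^ CARD('d))"
proof -
  define f where "f k = exp (- real_of_int \<bar>k\<bar> / m)" for k :: int
  have f0: "0 \<le> f k" for k by (simp add: f_def)
  have "(\<Sigma>\<^sup>+y. ennreal (exp (- real_of_int (l1_dist x y) / m))) = (\<Sigma>\<^sup>+y. ennreal (exp (- real_of_int (l1_dist x (x + y)) / m)))"
    by (rule esum_shift(2)[symmetric])
  also have "\<dots> = (\<Sigma>\<^sup>+y::'d site. ennreal (\<Prod>i\<in>UNIV. f (y $ i)))"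
    by (rule nn_integral_cong) (simp add: f_def l1_dist_def exp_sum[symmetric] sum_divide_distrib sum_negf)
  also have "\<dots> = (\<Sigma>\<^sup>+y::'d site. (SUP n::nat. ennreal (\<Prod>i\<in>UNIV. f (y $ i)) * indicator {y. \<forall>i. y $ i \<in> {- int n..int n}} y))"
  proof (rule nn_integral_cong)
    fix y :: "'d site"
    define n where "n = nat (\<Sum>i\<in>UNIV. \<bar>y $ i\<bar>)"
    have le: "\<bar>y $ i\<bar> \<le> int n" for i unfolding n_def using member_le_sum[of i UNIV "\<lambda>i. \<bar>y $ i\<bar>"] by simp
    have "- int n \<le> y $ i \<and> y $ i \<le> int n" for i using le[of i] by linarith
    then have "ennreal (\<Prod>i\<in>UNIV. f (y $ i)) \<le> (SUP n::nat. ennreal (\<Prod>i\<in>UNIV. f (y $ i)) * indicator {y. \<forall>i. y $ i \<in> {- int n..int n}} y)"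
      by (intro SUP_upper2[of n]) auto
    moreover have "(SUP n::nat. ennreal (\<Prod>i\<in>UNIV. f (y $ i)) * indicator {y. \<forall>i. y $ i \<in> {- int n..int n}} y) \<le> ennreal (\<Prod>i\<in>UNIV. f (y $ i))"
      by (rule SUP_least) (auto split: split_indicator)
    ultimately show "ennreal (\<Prod>i\<in>UNIV. f (y $ i)) = (SUP n::nat. ennreal (\<Prod>i\<in>UNIV. f (y $ i)) * indicator {y. \<forall>i. y $ i \<in> {- int n..int n}} y)"
      by (rule antisym)
  qed
  also have "\<dots> = (SUP n. \<Sigma>\<^sup>+y::'d site. ennreal (\<Prod>i\<in>UNIV. f (y $ i)) * indicator {y. \<forall>i. y $ i \<in> {- int n..int n}} y)"
  proof (rule nn_integral_monotone_convergence_SUP)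
    show "incseq (\<lambda>n (y::'d site). ennreal (\<Prod>i\<in>UNIV. f (y $ i)) * indicator {y. \<forall>i. y $ i \<in> {- int n..int n}} y)"
    proof (intro incseq_SucI le_funI mult_left_mono indicator_leI)
      fix n and y :: "'d site" assume "y \<in> {y. \<forall>i. y $ i \<in> {- int n..int n}}"
      then have "- int n \<le> y $ i \<and> y $ i \<le> int n" for i by auto
      then have "- int (Suc n) \<le> y $ i \<and> y $ i \<le> int (Suc n)" for i by (smt (verit) of_nat_Suc)
      then show "y \<in> {y. \<forall>i. y $ i \<in> {- int (Suc n)..int (Suc n)}}" by auto
    qed simp
  qed simp
  also have "\<dots> \<le> ennreal ((3 * m) ^ CARD('d))"
  proof (rule SUP_least)
    fix n :: nat
    let ?A = "{y::'d site. \<forall>i. y $ i \<in> {- int n..int n}}"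
    have b: "bij_betw vec_lambda (PiE UNIV (\<lambda>_::'d. {- int n..int n})) ?A" by (rule bij_betw_vec_lambda)
    have fin: "finite ?A" using bij_betw_finite[OF b] by (simp add: finite_PiE)
    have "(\<Sigma>\<^sup>+y::'d site. ennreal (\<Prod>i\<in>UNIV. f (y $ i)) * indicator ?A y) = (\<Sum>y\<in>?A. ennreal (\<Prod>i\<in>UNIV. f (y $ i)) * indicator ?A y)"
      by (rule nn_integral_count_space'[OF fin]) auto
    also have "\<dots> = (\<Sum>y\<in>?A. ennreal (\<Prod>i\<in>UNIV. f (y $ i)))" by (rule sum.cong) auto
    also have "\<dots> = ennreal (\<Sum>y\<in>?A. \<Prod>i\<in>UNIV. f (y $ i))" by (rule sum_ennreal) (auto intro: prod_nonneg f0)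
    also have "(\<Sum>y\<in>?A. \<Prod>i\<in>UNIV. f (y $ i)) = (\<Sum>g\<in>PiE UNIV (\<lambda>_::'d. {- int n..int n}). \<Prod>i\<in>UNIV. f (g i))"
      by (subst sum.reindex_bij_betw[OF b, symmetric]) simp
    also have "\<dots> = (\<Prod>i\<in>(UNIV::'d set). \<Sum>k\<in>{- int n..int n}. f k)" by (rule prod_sum_PiE[symmetric]) auto
    also have "\<dots> = (\<Sum>k\<in>{- int n..int n}. f k) ^ CARD('d)" by simp
    also have "ennreal \<dots> \<le> ennreal ((3 * m) ^ CARD('d))"
      unfolding f_def by (intro ennreal_leI power_mono exp_abs_sum_le m sum_nonneg) auto
    finally show "(\<Sigma>\<^sup>+y::'d site. ennreal (\<Prod>i\<in>UNIV. f (y $ i)) * indicator ?A y) \<le> ennreal ((3 * m) ^ CARD('d))" .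
  qed
  finally show ?thesis .
qed

context active_walk
begin

definition moment :: "real \<Rightarrow> ennreal" where
  "moment t = (\<Sigma>\<^sup>+y. ennreal (real_of_int (l1_dist x y) * q t y))"

abbreviation fisher :: "real \<Rightarrow> real \<Rightarrow> ennreal" where
  "fisher \<epsilon> u \<equiv> (\<Sigma>\<^sup>+y. \<Sigma>\<^sup>+z. ennreal (a u y z * ((q u y - q u z)\<^sup>2 / (q u y + q u z + 2 * \<epsilon>))))"

text \<open>
  In the dissipation formula \<open>\<phi>'\<close> is a logarithm, and \<open>(x - y)\<^sup>2 / (x + y)\<close> is at most
  \<open>(ln x - ln y) * (x - y)\<close>.
\<close>

lemma entropy_dissipation:
  assumes st: "s0 \<le> s" "s \<le> t" and \<epsilon>: "\<epsilon> > 0"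
  shows "2 * (\<Sigma>\<^sup>+y. ennreal (ent \<epsilon> (q t y))) + (\<integral>\<^sup>+u. indicator {s..t} u * fisher \<epsilon> u \<partial>lborel)
    \<le> 2 * (\<Sigma>\<^sup>+y. ennreal (ent \<epsilon> (q s y)))"
proof -
  have "2 * (\<Sigma>\<^sup>+y. ennreal (ent \<epsilon> (q t y))) + (\<integral>\<^sup>+u. indicator {s..t} u * (\<Sigma>\<^sup>+y. \<Sigma>\<^sup>+z. ennreal (a u y z * ((ln (1 + q u y / \<epsilon>) - ln (1 + q u z / \<epsilon>)) * (q u y - q u z)))) \<partial>lborel)
    = 2 * (\<Sigma>\<^sup>+y. ennreal (ent \<epsilon> (q s y)))"
  proof (rule dissipation[OF st, where L="1 / \<epsilon>" and B="ln (1 + 1 / \<epsilon>)"])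
    show "(\<lambda>x. ln (1 + x / \<epsilon>)) \<in> borel_measurable borel" by measurable
    show "(ent \<epsilon> has_real_derivative ln (1 + x / \<epsilon>)) (at x within {0..1})" if "x \<in> {0..1}" for x
      using that \<epsilon> by (intro ent_derivative) auto
    show "\<bar>ln (1 + x / \<epsilon>) - ln (1 + y / \<epsilon>)\<bar> \<le> 1 / \<epsilon> * \<bar>x - y\<bar>" if "x \<in> {0..1}" "y \<in> {0..1}" for x y
    proof -
      have *: "\<bar>ln (1 + x / \<epsilon>) - ln (1 + y / \<epsilon>)\<bar> \<le> 1 / \<epsilon> * \<bar>x - y\<bar>" if "0 \<le> y" "y \<le> x" for x y
      proof -
        have "0 \<le> (x - y) / (x + \<epsilon>)" using that \<epsilon> by simp
        then show ?thesis using ln_quotient_bounds[OF \<epsilon> that] that by simp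
      qed
      show ?thesis using *[of y x] *[of x y] that by (cases "y \<le> x") (auto simp: abs_minus_commute)
    qed
    show "ln (1 + x / \<epsilon>) \<le> ln (1 + y / \<epsilon>)" if "0 \<le> x" "x \<le> y" "y \<le> 1" for x y
      using that \<epsilon> by (intro ln_mono) (auto intro!: add_pos_nonneg divide_right_mono)
    then show "ln (1 + x / \<epsilon>) \<le> ln (1 + 1 / \<epsilon>)" if "x \<in> {0..1}" for x
      using that by auto
  qed (use \<epsilon> ent_nonneg in auto)
  note id = this
  have "(\<integral>\<^sup>+u. indicator {s..t} u * fisher \<epsilon> u \<partial>lborel)
    \<le> (\<integral>\<^sup>+u. indicator {s..t} u * (\<Sigma>\<^sup>+y. \<Sigma>\<^sup>+z. ennreal (a u y z * ((ln (1 + q u y / \<epsilon>) - ln (1 + q u z / \<epsilon>)) * (q u y - q u z)))) \<partial>lborel)"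
  proof (intro nn_integral_mono mult_left_mono ennreal_leI)
    fix u y z
    have *: "(x - y)\<^sup>2 / (x + y + 2 * \<epsilon>) \<le> (ln (1 + x / \<epsilon>) - ln (1 + y / \<epsilon>)) * (x - y)" if "0 \<le> y" "y \<le> x" for x y
    proof -
      have "(x - y)\<^sup>2 / (x + y + 2 * \<epsilon>) \<le> (x - y)\<^sup>2 / (x + \<epsilon>)" using that \<epsilon> by (intro divide_left_mono) auto
      also have "\<dots> = (x - y) / (x + \<epsilon>) * (x - y)" by (simp add: power2_eq_square)
      also have "\<dots> \<le> (ln (1 + x / \<epsilon>) - ln (1 + y / \<epsilon>)) * (x - y)"
        using ln_quotient_bounds(2)[OF \<epsilon> that] that by (intro mult_right_mono) auto
      finally show ?thesis .
    qed
    show "(q u y - q u z)\<^sup>2 / (q u y + q u z + 2 * \<epsilon>) \<le> (ln (1 + q u y / \<epsilon>) - ln (1 + q u z / \<epsilon>)) * (q u y - q u z)"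
    proof (cases "q u z \<le> q u y")
      case True then show ?thesis using * q_nonneg by blast
    next
      case False
      then have "(q u z - q u y)\<^sup>2 / (q u z + q u y + 2 * \<epsilon>) \<le> (ln (1 + q u z / \<epsilon>) - ln (1 + q u y / \<epsilon>)) * (q u z - q u y)"
        using * q_nonneg by simp
      moreover have "(ln (1 + q u z / \<epsilon>) - ln (1 + q u y / \<epsilon>)) * (q u z - q u y) = (ln (1 + q u y / \<epsilon>) - ln (1 + q u z / \<epsilon>)) * (q u y - q u z)"
        by (simp add: algebra_simps)
      ultimately show ?thesis by (simp add: power2_commute add.commute)
    qed
  qed (auto simp: rate_nonneg)
  then have "2 * (\<Sigma>\<^sup>+y. ennreal (ent \<epsilon> (q t y))) + (\<integral>\<^sup>+u. indicator {s..t} u * fisher \<epsilon> u \<partial>lborel)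
    \<le> 2 * (\<Sigma>\<^sup>+y. ennreal (ent \<epsilon> (q t y))) + (\<integral>\<^sup>+u. indicator {s..t} u * (\<Sigma>\<^sup>+y. \<Sigma>\<^sup>+z. ennreal (a u y z * ((ln (1 + q u y / \<epsilon>) - ln (1 + q u z / \<epsilon>)) * (q u y - q u z)))) \<partial>lborel)"
    by (rule add_left_mono)
  then show ?thesis by (rule order_trans) (rule eq_refl[OF id])
qed

text \<open>
  The entropy produced is the difference of the convex functionals \<open>\<Sum>y. ent \<epsilon> (q u y)\<close> at the times
  \<open>s\<close> and \<open>t\<close>. The first is bounded above through the energy at time \<open>s\<close>, the second below by
  Gibbs' inequality against the weight \<open>exp (- l1_dist x y / m) / Z\<close>.
\<close>

lemma entropy_production:
  assumes st: "s0 \<le> s" "s \<le> t" and B: "(\<Sigma>\<^sup>+y. ennreal ((q s y)\<^sup>2)) \<le> ennreal B"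
    and \<epsilon>: "0 < \<epsilon>" "\<epsilon> \<le> B" and Z: "0 < Z" "Z * \<epsilon> \<le> 1" and m: "0 < m"
    and part: "(\<Sigma>\<^sup>+y. ennreal (exp (- real_of_int (l1_dist x y) / m))) \<le> ennreal Z"
  shows "(\<integral>\<^sup>+u. indicator {s..t} u * fisher \<epsilon> u \<partial>lborel) + ennreal (2 * (- ln (Z * \<epsilon>)))
    \<le> ennreal (2 * (1 + ln (B / \<epsilon>))) + (2 + ennreal (2 / m) * moment t)"
proof -
  have B0: "0 < B" using \<epsilon> by simp
  have lB: "0 \<le> ln (B / \<epsilon>)" using \<epsilon> by simp
  have lZ: "0 \<le> - ln (Z * \<epsilon>)" using Z \<epsilon> by (simp add: ln_le_zero_iff)
  let ?l = "\<lambda>y. real_of_int (l1_dist x y)"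
  have l0: "0 \<le> ?l y" for y by (simp add: l1_dist_nonneg)
  have up: "(\<Sigma>\<^sup>+y. ennreal (ent \<epsilon> (q s y))) \<le> ennreal (1 + ln (B / \<epsilon>))"
  proof -
    have "(\<Sigma>\<^sup>+y. ennreal (ent \<epsilon> (q s y))) \<le> (\<Sigma>\<^sup>+y. ennreal ((q s y)\<^sup>2) * ennreal (inverse B) + ennreal (q s y) * ennreal (ln (B / \<epsilon>)))"
    proof (rule nn_integral_mono)
      fix y
      have "ent \<epsilon> (q s y) \<le> (q s y)\<^sup>2 / B + q s y * ln (B / \<epsilon>)" by (rule ent_upper) (use q_nonneg \<epsilon> in auto)
      then have "ennreal (ent \<epsilon> (q s y)) \<le> ennreal ((q s y)\<^sup>2 * inverse B + q s y * ln (B / \<epsilon>))" by (intro ennreal_leI) (simp add: divide_inverse)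
      also have "\<dots> = ennreal ((q s y)\<^sup>2) * ennreal (inverse B) + ennreal (q s y) * ennreal (ln (B / \<epsilon>))"
        using q_nonneg lB B0 by (simp add: ennreal_plus ennreal_mult)
      finally show "ennreal (ent \<epsilon> (q s y)) \<le> ennreal ((q s y)\<^sup>2) * ennreal (inverse B) + ennreal (q s y) * ennreal (ln (B / \<epsilon>))" .
    qed
    also have "\<dots> = (\<Sigma>\<^sup>+y. ennreal ((q s y)\<^sup>2)) * ennreal (inverse B) + ennreal (ln (B / \<epsilon>))"
      by (simp only: esum_add esum_cmult mass_conserved[OF st(1)] mult_1)
    also have "\<dots> \<le> ennreal B * ennreal (inverse B) + ennreal (ln (B / \<epsilon>))"
      by (intro add_right_mono mult_right_mono B) auto
    also have "\<dots> = ennreal (1 + ln (B / \<epsilon>))" using B0 lB by (simp add: ennreal_mult[symmetric] ennreal_plus)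
    finally show ?thesis .
  qed
  have low: "ennreal (- ln (Z * \<epsilon>)) \<le> (\<Sigma>\<^sup>+y. ennreal (ent \<epsilon> (q t y))) + (1 + ennreal (1 / m) * moment t)"
  proof -
    have "ennreal (- ln (Z * \<epsilon>)) = (\<Sigma>\<^sup>+y. ennreal (q t y) * ennreal (- ln (Z * \<epsilon>)))"
      using mass_conserved[of t] st by (simp only: esum_cmult) simp
    also have "\<dots> \<le> (\<Sigma>\<^sup>+y. ennreal (ent \<epsilon> (q t y)) + (ennreal (exp (- ?l y / m)) * ennreal (1 / Z) + ennreal (1 / m) * ennreal (?l y * q t y)))"
    proof (rule nn_integral_mono)
      fix y
      have w0: "0 < exp (- ?l y / m) / Z" using Z by simp
      have "ln (exp (- ?l y / m) / Z / \<epsilon>) = - ?l y / m - ln (Z * \<epsilon>)" using Z \<epsilon> by (simp add: ln_div ln_mult)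
      then have "q t y * (- ?l y / m - ln (Z * \<epsilon>)) \<le> ent \<epsilon> (q t y) + exp (- ?l y / m) / Z"
        using ent_lower[OF q_nonneg[of t y] \<epsilon>(1) w0] by simp
      then have "q t y * (- ln (Z * \<epsilon>)) \<le> ent \<epsilon> (q t y) + (exp (- ?l y / m) * (1 / Z) + 1 / m * (?l y * q t y))"
        by (simp add: algebra_simps)
      then have "ennreal (q t y * (- ln (Z * \<epsilon>))) \<le> ennreal (ent \<epsilon> (q t y) + (exp (- ?l y / m) * (1 / Z) + 1 / m * (?l y * q t y)))" by (rule ennreal_leI)
      then show "ennreal (q t y) * ennreal (- ln (Z * \<epsilon>)) \<le> ennreal (ent \<epsilon> (q t y)) + (ennreal (exp (- ?l y / m)) * ennreal (1 / Z) + ennreal (1 / m) * ennreal (?l y * q t y))"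
        using q_nonneg lZ ent_nonneg[OF q_nonneg \<epsilon>(1)] Z m l0
        by (simp add: ennreal_mult[symmetric] ennreal_plus[symmetric] mult_nonneg_nonneg add_nonneg_nonneg del: ennreal_plus)
    qed
    also have "\<dots> = (\<Sigma>\<^sup>+y. ennreal (ent \<epsilon> (q t y))) + ((\<Sigma>\<^sup>+y. ennreal (exp (- ?l y / m))) * ennreal (1 / Z) + ennreal (1 / m) * moment t)"
      unfolding moment_def by (simp only: esum_add esum_cmult)
    also have "\<dots> \<le> (\<Sigma>\<^sup>+y. ennreal (ent \<epsilon> (q t y))) + (ennreal Z * ennreal (1 / Z) + ennreal (1 / m) * moment t)"
      by (intro add_left_mono add_right_mono mult_right_mono part) auto
    also have "ennreal Z * ennreal (1 / Z) = 1" using Z by (simp add: ennreal_mult[symmetric])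
    finally show ?thesis .
  qed
  let ?F = "\<integral>\<^sup>+u. indicator {s..t} u * fisher \<epsilon> u \<partial>lborel"
  have two: "ennreal (2 * c) = 2 * ennreal c" if "0 \<le> c" for c using that by (simp add: ennreal_mult)
  have "?F + ennreal (2 * (- ln (Z * \<epsilon>))) = ?F + 2 * ennreal (- ln (Z * \<epsilon>))" by (simp only: two[OF lZ])
  also have "\<dots> \<le> ?F + 2 * ((\<Sigma>\<^sup>+y. ennreal (ent \<epsilon> (q t y))) + (1 + ennreal (1 / m) * moment t))"
    by (intro add_left_mono mult_left_mono low) auto
  also have "\<dots> = (2 * (\<Sigma>\<^sup>+y. ennreal (ent \<epsilon> (q t y))) + ?F) + (2 + 2 * (ennreal (1 / m) * moment t))"
    by (simp only: distrib_left mult_1_right mult_1_left ac_simps)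
  also have "\<dots> \<le> 2 * ennreal (1 + ln (B / \<epsilon>)) + (2 + 2 * (ennreal (1 / m) * moment t))"
    by (intro add_right_mono order_trans[OF entropy_dissipation[OF st \<epsilon>(1)]] mult_left_mono up) auto
  also have "2 * ennreal (1 + ln (B / \<epsilon>)) = ennreal (2 * (1 + ln (B / \<epsilon>)))" using two[of "1 + ln (B / \<epsilon>)"] lB by simp
  also have "2 * (ennreal (1 / m) * moment t) = ennreal (2 / m) * moment t"
    using two[of "1 / m"] m by (simp add: mult.assoc[symmetric])
  finally show ?thesis .
qed

text \<open>
  The distance to the starting point changes by at most one along a bond. It is truncated at \<open>R\<close> to
  get a bounded weight, and monotone convergence removes the truncation.
\<close>

lemma moment_growth:
  assumes st: "s0 \<le> s" "s \<le> t"
  shows "2 * moment t \<le> 2 * moment s + (\<integral>\<^sup>+u. indicator {s..t} u * (\<Sigma>\<^sup>+y. \<Sigma>\<^sup>+z. ennreal (a u y z * \<bar>q u y - q u z\<bar>)) \<partial>lborel)"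
proof -
  let ?D = "\<integral>\<^sup>+u. indicator {s..t} u * (\<Sigma>\<^sup>+y. \<Sigma>\<^sup>+z. ennreal (a u y z * \<bar>q u y - q u z\<bar>)) \<partial>lborel"
  let ?w = "\<lambda>R y. min (real_of_int (l1_dist x y)) (real R)"
  have w0: "0 \<le> ?w R y" for R y by (simp add: l1_dist_nonneg)
  have b: "2 * (\<Sigma>\<^sup>+y. ennreal (?w R y * q t y)) \<le> 2 * moment s + ?D" for R :: nat
  proof -
    have "2 * (\<Sigma>\<^sup>+y. ennreal (?w R y * q t y)) \<le> 2 * (\<Sigma>\<^sup>+y. ennreal (?w R y * q s y))
      + (\<integral>\<^sup>+u. indicator {s..t} u * (\<Sigma>\<^sup>+y. \<Sigma>\<^sup>+z. ennreal (a u y z * (\<bar>?w R y - ?w R z\<bar> * \<bar>q u y - q u z\<bar>))) \<partial>lborel)"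
      by (rule weighted_mass_growth[OF st w0, where B="real R"]) simp
    also have "\<dots> \<le> 2 * moment s + ?D"
    proof (intro add_mono)
      have "(\<Sigma>\<^sup>+y. ennreal (?w R y * q s y)) \<le> moment s"
        unfolding moment_def by (intro nn_integral_mono ennreal_leI mult_right_mono q_nonneg) simp
      then show "2 * (\<Sigma>\<^sup>+y. ennreal (?w R y * q s y)) \<le> 2 * moment s" by (rule mult_left_mono) simp
      have edge: "a u y z * (\<bar>?w R y - ?w R z\<bar> * \<bar>q u y - q u z\<bar>) \<le> a u y z * \<bar>q u y - q u z\<bar>" for u y z
      proof (cases "nbr y z")
        case True
        then have "l1_dist x y \<le> l1_dist x z + 1" "l1_dist x z \<le> l1_dist x y + 1"
          using l1_dist_triangle[of x y z] l1_dist_triangle[of x z y] by (simp_all add: nbr_def l1_dist_commute)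
        then have "\<bar>?w R y - ?w R z\<bar> \<le> 1" by linarith
        then have "\<bar>?w R y - ?w R z\<bar> * \<bar>q u y - q u z\<bar> \<le> 1 * \<bar>q u y - q u z\<bar>" by (rule mult_right_mono) simp
        then show ?thesis using rate_nonneg by (simp add: mult_left_mono)
      next
        case False
        then have "a u y z = 0" using env by (auto simp: Env_def)
        then show ?thesis by simp
      qed
      show "(\<integral>\<^sup>+u. indicator {s..t} u * (\<Sigma>\<^sup>+y. \<Sigma>\<^sup>+z. ennreal (a u y z * (\<bar>?w R y - ?w R z\<bar> * \<bar>q u y - q u z\<bar>))) \<partial>lborel) \<le> ?D"
        by (intro nn_integral_mono mult_left_mono ennreal_leI edge) auto
    qed
    finally show ?thesis .
  qed
  have "moment t = (\<Sigma>\<^sup>+y. SUP R. ennreal (?w R y * q t y))"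
    unfolding moment_def
  proof (rule nn_integral_cong)
    fix y
    define R where "R = nat (l1_dist x y)"
    have "?w R y = real_of_int (l1_dist x y)" unfolding R_def using l1_dist_nonneg[of x y] by simp
    then have "ennreal (real_of_int (l1_dist x y) * q t y) \<le> (SUP R. ennreal (?w R y * q t y))"
      by (intro SUP_upper2[of R]) auto
    moreover have "(SUP R. ennreal (?w R y * q t y)) \<le> ennreal (real_of_int (l1_dist x y) * q t y)"
      by (intro SUP_least ennreal_leI mult_right_mono q_nonneg) simp
    ultimately show "ennreal (real_of_int (l1_dist x y) * q t y) = (SUP R. ennreal (?w R y * q t y))" by (rule antisym)
  qed
  also have "\<dots> = (SUP R. \<Sigma>\<^sup>+y. ennreal (?w R y * q t y))"
    by (rule nn_integral_monotone_convergence_SUP) (auto intro!: incseq_SucI le_funI ennreal_leI mult_right_mono q_nonneg)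
  finally have "2 * moment t = (SUP R. 2 * (\<Sigma>\<^sup>+y. ennreal (?w R y * q t y)))"
    by (simp add: SUP_mult_left_ennreal)
  also have "\<dots> \<le> 2 * moment s + ?D" by (rule SUP_least) (rule b)
  finally show ?thesis .
qed

lemma moment_start: "moment s0 = 0"
proof -
  have "q s0 y = 0" if "y \<noteq> x" for y
  proof -
    have "njump a (Suc n) s0 s0 x y = 0" for n
      unfolding njump.simps by (rule nn_integral_zero') (use AE_lborel_singleton[of s0] in \<open>eventually_elim, auto split: split_indicator\<close>)
    then have "kern a s0 s0 x y = 0" using that unfolding kern_def by (subst esum_nat_shift) (auto simp del: njump.simps(2))
    then show ?thesis by (simp add: q_def)
  qed
  then have z: "real_of_int (l1_dist x y) * q s0 y = 0" for y by (cases "y = x") (auto simp: l1_dist_def)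
  show ?thesis unfolding moment_def z by simp
qed

end


section \<open>Stationary random environments\<close>

text \<open>
  Only countably many time integrals are involved, so that the regularity of a random environment is
  an event.
\<close>

lemma regular_env_iff_countable:
  fixes a :: "'d::finite env"
  assumes env: "a \<in> Env" and meas: "\<And>x y. (\<lambda>t. a t x y) \<in> borel_measurable borel"
  shows "regular_env a \<longleftrightarrow>
      (\<forall>x. \<forall>N::nat. (\<integral>\<^sup>+u. indicator {- real N..real N} u * ennreal (total_rate a u x) \<partial>lborel) < \<infinity>)
    \<and> (\<forall>x. \<forall>m K::nat. \<exists>N::nat. ennreal (real K) \<le> (\<integral>\<^sup>+u. indicator {real m..real N} u * ennreal (total_rate a u x) \<partial>lborel))"
    (is "_ \<longleftrightarrow> ?fin \<and> ?div")
proof -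
  note [measurable] = meas
  have [measurable]: "(\<lambda>t. total_rate a t x) \<in> borel_measurable borel" for x unfolding total_rate_def by measurable
  have nn: "0 \<le> total_rate a u x" for u x using total_rate_pos[OF env] by (simp add: less_imp_le)
  define I where "I r t x = (\<integral>\<^sup>+u. indicator {r..t} u * ennreal (total_rate a u x) \<partial>lborel)" for r t x
  have I_eq: "I r t x = (\<integral>\<^sup>+u. ennreal (indicator {r..t} u *\<^sub>R total_rate a u x) \<partial>lborel)" for r t x
    unfolding I_def by (rule nn_integral_cong) (auto split: split_indicator)
  have I_mono: "I r t x \<le> I r' t' x" if "r' \<le> r" "t \<le> t'" for r r' t t' x
    unfolding I_def by (rule nn_integral_mono) (use that in \<open>auto split: split_indicator\<close>)
  have I_LBINT: "I r t x = ennreal (LBINT u:{r..t}. total_rate a u x)"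
    if "set_integrable lborel {r..t} (\<lambda>u. total_rate a u x)" for r t x
    unfolding I_eq set_lebesgue_integral_def
    by (rule nn_integral_eq_integral) (use that in \<open>auto simp: set_integrable_def nn\<close>)
  show ?thesis
  proof
    assume r: "regular_env a"
    have si: "set_integrable lborel {r..t} (\<lambda>u. total_rate a u x)" for r t x using r by (simp add: regular_env_def)
    have ?fin unfolding I_def[symmetric] I_LBINT[OF si] by simp
    moreover have ?div unfolding I_def[symmetric] I_LBINT[OF si]
    proof (intro allI)
      fix x and m K :: nat
      have "filterlim (\<lambda>t. LBINT u:{real m..t}. total_rate a u x) at_top at_top" using r by (simp add: regular_env_def)
      then have "eventually (\<lambda>t. real K \<le> (LBINT u:{real m..t}. total_rate a u x)) at_top" unfolding filterlim_at_top by blast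
      then obtain T where T: "\<And>t. T \<le> t \<Longrightarrow> real K \<le> (LBINT u:{real m..t}. total_rate a u x)" unfolding eventually_at_top_linorder by blast
      obtain N :: nat where "T \<le> real N" using real_arch_simple by blast
      from T[OF this] show "\<exists>N::nat. ennreal (real K) \<le> ennreal (LBINT u:{real m..real N}. total_rate a u x)" by (blast intro: ennreal_leI)
    qed
    ultimately show "?fin \<and> ?div" ..
  next
    assume fd: "?fin \<and> ?div"
    have si: "set_integrable lborel {r..t} (\<lambda>u. total_rate a u x)" for r t x
    proof -
      obtain N :: nat where N: "max \<bar>r\<bar> \<bar>t\<bar> \<le> real N" using real_arch_simple by blast
      have "I r t x \<le> I (- real N) (real N) x" by (rule I_mono) (use N in auto)
      also have "\<dots> < \<infinity>" using fd unfolding I_def by blast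
      finally show ?thesis unfolding set_integrable_def I_eq
        by (intro integrableI_nonneg) (auto simp: nn)
    qed
    have "filterlim (\<lambda>t. LBINT u:{r..t}. total_rate a u x) at_top at_top" for x r
      unfolding filterlim_at_top
    proof
      fix Z :: real
      obtain m :: nat where m: "r \<le> real m" using real_arch_simple by blast
      obtain K :: nat where K: "Z \<le> real K" using real_arch_simple by blast
      obtain N :: nat where N: "ennreal (real K) \<le> I (real m) (real N) x" using fd unfolding I_def by blast
      have "Z \<le> (LBINT u:{r..t}. total_rate a u x)" if "real N \<le> t" for t
      proof -
        have "ennreal (real K) \<le> I r t x" using N I_mono[OF m that, of x] by (rule order_trans)
        then have "real K \<le> (LBINT u:{r..t}. total_rate a u x)"
          unfolding I_LBINT[OF si] by (subst (asm) ennreal_le_iff) (auto intro: integrated_rate_nonneg[OF env])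
        then show ?thesis using K by simp
      qed
      then show "eventually (\<lambda>t. Z \<le> (LBINT u:{r..t}. total_rate a u x)) at_top"
        unfolding eventually_at_top_linorder by blast
    qed
    then show "regular_env a" unfolding regular_env_def using meas si by blast
  qed
qed

text \<open>
  Ellipticity makes the integrated total rates grow at least linearly.
\<close>

lemma regular_envI:
  fixes a :: "'d::finite env"
  assumes env: "a \<in> Env" and meas: "\<And>x y. (\<lambda>t. a t x y) \<in> borel_measurable borel"
    and fin: "\<And>x N::nat. (\<integral>\<^sup>+u. indicator {- real N..real N} u * ennreal (total_rate a u x) \<partial>lborel) < \<infinity>"
    and c0: "c0 > 0" and ell: "AE u in lborel. \<forall>y z. nbr y z \<longrightarrow> c0 \<le> a u y z"
  shows "regular_env a"
proof -
  note [measurable] = meas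
  have [measurable]: "(\<lambda>t. total_rate a t x) \<in> borel_measurable borel" for x unfolding total_rate_def by measurable
  have "\<exists>N::nat. ennreal (real K) \<le> (\<integral>\<^sup>+u. indicator {real m..real N} u * ennreal (total_rate a u x) \<partial>lborel)" for x and m K :: nat
  proof -
    obtain k :: nat where k: "real K / c0 \<le> real k" using real_arch_simple by blast
    have "real K \<le> c0 * (real (m + k) - real m)" using k c0 by (simp add: field_simps)
    then have "ennreal (real K) \<le> ennreal (c0 * (real (m + k) - real m))" by (rule ennreal_leI)
    also have "\<dots> = ennreal c0 * ennreal (real (m + k) - real m)" using c0 by (intro ennreal_mult) auto
    also have "\<dots> = (\<integral>\<^sup>+u. indicator {real m..real (m + k)} u * ennreal c0 \<partial>lborel)"
      by (rule nn_integral_Icc_const[symmetric]) simp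
    also have "\<dots> \<le> (\<integral>\<^sup>+u. indicator {real m..real (m + k)} u * ennreal (total_rate a u x) \<partial>lborel)"
    proof (rule nn_integral_mono_AE, use ell in eventually_elim, rule mult_left_mono, rule ennreal_leI)
      fix u assume u: "\<forall>y z. nbr y z \<longrightarrow> c0 \<le> a u y z"
      obtain i :: 'd where True by simp
      have "nbr x (x + axis i 1)" by (rule nbr_axis)
      then have "c0 \<le> a u x (x + axis i 1)" using u by blast
      also have "\<dots> \<le> total_rate a u x" unfolding total_rate_def
        by (rule member_le_sum) (use env finite_nbr nbr_axis in \<open>auto simp: Env_def less_imp_le\<close>)
      finally show "c0 \<le> total_rate a u x" .
    qed simp
    finally show ?thesis by blast
  qed
  then show ?thesis unfolding regular_env_iff_countable[OF env meas] using fin by blast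
qed

lemma esum_abs_diff_le:
  fixes \<alpha> \<beta> :: "'a \<Rightarrow> real"
  assumes nn: "0 \<le> A" "0 \<le> B" "\<And>z. 0 \<le> \<alpha> z" "\<And>z. 0 \<le> \<beta> z"
    and A: "ennreal A = (\<Sigma>\<^sup>+z. ennreal (\<alpha> z))" and B: "ennreal B = (\<Sigma>\<^sup>+z. ennreal (\<beta> z))"
  shows "ennreal \<bar>A - B\<bar> \<le> (\<Sigma>\<^sup>+z. ennreal \<bar>\<alpha> z - \<beta> z\<bar>)"
proof (cases "(\<Sigma>\<^sup>+z. ennreal \<bar>\<alpha> z - \<beta> z\<bar>) = \<infinity>")
  case False
  then obtain S where S: "0 \<le> S" "(\<Sigma>\<^sup>+z. ennreal \<bar>\<alpha> z - \<beta> z\<bar>) = ennreal S" by (cases rule: ennreal_cases) auto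
  have "ennreal A \<le> (\<Sigma>\<^sup>+z. ennreal (\<beta> z) + ennreal \<bar>\<alpha> z - \<beta> z\<bar>)"
    unfolding A using nn by (intro nn_integral_mono) (simp add: ennreal_plus[symmetric] ennreal_leI del: ennreal_plus)
  also have "\<dots> = ennreal (B + S)" unfolding esum_add S(2) B[symmetric] using nn S by simp
  finally have 1: "A \<le> B + S" using nn S by (simp add: ennreal_plus[symmetric] del: ennreal_plus)
  have "ennreal B \<le> (\<Sigma>\<^sup>+z. ennreal (\<alpha> z) + ennreal \<bar>\<alpha> z - \<beta> z\<bar>)"
    unfolding B using nn by (intro nn_integral_mono) (simp add: ennreal_plus[symmetric] ennreal_leI del: ennreal_plus)
  also have "\<dots> = ennreal (A + S)" unfolding esum_add S(2) A[symmetric] using nn S by simp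
  finally have "B \<le> A + S" using nn S by (simp add: ennreal_plus[symmetric] del: ennreal_plus)
  with 1 show ?thesis unfolding S(2) by (intro ennreal_leI) linarith
qed simp

text \<open>
  Random rates \<open>W \<omega>\<close> on a probability space with measure-preserving maps \<open>\<theta> r z\<close> that induce the time-space
  shifts. The sample space is abstract because the results are applied twice: to the environments
  themselves, and to the environments run backwards in time.
\<close>

locale stationary_rates = prob_space M for M :: "'w measure" +
  fixes W :: "'w \<Rightarrow> 'd::finite env" and \<theta> :: "real \<Rightarrow> 'd site \<Rightarrow> 'w \<Rightarrow> 'w" and c0 :: real
  assumes W_joint: "(\<lambda>p. W (fst p) (snd p) x y) \<in> borel_measurable (M \<Otimes>\<^sub>M borel)"
    and W_Env: "\<omega> \<in> space M \<Longrightarrow> W \<omega> \<in> Env"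
    and \<theta>_meas: "\<theta> r z \<in> M \<rightarrow>\<^sub>M M" and \<theta>_distr: "distr M M (\<theta> r z) = M"
    and W_\<theta>: "\<omega> \<in> space M \<Longrightarrow> W (\<theta> r z \<omega>) = env_shift r z (W \<omega>)"
    and W_sym: "AE \<omega> in M. \<forall>t x y. W \<omega> t x y = W \<omega> t y x"
    and W_int: "(\<integral>\<^sup>+\<omega>. ennreal (W \<omega> 0 0 y) \<partial>M) < \<infinity>"
    and c0: "c0 > 0" and W_ell: "nbr x y \<Longrightarrow> AE \<omega> in M. c0 \<le> W \<omega> t x y"
begin

lemma measurable_W [measurable (raw)]:
  assumes "f \<in> N \<rightarrow>\<^sub>M M" "g \<in> borel_measurable N"
  shows "(\<lambda>p. W (f p) (g p) x y) \<in> borel_measurable N"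
  using measurable_compose[of "\<lambda>p. (f p, g p)" N "M \<Otimes>\<^sub>M borel", OF _ W_joint] assms by simp

lemma measurable_total_rate_W [measurable (raw)]:
  assumes "f \<in> N \<rightarrow>\<^sub>M M" "g \<in> borel_measurable N"
  shows "(\<lambda>p. total_rate (W (f p)) (g p) x) \<in> borel_measurable N"
  unfolding total_rate_def using assms by measurable

lemma measurable_kern_W [measurable (raw)]:
  assumes "f \<in> N \<rightarrow>\<^sub>M M" "g \<in> borel_measurable N" "h \<in> borel_measurable N"
  shows "(\<lambda>p. kern (W (f p)) (g p) (h p) x y) \<in> borel_measurable N"
  using measurable_compose[of "\<lambda>p. (f p, (g p, h p))" N "M \<Otimes>\<^sub>M (borel \<Otimes>\<^sub>M borel)", OF _ measurable_kern_joint[of W M, OF W_joint]] assms by simp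

definition p :: "'w \<Rightarrow> real \<Rightarrow> real \<Rightarrow> 'd site \<Rightarrow> 'd site \<Rightarrow> real" where
  "p \<omega> s t x y = enn2real (kern (W \<omega>) s t x y)"

lemma measurable_p [measurable (raw)]:
  assumes "f \<in> N \<rightarrow>\<^sub>M M" "g \<in> borel_measurable N" "h \<in> borel_measurable N"
  shows "(\<lambda>q. p (f q) (g q) (h q) x y) \<in> borel_measurable N"
  unfolding p_def using assms by measurable

lemma p_nonneg: "0 \<le> p \<omega> s t x y" by (simp add: p_def)

lemma W_nonneg: "\<omega> \<in> space M \<Longrightarrow> 0 \<le> W \<omega> t x y"
  using W_Env[of \<omega>] unfolding Env_def by (smt (verit) mem_Collect_eq)

lemma expectation_shift:
  assumes "(\<lambda>\<omega>. F (W \<omega>)) \<in> borel_measurable M"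
  shows "(\<integral>\<^sup>+\<omega>. F (W \<omega>) \<partial>M) = (\<integral>\<^sup>+\<omega>. F (env_shift r z (W \<omega>)) \<partial>M)"
proof -
  have "(\<integral>\<^sup>+\<omega>. F (W \<omega>) \<partial>M) = (\<integral>\<^sup>+\<omega>. F (W \<omega>) \<partial>distr M M (\<theta> r z))" by (simp add: \<theta>_distr)
  also have "\<dots> = (\<integral>\<^sup>+\<omega>. F (W (\<theta> r z \<omega>)) \<partial>M)" by (rule nn_integral_distr[OF \<theta>_meas]) (use assms in simp)
  also have "\<dots> = (\<integral>\<^sup>+\<omega>. F (env_shift r z (W \<omega>)) \<partial>M)" by (rule nn_integral_cong) (simp add: W_\<theta>)
  finally show ?thesis .
qed

definition mean_rate :: ennreal where
  "mean_rate = (\<integral>\<^sup>+\<omega>. ennreal (total_rate (W \<omega>) 0 0) \<partial>M)"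

lemma mean_rate_eq: "(\<integral>\<^sup>+\<omega>. ennreal (total_rate (W \<omega>) t x) \<partial>M) = mean_rate"
  unfolding mean_rate_def
  using expectation_shift[of "\<lambda>a. ennreal (total_rate a 0 0)" t x] by (simp add: total_rate_env_shift)

lemma mean_rate_finite: "mean_rate < \<infinity>"
proof -
  have "mean_rate = (\<Sum>y | nbr 0 y. \<integral>\<^sup>+\<omega>. ennreal (W \<omega> 0 0 y) \<partial>M)"
    unfolding mean_rate_def total_rate_def
    by (subst nn_integral_sum[symmetric]) (auto intro!: nn_integral_cong simp: sum_ennreal W_nonneg)
  also have "\<dots> < \<infinity>" by (subst infinity_ennreal_def, subst ennreal_sum_less_top) (use W_int finite_nbr[of 0] in auto)
  finally show ?thesis .
qed

lemma pair_sigma_finite_lborel: "pair_sigma_finite M (lborel :: real measure)"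
  by (simp add: pair_sigma_finite_def sigma_finite_measure_axioms lborel.sigma_finite_measure_axioms)

lemma Fubini_lborel:
  assumes "(\<lambda>(\<omega>, u). f \<omega> u) \<in> borel_measurable (M \<Otimes>\<^sub>M (lborel :: real measure))"
  shows "(\<integral>\<^sup>+\<omega>. (\<integral>\<^sup>+u. f \<omega> u \<partial>lborel) \<partial>M) = (\<integral>\<^sup>+u. (\<integral>\<^sup>+\<omega>. f \<omega> u \<partial>M) \<partial>lborel)"
proof -
  interpret pair_sigma_finite M "lborel :: real measure" by (rule pair_sigma_finite_lborel)
  show ?thesis using Fubini'[OF assms] by simp
qed

lemma AE_elliptic: "AE \<omega> in M. AE u in lborel. \<forall>y z. nbr y z \<longrightarrow> c0 \<le> W \<omega> u y z"
proof -
  interpret pair_sigma_finite M "lborel :: real measure" by (rule pair_sigma_finite_lborel)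
  have "(AE \<omega> in M. AE u in lborel. \<forall>y z. nbr y z \<longrightarrow> c0 \<le> W \<omega> u y z) \<longleftrightarrow> (AE u in lborel. AE \<omega> in M. \<forall>y z. nbr y z \<longrightarrow> c0 \<le> W \<omega> u y z)"
    by (rule AE_commute) measurable
  moreover have "AE \<omega> in M. nbr y z \<longrightarrow> c0 \<le> W \<omega> u y z" for u y z
    using W_ell[of y z u] by (cases "nbr y z") auto
  ultimately show ?thesis by (simp add: AE_all_countable)
qed

lemma AE_locally_integrable: "AE \<omega> in M. \<forall>x N. (\<integral>\<^sup>+u. indicator {- real N..real N} u * ennreal (total_rate (W \<omega>) u x) \<partial>lborel) < \<infinity>"
proof -
  have "AE \<omega> in M. (\<integral>\<^sup>+u. indicator {- real N..real N} u * ennreal (total_rate (W \<omega>) u x) \<partial>lborel) \<noteq> \<infinity>" for x N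
  proof (rule nn_integral_PInf_AE)
    show "(\<lambda>\<omega>. \<integral>\<^sup>+u. indicator {- real N..real N} u * ennreal (total_rate (W \<omega>) u x) \<partial>lborel) \<in> borel_measurable M"
      by (rule lborel.borel_measurable_nn_integral) measurable
    have "(\<integral>\<^sup>+\<omega>. (\<integral>\<^sup>+u. indicator {- real N..real N} u * ennreal (total_rate (W \<omega>) u x) \<partial>lborel) \<partial>M)
      = (\<integral>\<^sup>+u. (\<integral>\<^sup>+\<omega>. indicator {- real N..real N} u * ennreal (total_rate (W \<omega>) u x) \<partial>M) \<partial>lborel)"
      by (rule Fubini_lborel) measurable
    also have "\<dots> = (\<integral>\<^sup>+u. indicator {- real N..real N} u * mean_rate \<partial>lborel)"
      by (intro nn_integral_cong) (simp add: nn_integral_cmult mean_rate_eq)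
    also have "\<dots> = mean_rate * ennreal (real N - - real N)" by (rule nn_integral_Icc_const) simp
    also have "\<dots> < \<infinity>" using mean_rate_finite by (simp add: ennreal_mult_less_top)
    finally show "(\<integral>\<^sup>+\<omega>. (\<integral>\<^sup>+u. indicator {- real N..real N} u * ennreal (total_rate (W \<omega>) u x) \<partial>lborel) \<partial>M) \<noteq> \<infinity>" by simp
  qed
  then show ?thesis by (simp add: AE_all_countable less_top)
qed

lemma total_rate_env_rev: "total_rate (env_rev a) t x = total_rate a (- t) x"
  by (simp add: total_rate_def env_rev_def)

definition good :: "'w \<Rightarrow> bool" where
  "good \<omega> \<longleftrightarrow> regular_rates (W \<omega>) \<and> regular_rates (env_rev (W \<omega>)) \<and> (\<forall>t x y. W \<omega> t x y = W \<omega> t y x)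
    \<and> (AE u in lborel. \<forall>y z. nbr y z \<longrightarrow> c0 \<le> W \<omega> u y z)"

lemma AE_good: "AE \<omega> in M. good \<omega>"
  using AE_elliptic AE_locally_integrable W_sym AE_space
proof eventually_elim
  fix \<omega> assume ell: "AE u in lborel. \<forall>y z. nbr y z \<longrightarrow> c0 \<le> W \<omega> u y z"
    and loc: "\<forall>x N. (\<integral>\<^sup>+u. indicator {- real N..real N} u * ennreal (total_rate (W \<omega>) u x) \<partial>lborel) < \<infinity>"
    and sym: "\<forall>t x y. W \<omega> t x y = W \<omega> t y x" and \<omega>: "\<omega> \<in> space M"
  have m[measurable]: "(\<lambda>t. W \<omega> t x y) \<in> borel_measurable borel" for x y using \<omega> by measurable
  have [measurable]: "(\<lambda>t. total_rate (W \<omega>) t x) \<in> borel_measurable borel" for x unfolding total_rate_def by measurable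
  have "regular_env (W \<omega>)"
    by (rule regular_envI[OF W_Env[OF \<omega>] m _ c0 ell]) (use loc in blast)
  moreover have "regular_env (env_rev (W \<omega>))"
  proof (rule regular_envI[OF _ _ _ c0])
    show "env_rev (W \<omega>) \<in> Env" using W_Env[OF \<omega>] by (simp add: Env_def env_rev_def)
    show "(\<lambda>t. env_rev (W \<omega>) t x y) \<in> borel_measurable borel" for x y unfolding env_rev_def by measurable
    show "(\<integral>\<^sup>+u. indicator {- real N..real N} u * ennreal (total_rate (env_rev (W \<omega>)) u x) \<partial>lborel) < \<infinity>" for x and N :: nat
    proof -
      have "(\<integral>\<^sup>+u. indicator {- real N..real N} u * ennreal (total_rate (W \<omega>) u x) \<partial>lborel)
        = (\<integral>\<^sup>+u. indicator {- real N..real N} (0 + (-1) * u) * ennreal (total_rate (W \<omega>) (0 + (-1) * u) x) \<partial>lborel)"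
        by (subst nn_integral_real_affine[where c="-1" and t=0]) auto
      also have "\<dots> = (\<integral>\<^sup>+u. indicator {- real N..real N} u * ennreal (total_rate (env_rev (W \<omega>)) u x) \<partial>lborel)"
        by (rule nn_integral_cong) (auto simp: total_rate_env_rev split: split_indicator)
      finally have eq: "(\<integral>\<^sup>+u. indicator {- real N..real N} u * ennreal (total_rate (W \<omega>) u x) \<partial>lborel)
        = (\<integral>\<^sup>+u. indicator {- real N..real N} u * ennreal (total_rate (env_rev (W \<omega>)) u x) \<partial>lborel)" .
      show ?thesis using loc unfolding eq[symmetric] by blast
    qed
    have "AE u in distr lborel borel uminus. \<forall>y z. nbr y z \<longrightarrow> c0 \<le> W \<omega> u y z"
      unfolding lborel_distr_uminus by (rule ell)
    then have "AE u in lborel. \<forall>y z. nbr y z \<longrightarrow> c0 \<le> W \<omega> (- u) y z"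
      by (subst (asm) AE_distr_iff) auto
    then show "AE u in lborel. \<forall>y z. nbr y z \<longrightarrow> c0 \<le> env_rev (W \<omega>) u y z" by (simp add: env_rev_def)
  qed
  moreover have "env_rev (W \<omega>) \<in> Env" using W_Env[OF \<omega>] by (simp add: Env_def env_rev_def)
  ultimately show "good \<omega>" unfolding good_def using W_Env[OF \<omega>] sym ell by (simp add: regular_rates_def)
qed

lemma goodD:
  assumes "good \<omega>"
  shows "regular_rates (W \<omega>)" "regular_rates (env_rev (W \<omega>))" "W \<omega> t x y = W \<omega> t y x"
    "AE u in lborel. \<forall>y z. nbr y z \<longrightarrow> c0 \<le> W \<omega> u y z"
  using assms by (auto simp: good_def)

lemma ennreal_p: "good \<omega> \<Longrightarrow> ennreal (p \<omega> s t x y) = kern (W \<omega>) s t x y"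
  unfolding p_def using regular_rates.kern_le_1[OF goodD(1), of \<omega> s t x y]
  by (intro ennreal_enn2real) (auto simp: less_top[symmetric] top_unique)

lemma p_row: "good \<omega> \<Longrightarrow> s \<le> t \<Longrightarrow> (\<Sigma>\<^sup>+y. ennreal (p \<omega> s t x y)) \<le> 1"
  by (simp add: ennreal_p regular_rates.kern_row_le_1[OF goodD(1)])

lemma p_column:
  assumes "good \<omega>" "s \<le> t" shows "(\<Sigma>\<^sup>+x. ennreal (p \<omega> s t x y)) \<le> 1"
proof -
  have "kern (W \<omega>) s t x y = kern (env_rev (W \<omega>)) (- t) (- s) y x" for x
    by (rule regular_rates.kern_env_rev[symmetric]) (use goodD[OF assms(1)] in auto)
  then have "(\<Sigma>\<^sup>+x. ennreal (p \<omega> s t x y)) = (\<Sigma>\<^sup>+x. kern (env_rev (W \<omega>)) (- t) (- s) y x)"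
    by (simp add: ennreal_p[OF assms(1)])
  also have "\<dots> \<le> 1" by (rule regular_rates.kern_row_le_1[OF goodD(2)[OF assms(1)]]) (use assms in simp)
  finally show ?thesis .
qed

lemma p_Chapman_Kolmogorov:
  assumes "good \<omega>" "s \<le> u" "u \<le> t"
  shows "ennreal (p \<omega> s t x y) = (\<Sigma>\<^sup>+z. ennreal (p \<omega> s u x z * p \<omega> u t z y))"
  using regular_rates.kern_Chapman_Kolmogorov[OF goodD(1)[OF assms(1)] assms(2,3), of x y]
  by (simp add: ennreal_p[OF assms(1), symmetric] ennreal_mult p_nonneg)

lemma p_shift: "good \<omega> \<Longrightarrow> enn2real (kern (env_shift r z (W \<omega>)) s t x y) = p \<omega> (s + r) (t + r) (x + z) (y + z)"
  unfolding p_def by (simp add: regular_rates.kern_env_shift[OF goodD(1)])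

text \<open>
  Moving the end point \<open>y\<close> to the origin by stationarity turns the sum over end points into a sum over
  starting points, and the sum of the kernel over all starting points is at most one.
\<close>

lemma mean_activity:
  assumes "s \<le> t"
  shows "(\<integral>\<^sup>+\<omega>. (\<Sigma>\<^sup>+y. ennreal (total_rate (W \<omega>) t y) * kern (W \<omega>) s t x y) \<partial>M) \<le> mean_rate"
proof -
  have "(\<integral>\<^sup>+\<omega>. ennreal (total_rate (W \<omega>) t y) * kern (W \<omega>) s t x y \<partial>M)
    = (\<integral>\<^sup>+\<omega>. ennreal (total_rate (W \<omega>) t 0) * kern (W \<omega>) s t (x - y) 0 \<partial>M)" for y
  proof -
    have "(\<integral>\<^sup>+\<omega>. ennreal (total_rate (W \<omega>) t 0) * kern (W \<omega>) s t (x - y) 0 \<partial>M)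
      = (\<integral>\<^sup>+\<omega>. ennreal (total_rate (env_shift 0 y (W \<omega>)) t 0) * kern (env_shift 0 y (W \<omega>)) s t (x - y) 0 \<partial>M)"
      by (rule expectation_shift) measurable
    also have "\<dots> = (\<integral>\<^sup>+\<omega>. ennreal (total_rate (W \<omega>) t y) * kern (W \<omega>) s t x y \<partial>M)"
      by (rule nn_integral_cong_AE, use AE_good in eventually_elim)
        (simp add: total_rate_env_shift regular_rates.kern_env_shift[OF goodD(1)])
    finally show ?thesis by simp
  qed
  then have "(\<integral>\<^sup>+\<omega>. (\<Sigma>\<^sup>+y. ennreal (total_rate (W \<omega>) t y) * kern (W \<omega>) s t x y) \<partial>M)
    = (\<Sigma>\<^sup>+y. \<integral>\<^sup>+\<omega>. ennreal (total_rate (W \<omega>) t 0) * kern (W \<omega>) s t (x - y) 0 \<partial>M)"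
  proof -
    assume eq: "\<And>y. (\<integral>\<^sup>+\<omega>. ennreal (total_rate (W \<omega>) t y) * kern (W \<omega>) s t x y \<partial>M) = (\<integral>\<^sup>+\<omega>. ennreal (total_rate (W \<omega>) t 0) * kern (W \<omega>) s t (x - y) 0 \<partial>M)"
    have "(\<integral>\<^sup>+\<omega>. (\<Sigma>\<^sup>+y. ennreal (total_rate (W \<omega>) t y) * kern (W \<omega>) s t x y) \<partial>M) = (\<Sigma>\<^sup>+y. \<integral>\<^sup>+\<omega>. ennreal (total_rate (W \<omega>) t y) * kern (W \<omega>) s t x y \<partial>M)"
      by (rule nn_integral_esum) measurable
    then show ?thesis by (simp only: eq)
  qed
  also have "\<dots> = (\<integral>\<^sup>+\<omega>. (\<Sigma>\<^sup>+y. ennreal (total_rate (W \<omega>) t 0) * kern (W \<omega>) s t (x - y) 0) \<partial>M)"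
    by (rule nn_integral_esum[symmetric]) measurable
  also have "\<dots> \<le> (\<integral>\<^sup>+\<omega>. ennreal (total_rate (W \<omega>) t 0) \<partial>M)"
  proof (rule nn_integral_mono_AE, use AE_good in eventually_elim)
    fix \<omega> assume g: "good \<omega>"
    have "(\<Sigma>\<^sup>+y. kern (W \<omega>) s t (x - y) 0) = (\<Sigma>\<^sup>+y. kern (W \<omega>) s t y 0)" by (rule esum_shift(4)[of "\<lambda>y. kern (W \<omega>) s t y 0"])
    also have "\<dots> \<le> 1" using p_column[OF g assms, of 0] by (simp add: ennreal_p[OF g])
    finally show "(\<Sigma>\<^sup>+y. ennreal (total_rate (W \<omega>) t 0) * kern (W \<omega>) s t (x - y) 0) \<le> ennreal (total_rate (W \<omega>) t 0)"
      unfolding esum_cmult using mult_left_mono[of _ 1 "ennreal (total_rate (W \<omega>) t 0)"] by simp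
  qed
  finally show ?thesis by (simp add: mean_rate_eq)
qed

lemma mean_activity_integral:
  assumes "s \<le> T"
  shows "(\<integral>\<^sup>+\<omega>. (\<integral>\<^sup>+u. indicator {s..T} u * (\<Sigma>\<^sup>+y. ennreal (total_rate (W \<omega>) u y) * kern (W \<omega>) s u x y) \<partial>lborel) \<partial>M)
    \<le> mean_rate * ennreal (T - s)"
proof -
  have "(\<integral>\<^sup>+\<omega>. (\<integral>\<^sup>+u. indicator {s..T} u * (\<Sigma>\<^sup>+y. ennreal (total_rate (W \<omega>) u y) * kern (W \<omega>) s u x y) \<partial>lborel) \<partial>M)
    = (\<integral>\<^sup>+u. (\<integral>\<^sup>+\<omega>. indicator {s..T} u * (\<Sigma>\<^sup>+y. ennreal (total_rate (W \<omega>) u y) * kern (W \<omega>) s u x y) \<partial>M) \<partial>lborel)"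
    by (rule Fubini_lborel) measurable
  also have "\<dots> \<le> (\<integral>\<^sup>+u. indicator {s..T} u * mean_rate \<partial>lborel)"
  proof (rule nn_integral_mono)
    fix u
    have "(\<integral>\<^sup>+\<omega>. indicator {s..T} u * (\<Sigma>\<^sup>+y. ennreal (total_rate (W \<omega>) u y) * kern (W \<omega>) s u x y) \<partial>M)
      = indicator {s..T} u * (\<integral>\<^sup>+\<omega>. (\<Sigma>\<^sup>+y. ennreal (total_rate (W \<omega>) u y) * kern (W \<omega>) s u x y) \<partial>M)"
      by (rule nn_integral_cmult) measurable
    also have "\<dots> \<le> indicator {s..T} u * mean_rate"
      using mean_activity[of s u x] by (cases "u \<in> {s..T}") auto
    finally show "(\<integral>\<^sup>+\<omega>. indicator {s..T} u * (\<Sigma>\<^sup>+y. ennreal (total_rate (W \<omega>) u y) * kern (W \<omega>) s u x y) \<partial>M) \<le> indicator {s..T} u * mean_rate" .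
  qed
  also have "\<dots> = mean_rate * ennreal (T - s)" by (rule nn_integral_Icc_const[OF assms])
  finally show ?thesis .
qed

text \<open>
  By the preceding bounds the expected number of jumps up to a given time is integrable over the
  environments.
\<close>

lemma AE_elliptic_walk: "AE \<omega> in M. good \<omega> \<and> elliptic_walk (W \<omega>) s x c0"
proof -
  let ?A = "\<lambda>\<omega> T. \<integral>\<^sup>+u. indicator {s..T} u * (\<Sigma>\<^sup>+y. ennreal (total_rate (W \<omega>) u y) * kern (W \<omega>) s u x y) \<partial>lborel"
  have "AE \<omega> in M. ?A \<omega> (s + real N) \<noteq> \<infinity>" for N :: nat
  proof (rule nn_integral_PInf_AE)
    show "(\<lambda>\<omega>. ?A \<omega> (s + real N)) \<in> borel_measurable M"
      by (rule lborel.borel_measurable_nn_integral) measurable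
    have "(\<integral>\<^sup>+\<omega>. ?A \<omega> (s + real N) \<partial>M) \<le> mean_rate * ennreal (s + real N - s)"
      by (rule mean_activity_integral) simp
    also have "\<dots> < \<infinity>" using mean_rate_finite by (simp add: ennreal_mult_less_top)
    finally show "(\<integral>\<^sup>+\<omega>. ?A \<omega> (s + real N) \<partial>M) \<noteq> \<infinity>" by simp
  qed
  then have "AE \<omega> in M. \<forall>N. ?A \<omega> (s + real N) \<noteq> \<infinity>" by (simp add: AE_all_countable)
  with AE_good show ?thesis
  proof eventually_elim
    fix \<omega> assume g: "good \<omega>" and A: "\<forall>N. ?A \<omega> (s + real N) \<noteq> \<infinity>"
    have "?A \<omega> T < \<infinity>" for T
    proof -
      obtain N :: nat where N: "T - s \<le> real N" using real_arch_simple by blast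
      have "?A \<omega> T \<le> ?A \<omega> (s + real N)"
        by (rule nn_integral_mono) (use N in \<open>auto split: split_indicator\<close>)
      also have "\<dots> < \<infinity>" using A by (simp add: less_top)
      finally show ?thesis .
    qed
    then have "active_walk (W \<omega>) s x"
      using goodD[OF g] by (simp add: active_walk_def active_walk_axioms_def)
    then show "good \<omega> \<and> elliptic_walk (W \<omega>) s x c0"
      using g goodD(4)[OF g] c0 by (simp add: elliptic_walk_def elliptic_walk_axioms_def)
  qed
qed

lemma walk_q: "elliptic_walk (W \<omega>) s x c0 \<Longrightarrow> active_walk.q (W \<omega>) s x t y = p \<omega> s t x y"
  by (simp add: active_walk.q_def[OF elliptic_walk.axioms(1)] p_def)


section \<open>Annealed gradient sums\<close>

definition grad_sum :: "(real \<Rightarrow> real) \<Rightarrow> 'd site \<Rightarrow> real \<Rightarrow> ennreal" where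
  "grad_sum f e t = (\<integral>\<^sup>+\<omega>. (\<Sigma>\<^sup>+y. ennreal (f (p \<omega> 0 t 0 (y + e) - p \<omega> 0 t 0 y))) \<partial>M)"

text \<open>
  By stationarity only the difference between end point and starting point matters, so that summing
  over either of them gives the same result.
\<close>

lemma grad_sum_shift:
  assumes [measurable]: "f \<in> borel_measurable borel"
  shows "(\<Sigma>\<^sup>+y. \<integral>\<^sup>+\<omega>. ennreal (f (p \<omega> s (s + t) x (y + e) - p \<omega> s (s + t) x y)) \<partial>M) = grad_sum f e t" (is ?A)
    and "(\<Sigma>\<^sup>+x. \<integral>\<^sup>+\<omega>. ennreal (f (p \<omega> s (s + t) x (y + e) - p \<omega> s (s + t) x y)) \<partial>M) = grad_sum f e t" (is ?B)
proof -
  have *: "(\<integral>\<^sup>+\<omega>. ennreal (f (p \<omega> s (s + t) x (y + e) - p \<omega> s (s + t) x y)) \<partial>M)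
    = (\<integral>\<^sup>+\<omega>. ennreal (f (p \<omega> 0 t 0 ((y - x) + e) - p \<omega> 0 t 0 (y - x))) \<partial>M)" for x y
  proof -
    let ?F = "\<lambda>a. ennreal (f (enn2real (kern a 0 t 0 ((y - x) + e)) - enn2real (kern a 0 t 0 (y - x))))"
    have "(\<integral>\<^sup>+\<omega>. ?F (W \<omega>) \<partial>M) = (\<integral>\<^sup>+\<omega>. ?F (env_shift s x (W \<omega>)) \<partial>M)"
      by (rule expectation_shift) measurable
    also have "\<dots> = (\<integral>\<^sup>+\<omega>. ennreal (f (p \<omega> s (s + t) x (y + e) - p \<omega> s (s + t) x y)) \<partial>M)"
      by (rule nn_integral_cong_AE, use AE_good in eventually_elim) (simp add: p_shift algebra_simps)
    finally show ?thesis by (simp add: p_def)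
  qed
  have g: "grad_sum f e t = (\<Sigma>\<^sup>+y. \<integral>\<^sup>+\<omega>. ennreal (f (p \<omega> 0 t 0 (y + e) - p \<omega> 0 t 0 y)) \<partial>M)"
    unfolding grad_sum_def by (rule nn_integral_esum) measurable
  show ?A unfolding * g
    by (rule esum_shift(3)[of "\<lambda>y. \<integral>\<^sup>+\<omega>. ennreal (f (p \<omega> 0 t 0 (y + e) - p \<omega> 0 t 0 y)) \<partial>M"])
  show ?B unfolding * g
    by (rule esum_shift(4)[of "\<lambda>y. \<integral>\<^sup>+\<omega>. ennreal (f (p \<omega> 0 t 0 (y + e) - p \<omega> 0 t 0 y)) \<partial>M"])
qed

text \<open>
  Monotonicity in time: by the Chapman-Kolmogorov equation the kernel at time \<open>t\<close> is an average of
  kernels run for the shorter time \<open>u\<close>, so a functional with the Jensen property below cannot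
  increase; stationarity and the column sums remove the dependence between the two factors.
\<close>

lemma grad_sum_mono:
  assumes f[measurable]: "f \<in> borel_measurable borel" and f0: "\<And>d. 0 \<le> f d"
    and jensen: "\<And>A B (k :: 'd site \<Rightarrow> real) \<alpha> \<beta>. 0 \<le> A \<Longrightarrow> 0 \<le> B \<Longrightarrow> (\<And>z. 0 \<le> k z) \<Longrightarrow> (\<And>z. 0 \<le> \<alpha> z) \<Longrightarrow> (\<And>z. 0 \<le> \<beta> z)
      \<Longrightarrow> (\<Sigma>\<^sup>+z. ennreal (k z)) \<le> 1 \<Longrightarrow> ennreal A = (\<Sigma>\<^sup>+z. ennreal (k z * \<alpha> z)) \<Longrightarrow> ennreal B = (\<Sigma>\<^sup>+z. ennreal (k z * \<beta> z))
      \<Longrightarrow> ennreal (f (A - B)) \<le> (\<Sigma>\<^sup>+z. ennreal (k z) * ennreal (f (\<alpha> z - \<beta> z)))"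
    and ut: "0 \<le> u" "u \<le> t"
  shows "grad_sum f e t \<le> grad_sum f e u"
proof -
  define v where "v = t - u"
  have v: "0 \<le> v" "v \<le> t" "v + u = t" using ut by (auto simp: v_def)
  let ?D = "\<lambda>\<omega> z y. ennreal (f (p \<omega> v t z (y + e) - p \<omega> v t z y))"
  have "grad_sum f e t \<le> (\<integral>\<^sup>+\<omega>. (\<Sigma>\<^sup>+y. \<Sigma>\<^sup>+z. ennreal (p \<omega> 0 v 0 z) * ?D \<omega> z y) \<partial>M)"
    unfolding grad_sum_def
  proof (rule nn_integral_mono_AE, use AE_good in eventually_elim, rule nn_integral_mono)
    fix \<omega> y assume g: "good \<omega>"
    show "ennreal (f (p \<omega> 0 t 0 (y + e) - p \<omega> 0 t 0 y)) \<le> (\<Sigma>\<^sup>+z. ennreal (p \<omega> 0 v 0 z) * ?D \<omega> z y)"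
      by (rule jensen) (use p_nonneg p_row[OF g v(1)] p_Chapman_Kolmogorov[OF g v(1,2)] in auto)
  qed
  also have "\<dots> = (\<Sigma>\<^sup>+y. \<Sigma>\<^sup>+z. \<integral>\<^sup>+\<omega>. ennreal (p \<omega> 0 v 0 z) * ?D \<omega> z y \<partial>M)"
    by (subst nn_integral_esum, measurable, subst nn_integral_esum, measurable)
  also have "\<dots> = (\<Sigma>\<^sup>+z. \<Sigma>\<^sup>+y. \<integral>\<^sup>+\<omega>. ennreal (p \<omega> 0 v 0 z) * ?D \<omega> z y \<partial>M)" by (rule esum_commute)
  also have "\<dots> = (\<Sigma>\<^sup>+z. \<Sigma>\<^sup>+y. \<integral>\<^sup>+\<omega>. ennreal (p \<omega> 0 v (- z) 0) * ?D \<omega> 0 y \<partial>M)"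
  proof (rule nn_integral_cong)
    fix z :: "'d site"
    have "(\<integral>\<^sup>+\<omega>. ennreal (p \<omega> 0 v 0 z) * ?D \<omega> z y \<partial>M) = (\<integral>\<^sup>+\<omega>. ennreal (p \<omega> 0 v (- z) 0) * ?D \<omega> 0 (y - z) \<partial>M)" for y
    proof -
      let ?F = "\<lambda>a. ennreal (enn2real (kern a 0 v (- z) 0)) * ennreal (f (enn2real (kern a v t 0 ((y - z) + e)) - enn2real (kern a v t 0 (y - z))))"
      have "(\<integral>\<^sup>+\<omega>. ?F (W \<omega>) \<partial>M) = (\<integral>\<^sup>+\<omega>. ?F (env_shift 0 z (W \<omega>)) \<partial>M)"
        by (rule expectation_shift) measurable
      also have "\<dots> = (\<integral>\<^sup>+\<omega>. ennreal (p \<omega> 0 v 0 z) * ?D \<omega> z y \<partial>M)"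
        by (rule nn_integral_cong_AE, use AE_good in eventually_elim) (simp add: p_shift algebra_simps)
      finally show ?thesis by (simp add: p_def)
    qed
    then show "(\<Sigma>\<^sup>+y. \<integral>\<^sup>+\<omega>. ennreal (p \<omega> 0 v 0 z) * ?D \<omega> z y \<partial>M) = (\<Sigma>\<^sup>+y. \<integral>\<^sup>+\<omega>. ennreal (p \<omega> 0 v (- z) 0) * ?D \<omega> 0 y \<partial>M)"
      using esum_shift(3)[of "\<lambda>y. \<integral>\<^sup>+\<omega>. ennreal (p \<omega> 0 v (- z) 0) * ?D \<omega> 0 y \<partial>M" z] by simp
  qed
  also have "\<dots> = (\<Sigma>\<^sup>+y. \<integral>\<^sup>+\<omega>. (\<Sigma>\<^sup>+z. ennreal (p \<omega> 0 v (- z) 0)) * ?D \<omega> 0 y \<partial>M)"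
    by (subst esum_commute, subst nn_integral_esum[symmetric], measurable, simp only: esum_cmult)
  also have "\<dots> \<le> (\<Sigma>\<^sup>+y. \<integral>\<^sup>+\<omega>. ?D \<omega> 0 y \<partial>M)"
  proof (rule nn_integral_mono, rule nn_integral_mono_AE, use AE_good in eventually_elim)
    fix \<omega> y assume g: "good \<omega>"
    have "(\<Sigma>\<^sup>+z. ennreal (p \<omega> 0 v (- z) 0)) = (\<Sigma>\<^sup>+z. ennreal (p \<omega> 0 v z 0))" by (rule esum_shift(5)[of "\<lambda>z. ennreal (p \<omega> 0 v z 0)"])
    also have "\<dots> \<le> 1" by (rule p_column[OF g v(1)])
    finally show "(\<Sigma>\<^sup>+z. ennreal (p \<omega> 0 v (- z) 0)) * ?D \<omega> 0 y \<le> ?D \<omega> 0 y"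
      using mult_right_mono[of _ 1 "?D \<omega> 0 y"] by simp
  qed
  also have "\<dots> = grad_sum f e u" using grad_sum_shift(1)[OF f, of v u 0 e] v by simp
  finally show ?thesis .
qed

lemma abs_jensen:
  fixes k \<alpha> \<beta> :: "'a \<Rightarrow> real"
  assumes "0 \<le> A" "0 \<le> B" "\<And>z. 0 \<le> k z" "\<And>z. 0 \<le> \<alpha> z" "\<And>z. 0 \<le> \<beta> z"
    and "ennreal A = (\<Sigma>\<^sup>+z. ennreal (k z * \<alpha> z))" "ennreal B = (\<Sigma>\<^sup>+z. ennreal (k z * \<beta> z))"
  shows "ennreal \<bar>A - B\<bar> \<le> (\<Sigma>\<^sup>+z. ennreal (k z) * ennreal \<bar>\<alpha> z - \<beta> z\<bar>)"
proof -
  have "ennreal \<bar>A - B\<bar> \<le> (\<Sigma>\<^sup>+z. ennreal \<bar>k z * \<alpha> z - k z * \<beta> z\<bar>)"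
    by (rule esum_abs_diff_le) (use assms in auto)
  also have "\<dots> = (\<Sigma>\<^sup>+z. ennreal (k z) * ennreal \<bar>\<alpha> z - \<beta> z\<bar>)"
    using assms by (intro nn_integral_cong) (simp add: ennreal_mult[symmetric] abs_mult right_diff_distrib[symmetric])
  finally show ?thesis .
qed

lemma square_jensen:
  fixes k \<alpha> \<beta> :: "'a \<Rightarrow> real"
  assumes nn: "0 \<le> A" "0 \<le> B" "\<And>z. 0 \<le> k z" "\<And>z. 0 \<le> \<alpha> z" "\<And>z. 0 \<le> \<beta> z"
    and mass: "(\<Sigma>\<^sup>+z. ennreal (k z)) \<le> 1"
    and AB: "ennreal A = (\<Sigma>\<^sup>+z. ennreal (k z * \<alpha> z))" "ennreal B = (\<Sigma>\<^sup>+z. ennreal (k z * \<beta> z))"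
  shows "ennreal ((A - B)\<^sup>2) \<le> (\<Sigma>\<^sup>+z. ennreal (k z) * ennreal ((\<alpha> z - \<beta> z)\<^sup>2))" (is "_ \<le> ?S")
proof (cases "A = B \<or> ?S = \<infinity>")
  case False
  define l where "l = \<bar>A - B\<bar>"
  have l: "l > 0" using False by (simp add: l_def)
  obtain S where S: "0 \<le> S" "?S = ennreal S" using False by (cases ?S rule: ennreal_cases) auto
  \<comment> \<open>instead of Cauchy-Schwarz: \<open>2 \<bar>x\<bar> \<le> l + x\<^sup>2 / l\<close> with \<open>l\<close> the quantity to be bounded\<close>
  have pt: "ennreal \<bar>x\<bar> \<le> ennreal (l / 2) + ennreal (1 / (2 * l)) * ennreal (x\<^sup>2)" for x
  proof -
    have "0 \<le> (\<bar>x\<bar> - l)\<^sup>2 / (2 * l)" using l by simp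
    also have "\<dots> = l / 2 + 1 / (2 * l) * x\<^sup>2 - \<bar>x\<bar>" using l by (simp add: power2_eq_square field_simps)
    finally have "ennreal \<bar>x\<bar> \<le> ennreal (l / 2 + 1 / (2 * l) * x\<^sup>2)" by (intro ennreal_leI) simp
    also have "\<dots> = ennreal (l / 2) + ennreal (1 / (2 * l) * x\<^sup>2)" using l by (intro ennreal_plus) auto
    also have "ennreal (1 / (2 * l) * x\<^sup>2) = ennreal (1 / (2 * l)) * ennreal (x\<^sup>2)" using l by (intro ennreal_mult) auto
    finally show ?thesis .
  qed
  have "ennreal l \<le> (\<Sigma>\<^sup>+z. ennreal (k z) * ennreal \<bar>\<alpha> z - \<beta> z\<bar>)"
    unfolding l_def by (rule abs_jensen[OF nn AB])
  also have "\<dots> \<le> (\<Sigma>\<^sup>+z. ennreal (k z) * (ennreal (l / 2) + ennreal (1 / (2 * l)) * ennreal ((\<alpha> z - \<beta> z)\<^sup>2)))"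
    by (intro nn_integral_mono mult_left_mono pt) auto
  also have "\<dots> = (\<Sigma>\<^sup>+z. ennreal (k z)) * ennreal (l / 2) + ennreal (1 / (2 * l)) * ?S"
    by (simp add: distrib_left esum_add esum_cmult[symmetric] mult_ac)
  also have "\<dots> \<le> 1 * ennreal (l / 2) + ennreal (1 / (2 * l)) * ennreal S"
    unfolding S(2) by (intro add_right_mono mult_right_mono mass) auto
  also have "\<dots> = ennreal (l / 2 + S / (2 * l))" using l S by (simp add: ennreal_mult[symmetric] ennreal_plus)
  finally have "l \<le> l / 2 + S / (2 * l)" using l S by (subst (asm) ennreal_le_iff) auto
  then have "l\<^sup>2 \<le> S" using l by (simp add: field_simps power2_eq_square)
  then show ?thesis unfolding S(2) l_def by (intro ennreal_leI) simp
qed auto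

lemma square_grad_sum_mono: "0 \<le> u \<Longrightarrow> u \<le> t \<Longrightarrow> grad_sum (\<lambda>d. d\<^sup>2) e t \<le> grad_sum (\<lambda>d. d\<^sup>2) e u"
  by (rule grad_sum_mono) (auto intro: square_jensen)

lemma abs_grad_sum_mono: "0 \<le> u \<Longrightarrow> u \<le> t \<Longrightarrow> grad_sum abs e t \<le> grad_sum abs e u"
  by (rule grad_sum_mono) (auto intro: abs_jensen)

definition C1 :: real where "C1 = decay_const CARD('d) ((real CARD('d))\<^sup>2 / c0)"

lemma C1_pos: "0 < C1"
  unfolding C1_def decay_const_def using c0 by simp

lemma AE_energy_decay:
  assumes "s < t"
  shows "AE \<omega> in M. (\<Sigma>\<^sup>+y. ennreal ((p \<omega> s t x y)\<^sup>2)) \<le> ennreal (C1 * (t - s) powr (- real CARD('d) / 2))"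
  using AE_elliptic_walk[of s x]
proof eventually_elim
  fix \<omega> assume "good \<omega> \<and> elliptic_walk (W \<omega>) s x c0"
  then have ew: "elliptic_walk (W \<omega>) s x c0" by simp
  show "(\<Sigma>\<^sup>+y. ennreal ((p \<omega> s t x y)\<^sup>2)) \<le> ennreal (C1 * (t - s) powr (- real CARD('d) / 2))"
    using elliptic_walk.energy_decay[OF ew assms] unfolding walk_q[OF ew] C1_def .
qed

text \<open>
  By monotonicity the gradient sum at time \<open>t\<close> is at most its average over \<open>[t / 2, t]\<close>. By ellipticity its time
  integral is at most that of the Dirichlet form, and hence at most the energy at time \<open>t / 2\<close>.
\<close>

lemma square_grad_sum_bound:
  assumes e: "nbr 0 e" and t: "0 < t"
  shows "grad_sum (\<lambda>d. d\<^sup>2) e t \<le> ennreal (C1 * (t / 2) powr (- real CARD('d) / 2) * (2 / t) / c0)"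
proof -
  let ?s = "t / 2" let ?B = "C1 * (t / 2) powr (- real CARD('d) / 2)"
  let ?f = "\<lambda>d::real. d\<^sup>2"
  have B: "0 \<le> ?B" using C1_pos by simp
  have "ennreal c0 * (grad_sum ?f e t * ennreal (t - ?s)) = ennreal c0 * (\<integral>\<^sup>+u. indicator {?s..t} u * grad_sum ?f e t \<partial>lborel)"
    using t by (subst nn_integral_Icc_const) auto
  also have "\<dots> \<le> ennreal c0 * (\<integral>\<^sup>+u. indicator {?s..t} u * grad_sum ?f e u \<partial>lborel)"
  proof (rule mult_left_mono, rule nn_integral_mono)
    fix u show "indicator {?s..t} u * grad_sum ?f e t \<le> indicator {?s..t} u * grad_sum ?f e u"
      by (cases "u \<in> {?s..t}") (use t in \<open>auto intro!: square_grad_sum_mono\<close>)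
  qed simp
  also have "(\<integral>\<^sup>+u. indicator {?s..t} u * grad_sum ?f e u \<partial>lborel)
    = (\<integral>\<^sup>+u. (\<integral>\<^sup>+\<omega>. indicator {?s..t} u * (\<Sigma>\<^sup>+y. ennreal (?f (p \<omega> 0 u 0 (y + e) - p \<omega> 0 u 0 y))) \<partial>M) \<partial>lborel)"
    unfolding grad_sum_def by (intro nn_integral_cong nn_integral_cmult[symmetric]) measurable
  also have "\<dots> = (\<integral>\<^sup>+\<omega>. (\<integral>\<^sup>+u. indicator {?s..t} u * (\<Sigma>\<^sup>+y. ennreal (?f (p \<omega> 0 u 0 (y + e) - p \<omega> 0 u 0 y))) \<partial>lborel) \<partial>M)"
    by (rule Fubini_lborel[symmetric]) measurable
  also have "ennreal c0 * \<dots> = (\<integral>\<^sup>+\<omega>. ennreal c0 * (\<integral>\<^sup>+u. indicator {?s..t} u * (\<Sigma>\<^sup>+y. ennreal (?f (p \<omega> 0 u 0 (y + e) - p \<omega> 0 u 0 y))) \<partial>lborel) \<partial>M)"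
    by (rule nn_integral_cmult[symmetric], rule lborel.borel_measurable_nn_integral) measurable
  also have "\<dots> \<le> (\<integral>\<^sup>+\<omega>. ennreal ?B \<partial>M)"
  proof (rule nn_integral_mono_AE, use AE_elliptic_walk[of 0 0] in eventually_elim)
    fix \<omega> assume "good \<omega> \<and> elliptic_walk (W \<omega>) 0 0 c0"
    then interpret ew: elliptic_walk "W \<omega>" 0 0 c0 by simp
    have q: "ew.q u y = p \<omega> 0 u 0 y" for u y by (rule walk_q) unfold_locales
    have "ennreal c0 * (\<integral>\<^sup>+u. indicator {?s..t} u * (\<Sigma>\<^sup>+y. ennreal (?f (p \<omega> 0 u 0 (y + e) - p \<omega> 0 u 0 y))) \<partial>lborel)
      = (\<integral>\<^sup>+u. ennreal c0 * (indicator {?s..t} u * (\<Sigma>\<^sup>+y. ennreal (?f (ew.q u y - ew.q u (y + e))))) \<partial>lborel)"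
      unfolding q[symmetric] power2_commute[of "ew.q _ (_ + e)"] by (rule nn_integral_cmult[symmetric]) measurable
    also have "\<dots> \<le> (\<integral>\<^sup>+u. indicator {?s..t} u * ew.dirichlet u \<partial>lborel)"
    proof (rule nn_integral_mono_AE, use ew.ell in eventually_elim)
      fix u assume u: "\<forall>y z. nbr y z \<longrightarrow> c0 \<le> W \<omega> u y z"
      have "ennreal c0 * (\<Sigma>\<^sup>+y. ennreal (?f (ew.q u y - ew.q u (y + e)))) \<le> ew.dirichlet u"
        by (rule ew.bond_sum_le[OF e, where G="\<lambda>y z. ?f (ew.q u y - ew.q u z)"]) (use u in auto)
      then show "ennreal c0 * (indicator {?s..t} u * (\<Sigma>\<^sup>+y. ennreal (?f (ew.q u y - ew.q u (y + e))))) \<le> indicator {?s..t} u * ew.dirichlet u"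
        by (auto split: split_indicator)
    qed
    also have "\<dots> \<le> (\<Sigma>\<^sup>+y. ennreal ((ew.q ?s y)\<^sup>2))"
    proof -
      have id: "(\<Sigma>\<^sup>+y. ennreal ((ew.q t y)\<^sup>2)) + (\<integral>\<^sup>+u. indicator {?s..t} u * ew.dirichlet u \<partial>lborel) = (\<Sigma>\<^sup>+y. ennreal ((ew.q ?s y)\<^sup>2))"
        by (rule ew.energy_identity) (use t in auto)
      show ?thesis unfolding id[symmetric] by simp
    qed
    also have "\<dots> \<le> ennreal ?B" using ew.energy_decay[of ?s] t by (simp add: C1_def)
    finally show "ennreal c0 * (\<integral>\<^sup>+u. indicator {?s..t} u * (\<Sigma>\<^sup>+y. ennreal (?f (p \<omega> 0 u 0 (y + e) - p \<omega> 0 u 0 y))) \<partial>lborel) \<le> ennreal ?B" .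
  qed
  also have "\<dots> = ennreal ?B" by (simp add: emeasure_space_1)
  finally have *: "ennreal c0 * (grad_sum ?f e t * ennreal (t - ?s)) \<le> ennreal ?B" .
  have "grad_sum ?f e t = ennreal (1 / (c0 * ?s)) * (ennreal c0 * (grad_sum ?f e t * ennreal (t - ?s)))"
  proof -
    have "ennreal (1 / (c0 * ?s)) * (ennreal c0 * ennreal (t - ?s)) = ennreal (1 / (c0 * ?s) * (c0 * ?s))"
      using c0 t by (simp add: ennreal_mult[symmetric])
    also have "\<dots> = 1" using c0 t by simp
    finally have "grad_sum ?f e t = grad_sum ?f e t * (ennreal (1 / (c0 * ?s)) * (ennreal c0 * ennreal (t - ?s)))" by simp
    then show ?thesis by (simp only: mult_ac)
  qed
  also have "\<dots> \<le> ennreal (1 / (c0 * ?s)) * ennreal ?B" by (intro mult_left_mono *) simp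
  also have "\<dots> = ennreal (?B * (2 / t) / c0)" using c0 t B by (simp add: ennreal_mult[symmetric] field_simps)
  finally show ?thesis .
qed

end


section \<open>Nash's entropy argument\<close>

lemma nn_integral_SUP_Suc:
  assumes "\<And>k x. f k x \<le> f (Suc k) x" "\<And>k. f k \<in> borel_measurable M"
  shows "(\<integral>\<^sup>+x. (SUP k::nat. f k x) \<partial>M) = (SUP k. \<integral>\<^sup>+x. f k x \<partial>M)"
  by (rule nn_integral_monotone_convergence_SUP) (use assms in \<open>auto intro!: incseq_SucI le_funI\<close>)

context stationary_rates
begin

definition edge_mass :: "'w \<Rightarrow> real \<Rightarrow> ennreal" where
  "edge_mass \<omega> u = (\<Sigma>\<^sup>+y. \<Sigma>\<^sup>+z. ennreal (W \<omega> u y z * (p \<omega> 0 u 0 y + p \<omega> 0 u 0 z)))"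

definition edge_variation :: "'w \<Rightarrow> real \<Rightarrow> ennreal" where
  "edge_variation \<omega> u = (\<Sigma>\<^sup>+y. \<Sigma>\<^sup>+z. ennreal (W \<omega> u y z * \<bar>p \<omega> 0 u 0 y - p \<omega> 0 u 0 z\<bar>))"

definition fisher_information :: "real \<Rightarrow> 'w \<Rightarrow> real \<Rightarrow> ennreal" where
  "fisher_information \<epsilon> \<omega> u = (\<Sigma>\<^sup>+y. \<Sigma>\<^sup>+z. ennreal (W \<omega> u y z * ((p \<omega> 0 u 0 y - p \<omega> 0 u 0 z)\<^sup>2 / (p \<omega> 0 u 0 y + p \<omega> 0 u 0 z + 2 * \<epsilon>))))"

definition mean_moment :: "real \<Rightarrow> ennreal" where
  "mean_moment t = (\<integral>\<^sup>+\<omega>. (\<Sigma>\<^sup>+y. ennreal (real_of_int (l1_dist 0 y) * p \<omega> 0 t 0 y)) \<partial>M)"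

lemma measurable_edge [measurable (raw)]:
  assumes [measurable]: "f \<in> N \<rightarrow>\<^sub>M M" "g \<in> borel_measurable N"
  shows "(\<lambda>q. edge_mass (f q) (g q)) \<in> borel_measurable N"
    "(\<lambda>q. edge_variation (f q) (g q)) \<in> borel_measurable N"
    "(\<lambda>q. fisher_information \<epsilon> (f q) (g q)) \<in> borel_measurable N"
  unfolding edge_mass_def edge_variation_def fisher_information_def by measurable

definition annealed :: "real \<Rightarrow> real \<Rightarrow> ('w \<Rightarrow> real \<Rightarrow> ennreal) \<Rightarrow> ennreal" where
  "annealed s t f = (\<integral>\<^sup>+\<omega>. (\<integral>\<^sup>+u. indicator {s..t} u * f \<omega> u \<partial>lborel) \<partial>M)"

lemma annealed_linear:
  assumes f[measurable]: "(\<lambda>(\<omega>, u). f \<omega> u) \<in> borel_measurable (M \<Otimes>\<^sub>M lborel)" and g[measurable]: "(\<lambda>(\<omega>, u). g \<omega> u) \<in> borel_measurable (M \<Otimes>\<^sub>M lborel)"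
  shows "annealed s t (\<lambda>\<omega> u. a * f \<omega> u + b * g \<omega> u) = a * annealed s t f + b * annealed s t g"
proof -
  have m: "(\<lambda>u. f \<omega> u) \<in> borel_measurable lborel" "(\<lambda>u. g \<omega> u) \<in> borel_measurable lborel" if "\<omega> \<in> space M" for \<omega>
    using measurable_Pair2[OF f that] measurable_Pair2[OF g that] by auto
  have mi: "(\<lambda>\<omega>. \<integral>\<^sup>+u. indicator {s..t} u * f \<omega> u \<partial>lborel) \<in> borel_measurable M"
      "(\<lambda>\<omega>. \<integral>\<^sup>+u. indicator {s..t} u * g \<omega> u \<partial>lborel) \<in> borel_measurable M"
    by (rule lborel.borel_measurable_nn_integral, measurable)+
  have "annealed s t (\<lambda>\<omega> u. a * f \<omega> u + b * g \<omega> u)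
    = (\<integral>\<^sup>+\<omega>. a * (\<integral>\<^sup>+u. indicator {s..t} u * f \<omega> u \<partial>lborel) + b * (\<integral>\<^sup>+u. indicator {s..t} u * g \<omega> u \<partial>lborel) \<partial>M)"
    unfolding annealed_def
  proof (rule nn_integral_cong)
    fix \<omega> assume \<omega>: "\<omega> \<in> space M"
    note [measurable] = m[OF \<omega>]
    have "(\<integral>\<^sup>+u. indicator {s..t} u * (a * f \<omega> u + b * g \<omega> u) \<partial>lborel) = (\<integral>\<^sup>+u. a * (indicator {s..t} u * f \<omega> u) + b * (indicator {s..t} u * g \<omega> u) \<partial>lborel)"
      by (rule nn_integral_cong) (auto split: split_indicator)
    also have "\<dots> = a * (\<integral>\<^sup>+u. indicator {s..t} u * f \<omega> u \<partial>lborel) + b * (\<integral>\<^sup>+u. indicator {s..t} u * g \<omega> u \<partial>lborel)"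
      by (simp add: nn_integral_add nn_integral_cmult)
    finally show "(\<integral>\<^sup>+u. indicator {s..t} u * (a * f \<omega> u + b * g \<omega> u) \<partial>lborel)
      = a * (\<integral>\<^sup>+u. indicator {s..t} u * f \<omega> u \<partial>lborel) + b * (\<integral>\<^sup>+u. indicator {s..t} u * g \<omega> u \<partial>lborel)" .
  qed
  also have "\<dots> = a * annealed s t f + b * annealed s t g"
    unfolding annealed_def using mi by (simp add: nn_integral_add nn_integral_cmult)
  finally show ?thesis .
qed

lemma annealed_mono:
  assumes "AE \<omega> in M. AE u in lborel. u \<in> {s..t} \<longrightarrow> f \<omega> u \<le> g \<omega> u"
  shows "annealed s t f \<le> annealed s t g"
  unfolding annealed_def
proof (rule nn_integral_mono_AE, use assms in eventually_elim)
  fix \<omega> assume *: "AE u in lborel. u \<in> {s..t} \<longrightarrow> f \<omega> u \<le> g \<omega> u"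
  show "(\<integral>\<^sup>+u. indicator {s..t} u * f \<omega> u \<partial>lborel) \<le> (\<integral>\<^sup>+u. indicator {s..t} u * g \<omega> u \<partial>lborel)"
    by (rule nn_integral_mono_AE, use * in eventually_elim) (auto split: split_indicator)
qed

lemma edge_mass_eq:
  assumes g: "good \<omega>" shows "edge_mass \<omega> u = 2 * (\<Sigma>\<^sup>+y. ennreal (total_rate (W \<omega>) u y) * kern (W \<omega>) 0 u 0 y)"
proof -
  interpret r: regular_rates "W \<omega>" by (rule goodD(1)[OF g])
  have "edge_mass \<omega> u = (\<Sigma>\<^sup>+y. \<Sigma>\<^sup>+z. ennreal (W \<omega> u y z * p \<omega> 0 u 0 y)) + (\<Sigma>\<^sup>+y. \<Sigma>\<^sup>+z. ennreal (W \<omega> u y z * p \<omega> 0 u 0 z))"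
    unfolding edge_mass_def esum_add[symmetric]
    by (intro nn_integral_cong) (simp add: distrib_left r.rate_nonneg p_nonneg)
  also have "(\<Sigma>\<^sup>+y. \<Sigma>\<^sup>+z. ennreal (W \<omega> u y z * p \<omega> 0 u 0 z)) = (\<Sigma>\<^sup>+y. \<Sigma>\<^sup>+z. ennreal (W \<omega> u y z * p \<omega> 0 u 0 y))"
    by (rule esum_swap) (subst goodD(3)[OF g], rule refl)
  also have "(\<Sigma>\<^sup>+y. \<Sigma>\<^sup>+z. ennreal (W \<omega> u y z * p \<omega> 0 u 0 y)) = (\<Sigma>\<^sup>+y. ennreal (total_rate (W \<omega>) u y) * kern (W \<omega>) 0 u 0 y)"
  proof (rule nn_integral_cong)
    fix y
    have "(\<Sigma>\<^sup>+z. ennreal (W \<omega> u y z * p \<omega> 0 u 0 y)) = (\<Sigma>\<^sup>+z. ennreal (W \<omega> u y z)) * ennreal (p \<omega> 0 u 0 y)"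
      unfolding esum_cmult(2)[symmetric] by (intro nn_integral_cong) (simp add: ennreal_mult r.rate_nonneg p_nonneg)
    then show "(\<Sigma>\<^sup>+z. ennreal (W \<omega> u y z * p \<omega> 0 u 0 y)) = ennreal (total_rate (W \<omega>) u y) * kern (W \<omega>) 0 u 0 y"
      by (simp only: r.esum_rate ennreal_p[OF g])
  qed
  finally show ?thesis by (simp add: mult_2)
qed

lemma annealed_edge_mass:
  assumes "0 \<le> s" "s \<le> t"
  shows "annealed s t edge_mass \<le> 2 * mean_rate * ennreal (t - s)"
proof -
  have "annealed s t edge_mass = (\<integral>\<^sup>+u. (\<integral>\<^sup>+\<omega>. indicator {s..t} u * edge_mass \<omega> u \<partial>M) \<partial>lborel)"
    unfolding annealed_def by (rule Fubini_lborel) measurable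
  also have "\<dots> \<le> (\<integral>\<^sup>+u. indicator {s..t} u * (2 * mean_rate) \<partial>lborel)"
  proof (rule nn_integral_mono)
    fix u
    have "(\<integral>\<^sup>+\<omega>. edge_mass \<omega> u \<partial>M) \<le> 2 * mean_rate" if "0 \<le> u"
    proof -
      have "(\<integral>\<^sup>+\<omega>. edge_mass \<omega> u \<partial>M) = (\<integral>\<^sup>+\<omega>. 2 * (\<Sigma>\<^sup>+y. ennreal (total_rate (W \<omega>) u y) * kern (W \<omega>) 0 u 0 y) \<partial>M)"
        by (rule nn_integral_cong_AE, use AE_good in eventually_elim) (rule edge_mass_eq)
      also have "\<dots> = 2 * (\<integral>\<^sup>+\<omega>. (\<Sigma>\<^sup>+y. ennreal (total_rate (W \<omega>) u y) * kern (W \<omega>) 0 u 0 y) \<partial>M)"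
        by (rule nn_integral_cmult) measurable
      also have "\<dots> \<le> 2 * mean_rate" by (intro mult_left_mono mean_activity that) simp
      finally show ?thesis .
    qed
    moreover have "(\<integral>\<^sup>+\<omega>. indicator {s..t} u * edge_mass \<omega> u \<partial>M) = indicator {s..t} u * (\<integral>\<^sup>+\<omega>. edge_mass \<omega> u \<partial>M)"
      by (rule nn_integral_cmult) measurable
    ultimately show "(\<integral>\<^sup>+\<omega>. indicator {s..t} u * edge_mass \<omega> u \<partial>M) \<le> indicator {s..t} u * (2 * mean_rate)"
      using assms by (cases "u \<in> {s..t}") auto
  qed
  also have "\<dots> = 2 * mean_rate * ennreal (t - s)" by (rule nn_integral_Icc_const[OF assms(2)])
  finally show ?thesis .
qed

lemma mean_moment_growth:
  assumes "0 \<le> s" "s \<le> t"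
  shows "2 * mean_moment t \<le> 2 * mean_moment s + annealed s t edge_variation"
proof -
  let ?m = "\<lambda>\<omega> t. (\<Sigma>\<^sup>+y. ennreal (real_of_int (l1_dist 0 y) * p \<omega> 0 t 0 y))"
  let ?D = "\<lambda>\<omega>. \<integral>\<^sup>+u. indicator {s..t} u * edge_variation \<omega> u \<partial>lborel"
  have [measurable]: "?D \<in> borel_measurable M" by (rule lborel.borel_measurable_nn_integral) measurable
  have "(\<integral>\<^sup>+\<omega>. 2 * ?m \<omega> t \<partial>M) \<le> (\<integral>\<^sup>+\<omega>. 2 * ?m \<omega> s + ?D \<omega> \<partial>M)"
  proof (rule nn_integral_mono_AE, use AE_elliptic_walk[of 0 0] in eventually_elim)
    fix \<omega> assume "good \<omega> \<and> elliptic_walk (W \<omega>) 0 0 c0"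
    then interpret ew: elliptic_walk "W \<omega>" 0 0 c0 by simp
    have q: "ew.q u y = p \<omega> 0 u 0 y" for u y by (rule walk_q) unfold_locales
    show "2 * ?m \<omega> t \<le> 2 * ?m \<omega> s + ?D \<omega>"
      using ew.moment_growth[OF assms] unfolding ew.moment_def q edge_variation_def .
  qed
  then show ?thesis
    unfolding mean_moment_def annealed_def by (simp add: nn_integral_add nn_integral_cmult)
qed

lemma mean_moment_0: "mean_moment 0 = 0"
proof -
  have "mean_moment 0 = (\<integral>\<^sup>+\<omega>. 0 \<partial>M)" unfolding mean_moment_def
  proof (rule nn_integral_cong_AE, use AE_elliptic_walk[of 0 0] in eventually_elim)
    fix \<omega> assume "good \<omega> \<and> elliptic_walk (W \<omega>) 0 0 c0"
    then interpret ew: elliptic_walk "W \<omega>" 0 0 c0 by simp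
    have q: "ew.q u y = p \<omega> 0 u 0 y" for u y by (rule walk_q) unfold_locales
    show "(\<Sigma>\<^sup>+y. ennreal (real_of_int (l1_dist 0 y) * p \<omega> 0 0 0 y)) = 0"
      using ew.moment_start unfolding ew.moment_def q .
  qed
  then show ?thesis by simp
qed

text \<open>
  The distance travelled is at most the number of jumps.
\<close>

lemma mean_moment_finite:
  assumes "0 \<le> t" shows "mean_moment t < \<infinity>"
proof -
  have "2 * mean_moment t \<le> annealed 0 t edge_variation"
    using mean_moment_growth[of 0 t] assms by (simp add: mean_moment_0)
  also have "\<dots> \<le> annealed 0 t edge_mass"
  proof (rule annealed_mono, use AE_good in eventually_elim, rule AE_I2, rule impI)
    fix \<omega> u assume "good \<omega>"
    then show "edge_variation \<omega> u \<le> edge_mass \<omega> u"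
      unfolding edge_variation_def edge_mass_def
      by (intro nn_integral_mono ennreal_leI mult_left_mono regular_rates.rate_nonneg[OF goodD(1)])
        (use p_nonneg[of \<omega> 0 u 0] in \<open>auto simp: abs_le_iff add_increasing add_increasing2\<close>)
  qed
  also have "\<dots> \<le> 2 * mean_rate * ennreal (t - 0)" by (rule annealed_edge_mass) (use assms in auto)
  also have "\<dots> < \<infinity>" using mean_rate_finite by (simp add: ennreal_mult_less_top)
  finally show ?thesis by (auto simp: ennreal_mult_less_top)
qed

text \<open>
  Young's inequality \<open>\<bar>x - y\<bar> \<le> l / 2 * ((x - y)\<^sup>2 / (x + y)) + (x + y) / (2 * l)\<close> on every bond. The free
  parameter \<open>l\<close> is a length, later taken of order \<open>sqrt t\<close>.
\<close>

lemma annealed_edge_variation: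
  assumes st: "0 \<le> s" "s \<le> t" and l: "0 < l"
  shows "annealed s t edge_variation \<le> ennreal (l / 2) * annealed s t (fisher_information 0) + ennreal (1 / (2 * l)) * (2 * mean_rate * ennreal (t - s))"
proof -
  have young: "\<bar>x - y\<bar> \<le> l / 2 * ((x - y)\<^sup>2 / (x + y)) + 1 / (2 * l) * (x + y)" if "0 \<le> x" "0 \<le> y" for x y
  proof (cases "x + y = 0")
    case True then have "x = 0" "y = 0" using that by auto
    then show ?thesis by simp
  next
    case False
    then have s: "0 < x + y" using that by simp
    have "0 \<le> (l * \<bar>x - y\<bar> - (x + y))\<^sup>2 / (2 * l * (x + y))" using s l by simp
    also have "\<dots> = l / 2 * ((x - y)\<^sup>2 / (x + y)) + 1 / (2 * l) * (x + y) - \<bar>x - y\<bar>"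
    proof -
      have "(l * \<bar>x - y\<bar> - (x + y))\<^sup>2 = l\<^sup>2 * (x - y)\<^sup>2 - 2 * l * (x + y) * \<bar>x - y\<bar> + (x + y)\<^sup>2"
        by (simp add: power2_diff power_mult_distrib)
      then have "(l * \<bar>x - y\<bar> - (x + y))\<^sup>2 / (2 * l * (x + y))
        = l\<^sup>2 * (x - y)\<^sup>2 / (2 * l * (x + y)) - 2 * l * (x + y) * \<bar>x - y\<bar> / (2 * l * (x + y)) + (x + y)\<^sup>2 / (2 * l * (x + y))"
        by (simp add: add_divide_distrib diff_divide_distrib)
      also have "l\<^sup>2 * (x - y)\<^sup>2 / (2 * l * (x + y)) = l / 2 * ((x - y)\<^sup>2 / (x + y))" using s l by (simp add: power2_eq_square)
      also have "2 * l * (x + y) * \<bar>x - y\<bar> / (2 * l * (x + y)) = \<bar>x - y\<bar>" using s l by simp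
      also have "(x + y)\<^sup>2 / (2 * l * (x + y)) = 1 / (2 * l) * (x + y)" using s l by (simp add: power2_eq_square)
      finally show ?thesis by simp
    qed
    finally show ?thesis by simp
  qed
  have "annealed s t edge_variation \<le> annealed s t (\<lambda>\<omega> u. ennreal (l / 2) * fisher_information 0 \<omega> u + ennreal (1 / (2 * l)) * edge_mass \<omega> u)"
  proof (rule annealed_mono, use AE_good in eventually_elim, rule AE_I2, rule impI)
    fix \<omega> u assume g: "good \<omega>"
    interpret r: regular_rates "W \<omega>" by (rule goodD(1)[OF g])
    show "edge_variation \<omega> u \<le> ennreal (l / 2) * fisher_information 0 \<omega> u + ennreal (1 / (2 * l)) * edge_mass \<omega> u"
      unfolding edge_variation_def fisher_information_def edge_mass_def esum_cmult(1)[symmetric] esum_add[symmetric]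
    proof (intro nn_integral_mono)
      fix y z
      let ?x = "p \<omega> 0 u 0 y" and ?y = "p \<omega> 0 u 0 z" and ?a = "W \<omega> u y z"
      have "?a * \<bar>?x - ?y\<bar> \<le> ?a * (l / 2 * ((?x - ?y)\<^sup>2 / (?x + ?y)) + 1 / (2 * l) * (?x + ?y))"
        by (intro mult_left_mono young r.rate_nonneg p_nonneg)
      then have "ennreal (?a * \<bar>?x - ?y\<bar>) \<le> ennreal (l / 2 * (?a * ((?x - ?y)\<^sup>2 / (?x + ?y + 2 * 0))) + 1 / (2 * l) * (?a * (?x + ?y)))"
        by (intro ennreal_leI) (simp add: algebra_simps)
      also have "\<dots> = ennreal (l / 2 * (?a * ((?x - ?y)\<^sup>2 / (?x + ?y + 2 * 0)))) + ennreal (1 / (2 * l) * (?a * (?x + ?y)))"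
        using l r.rate_nonneg p_nonneg by (intro ennreal_plus mult_nonneg_nonneg) (auto intro!: divide_nonneg_nonneg add_nonneg_nonneg)
      also have "ennreal (l / 2 * (?a * ((?x - ?y)\<^sup>2 / (?x + ?y + 2 * 0)))) = ennreal (l / 2) * ennreal (?a * ((?x - ?y)\<^sup>2 / (?x + ?y + 2 * 0)))"
        using l by (intro ennreal_mult') auto
      also have "ennreal (1 / (2 * l) * (?a * (?x + ?y))) = ennreal (1 / (2 * l)) * ennreal (?a * (?x + ?y))"
        using l by (intro ennreal_mult') auto
      finally show "ennreal (?a * \<bar>?x - ?y\<bar>) \<le> ennreal (l / 2) * ennreal (?a * ((?x - ?y)\<^sup>2 / (?x + ?y + 2 * 0))) + ennreal (1 / (2 * l)) * ennreal (?a * (?x + ?y))" .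
    qed
  qed
  also have "\<dots> = ennreal (l / 2) * annealed s t (fisher_information 0) + ennreal (1 / (2 * l)) * annealed s t edge_mass"
    by (rule annealed_linear) measurable
  also have "\<dots> \<le> ennreal (l / 2) * annealed s t (fisher_information 0) + ennreal (1 / (2 * l)) * (2 * mean_rate * ennreal (t - s))"
    by (intro add_left_mono mult_left_mono annealed_edge_mass st) simp
  finally show ?thesis .
qed

text \<open>
  The entropy bounds concern the regularised Fisher information; monotone convergence removes the
  regularisation.
\<close>

lemma annealed_fisher_SUP:
  assumes \<epsilon>: "0 < \<epsilon>"
  shows "annealed s t (fisher_information 0) = (SUP k. annealed s t (fisher_information (\<epsilon> / real (Suc k))))"
proof -
  let ?e = "\<lambda>k. \<epsilon> / real (Suc k)"
  have e_dec: "?e (Suc k) \<le> ?e k" for k using \<epsilon> by (intro divide_left_mono) auto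
  have e_pos: "0 < ?e k" for k using \<epsilon> by simp
  let ?h = "\<lambda>k \<omega> u y z. ennreal (W \<omega> u y z * ((p \<omega> 0 u 0 y - p \<omega> 0 u 0 z)\<^sup>2 / (p \<omega> 0 u 0 y + p \<omega> 0 u 0 z + 2 * ?e k)))"
  have h_mono: "?h k \<omega> u y z \<le> ?h (Suc k) \<omega> u y z" if "\<omega> \<in> space M" for k \<omega> u y z
  proof (intro ennreal_leI mult_left_mono divide_left_mono W_nonneg that)
    have pos: "0 < p \<omega> 0 u 0 y + p \<omega> 0 u 0 z + 2 * ?e k" for k
      using e_pos[of k] p_nonneg[of \<omega> 0 u 0 y] p_nonneg[of \<omega> 0 u 0 z] by linarith
    show "0 < (p \<omega> 0 u 0 y + p \<omega> 0 u 0 z + 2 * ?e k) * (p \<omega> 0 u 0 y + p \<omega> 0 u 0 z + 2 * ?e (Suc k))"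
      by (rule mult_pos_pos[OF pos pos])
    show "p \<omega> 0 u 0 y + p \<omega> 0 u 0 z + 2 * ?e (Suc k) \<le> p \<omega> 0 u 0 y + p \<omega> 0 u 0 z + 2 * ?e k"
      using e_dec[of k] by linarith
  qed simp
  have h_SUP: "ennreal (W \<omega> u y z * ((p \<omega> 0 u 0 y - p \<omega> 0 u 0 z)\<^sup>2 / (p \<omega> 0 u 0 y + p \<omega> 0 u 0 z + 2 * 0))) = (SUP k. ?h k \<omega> u y z)"
    if "\<omega> \<in> space M" for \<omega> u y z
  proof (cases "p \<omega> 0 u 0 y + p \<omega> 0 u 0 z = 0")
    case True
    then have "p \<omega> 0 u 0 y = 0" "p \<omega> 0 u 0 z = 0" using p_nonneg[of \<omega> 0 u 0 y] p_nonneg[of \<omega> 0 u 0 z] by linarith+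
    then show ?thesis by simp
  next
    case False
    have "?e \<longlonglongrightarrow> 0" using LIMSEQ_Suc[OF lim_const_over_n[of \<epsilon>]] by simp
    then have "(\<lambda>k. W \<omega> u y z * ((p \<omega> 0 u 0 y - p \<omega> 0 u 0 z)\<^sup>2 / (p \<omega> 0 u 0 y + p \<omega> 0 u 0 z + 2 * ?e k)))
      \<longlonglongrightarrow> W \<omega> u y z * ((p \<omega> 0 u 0 y - p \<omega> 0 u 0 z)\<^sup>2 / (p \<omega> 0 u 0 y + p \<omega> 0 u 0 z + 2 * 0))"
      by (intro tendsto_intros) (use False in auto)
    then have "(\<lambda>k. ?h k \<omega> u y z) \<longlonglongrightarrow> ennreal (W \<omega> u y z * ((p \<omega> 0 u 0 y - p \<omega> 0 u 0 z)\<^sup>2 / (p \<omega> 0 u 0 y + p \<omega> 0 u 0 z + 2 * 0)))"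
      by (rule tendsto_ennrealI)
    moreover have "(\<lambda>k. ?h k \<omega> u y z) \<longlonglongrightarrow> (SUP k. ?h k \<omega> u y z)"
      by (rule LIMSEQ_SUP) (rule incseq_SucI, rule h_mono[OF that])
    ultimately show ?thesis by (rule LIMSEQ_unique)
  qed
  have f_mono: "fisher_information (?e k) \<omega> u \<le> fisher_information (?e (Suc k)) \<omega> u" if "\<omega> \<in> space M" for k \<omega> u
    unfolding fisher_information_def by (intro nn_integral_mono h_mono that)
  have f_SUP: "fisher_information 0 \<omega> u = (SUP k. fisher_information (?e k) \<omega> u)" if w: "\<omega> \<in> space M" for \<omega> u
  proof -
    have "fisher_information 0 \<omega> u = (\<Sigma>\<^sup>+y. \<Sigma>\<^sup>+z. SUP k. ?h k \<omega> u y z)"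
      unfolding fisher_information_def h_SUP[OF w] ..
    also have "\<dots> = (\<Sigma>\<^sup>+y. SUP k. \<Sigma>\<^sup>+z. ?h k \<omega> u y z)"
      by (intro nn_integral_cong nn_integral_SUP_Suc h_mono[OF w]) simp
    also have "\<dots> = (SUP k. \<Sigma>\<^sup>+y. \<Sigma>\<^sup>+z. ?h k \<omega> u y z)"
    proof (rule nn_integral_SUP_Suc)
      show "(\<Sigma>\<^sup>+z. ?h k \<omega> u y z) \<le> (\<Sigma>\<^sup>+z. ?h (Suc k) \<omega> u y z)" for k y
        by (rule nn_integral_mono) (rule h_mono[OF w])
    qed simp
    finally show ?thesis unfolding fisher_information_def .
  qed
  let ?J = "\<lambda>k \<omega>. \<integral>\<^sup>+u. indicator {s..t} u * fisher_information (?e k) \<omega> u \<partial>lborel"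
  have "annealed s t (fisher_information 0) = (\<integral>\<^sup>+\<omega>. (SUP k. ?J k \<omega>) \<partial>M)"
    unfolding annealed_def
  proof (rule nn_integral_cong)
    fix \<omega> assume w: "\<omega> \<in> space M"
    have [measurable]: "(\<lambda>u. fisher_information \<epsilon>' \<omega> u) \<in> borel_measurable lborel" for \<epsilon>'
      using w by measurable
    have "(\<integral>\<^sup>+u. indicator {s..t} u * fisher_information 0 \<omega> u \<partial>lborel) = (\<integral>\<^sup>+u. (SUP k. indicator {s..t} u * fisher_information (?e k) \<omega> u) \<partial>lborel)"
      by (simp only: f_SUP[OF w] SUP_mult_left_ennreal)
    also have "\<dots> = (SUP k. ?J k \<omega>)"
      by (rule nn_integral_SUP_Suc) (use f_mono[OF w] in \<open>auto intro!: mult_left_mono simp del: of_nat_Suc\<close>)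
    finally show "(\<integral>\<^sup>+u. indicator {s..t} u * fisher_information 0 \<omega> u \<partial>lborel) = (SUP k. ?J k \<omega>)" .
  qed
  also have "\<dots> = (SUP k. \<integral>\<^sup>+\<omega>. ?J k \<omega> \<partial>M)"
  proof (rule nn_integral_monotone_convergence_SUP_AE)
    show "AE \<omega> in M. ?J k \<omega> \<le> ?J (Suc k) \<omega>" for k
      by (rule AE_I2) (intro nn_integral_mono mult_left_mono f_mono; simp)
    show "?J k \<in> borel_measurable M" for k by (rule lborel.borel_measurable_nn_integral) measurable
  qed
  finally show ?thesis unfolding annealed_def .
qed

text \<open>
  The lower and the upper bound on the entropy contain \<open>ln \<epsilon>\<close> with the same coefficient, so that
  the bound on the entropy production is uniform in the regularisation.
\<close>

lemma annealed_fisher_bound: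
  assumes st: "0 < s" "s \<le> t" and m: "1 \<le> m" and mom: "mean_moment t \<le> ennreal m"
  shows "annealed s t (fisher_information 0) \<le> ennreal (6 + 2 * ln (C1 * s powr (- real CARD('d) / 2) * (3 * m) ^ CARD('d)))"
proof -
  define B where "B = C1 * s powr (- real CARD('d) / 2)"
  define Z where "Z = (3 * m) ^ CARD('d)"
  have B: "0 < B" and Z: "0 < Z" using C1_pos st m by (auto simp: B_def Z_def)
  have b: "annealed s t (fisher_information \<epsilon>) \<le> ennreal (6 + 2 * ln (B * Z))" if \<epsilon>: "0 < \<epsilon>" "\<epsilon> \<le> B" "Z * \<epsilon> \<le> 1" for \<epsilon>
  proof -
    let ?m = "\<lambda>\<omega>. (\<Sigma>\<^sup>+y. ennreal (real_of_int (l1_dist 0 y) * p \<omega> 0 t 0 y))"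
    let ?D = "\<lambda>\<omega>. \<integral>\<^sup>+u. indicator {s..t} u * fisher_information \<epsilon> \<omega> u \<partial>lborel"
    have lZ: "0 \<le> - ln (Z * \<epsilon>)" using Z \<epsilon> by (simp add: ln_le_zero_iff)
    have lB: "0 \<le> ln (B / \<epsilon>)" using \<epsilon> by simp
    have [measurable]: "?D \<in> borel_measurable M" by (rule lborel.borel_measurable_nn_integral) measurable
    have "(\<integral>\<^sup>+\<omega>. ?D \<omega> + ennreal (2 * (- ln (Z * \<epsilon>))) \<partial>M) \<le> (\<integral>\<^sup>+\<omega>. ennreal (2 * (1 + ln (B / \<epsilon>))) + (2 + ennreal (2 / m) * ?m \<omega>) \<partial>M)"
    proof (rule nn_integral_mono_AE, use AE_elliptic_walk[of 0 0] in eventually_elim)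
      fix \<omega> assume "good \<omega> \<and> elliptic_walk (W \<omega>) 0 0 c0"
      then interpret ew: elliptic_walk "W \<omega>" 0 0 c0 by simp
      have q: "ew.q u y = p \<omega> 0 u 0 y" for u y by (rule walk_q) unfold_locales
      have Bq: "(\<Sigma>\<^sup>+y. ennreal ((ew.q s y)\<^sup>2)) \<le> ennreal B"
        using ew.energy_decay[of s] st by (simp add: B_def C1_def)
      have part: "(\<Sigma>\<^sup>+y. ennreal (exp (- real_of_int (l1_dist (0::'d site) y) / m))) \<le> ennreal Z"
        unfolding Z_def by (rule exp_l1_dist_sum_le[OF m])
      show "?D \<omega> + ennreal (2 * (- ln (Z * \<epsilon>))) \<le> ennreal (2 * (1 + ln (B / \<epsilon>))) + (2 + ennreal (2 / m) * ?m \<omega>)"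
        using ew.entropy_production[OF _ st(2) Bq \<epsilon>(1,2) Z \<epsilon>(3) _ part] st m
        unfolding ew.moment_def q fisher_information_def by simp
    qed
    then have "annealed s t (fisher_information \<epsilon>) + ennreal (2 * (- ln (Z * \<epsilon>)))
      \<le> ennreal (2 * (1 + ln (B / \<epsilon>))) + (2 + ennreal (2 / m) * mean_moment t)"
      unfolding annealed_def mean_moment_def by (simp add: nn_integral_add nn_integral_cmult emeasure_space_1)
    also have "\<dots> \<le> ennreal (2 * (1 + ln (B / \<epsilon>))) + (2 + ennreal (2 / m) * ennreal m)"
      by (intro add_left_mono mult_left_mono mom) simp
    also have "\<dots> = ennreal (2 * (1 + ln (B / \<epsilon>)) + 4)"
    proof -
      have "ennreal (2 / m) * ennreal m = ennreal 2" using m by (subst ennreal_mult[symmetric]) auto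
      then have "(2 + ennreal (2 / m) * ennreal m) = ennreal 4" by (simp add: ennreal_plus[symmetric] ennreal_numeral[symmetric] del: ennreal_plus ennreal_numeral)
      then show ?thesis using lB by (simp add: ennreal_plus)
    qed
    finally have le: "annealed s t (fisher_information \<epsilon>) + ennreal (2 * (- ln (Z * \<epsilon>))) \<le> ennreal (2 * (1 + ln (B / \<epsilon>)) + 4)" .
    then have "annealed s t (fisher_information \<epsilon>) < \<infinity>" by (metis ennreal_less_top infinity_ennreal_def le_less_trans add_increasing2 order_refl zero_le)
    then obtain F where F: "0 \<le> F" "annealed s t (fisher_information \<epsilon>) = ennreal F" by (cases "annealed s t (fisher_information \<epsilon>)" rule: ennreal_cases) auto
    have "ennreal (F + 2 * (- ln (Z * \<epsilon>))) \<le> ennreal (2 * (1 + ln (B / \<epsilon>)) + 4)"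
      using le lZ F by (simp add: ennreal_plus[symmetric] del: ennreal_plus)
    then have "F + 2 * (- ln (Z * \<epsilon>)) \<le> 2 * (1 + ln (B / \<epsilon>)) + 4" using lB by (subst (asm) ennreal_le_iff) auto
    then have "F + 2 * (- (ln Z + ln \<epsilon>)) \<le> 2 * (1 + (ln B - ln \<epsilon>)) + 4"
      using B Z \<epsilon> by (simp add: ln_div ln_mult)
    then have "F \<le> 6 + 2 * (ln B + ln Z)" by (simp add: algebra_simps)
    also have "ln B + ln Z = ln (B * Z)" using B Z by (simp add: ln_mult)
    finally show ?thesis unfolding F(2) by (intro ennreal_leI)
  qed
  \<comment> \<open>any starting value of the regularisation that makes both logarithms in the entropy bound nonnegative\<close>
  define \<epsilon> where "\<epsilon> = min B (1 / Z)"
  have \<epsilon>: "0 < \<epsilon>" "\<epsilon> \<le> B" "\<epsilon> \<le> 1 / Z" using B Z by (auto simp: \<epsilon>_def)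
  have "annealed s t (fisher_information 0) \<le> ennreal (6 + 2 * ln (B * Z))"
    unfolding annealed_fisher_SUP[OF \<epsilon>(1)]
  proof (rule SUP_least, rule b)
    fix k
    have le: "\<epsilon> / real (Suc k) \<le> \<epsilon>" using \<epsilon> by (simp add: field_simps)
    show "0 < \<epsilon> / real (Suc k)" using \<epsilon> by simp
    show "\<epsilon> / real (Suc k) \<le> B" using le \<epsilon> by linarith
    have "Z * (\<epsilon> / real (Suc k)) \<le> Z * (1 / Z)" using le \<epsilon> Z by (intro mult_left_mono) auto
    then show "Z * (\<epsilon> / real (Suc k)) \<le> 1" using Z by simp
  qed
  then show ?thesis by (simp add: B_def Z_def)
qed

definition r0 :: real where "r0 = enn2real mean_rate"

lemma ennreal_r0: "ennreal r0 = mean_rate" and r0_nonneg: "0 \<le> r0"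
  unfolding r0_def using mean_rate_finite by auto

text \<open>
  A bound on the entropy produced during \<open>[t / 2, t]\<close> when the first moment at time \<open>t\<close> is at most \<open>sqrt t * X\<close>.
\<close>

definition entropy_const :: "real \<Rightarrow> real" where
  "entropy_const X = 6 + 2 * \<bar>ln (C1 * 2 powr (real CARD('d) / 2) * 3 ^ CARD('d))\<bar> + 2 * real CARD('d) * ln X"

text \<open>
  On the diffusive scale the powers of \<open>t\<close> coming from the on-diagonal decay and from the volume of the
  box of radius \<open>sqrt t\<close> cancel.
\<close>

lemma edge_variation_scaled:
  assumes t: "1 \<le> t" and X: "1 \<le> X" and mom: "mean_moment t \<le> ennreal (sqrt t * X)"
  shows "annealed (t / 2) t edge_variation \<le> ennreal (sqrt t / 2 * (entropy_const X + r0))"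
proof -
  let ?d = "real CARD('d)"
  let ?L = "C1 * 2 powr (?d / 2) * 3 ^ CARD('d)"
  have L: "0 < ?L" using C1_pos by simp
  have m: "1 \<le> sqrt t * X" using t X by (simp add: mult_ge1_I)
  have "C1 * (t / 2) powr (- ?d / 2) * (3 * (sqrt t * X)) ^ CARD('d) = ?L * X ^ CARD('d)"
  proof -
    have "(t / 2) powr (- ?d / 2) = t powr (- ?d / 2) * 2 powr (?d / 2)"
      using t by (simp add: powr_divide powr_minus field_simps)
    moreover have "(sqrt t) ^ CARD('d) = t powr (?d / 2)"
      using t by (simp add: powr_half_sqrt[symmetric] powr_realpow[symmetric] powr_powr)
    moreover have "t powr (- ?d / 2) * t powr (?d / 2) = 1" using t by (simp add: powr_add[symmetric])
    ultimately show ?thesis by (simp add: power_mult_distrib mult_ac)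
  qed
  moreover have "ln (?L * X ^ CARD('d)) = ln ?L + ln (X ^ CARD('d))" by (rule ln_mult_pos[OF L]) (use X in simp)
  moreover have "ln (X ^ CARD('d)) = ?d * ln X" by (rule ln_realpow)
  ultimately have "ln (C1 * (t / 2) powr (- ?d / 2) * (3 * (sqrt t * X)) ^ CARD('d)) = ln ?L + ?d * ln X"
    by (simp only:)
  then have k: "6 + 2 * ln (C1 * (t / 2) powr (- ?d / 2) * (3 * (sqrt t * X)) ^ CARD('d)) \<le> entropy_const X"
    unfolding entropy_const_def by simp
  have "annealed (t / 2) t (fisher_information 0) \<le> ennreal (6 + 2 * ln (C1 * (t / 2) powr (- ?d / 2) * (3 * (sqrt t * X)) ^ CARD('d)))"
    by (rule annealed_fisher_bound) (use t m mom in auto)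
  also have "\<dots> \<le> ennreal (entropy_const X)" by (rule ennreal_leI[OF k])
  finally have F: "annealed (t / 2) t (fisher_information 0) \<le> ennreal (entropy_const X)" .
  have K0: "0 \<le> entropy_const X" unfolding entropy_const_def using X by simp
  have s: "0 < sqrt t" "sqrt t * sqrt t = t" using t by auto
  have "annealed (t / 2) t edge_variation \<le> ennreal (sqrt t / 2) * annealed (t / 2) t (fisher_information 0) + ennreal (1 / (2 * sqrt t)) * (2 * mean_rate * ennreal (t - t / 2))"
    by (rule annealed_edge_variation) (use t in auto)
  also have "\<dots> \<le> ennreal (sqrt t / 2) * ennreal (entropy_const X) + ennreal (1 / (2 * sqrt t)) * (2 * mean_rate * ennreal (t - t / 2))"
    by (intro add_right_mono mult_left_mono F) simp
  also have "ennreal (1 / (2 * sqrt t)) * (2 * mean_rate * ennreal (t - t / 2)) = ennreal (1 / (2 * sqrt t) * (2 * r0 * (t - t / 2)))"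
    using t r0_nonneg unfolding ennreal_r0[symmetric] by (simp add: ennreal_mult[symmetric] ennreal_numeral[symmetric] del: ennreal_numeral)
  also have "1 / (2 * sqrt t) * (2 * r0 * (t - t / 2)) = sqrt t / 2 * r0"
    using s by (simp add: field_simps)
  also have "ennreal (sqrt t / 2) * ennreal (entropy_const X) + ennreal (sqrt t / 2 * r0) = ennreal (sqrt t / 2 * (entropy_const X + r0))"
    using s K0 r0_nonneg by (simp add: ennreal_mult[symmetric] ennreal_plus[symmetric] distrib_left del: ennreal_plus)
  finally show ?thesis .
qed

text \<open>
  The circle closes: the moment controls the entropy production only logarithmically, while the
  entropy production controls the growth of the moment linearly, so the moment is diffusive along
  dyadic times.
\<close>

lemma mean_moment_diffusive: "\<exists>A\<ge>1. \<forall>n. mean_moment (2 ^ n) \<le> ennreal (sqrt (2 ^ n) * A)"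
proof -
  \<comment> \<open>in diffusive units, doubling the time costs a factor \<open>1 / sqrt 2 \<le> 3 / 4\<close>\<close>
  define x where "x n = enn2real (mean_moment (2 ^ n)) / sqrt (2 ^ n)" for n
  have x0: "0 \<le> x n" for n by (simp add: x_def)
  have mx: "mean_moment (2 ^ n) = ennreal (sqrt (2 ^ n) * x n)" for n
    using mean_moment_finite[of "2 ^ n"] by (simp add: x_def)
  let ?d = "real CARD('d)"
  have d: "?d \<ge> 1" by (simp add: Suc_leI)
  define k0 where "k0 = 6 + 2 * \<bar>ln (C1 * 2 powr (?d / 2) * 3 ^ CARD('d))\<bar>"
  define c where "c = (k0 + r0) / 4 + 1 / 8 + ?d / 2 * ln (4 * ?d)"
  have "1 * 1 \<le> 4 * ?d" by (rule mult_mono) (use d in auto)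
  then have "0 \<le> ln (4 * ?d)" by simp
  from mult_nonneg_nonneg[OF _ this, of "?d / 2"] have "0 \<le> ?d / 2 * ln (4 * ?d)" by simp
  moreover have "0 \<le> (k0 + r0) / 4" unfolding k0_def using r0_nonneg by simp
  ultimately have c: "0 \<le> c" unfolding c_def by linarith
  have step: "7 / 8 * x (Suc n) \<le> 3 / 4 * x n + c" for n
  proof -
    let ?t = "2 ^ Suc n :: real"
    define X where "X = max 1 (x (Suc n))"
    have X: "1 \<le> X" "X \<le> 1 + x (Suc n)" using x0[of "Suc n"] by (auto simp: X_def)
    have t: "1 \<le> ?t" "?t / 2 = 2 ^ n" by (simp_all add: mult_ge1_I)
    have "mean_moment ?t \<le> ennreal (sqrt ?t * X)" unfolding mx by (intro ennreal_leI mult_left_mono) (auto simp: X_def)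
    then have ev: "annealed (2 ^ n) ?t edge_variation \<le> ennreal (sqrt ?t / 2 * (entropy_const X + r0))"
      using edge_variation_scaled[OF t(1) X(1)] unfolding t(2) by simp
    have K0: "0 \<le> entropy_const X" unfolding entropy_const_def using X by simp
    have "2 * mean_moment ?t \<le> 2 * mean_moment (2 ^ n) + annealed (2 ^ n) ?t edge_variation"
      by (rule mean_moment_growth) auto
    also have "\<dots> \<le> 2 * mean_moment (2 ^ n) + ennreal (sqrt ?t / 2 * (entropy_const X + r0))" by (rule add_left_mono[OF ev])
    finally have "ennreal (2 * (sqrt ?t * x (Suc n))) \<le> ennreal (2 * (sqrt (2 ^ n) * x n) + sqrt ?t / 2 * (entropy_const X + r0))"
      unfolding mx using x0 K0 r0_nonneg by (simp add: ennreal_mult ennreal_plus)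
    then have "2 * (sqrt ?t * x (Suc n)) \<le> 2 * (sqrt (2 ^ n) * x n) + sqrt ?t / 2 * (entropy_const X + r0)"
      using x0 K0 r0_nonneg by (subst (asm) ennreal_le_iff) (auto intro!: add_nonneg_nonneg mult_nonneg_nonneg)
    also have "sqrt (2 ^ n) = sqrt ?t / sqrt 2" by (simp add: real_sqrt_mult)
    finally have "sqrt ?t * (2 * x (Suc n)) \<le> sqrt ?t * (2 * (x n / sqrt 2) + (entropy_const X + r0) / 2)"
      by (simp add: algebra_simps add_divide_distrib)
    then have "2 * x (Suc n) \<le> 2 * (x n / sqrt 2) + (entropy_const X + r0) / 2" by (rule mult_left_le_imp_le) simp
    moreover have "x n / sqrt 2 \<le> 3 / 4 * x n"
    proof -
      have "4 / 3 \<le> sqrt 2" by (rule real_le_rsqrt) (simp add: power2_eq_square)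
      then have "x n / sqrt 2 \<le> x n / (4 / 3)" by (intro divide_left_mono x0) auto
      then show ?thesis by simp
    qed
    moreover have "entropy_const X / 4 \<le> k0 / 4 + X / 8 + ?d / 2 * ln (4 * ?d)"
    proof -
      \<comment> \<open>the logarithm is absorbed by a linear term that is small enough to keep a contraction: \<open>3 / 4 < 7 / 8\<close>\<close>
      have "ln (X / (4 * ?d)) \<le> X / (4 * ?d) - 1" by (rule ln_le_minus_one) (use X d in simp)
      then have "ln X \<le> X / (4 * ?d) + ln (4 * ?d)" using X d by (simp add: ln_div)
      then have "?d / 2 * ln X \<le> ?d / 2 * (X / (4 * ?d) + ln (4 * ?d))" by (rule mult_left_mono) simp
      also have "\<dots> = X / 8 + ?d / 2 * ln (4 * ?d)" using d by (simp add: field_simps)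
      finally have le: "?d / 2 * ln X \<le> X / 8 + ?d / 2 * ln (4 * ?d)" .
      have e: "entropy_const X / 4 = k0 / 4 + ?d / 2 * ln X" by (simp add: entropy_const_def k0_def add_divide_distrib)
      show ?thesis unfolding e using le by linarith
    qed
    ultimately show ?thesis unfolding c_def using X by (simp add: add_divide_distrib)
  qed
  define A where "A = max 1 (max (x 0) (8 * c))"
  have "x n \<le> A" for n
  proof (induction n)
    case (Suc n)
    have "7 / 8 * x (Suc n) \<le> 3 / 4 * A + A / 8" using step[of n] Suc by (simp add: A_def)
    then show ?case by simp
  qed (simp add: A_def)
  then have "mean_moment (2 ^ n) \<le> ennreal (sqrt (2 ^ n) * A)" for n
    unfolding mx by (intro ennreal_leI mult_left_mono) auto
  then show ?thesis by (intro exI[of _ A]) (auto simp: A_def)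
qed

lemma abs_grad_sum_le_2: "0 \<le> t \<Longrightarrow> grad_sum abs e t \<le> 2"
proof -
  assume t: "0 \<le> t"
  have "grad_sum abs e t \<le> (\<integral>\<^sup>+\<omega>. 2 \<partial>M)" unfolding grad_sum_def
  proof (rule nn_integral_mono_AE, use AE_good in eventually_elim)
    fix \<omega> assume g: "good \<omega>"
    have "(\<Sigma>\<^sup>+y. ennreal \<bar>p \<omega> 0 t 0 (y + e) - p \<omega> 0 t 0 y\<bar>) \<le> (\<Sigma>\<^sup>+y. ennreal (p \<omega> 0 t 0 (y + e)) + ennreal (p \<omega> 0 t 0 y))"
    proof (rule nn_integral_mono)
      fix y
      have "\<bar>p \<omega> 0 t 0 (y + e) - p \<omega> 0 t 0 y\<bar> \<le> p \<omega> 0 t 0 (y + e) + p \<omega> 0 t 0 y"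
        using p_nonneg[of \<omega> 0 t 0 y] p_nonneg[of \<omega> 0 t 0 "y + e"] by linarith
      then show "ennreal \<bar>p \<omega> 0 t 0 (y + e) - p \<omega> 0 t 0 y\<bar> \<le> ennreal (p \<omega> 0 t 0 (y + e)) + ennreal (p \<omega> 0 t 0 y)"
        by (simp add: ennreal_plus[symmetric] p_nonneg ennreal_leI del: ennreal_plus)
    qed
    also have "\<dots> = (\<Sigma>\<^sup>+y. ennreal (p \<omega> 0 t 0 y)) + (\<Sigma>\<^sup>+y. ennreal (p \<omega> 0 t 0 y))"
      unfolding esum_add using esum_shift(1)[of "\<lambda>y. ennreal (p \<omega> 0 t 0 y)" e] by simp
    also have "\<dots> \<le> 1 + 1" by (intro add_mono p_row[OF g t])
    finally show "(\<Sigma>\<^sup>+y. ennreal \<bar>p \<omega> 0 t 0 (y + e) - p \<omega> 0 t 0 y\<bar>) \<le> 2" by simp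
  qed
  then show ?thesis by (simp add: emeasure_space_1)
qed

text \<open>
  As for the squared gradients: monotonicity passes from time \<open>t\<close> to an average over \<open>[t / 2, t]\<close>, and
  ellipticity from the bonds in direction \<open>e\<close> to all bonds, weighted by the rates.
\<close>

lemma abs_grad_sum_from_variation:
  assumes e: "nbr 0 e" and t: "0 < t" and K: "0 \<le> K" and ev: "annealed (t / 2) t edge_variation \<le> ennreal (sqrt t / 2 * K)"
  shows "grad_sum abs e t \<le> ennreal (K / c0 / sqrt t)"
proof -
  let ?s = "t / 2"
  let ?g = "\<lambda>\<omega> u. (\<Sigma>\<^sup>+y. ennreal \<bar>p \<omega> 0 u 0 (y + e) - p \<omega> 0 u 0 y\<bar>)"
  have "ennreal c0 * (grad_sum abs e t * ennreal (t - ?s)) = ennreal c0 * (\<integral>\<^sup>+u. indicator {?s..t} u * grad_sum abs e t \<partial>lborel)"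
    using t by (subst nn_integral_Icc_const) auto
  also have "\<dots> \<le> ennreal c0 * (\<integral>\<^sup>+u. indicator {?s..t} u * grad_sum abs e u \<partial>lborel)"
  proof (rule mult_left_mono, rule nn_integral_mono)
    fix u show "indicator {?s..t} u * grad_sum abs e t \<le> indicator {?s..t} u * grad_sum abs e u"
      by (cases "u \<in> {?s..t}") (use t in \<open>auto intro!: abs_grad_sum_mono\<close>)
  qed simp
  also have "(\<integral>\<^sup>+u. indicator {?s..t} u * grad_sum abs e u \<partial>lborel) = (\<integral>\<^sup>+u. (\<integral>\<^sup>+\<omega>. indicator {?s..t} u * ?g \<omega> u \<partial>M) \<partial>lborel)"
    unfolding grad_sum_def by (intro nn_integral_cong nn_integral_cmult[symmetric]) measurable
  also have "\<dots> = annealed ?s t ?g"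
    unfolding annealed_def by (rule Fubini_lborel[symmetric]) measurable
  also have "ennreal c0 * annealed ?s t ?g = annealed ?s t (\<lambda>\<omega> u. ennreal c0 * ?g \<omega> u + 0 * ?g \<omega> u)"
  proof -
    have "annealed ?s t (\<lambda>\<omega> u. ennreal c0 * ?g \<omega> u + 0 * ?g \<omega> u) = ennreal c0 * annealed ?s t ?g + 0 * annealed ?s t ?g"
      by (rule annealed_linear) measurable
    then show ?thesis by simp
  qed
  also have "\<dots> \<le> annealed ?s t edge_variation"
  proof (rule annealed_mono, use AE_elliptic_walk[of 0 0] in eventually_elim)
    fix \<omega> assume "good \<omega> \<and> elliptic_walk (W \<omega>) 0 0 c0"
    then interpret ew: elliptic_walk "W \<omega>" 0 0 c0 by simp
    show "AE u in lborel. u \<in> {?s..t} \<longrightarrow> ennreal c0 * ?g \<omega> u + 0 * ?g \<omega> u \<le> edge_variation \<omega> u"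
      using ew.ell
    proof eventually_elim
      fix u assume u: "\<forall>y z. nbr y z \<longrightarrow> c0 \<le> W \<omega> u y z"
      have "ennreal c0 * (\<Sigma>\<^sup>+y. ennreal \<bar>p \<omega> 0 u 0 y - p \<omega> 0 u 0 (y + e)\<bar>) \<le> edge_variation \<omega> u"
        unfolding edge_variation_def
        by (rule ew.bond_sum_le[OF e, where G="\<lambda>y z. \<bar>p \<omega> 0 u 0 y - p \<omega> 0 u 0 z\<bar>"]) (use u in auto)
      then show "u \<in> {?s..t} \<longrightarrow> ennreal c0 * ?g \<omega> u + 0 * ?g \<omega> u \<le> edge_variation \<omega> u"
        by (simp add: abs_minus_commute)
    qed
  qed
  also have "\<dots> \<le> ennreal (sqrt t / 2 * K)" by (rule ev)
  finally have *: "ennreal c0 * (grad_sum abs e t * ennreal (t - ?s)) \<le> ennreal (sqrt t / 2 * K)" .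
  have "grad_sum abs e t = ennreal (1 / (c0 * ?s)) * (ennreal c0 * (grad_sum abs e t * ennreal (t - ?s)))"
  proof -
    have "ennreal (1 / (c0 * ?s)) * (ennreal c0 * ennreal (t - ?s)) = ennreal (1 / (c0 * ?s) * (c0 * ?s))"
      using c0 t by (simp add: ennreal_mult[symmetric])
    also have "\<dots> = 1" using c0 t by simp
    finally have "grad_sum abs e t = grad_sum abs e t * (ennreal (1 / (c0 * ?s)) * (ennreal c0 * ennreal (t - ?s)))" by simp
    then show ?thesis by (simp only: mult_ac)
  qed
  also have "\<dots> \<le> ennreal (1 / (c0 * ?s)) * ennreal (sqrt t / 2 * K)" by (intro mult_left_mono *) simp
  also have "\<dots> = ennreal (1 / (c0 * ?s) * (sqrt t / 2 * K))" using c0 t K by (simp add: ennreal_mult[symmetric])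
  also have "1 / (c0 * ?s) * (sqrt t / 2 * K) = K / c0 / sqrt t"
  proof -
    have "sqrt t * sqrt t = t" "sqrt t > 0" using t by auto
    then have "sqrt t / t = 1 / sqrt t" by (metis divide_divide_eq_left' divide_self_if less_irrefl nonzero_divide_mult_cancel_left)
    then show ?thesis using c0 t by (simp add: field_simps)
  qed
  finally show ?thesis .
qed

text \<open>
  Along dyadic times the diffusive moment bound applies; monotonicity in time covers the times in between.
\<close>

lemma abs_grad_sum_bound: "\<exists>C\<ge>0. \<forall>e t. nbr 0 e \<and> 1 \<le> t \<longrightarrow> grad_sum abs e t \<le> ennreal (C / sqrt t)"
proof -
  obtain A where A: "1 \<le> A" "\<And>n. mean_moment (2 ^ n) \<le> ennreal (sqrt (2 ^ n) * A)" using mean_moment_diffusive by blast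
  define K where "K = entropy_const A + r0"
  have K: "0 \<le> K" unfolding K_def entropy_const_def using A r0_nonneg by simp
  define C where "C = max 2 (K / c0) * sqrt 2"
  have C: "0 \<le> C" by (simp add: C_def le_max_iff_disj)
  have "grad_sum abs e t \<le> ennreal (C / sqrt t)" if e: "nbr 0 e" and t: "1 \<le> t" for e t
  proof -
    obtain n :: nat where n: "2 ^ n \<le> t" "t < 2 ^ (n + 1)"
    proof -
      have "\<exists>n. t < 2 ^ n" using real_arch_pow[of 2 t] by auto
      define N where "N = (LEAST n. t < 2 ^ n)"
      have N: "t < 2 ^ N" unfolding N_def using \<open>\<exists>n. t < 2 ^ n\<close> by (rule LeastI_ex)
      then obtain n where Nn: "N = Suc n" using t by (cases N) auto
      have "\<not> t < 2 ^ n" using not_less_Least[of n "\<lambda>n. t < 2 ^ n"] Nn unfolding N_def by simp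
      then show ?thesis using that[of n] N Nn by simp
    qed
    have "grad_sum abs e (2 ^ n) \<le> ennreal (max 2 (K / c0) / sqrt (2 ^ n))"
    proof (cases n)
      case 0
      have "grad_sum abs e 1 \<le> ennreal 2" using abs_grad_sum_le_2[of 1 e] by simp
      also have "\<dots> \<le> ennreal (max 2 (K / c0))" by (intro ennreal_leI) simp
      finally show ?thesis using 0 by simp
    next
      case (Suc k)
      have "grad_sum abs e (2 ^ n) \<le> ennreal (K / c0 / sqrt (2 ^ n))"
      proof (rule abs_grad_sum_from_variation[OF e _ K])
        show "annealed (2 ^ n / 2) (2 ^ n) edge_variation \<le> ennreal (sqrt (2 ^ n) / 2 * K)"
          unfolding K_def by (rule edge_variation_scaled) (use A in auto)
      qed simp
      also have "\<dots> \<le> ennreal (max 2 (K / c0) / sqrt (2 ^ n))" by (intro ennreal_leI divide_right_mono) auto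
      finally show ?thesis .
    qed
    moreover have "grad_sum abs e t \<le> grad_sum abs e (2 ^ n)" by (rule abs_grad_sum_mono) (use n in auto)
    moreover have "max 2 (K / c0) / sqrt (2 ^ n) \<le> C / sqrt t"
    proof -
      have "sqrt t \<le> sqrt 2 * sqrt (2 ^ n)" using n by (simp add: real_sqrt_mult[symmetric])
      then have "max 2 (K / c0) * sqrt t \<le> max 2 (K / c0) * (sqrt 2 * sqrt (2 ^ n))" by (intro mult_left_mono) auto
      then show ?thesis using t by (simp add: C_def field_simps)
    qed
    ultimately show ?thesis by (meson ennreal_leI order_trans)
  qed
  then show ?thesis using C by blast
qed

end


section \<open>Pointwise, interpolated and mixed gradient bounds\<close>

text \<open>
  One of the two terms alone is large enough, depending on whether \<open>a * l\<close> is at most one.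
\<close>

lemma powr_interpolation:
  fixes a l q :: real
  assumes "0 \<le> a" "0 < l" "1 \<le> q" "q \<le> 2"
  shows "a powr q \<le> l powr (1 - q) * a + l powr (2 - q) * a\<^sup>2"
proof (cases "a = 0")
  case False
  then have a: "a > 0" using assms by simp
  show ?thesis
  proof (cases "a * l \<le> 1")
    case True
    have "a powr q = a powr (q - 1) * a powr 1" by (simp only: powr_add[symmetric]) simp
    also have "a powr (q - 1) \<le> (1 / l) powr (q - 1)" by (rule powr_mono2) (use assms a True in \<open>auto simp: field_simps\<close>)
    also have "(1 / l) powr (q - 1) = l powr (1 - q)" using assms by (simp add: powr_divide powr_minus_divide[symmetric])
    finally have "a powr q \<le> l powr (1 - q) * a" using a by (simp add: mult_right_mono)
    then show ?thesis using a by (smt (verit) mult_nonneg_nonneg powr_ge_zero zero_le_power2)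
  next
    case False
    have "a powr q = a powr (q - 2) * a powr 2" by (simp only: powr_add[symmetric]) simp
    also have "a powr 2 = a\<^sup>2" using a by simp
    also have "a powr (q - 2) = (1 / a) powr (2 - q)" using a by (simp add: powr_divide powr_minus_divide[symmetric])
    also have "(1 / a) powr (2 - q) \<le> l powr (2 - q)" by (rule powr_mono2) (use assms a False in \<open>auto simp: field_simps\<close>)
    finally have "a powr q \<le> l powr (2 - q) * a\<^sup>2" using a by (simp add: mult_right_mono)
    then show ?thesis using a by (smt (verit) mult_nonneg_nonneg powr_ge_zero)
  qed
qed (use assms in simp)

lemma summable_on_of_esum_le:
  fixes f :: "'a \<Rightarrow> real"
  assumes f: "\<And>x. 0 \<le> f x" and B: "0 \<le> B" and le: "(\<Sigma>\<^sup>+x. ennreal (f x)) \<le> ennreal B"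
  shows "f summable_on UNIV" "infsum f UNIV \<le> B"
proof -
  have fin: "sum f F \<le> B" if "finite F" for F
  proof -
    have "ennreal (sum f F) = (\<Sum>x\<in>F. ennreal (f x))" by (rule sum_ennreal[symmetric]) (use f in auto)
    also have "\<dots> = (\<integral>\<^sup>+x. ennreal (f x) \<partial>count_space F)" by (rule nn_integral_count_space_finite[symmetric, OF that])
    also have "\<dots> = (\<Sigma>\<^sup>+x. ennreal (f x) * indicator F x)" by (rule nn_integral_count_space_indicator) auto
    also have "\<dots> \<le> (\<Sigma>\<^sup>+x. ennreal (f x))" by (rule nn_integral_mono) (auto split: split_indicator)
    also note le
    finally show ?thesis using B by simp
  qed
  show s: "f summable_on UNIV"
    by (rule nonneg_bdd_above_summable_on) (use f fin in \<open>auto intro!: bdd_aboveI2[where M=B]\<close>)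
  show "infsum f UNIV \<le> B" by (rule infsum_le_finite_sums[OF s]) (use fin in auto)
qed

context stationary_rates
begin

definition C2 :: real where "C2 = C1 * 2 powr (real CARD('d) / 2) * 2 / c0"

lemma C2_pos: "0 < C2" using C1_pos c0 by (simp add: C2_def)

lemma square_grad_sum_decay:
  assumes "nbr 0 e" "0 < t"
  shows "grad_sum (\<lambda>d. d\<^sup>2) e t \<le> ennreal (C2 * t powr (- 1 - real CARD('d) / 2))"
proof -
  have "C1 * (t / 2) powr (- real CARD('d) / 2) * (2 / t) / c0 = C2 * t powr (- 1 - real CARD('d) / 2)"
  proof -
    have "(t / 2) powr (- real CARD('d) / 2) = t powr (- (real CARD('d) / 2)) * 2 powr (real CARD('d) / 2)"
      using assms by (simp add: powr_divide powr_minus field_simps)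
    moreover have "t powr (- 1 - real CARD('d) / 2) = t powr (- (real CARD('d) / 2)) / t"
    proof -
      have "t powr (- 1 - real CARD('d) / 2) = t powr (- 1) * t powr (- (real CARD('d) / 2))"
        by (simp only: powr_add[symmetric]) simp
      then show ?thesis using assms powr_minus_divide[of t 1] by simp
    qed
    ultimately show ?thesis by (simp add: C2_def mult_ac)
  qed
  then show ?thesis using square_grad_sum_bound[OF assms] by simp
qed

definition C3 :: real where "C3 = C1 * C2 * 2 powr (real CARD('d) + 1)"

lemma C3_pos: "0 < C3" using C1_pos C2_pos by (simp add: C3_def)

text \<open>
  By the Chapman-Kolmogorov equation at the midpoint \<open>u\<close> and Cauchy-Schwarz, the squared gradient is
  at most the squared kernel mass on \<open>[s, u]\<close>, which decays deterministically, times the sum over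
  starting points of squared gradients on \<open>[u, t]\<close>, which stationarity turns into a gradient sum.
\<close>

lemma square_grad_pointwise:
  assumes e: "nbr 0 e" and st: "s < t"
  shows "(\<integral>\<^sup>+\<omega>. ennreal ((p \<omega> s t x (y + e) - p \<omega> s t x y)\<^sup>2) \<partial>M) \<le> ennreal (C3 * (t - s) powr (- (real CARD('d) + 1)))"
proof -
  define h where "h = (t - s) / 2"
  define u where "u = s + h"
  have h: "0 < h" "s < u" "u < t" "t = u + h" "u - s = h" using st by (auto simp: h_def u_def field_simps)
  let ?B = "C1 * h powr (- real CARD('d) / 2)"
  let ?D = "\<lambda>\<omega> z. p \<omega> u t z (y + e) - p \<omega> u t z y"
  have "(\<integral>\<^sup>+\<omega>. ennreal ((p \<omega> s t x (y + e) - p \<omega> s t x y)\<^sup>2) \<partial>M) \<le> (\<integral>\<^sup>+\<omega>. ennreal ?B * (\<Sigma>\<^sup>+z. ennreal ((?D \<omega> z)\<^sup>2)) \<partial>M)"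
  proof (rule nn_integral_mono_AE, use AE_good AE_energy_decay[OF h(2), of x] in eventually_elim)
    fix \<omega> assume g: "good \<omega>" and dec: "(\<Sigma>\<^sup>+z. ennreal ((p \<omega> s u x z)\<^sup>2)) \<le> ennreal (C1 * (u - s) powr (- real CARD('d) / 2))"
    let ?d = "p \<omega> s t x (y + e) - p \<omega> s t x y"
    have "ennreal \<bar>?d\<bar> \<le> (\<Sigma>\<^sup>+z. ennreal (p \<omega> s u x z) * ennreal \<bar>?D \<omega> z\<bar>)"
      by (rule abs_jensen) (use p_nonneg p_Chapman_Kolmogorov[OF g, of s u t] h in auto)
    then have "(ennreal \<bar>?d\<bar>)\<^sup>2 \<le> (\<Sigma>\<^sup>+z. ennreal (p \<omega> s u x z) * ennreal \<bar>?D \<omega> z\<bar>)\<^sup>2" by (rule power_mono) simp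
    also have "\<dots> \<le> (\<Sigma>\<^sup>+z. (ennreal (p \<omega> s u x z))\<^sup>2) * (\<Sigma>\<^sup>+z. (ennreal \<bar>?D \<omega> z\<bar>)\<^sup>2)"
      by (rule Cauchy_Schwarz_nn_integral) auto
    also have "\<dots> = (\<Sigma>\<^sup>+z. ennreal ((p \<omega> s u x z)\<^sup>2)) * (\<Sigma>\<^sup>+z. ennreal ((?D \<omega> z)\<^sup>2))"
      by (simp add: ennreal_power p_nonneg)
    also have "\<dots> \<le> ennreal ?B * (\<Sigma>\<^sup>+z. ennreal ((?D \<omega> z)\<^sup>2))"
      using dec unfolding h(5) by (rule mult_right_mono) simp
    finally show "ennreal (?d\<^sup>2) \<le> ennreal ?B * (\<Sigma>\<^sup>+z. ennreal ((?D \<omega> z)\<^sup>2))" by (simp add: ennreal_power)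
  qed
  also have "\<dots> = ennreal ?B * (\<integral>\<^sup>+\<omega>. (\<Sigma>\<^sup>+z. ennreal ((?D \<omega> z)\<^sup>2)) \<partial>M)" by (rule nn_integral_cmult) measurable
  also have "(\<integral>\<^sup>+\<omega>. (\<Sigma>\<^sup>+z. ennreal ((?D \<omega> z)\<^sup>2)) \<partial>M) = (\<Sigma>\<^sup>+z. \<integral>\<^sup>+\<omega>. ennreal ((?D \<omega> z)\<^sup>2) \<partial>M)"
    by (rule nn_integral_esum) measurable
  also have "\<dots> = grad_sum (\<lambda>d. d\<^sup>2) e h"
    unfolding h(4) by (rule grad_sum_shift(2)) measurable
  also have "ennreal ?B * \<dots> \<le> ennreal ?B * ennreal (C2 * h powr (- 1 - real CARD('d) / 2))"
    by (intro mult_left_mono square_grad_sum_decay e h) simp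
  also have "\<dots> = ennreal (?B * (C2 * h powr (- 1 - real CARD('d) / 2)))"
    using C1_pos C2_pos by (intro ennreal_mult[symmetric]) auto
  also have "?B * (C2 * h powr (- 1 - real CARD('d) / 2)) = C1 * C2 * (h powr (- real CARD('d) / 2) * h powr (- 1 - real CARD('d) / 2))"
    by simp
  also have "h powr (- real CARD('d) / 2) * h powr (- 1 - real CARD('d) / 2) = h powr (- (real CARD('d) + 1))"
    unfolding powr_add[symmetric] by (rule arg_cong[where f="\<lambda>r. h powr r"]) (simp add: field_simps)
  also have "h powr (- (real CARD('d) + 1)) = 2 powr (real CARD('d) + 1) * (t - s) powr (- (real CARD('d) + 1))"
  proof -
    have "h powr a = 2 powr (- a) * (t - s) powr a" for a
      unfolding h_def using st by (simp add: powr_divide powr_minus_divide)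
    from this[of "- (real CARD('d) + 1)"] show ?thesis by (simp only: minus_minus)
  qed
  finally show ?thesis by (simp add: C3_def mult.assoc)
qed

text \<open>
  Interpolation between the exponents 1 and 2, splitting the gradients at their typical
  size \<open>t powr (- (d + 1) / 2)\<close>.
\<close>

lemma powr_grad_sum_decay:
  "\<exists>C\<ge>1. \<forall>e t q. nbr 0 e \<and> 1 \<le> t \<and> q \<in> {1..2} \<longrightarrow>
     grad_sum (\<lambda>d. \<bar>d\<bar> powr q) e t \<le> ennreal (C * t powr (- (q + real CARD('d) * (q - 1)) / 2))"
proof -
  obtain C where C: "0 \<le> C" "\<And>e t. nbr 0 e \<Longrightarrow> 1 \<le> t \<Longrightarrow> grad_sum abs e t \<le> ennreal (C / sqrt t)"
    using abs_grad_sum_bound by blast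
  have "grad_sum (\<lambda>d. \<bar>d\<bar> powr q) e t \<le> ennreal ((1 + C + C2) * t powr (- (q + real CARD('d) * (q - 1)) / 2))"
    if e: "nbr 0 e" and t: "1 \<le> t" and q: "q \<in> {1..2}" for e t q
  proof -
    define n where "n = real CARD('d)"
    \<comment> \<open>the inverse of the typical size of a gradient, which makes both bounds equal up to constants\<close>
    define l where "l = t powr ((n + 1) / 2)"
    define r where "r = t powr (- (q + n * (q - 1)) / 2)"
    have l: "0 < l" using t by (simp add: l_def)
    let ?D = "\<lambda>\<omega> y. p \<omega> 0 t 0 (y + e) - p \<omega> 0 t 0 y"
    have "grad_sum (\<lambda>d. \<bar>d\<bar> powr q) e t
      \<le> (\<integral>\<^sup>+\<omega>. (\<Sigma>\<^sup>+y. ennreal (l powr (1 - q)) * ennreal \<bar>?D \<omega> y\<bar> + ennreal (l powr (2 - q)) * ennreal ((?D \<omega> y)\<^sup>2)) \<partial>M)"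
      unfolding grad_sum_def
    proof (intro nn_integral_mono)
      fix \<omega> y
      have "\<bar>?D \<omega> y\<bar> powr q \<le> l powr (1 - q) * \<bar>?D \<omega> y\<bar> + l powr (2 - q) * \<bar>?D \<omega> y\<bar>\<^sup>2"
        by (rule powr_interpolation) (use l q in auto)
      then show "ennreal (\<bar>?D \<omega> y\<bar> powr q) \<le> ennreal (l powr (1 - q)) * ennreal \<bar>?D \<omega> y\<bar> + ennreal (l powr (2 - q)) * ennreal ((?D \<omega> y)\<^sup>2)"
        by (simp add: ennreal_mult[symmetric] ennreal_plus[symmetric] ennreal_leI del: ennreal_plus)
    qed
    also have "\<dots> = ennreal (l powr (1 - q)) * grad_sum abs e t + ennreal (l powr (2 - q)) * grad_sum (\<lambda>d. d\<^sup>2) e t"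
    proof -
      have "(\<lambda>\<omega>. \<Sigma>\<^sup>+y. ennreal \<bar>?D \<omega> y\<bar>) \<in> borel_measurable M" by measurable
      moreover have "(\<lambda>\<omega>. \<Sigma>\<^sup>+y. ennreal ((?D \<omega> y)\<^sup>2)) \<in> borel_measurable M" by measurable
      ultimately show ?thesis unfolding esum_add esum_cmult grad_sum_def
        by (simp add: nn_integral_add nn_integral_cmult)
    qed
    also have "\<dots> \<le> ennreal (l powr (1 - q)) * ennreal (C / sqrt t) + ennreal (l powr (2 - q)) * ennreal (C2 * t powr (- 1 - n / 2))"
      unfolding n_def by (intro add_mono mult_left_mono C(2) square_grad_sum_decay e t) (use t in auto)
    also have "\<dots> = ennreal (l powr (1 - q) * (C / sqrt t) + l powr (2 - q) * (C2 * t powr (- 1 - n / 2)))"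
      using C(1) C2_pos t by (simp add: ennreal_mult[symmetric] ennreal_plus[symmetric] del: ennreal_plus)
    also have "l powr (1 - q) * (C / sqrt t) = C * r"
    proof -
      have "l powr (1 - q) * (C / sqrt t) = C * (t powr ((n + 1) / 2 * (1 - q)) * t powr (- (1 / 2)))"
      proof -
        have "l powr (1 - q) = t powr ((n + 1) / 2 * (1 - q))" by (simp only: l_def powr_powr)
        moreover have "C / sqrt t = C * t powr (- (1 / 2))" using t powr_minus_divide[of t "1/2"] powr_half_sqrt[of t] by simp
        ultimately show ?thesis by (simp only: mult_ac)
      qed
      also have "t powr ((n + 1) / 2 * (1 - q)) * t powr (- (1 / 2)) = r"
        unfolding r_def powr_add[symmetric] by (rule arg_cong[where f="\<lambda>x. t powr x"]) (simp add: field_simps)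
      finally show ?thesis .
    qed
    also have "l powr (2 - q) * (C2 * t powr (- 1 - n / 2)) = C2 * r"
    proof -
      have "l powr (2 - q) * (C2 * t powr (- 1 - n / 2)) = C2 * (t powr ((n + 1) / 2 * (2 - q)) * t powr (- 1 - n / 2))"
        by (simp only: l_def powr_powr mult_ac)
      also have "t powr ((n + 1) / 2 * (2 - q)) * t powr (- 1 - n / 2) = r"
        unfolding r_def powr_add[symmetric] by (rule arg_cong[where f="\<lambda>x. t powr x"]) (simp add: field_simps)
      finally show ?thesis .
    qed
    also have "ennreal (C * r + C2 * r) \<le> ennreal ((1 + C + C2) * r)"
      by (rule ennreal_leI) (simp add: distrib_right r_def)
    finally show ?thesis unfolding r_def n_def .
  qed
  moreover have "1 \<le> 1 + C + C2" using C(1) C2_pos by simp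
  ultimately show ?thesis by blast
qed

text \<open>
  Running time backwards preserves ellipticity, symmetry and stationarity, with the time shifts
  reversed as well.
\<close>

lemma reversed: "stationary_rates M (\<lambda>\<omega>. env_rev (W \<omega>)) (\<lambda>r. \<theta> (- r)) c0"
proof
  show "(\<lambda>p. env_rev (W (fst p)) (snd p) x y) \<in> borel_measurable (M \<Otimes>\<^sub>M borel)" for x y
    unfolding env_rev_def by measurable
  show "env_rev (W \<omega>) \<in> Env" if "\<omega> \<in> space M" for \<omega> using W_Env[OF that] by (simp add: Env_def env_rev_def)
  show "\<theta> (- r) z \<in> M \<rightarrow>\<^sub>M M" "distr M M (\<theta> (- r) z) = M" for r z by (rule \<theta>_meas, rule \<theta>_distr)
  show "env_rev (W (\<theta> (- r) z \<omega>)) = env_shift r z (env_rev (W \<omega>))" if "\<omega> \<in> space M" for r z \<omega>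
    unfolding W_\<theta>[OF that] by (simp add: env_rev_def env_shift_def)
  show "AE \<omega> in M. \<forall>t x y. env_rev (W \<omega>) t x y = env_rev (W \<omega>) t y x"
    using W_sym by eventually_elim (simp add: env_rev_def)
  show "(\<integral>\<^sup>+\<omega>. ennreal (env_rev (W \<omega>) 0 0 y) \<partial>M) < \<infinity>" for y using W_int[of y] by (simp add: env_rev_def)
  show "AE \<omega> in M. c0 \<le> env_rev (W \<omega>) t x y" if "nbr x y" for x y t using W_ell[OF that, of "- t"] by (simp add: env_rev_def)
qed (rule c0)

lemma p_reversed:
  assumes "good \<omega>" shows "p \<omega> s t x y = stationary_rates.p (\<lambda>\<omega>. env_rev (W \<omega>)) \<omega> (- t) (- s) y x"
proof -
  interpret rev: stationary_rates M "\<lambda>\<omega>. env_rev (W \<omega>)" "\<lambda>r. \<theta> (- r)" c0 by (rule reversed)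
  show ?thesis unfolding p_def rev.p_def
    by (subst regular_rates.kern_env_rev) (use goodD[OF assms] in auto)
qed

text \<open>
  Time reversal exchanges the starting point and the end point.
\<close>

lemma start_grad_moment:
  "(\<integral>\<^sup>+\<omega>. ennreal (f (p \<omega> 0 t (y + e) y' - p \<omega> 0 t y y')) \<partial>M)
    = (\<integral>\<^sup>+\<omega>. ennreal (f (stationary_rates.p (\<lambda>\<omega>. env_rev (W \<omega>)) \<omega> (- t) 0 y' (y + e)
        - stationary_rates.p (\<lambda>\<omega>. env_rev (W \<omega>)) \<omega> (- t) 0 y' y)) \<partial>M)"
  by (rule nn_integral_cong_AE, use AE_good in eventually_elim) (simp add: p_reversed[of _ 0 t])

lemma square_grad_decay:
  "\<exists>C\<ge>0. \<forall>e t y y'. nbr 0 e \<and> 0 < t \<longrightarrow>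
      (\<integral>\<^sup>+\<omega>. ennreal ((p \<omega> 0 t y (y' + e) - p \<omega> 0 t y y')\<^sup>2) \<partial>M) \<le> ennreal (C * t powr (- (real CARD('d) + 1)))
    \<and> (\<integral>\<^sup>+\<omega>. ennreal ((p \<omega> 0 t (y + e) y' - p \<omega> 0 t y y')\<^sup>2) \<partial>M) \<le> ennreal (C * t powr (- (real CARD('d) + 1)))"
proof -
  interpret rev: stationary_rates M "\<lambda>\<omega>. env_rev (W \<omega>)" "\<lambda>r. \<theta> (- r)" c0 by (rule reversed)
  define C where "C = max C3 rev.C3"
  have C: "0 \<le> C" using C3_pos by (simp add: C_def)
  have "(\<integral>\<^sup>+\<omega>. ennreal ((p \<omega> 0 t y (y' + e) - p \<omega> 0 t y y')\<^sup>2) \<partial>M) \<le> ennreal (C * t powr (- (real CARD('d) + 1)))"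
    and "(\<integral>\<^sup>+\<omega>. ennreal ((p \<omega> 0 t (y + e) y' - p \<omega> 0 t y y')\<^sup>2) \<partial>M) \<le> ennreal (C * t powr (- (real CARD('d) + 1)))"
    if e: "nbr 0 e" and t: "0 < t" for e t y y'
  proof -
    have "ennreal (C3 * t powr (- (real CARD('d) + 1))) \<le> ennreal (C * t powr (- (real CARD('d) + 1)))"
      by (intro ennreal_leI mult_right_mono) (auto simp: C_def)
    then show "(\<integral>\<^sup>+\<omega>. ennreal ((p \<omega> 0 t y (y' + e) - p \<omega> 0 t y y')\<^sup>2) \<partial>M) \<le> ennreal (C * t powr (- (real CARD('d) + 1)))"
      using square_grad_pointwise[OF e t, of y y'] by simp
    have "ennreal (rev.C3 * t powr (- (real CARD('d) + 1))) \<le> ennreal (C * t powr (- (real CARD('d) + 1)))"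
      by (intro ennreal_leI mult_right_mono) (auto simp: C_def)
    then show "(\<integral>\<^sup>+\<omega>. ennreal ((p \<omega> 0 t (y + e) y' - p \<omega> 0 t y y')\<^sup>2) \<partial>M) \<le> ennreal (C * t powr (- (real CARD('d) + 1)))"
      unfolding start_grad_moment[of "\<lambda>d. d\<^sup>2"] using rev.square_grad_pointwise[OF e, of "- t" 0 y' y] t by simp
  qed
  then show ?thesis using C by blast
qed

lemma powr_grad_decay:
  "\<exists>C\<ge>1. \<forall>e t q y. nbr 0 e \<and> 1 \<le> t \<and> q \<in> {1..2} \<longrightarrow>
      (\<Sigma>\<^sup>+y'. \<integral>\<^sup>+\<omega>. ennreal (\<bar>p \<omega> 0 t y (y' + e) - p \<omega> 0 t y y'\<bar> powr q) \<partial>M) \<le> ennreal (C * t powr (- (q + real CARD('d) * (q - 1)) / 2))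
    \<and> (\<Sigma>\<^sup>+y'. \<integral>\<^sup>+\<omega>. ennreal (\<bar>p \<omega> 0 t (y + e) y' - p \<omega> 0 t y y'\<bar> powr q) \<partial>M) \<le> ennreal (C * t powr (- (q + real CARD('d) * (q - 1)) / 2))"
proof -
  interpret rev: stationary_rates M "\<lambda>\<omega>. env_rev (W \<omega>)" "\<lambda>r. \<theta> (- r)" c0 by (rule reversed)
  obtain A where A: "1 \<le> A" "\<And>e t q. nbr 0 e \<and> 1 \<le> t \<and> q \<in> {1..2} \<Longrightarrow>
     grad_sum (\<lambda>d. \<bar>d\<bar> powr q) e t \<le> ennreal (A * t powr (- (q + real CARD('d) * (q - 1)) / 2))"
    using powr_grad_sum_decay by blast
  obtain B where B: "1 \<le> B" "\<And>e t q. nbr 0 e \<and> 1 \<le> t \<and> q \<in> {1..2} \<Longrightarrow>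
     rev.grad_sum (\<lambda>d. \<bar>d\<bar> powr q) e t \<le> ennreal (B * t powr (- (q + real CARD('d) * (q - 1)) / 2))"
    using rev.powr_grad_sum_decay by blast
  have le: "ennreal (A * r) \<le> ennreal (max A B * r)" "ennreal (B * r) \<le> ennreal (max A B * r)" if "0 \<le> r" for r
    using that by (auto intro!: ennreal_leI mult_right_mono)
  show ?thesis
  proof (intro exI[of _ "max A B"] conjI allI impI)
    show "1 \<le> max A B" using A by simp
    fix e :: "'d site" and t q :: real and y :: "'d site" assume a: "nbr 0 e \<and> 1 \<le> t \<and> q \<in> {1..2}"
    have m: "(\<lambda>d::real. \<bar>d\<bar> powr q) \<in> borel_measurable borel" by measurable
    have "(\<Sigma>\<^sup>+y'. \<integral>\<^sup>+\<omega>. ennreal (\<bar>p \<omega> 0 t y (y' + e) - p \<omega> 0 t y y'\<bar> powr q) \<partial>M) = grad_sum (\<lambda>d. \<bar>d\<bar> powr q) e t"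
      using grad_sum_shift(1)[OF m, of 0 t y e] by simp
    also note A(2)[OF a]
    also note le(1)
    finally show "(\<Sigma>\<^sup>+y'. \<integral>\<^sup>+\<omega>. ennreal (\<bar>p \<omega> 0 t y (y' + e) - p \<omega> 0 t y y'\<bar> powr q) \<partial>M)
      \<le> ennreal (max A B * t powr (- (q + real CARD('d) * (q - 1)) / 2))" by simp
    have "(\<Sigma>\<^sup>+y'. \<integral>\<^sup>+\<omega>. ennreal (\<bar>p \<omega> 0 t (y + e) y' - p \<omega> 0 t y y'\<bar> powr q) \<partial>M) = rev.grad_sum (\<lambda>d. \<bar>d\<bar> powr q) e t"
      unfolding start_grad_moment[of "\<lambda>d. \<bar>d\<bar> powr q"]
      using rev.grad_sum_shift(2)[OF m, of "- t" t y e] by simp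
    also note B(2)[OF a]
    also note le(2)
    finally show "(\<Sigma>\<^sup>+y'. \<integral>\<^sup>+\<omega>. ennreal (\<bar>p \<omega> 0 t (y + e) y' - p \<omega> 0 t y y'\<bar> powr q) \<partial>M)
      \<le> ennreal (max A B * t powr (- (q + real CARD('d) * (q - 1)) / 2))" by simp
  qed
qed

text \<open>
  By the Chapman-Kolmogorov equation at the midpoint, the second difference is a sum over the intermediate
  site of products of a gradient in the starting point and a gradient in the end point. Each product
  is at most half the sum of the squares, and these sum to gradient sums over time \<open>t / 2\<close>, one
  of them for the reversed rates.
\<close>

lemma mixed_grad_decay:
  "\<exists>C\<ge>0. \<forall>e e' t y y'. nbr 0 e \<and> nbr 0 e' \<and> 0 < t \<longrightarrow>
      (\<integral>\<^sup>+\<omega>. ennreal \<bar>p \<omega> 0 t (y + e) (y' + e') - p \<omega> 0 t y (y' + e') - p \<omega> 0 t (y + e) y' + p \<omega> 0 t y y'\<bar> \<partial>M)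
        \<le> ennreal (C * t powr (- 1 - real CARD('d) / 2))"
proof -
  interpret rev: stationary_rates M "\<lambda>\<omega>. env_rev (W \<omega>)" "\<lambda>r. \<theta> (- r)" c0 by (rule reversed)
  define c where "c = (rev.C2 + C2) / 2"
  have c: "0 \<le> c" using C2_pos rev.C2_pos by (simp add: c_def)
  have "(\<integral>\<^sup>+\<omega>. ennreal \<bar>p \<omega> 0 t (y + e) (y' + e') - p \<omega> 0 t y (y' + e') - p \<omega> 0 t (y + e) y' + p \<omega> 0 t y y'\<bar> \<partial>M)
        \<le> ennreal (c * 2 powr (1 + real CARD('d) / 2) * t powr (- 1 - real CARD('d) / 2))"
    if e: "nbr 0 e" "nbr 0 e'" and t: "0 < t" for e e' t and y y' :: "'d site"
  proof -
    define s where "s = t / 2"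
    have s: "0 < s" "s < t" "t = s + s" using t by (auto simp: s_def)
    let ?U = "\<lambda>\<omega> z. p \<omega> 0 s (y + e) z - p \<omega> 0 s y z"
    let ?V = "\<lambda>\<omega> z. p \<omega> s t z (y' + e') - p \<omega> s t z y'"
    let ?X = "\<lambda>\<omega>. p \<omega> 0 t (y + e) (y' + e') - p \<omega> 0 t y (y' + e') - p \<omega> 0 t (y + e) y' + p \<omega> 0 t y y'"
    have "(\<integral>\<^sup>+\<omega>. ennreal \<bar>?X \<omega>\<bar> \<partial>M)
      \<le> (\<integral>\<^sup>+\<omega>. (\<Sigma>\<^sup>+z. ennreal (1/2) * (ennreal ((?U \<omega> z)\<^sup>2) + ennreal ((?V \<omega> z)\<^sup>2))) \<partial>M)"
    proof (rule nn_integral_mono_AE, use AE_good in eventually_elim)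
      fix \<omega> assume g: "good \<omega>"
      let ?al = "\<lambda>z. p \<omega> 0 s (y + e) z * p \<omega> s t z (y' + e') + p \<omega> 0 s y z * p \<omega> s t z y'"
      let ?be = "\<lambda>z. p \<omega> 0 s y z * p \<omega> s t z (y' + e') + p \<omega> 0 s (y + e) z * p \<omega> s t z y'"
      have ck: "ennreal (p \<omega> 0 t a b + p \<omega> 0 t a' b') = (\<Sigma>\<^sup>+z. ennreal (p \<omega> 0 s a z * p \<omega> s t z b + p \<omega> 0 s a' z * p \<omega> s t z b'))" for a b a' b'
      proof -
        have PC: "ennreal (p \<omega> 0 t a b) = (\<Sigma>\<^sup>+z. ennreal (p \<omega> 0 s a z * p \<omega> s t z b))" for a b
          by (rule p_Chapman_Kolmogorov[OF g]) (use s in auto)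
        have "ennreal (p \<omega> 0 t a b + p \<omega> 0 t a' b') = ennreal (p \<omega> 0 t a b) + ennreal (p \<omega> 0 t a' b')"
          by (intro ennreal_plus p_nonneg)
        also have "\<dots> = (\<Sigma>\<^sup>+z. ennreal (p \<omega> 0 s a z * p \<omega> s t z b)) + (\<Sigma>\<^sup>+z. ennreal (p \<omega> 0 s a' z * p \<omega> s t z b'))"
          unfolding PC ..
        also have "\<dots> = (\<Sigma>\<^sup>+z. ennreal (p \<omega> 0 s a z * p \<omega> s t z b + p \<omega> 0 s a' z * p \<omega> s t z b'))"
          unfolding esum_add[symmetric] by (intro nn_integral_cong ennreal_plus[symmetric] mult_nonneg_nonneg p_nonneg)
        finally show ?thesis .
      qed
      have "ennreal \<bar>?X \<omega>\<bar> = ennreal \<bar>(p \<omega> 0 t (y + e) (y' + e') + p \<omega> 0 t y y') - (p \<omega> 0 t y (y' + e') + p \<omega> 0 t (y + e) y')\<bar>"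
        by (simp add: algebra_simps)
      also have "\<dots> \<le> (\<Sigma>\<^sup>+z. ennreal \<bar>?al z - ?be z\<bar>)"
        by (rule esum_abs_diff_le[OF _ _ _ _ ck ck]) (auto intro!: add_nonneg_nonneg mult_nonneg_nonneg p_nonneg)
      also have "\<dots> \<le> (\<Sigma>\<^sup>+z. ennreal (1/2) * (ennreal ((?U \<omega> z)\<^sup>2) + ennreal ((?V \<omega> z)\<^sup>2)))"
      proof (rule nn_integral_mono)
        fix z
        have eq: "?al z - ?be z = ?U \<omega> z * ?V \<omega> z" by (simp add: algebra_simps)
        have am: "\<bar>a * b\<bar> \<le> 1/2 * (a\<^sup>2 + b\<^sup>2)" for a b :: real
          using zero_le_power2[of "\<bar>a\<bar> - \<bar>b\<bar>"] by (simp add: power2_diff abs_mult)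
        have "ennreal \<bar>?al z - ?be z\<bar> \<le> ennreal (1/2 * ((?U \<omega> z)\<^sup>2 + (?V \<omega> z)\<^sup>2))"
          unfolding eq by (rule ennreal_leI[OF am])
        also have "\<dots> = ennreal (1/2) * (ennreal ((?U \<omega> z)\<^sup>2) + ennreal ((?V \<omega> z)\<^sup>2))"
          by (subst ennreal_mult) (auto simp: ennreal_plus)
        finally show "ennreal \<bar>?al z - ?be z\<bar> \<le> ennreal (1/2) * (ennreal ((?U \<omega> z)\<^sup>2) + ennreal ((?V \<omega> z)\<^sup>2))" .
      qed
      finally show "ennreal \<bar>?X \<omega>\<bar> \<le> (\<Sigma>\<^sup>+z. ennreal (1/2) * (ennreal ((?U \<omega> z)\<^sup>2) + ennreal ((?V \<omega> z)\<^sup>2)))" .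
    qed
    also have "\<dots> = ennreal (1/2) * ((\<integral>\<^sup>+\<omega>. (\<Sigma>\<^sup>+z. ennreal ((?U \<omega> z)\<^sup>2)) \<partial>M) + (\<integral>\<^sup>+\<omega>. (\<Sigma>\<^sup>+z. ennreal ((?V \<omega> z)\<^sup>2)) \<partial>M))"
    proof -
      have "(\<lambda>\<omega>. \<Sigma>\<^sup>+z. ennreal ((?U \<omega> z)\<^sup>2)) \<in> borel_measurable M" by measurable
      moreover have "(\<lambda>\<omega>. \<Sigma>\<^sup>+z. ennreal ((?V \<omega> z)\<^sup>2)) \<in> borel_measurable M" by measurable
      ultimately show ?thesis unfolding esum_add esum_cmult
        by (simp add: nn_integral_add nn_integral_cmult)
    qed
    also have "(\<integral>\<^sup>+\<omega>. (\<Sigma>\<^sup>+z. ennreal ((?V \<omega> z)\<^sup>2)) \<partial>M) = grad_sum (\<lambda>d. d\<^sup>2) e' s"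
    proof -
      have "(\<integral>\<^sup>+\<omega>. (\<Sigma>\<^sup>+z. ennreal ((?V \<omega> z)\<^sup>2)) \<partial>M) = (\<Sigma>\<^sup>+z. \<integral>\<^sup>+\<omega>. ennreal ((?V \<omega> z)\<^sup>2) \<partial>M)"
        by (rule nn_integral_esum) measurable
      also have "\<dots> = grad_sum (\<lambda>d. d\<^sup>2) e' s" unfolding s(3) by (rule grad_sum_shift(2)) measurable
      finally show ?thesis .
    qed
    also have "(\<integral>\<^sup>+\<omega>. (\<Sigma>\<^sup>+z. ennreal ((?U \<omega> z)\<^sup>2)) \<partial>M) = rev.grad_sum (\<lambda>d. d\<^sup>2) e s"
    proof -
      have "(\<integral>\<^sup>+\<omega>. (\<Sigma>\<^sup>+z. ennreal ((?U \<omega> z)\<^sup>2)) \<partial>M) = (\<Sigma>\<^sup>+z. \<integral>\<^sup>+\<omega>. ennreal ((?U \<omega> z)\<^sup>2) \<partial>M)"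
        by (rule nn_integral_esum) measurable
      also have "\<dots> = (\<Sigma>\<^sup>+z. \<integral>\<^sup>+\<omega>. ennreal ((rev.p \<omega> (- s) (- s + s) z (y + e) - rev.p \<omega> (- s) (- s + s) z y)\<^sup>2) \<partial>M)"
        unfolding start_grad_moment[of "\<lambda>d. d\<^sup>2"] by simp
      also have "\<dots> = rev.grad_sum (\<lambda>d. d\<^sup>2) e s" by (rule rev.grad_sum_shift(2)) measurable
      finally show ?thesis .
    qed
    also have "ennreal (1/2) * (rev.grad_sum (\<lambda>d. d\<^sup>2) e s + grad_sum (\<lambda>d. d\<^sup>2) e' s)
      \<le> ennreal (1/2) * (ennreal (rev.C2 * s powr (- 1 - real CARD('d) / 2)) + ennreal (C2 * s powr (- 1 - real CARD('d) / 2)))"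
      by (intro mult_left_mono add_mono rev.square_grad_sum_decay square_grad_sum_decay e s) simp
    also have "\<dots> = ennreal (c * s powr (- 1 - real CARD('d) / 2))"
    proof -
      have "ennreal (1/2) * (ennreal (A * r) + ennreal (B * r)) = ennreal ((A + B) / 2 * r)" if "0 \<le> A" "0 \<le> B" "0 \<le> r" for A B r :: real
      proof -
        have "ennreal (A * r) + ennreal (B * r) = ennreal ((A + B) * r)"
          unfolding distrib_right using that by (intro ennreal_plus[symmetric]) auto
        then show ?thesis using that by (simp only:) (subst ennreal_mult[symmetric], auto)
      qed
      from this[of rev.C2 C2 "s powr (- 1 - real CARD('d) / 2)"] show ?thesis
        unfolding c_def using C2_pos rev.C2_pos by simp
    qed
    also have "s powr (- 1 - real CARD('d) / 2) = 2 powr (1 + real CARD('d) / 2) * t powr (- 1 - real CARD('d) / 2)"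
    proof -
      have "s powr a = 2 powr (- a) * t powr a" for a
        unfolding s_def using t by (simp add: powr_divide powr_minus_divide)
      from this[of "- 1 - real CARD('d) / 2"] show ?thesis by (simp add: add.commute)
    qed
    finally show ?thesis by (simp add: mult.assoc)
  qed
  moreover have "0 \<le> c * 2 powr (1 + real CARD('d) / 2)" using c by simp
  ultimately show ?thesis by blast
qed

end


section \<open>Measurability of the heat kernel in the environment\<close>

lemma integral_le_of_nn_integral_le:
  assumes "integrable M f" "\<And>x. 0 \<le> f x" "0 \<le> B" "(\<integral>\<^sup>+x. ennreal (f x) \<partial>M) \<le> ennreal B"
  shows "(\<integral>x. f x \<partial>M) \<le> B"
  using assms by (simp add: nn_integral_eq_integral)

lemma grad1_eq: "grad1 x f y y' = f (y + x) y' - f y y'"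
  by (simp add: grad1_def grad_def add.commute)

lemma grad2_eq: "grad2 x f y y' = f y (y' + x) - f y y'"
  by (simp add: grad2_def grad_def add.commute)

lemma nbr_uminus: "nbr 0 x \<Longrightarrow> nbr 0 (- x)"
  by (simp add: nbr_def l1_dist_def)

context stationary_rates
begin

lemma sets_regular_env: "{\<omega> \<in> space M. regular_env (W \<omega>)} \<in> sets M"
proof -
  define I where "I r t x \<omega> = (\<integral>\<^sup>+u. indicator {r..t} u * ennreal (total_rate (W \<omega>) u x) \<partial>lborel)" for r t x \<omega>
  have [measurable]: "I r t x \<in> borel_measurable M" for r t x
    unfolding I_def by (rule lborel.borel_measurable_nn_integral) measurable
  have "regular_env (W \<omega>) \<longleftrightarrow> (\<forall>x. \<forall>N::nat. I (- real N) (real N) x \<omega> < \<infinity>)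
      \<and> (\<forall>x. \<forall>m K::nat. \<exists>N::nat. ennreal (real K) \<le> I (real m) (real N) x \<omega>)" if "\<omega> \<in> space M" for \<omega>
    unfolding I_def by (rule regular_env_iff_countable[OF W_Env[OF that]]) (use that in measurable)
  then have "{\<omega> \<in> space M. regular_env (W \<omega>)} = {\<omega> \<in> space M. (\<forall>x. \<forall>N::nat. I (- real N) (real N) x \<omega> < \<infinity>)
      \<and> (\<forall>x. \<forall>m K::nat. \<exists>N::nat. ennreal (real K) \<le> I (real m) (real N) x \<omega>)}" by blast
  also have "\<dots> \<in> sets M" by measurable
  finally show ?thesis .
qed

lemma heat_kernel_eq_p:
  assumes "\<omega> \<in> space M" "s \<le> t"
  shows "heat_kernel (W \<omega>) s t x y = (if regular_env (W \<omega>) then p \<omega> s t x y else 0)"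
proof (cases "regular_env (W \<omega>)")
  case True
  have "ennreal (heat_kernel (W \<omega>) s t x y) = kern (W \<omega>) s t x y"
    by (rule regular_rates.heat_kernel_eq_kern) (use True assms W_Env in \<open>auto simp: regular_rates_def\<close>)
  then have "p \<omega> s t x y = enn2real (ennreal (heat_kernel (W \<omega>) s t x y))" by (simp add: p_def)
  then show ?thesis using True by (simp add: heat_kernel_def)
qed (use heat_kernel_irregular[OF W_Env] assms in auto)

lemma heat_kernel_good: "\<omega> \<in> space M \<Longrightarrow> good \<omega> \<Longrightarrow> s \<le> t \<Longrightarrow> heat_kernel (W \<omega>) s t x y = p \<omega> s t x y"
  using regular_rates.reg[OF goodD(1)] by (simp add: heat_kernel_eq_p)

lemma measurable_heat_kernel:
  assumes "s \<le> t"
  shows "(\<lambda>\<omega>. heat_kernel (W \<omega>) s t x y) \<in> borel_measurable M"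
proof -
  have [measurable]: "Measurable.pred M (\<lambda>\<omega>. regular_env (W \<omega>))" using sets_regular_env by (simp add: pred_def)
  have "(\<lambda>\<omega>. if regular_env (W \<omega>) then p \<omega> s t x y else 0) \<in> borel_measurable M" by measurable
  then show ?thesis using heat_kernel_eq_p[OF _ assms] by (simp cong: measurable_cong)
qed

lemma heat_kernel_bounds:
  assumes "\<omega> \<in> space M" "s \<le> t"
  shows "0 \<le> heat_kernel (W \<omega>) s t x y" "heat_kernel (W \<omega>) s t x y \<le> 1"
proof -
  show "0 \<le> heat_kernel (W \<omega>) s t x y" by (simp add: heat_kernel_def)
  show "heat_kernel (W \<omega>) s t x y \<le> 1"
  proof (cases "regular_env (W \<omega>)")
    case True
    then have r: "regular_rates (W \<omega>)" using W_Env assms by (simp add: regular_rates_def)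
    have "ennreal (heat_kernel (W \<omega>) s t x y) \<le> 1"
      unfolding regular_rates.heat_kernel_eq_kern[OF r assms(2)] by (rule regular_rates.kern_le_1[OF r])
    then show ?thesis by simp
  qed (use heat_kernel_irregular[OF W_Env] assms in auto)
qed

lemma integrable_heat_kernel: "s \<le> t \<Longrightarrow> integrable M (\<lambda>\<omega>. heat_kernel (W \<omega>) s t x y)"
  by (rule integrable_const_bound[where B=1]) (use heat_kernel_bounds measurable_heat_kernel in \<open>auto intro!: AE_I2\<close>)

lemma integrable_grad_powr:
  assumes D: "D \<in> {grad1, grad2}" and t: "0 \<le> t" and q: "0 \<le> q"
  shows "integrable M (\<lambda>\<omega>. \<bar>D x (heat_kernel (W \<omega>) 0 t) y y'\<bar> powr q)"
proof (rule integrable_const_bound[where B=1])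
  have [measurable]: "(\<lambda>\<omega>. heat_kernel (W \<omega>) 0 t x y) \<in> borel_measurable M" for x y by (rule measurable_heat_kernel[OF t])
  show "(\<lambda>\<omega>. \<bar>D x (heat_kernel (W \<omega>) 0 t) y y'\<bar> powr q) \<in> borel_measurable M"
    using D unfolding insert_iff empty_iff by (elim disjE FalseE; simp only: grad1_eq grad2_eq; measurable)
  show "AE \<omega> in M. norm (\<bar>D x (heat_kernel (W \<omega>) 0 t) y y'\<bar> powr q) \<le> 1"
  proof (rule AE_I2)
    fix \<omega> assume w: "\<omega> \<in> space M"
    have "\<bar>D x (heat_kernel (W \<omega>) 0 t) y y'\<bar> \<le> 1"
      using D heat_kernel_bounds[OF w t, of y y'] heat_kernel_bounds[OF w t, of "y + x" y'] heat_kernel_bounds[OF w t, of y "y' + x"]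
      by (auto simp: grad1_eq grad2_eq)
    then have "\<bar>D x (heat_kernel (W \<omega>) 0 t) y y'\<bar> powr q \<le> 1 powr q" by (intro powr_mono2 q) auto
    then show "norm (\<bar>D x (heat_kernel (W \<omega>) 0 t) y y'\<bar> powr q) \<le> 1" by simp
  qed
qed

text \<open>
  Transfers bounds from the kernels \<open>p\<close> to both derivatives of the heat kernel. The predicate
  \<open>R\<close> allows bounds at one end point as well as bounds on the sum over all end points.
\<close>

lemma grad_moment_cases:
  assumes D: "D \<in> {grad1, grad2}" and t: "0 \<le> t"
    and 1: "R (\<lambda>y'. \<integral>\<^sup>+\<omega>. ennreal (f (p \<omega> 0 t (y + x) y' - p \<omega> 0 t y y')) \<partial>M)"
    and 2: "R (\<lambda>y'. \<integral>\<^sup>+\<omega>. ennreal (f (p \<omega> 0 t y (y' + x) - p \<omega> 0 t y y')) \<partial>M)"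
  shows "R (\<lambda>y'. \<integral>\<^sup>+\<omega>. ennreal (f (D x (heat_kernel (W \<omega>) 0 t) y y')) \<partial>M)"
proof -
  have "(\<lambda>y'. \<integral>\<^sup>+\<omega>. ennreal (f (grad1 x (heat_kernel (W \<omega>) 0 t) y y')) \<partial>M) = (\<lambda>y'. \<integral>\<^sup>+\<omega>. ennreal (f (p \<omega> 0 t (y + x) y' - p \<omega> 0 t y y')) \<partial>M)"
    by (rule ext, rule nn_integral_cong_AE, use AE_good AE_space in eventually_elim) (simp add: grad1_eq heat_kernel_good t)
  moreover have "(\<lambda>y'. \<integral>\<^sup>+\<omega>. ennreal (f (grad2 x (heat_kernel (W \<omega>) 0 t) y y')) \<partial>M) = (\<lambda>y'. \<integral>\<^sup>+\<omega>. ennreal (f (p \<omega> 0 t y (y' + x) - p \<omega> 0 t y y')) \<partial>M)"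
    by (rule ext, rule nn_integral_cong_AE, use AE_good AE_space in eventually_elim) (simp add: grad2_eq heat_kernel_good t)
  ultimately show ?thesis using D 1 2 by auto
qed


section \<open>Annealed derivative estimates\<close>

theorem grad_L2_estimate:
  "\<exists>C. \<forall>D\<in>{grad1, grad2}. \<forall>x y y' t. nbr 0 x \<and> t \<ge> 1 \<longrightarrow>
     integrable M (\<lambda>\<omega>. \<bar>D x (heat_kernel (W \<omega>) 0 t) y y'\<bar>\<^sup>2) \<and>
     (\<integral>\<omega>. \<bar>D x (heat_kernel (W \<omega>) 0 t) y y'\<bar>\<^sup>2 \<partial>M) powr (1/2) \<le> C * t powr (- (real CARD('d) + 1) / 2)"
proof -
  obtain C where C: "0 \<le> C"
    and b: "\<And>e t y y'. nbr 0 e \<and> 0 < t \<Longrightarrow>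
      (\<integral>\<^sup>+\<omega>. ennreal ((p \<omega> 0 t y (y' + e) - p \<omega> 0 t y y')\<^sup>2) \<partial>M) \<le> ennreal (C * t powr (- (real CARD('d) + 1)))
    \<and> (\<integral>\<^sup>+\<omega>. ennreal ((p \<omega> 0 t (y + e) y' - p \<omega> 0 t y y')\<^sup>2) \<partial>M) \<le> ennreal (C * t powr (- (real CARD('d) + 1)))"
    using square_grad_decay by blast
  have "integrable M (\<lambda>\<omega>. \<bar>D x (heat_kernel (W \<omega>) 0 t) y y'\<bar>\<^sup>2) \<and>
     (\<integral>\<omega>. \<bar>D x (heat_kernel (W \<omega>) 0 t) y y'\<bar>\<^sup>2 \<partial>M) powr (1/2) \<le> C powr (1/2) * t powr (- (real CARD('d) + 1) / 2)"
    if D: "D \<in> {grad1, grad2}" and xt: "nbr 0 x \<and> t \<ge> 1" for D x y y' t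
  proof -
    let ?r = "t powr (- (real CARD('d) + 1))"
    have int: "integrable M (\<lambda>\<omega>. \<bar>D x (heat_kernel (W \<omega>) 0 t) y y'\<bar>\<^sup>2)"
      using integrable_grad_powr[OF D, of t 2 x y y'] xt by simp
    have "(\<integral>\<^sup>+\<omega>. ennreal ((D x (heat_kernel (W \<omega>) 0 t) y y')\<^sup>2) \<partial>M) \<le> ennreal (C * ?r)"
      by (rule grad_moment_cases[OF D, where R="\<lambda>F. F y' \<le> _" and f="\<lambda>d. d\<^sup>2"]) (use b[of x t y y'] xt in auto)
    then have "(\<integral>\<omega>. \<bar>D x (heat_kernel (W \<omega>) 0 t) y y'\<bar>\<^sup>2 \<partial>M) \<le> C * ?r"
      by (intro integral_le_of_nn_integral_le int) (use C in auto)
    then have "(\<integral>\<omega>. \<bar>D x (heat_kernel (W \<omega>) 0 t) y y'\<bar>\<^sup>2 \<partial>M) powr (1/2) \<le> (C * ?r) powr (1/2)"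
      by (intro powr_mono2) (auto intro: Bochner_Integration.integral_nonneg)
    also have "\<dots> = C powr (1/2) * ?r powr (1/2)" by (rule powr_mult)
    also have "?r powr (1/2) = t powr (- (real CARD('d) + 1) / 2)" by (simp add: powr_powr)
    finally show ?thesis using int by blast
  qed
  then show ?thesis by blast
qed

theorem grad_Lp_estimate:
  "\<exists>C\<ge>0. \<forall>D\<in>{grad1, grad2}. \<forall>q x y t. q \<in> {1..2} \<and> nbr 0 x \<and> t \<ge> 1 \<longrightarrow>
     (\<forall>y'. integrable M (\<lambda>\<omega>. \<bar>D x (heat_kernel (W \<omega>) 0 t) y y'\<bar> powr q)) \<and>
     (\<lambda>y'. \<integral>\<omega>. \<bar>D x (heat_kernel (W \<omega>) 0 t) y y'\<bar> powr q \<partial>M) summable_on UNIV \<and>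
     (\<Sum>\<^sub>\<infinity>y'. \<integral>\<omega>. \<bar>D x (heat_kernel (W \<omega>) 0 t) y y'\<bar> powr q \<partial>M) powr (1/q)
       \<le> C * t powr (- (1 + real CARD('d) * (1 - 1/q)) / 2)"
proof -
  obtain C where C: "1 \<le> C"
    and b: "\<And>e t q y. nbr 0 e \<and> 1 \<le> t \<and> q \<in> {1..2} \<Longrightarrow>
      (\<Sigma>\<^sup>+y'. \<integral>\<^sup>+\<omega>. ennreal (\<bar>p \<omega> 0 t y (y' + e) - p \<omega> 0 t y y'\<bar> powr q) \<partial>M) \<le> ennreal (C * t powr (- (q + real CARD('d) * (q - 1)) / 2))
    \<and> (\<Sigma>\<^sup>+y'. \<integral>\<^sup>+\<omega>. ennreal (\<bar>p \<omega> 0 t (y + e) y' - p \<omega> 0 t y y'\<bar> powr q) \<partial>M) \<le> ennreal (C * t powr (- (q + real CARD('d) * (q - 1)) / 2))"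
    using powr_grad_decay by blast
  have "(\<forall>y'. integrable M (\<lambda>\<omega>. \<bar>D x (heat_kernel (W \<omega>) 0 t) y y'\<bar> powr q)) \<and>
     (\<lambda>y'. \<integral>\<omega>. \<bar>D x (heat_kernel (W \<omega>) 0 t) y y'\<bar> powr q \<partial>M) summable_on UNIV \<and>
     (\<Sum>\<^sub>\<infinity>y'. \<integral>\<omega>. \<bar>D x (heat_kernel (W \<omega>) 0 t) y y'\<bar> powr q \<partial>M) powr (1/q)
       \<le> C * t powr (- (1 + real CARD('d) * (1 - 1/q)) / 2)"
    if D: "D \<in> {grad1, grad2}" and a: "q \<in> {1..2} \<and> nbr 0 x \<and> t \<ge> 1" for D q x y t
  proof -
    let ?r = "t powr (- (q + real CARD('d) * (q - 1)) / 2)"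
    define F where "F y' = (\<integral>\<omega>. \<bar>D x (heat_kernel (W \<omega>) 0 t) y y'\<bar> powr q \<partial>M)" for y'
    have q: "1 \<le> q" and t: "0 \<le> t" using a by auto
    have int: "integrable M (\<lambda>\<omega>. \<bar>D x (heat_kernel (W \<omega>) 0 t) y y'\<bar> powr q)" for y'
      by (rule integrable_grad_powr[OF D t]) (use q in simp)
    have F0: "0 \<le> F y'" for y' unfolding F_def by (intro Bochner_Integration.integral_nonneg) auto
    have "ennreal (F y') = (\<integral>\<^sup>+\<omega>. ennreal (\<bar>D x (heat_kernel (W \<omega>) 0 t) y y'\<bar> powr q) \<partial>M)" for y'
      unfolding F_def by (rule nn_integral_eq_integral[symmetric, OF int]) auto
    then have "(\<Sigma>\<^sup>+y'. ennreal (F y')) = (\<Sigma>\<^sup>+y'. \<integral>\<^sup>+\<omega>. ennreal (\<bar>D x (heat_kernel (W \<omega>) 0 t) y y'\<bar> powr q) \<partial>M)" by simp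
    also have "\<dots> \<le> ennreal (C * ?r)"
      by (rule grad_moment_cases[OF D t, where R="\<lambda>F. esum F \<le> ennreal (C * ?r)" and f="\<lambda>d. \<bar>d\<bar> powr q"]) (use b[of x t q y] a in auto)
    finally have le: "(\<Sigma>\<^sup>+y'. ennreal (F y')) \<le> ennreal (C * ?r)" .
    have Cr: "0 \<le> C * ?r" using C by simp
    note S = summable_on_of_esum_le[OF F0 Cr le]
    have "infsum F UNIV powr (1/q) \<le> (C * ?r) powr (1/q)"
      by (rule powr_mono2) (use q S(2) F0 in \<open>auto intro: infsum_nonneg\<close>)
    also have "\<dots> = C powr (1/q) * ?r powr (1/q)" by (rule powr_mult)
    also have "?r powr (1/q) = t powr (- (1 + real CARD('d) * (1 - 1/q)) / 2)"
      unfolding powr_powr by (rule arg_cong[where f="\<lambda>r. t powr r"]) (use q in \<open>simp add: field_simps\<close>)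
    also have "C powr (1/q) * \<dots> \<le> C * \<dots>"
    proof (rule mult_right_mono)
      have "C powr (1/q) \<le> C powr 1" by (rule powr_mono) (use C q in auto)
      then show "C powr (1/q) \<le> C" using C by simp
    qed simp
    finally show ?thesis using int S(1) unfolding F_def by blast
  qed
  moreover have "0 \<le> C" using C by simp
  ultimately show ?thesis by blast
qed

lemma mixed_grad_eq:
  "grad1 e (grad2 e' f) y y' = f (y + e) (y' + e') - f y (y' + e') - f (y + e) y' + f y y'"
  by (simp add: grad1_eq grad2_eq)

lemma annealed_translation:
  assumes "0 \<le> t"
  shows "(\<integral>\<omega>. heat_kernel (W \<omega>) 0 t (x + z) (y + z) \<partial>M) = (\<integral>\<omega>. heat_kernel (W \<omega>) 0 t x y \<partial>M)"
proof -
  have eq: "ennreal (\<integral>\<omega>. heat_kernel (W \<omega>) 0 t x y \<partial>M) = (\<integral>\<^sup>+\<omega>. ennreal (p \<omega> 0 t x y) \<partial>M)" for x y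
  proof -
    have "ennreal (\<integral>\<omega>. heat_kernel (W \<omega>) 0 t x y \<partial>M) = (\<integral>\<^sup>+\<omega>. ennreal (heat_kernel (W \<omega>) 0 t x y) \<partial>M)"
      by (rule nn_integral_eq_integral[symmetric, OF integrable_heat_kernel[OF assms]]) (use heat_kernel_bounds assms in \<open>auto intro!: AE_I2\<close>)
    also have "\<dots> = (\<integral>\<^sup>+\<omega>. ennreal (p \<omega> 0 t x y) \<partial>M)"
      by (rule nn_integral_cong_AE, use AE_good AE_space in eventually_elim) (simp add: heat_kernel_good assms)
    finally show ?thesis .
  qed
  have "(\<integral>\<^sup>+\<omega>. ennreal (enn2real (kern (W \<omega>) 0 t x y)) \<partial>M) = (\<integral>\<^sup>+\<omega>. ennreal (enn2real (kern (env_shift 0 z (W \<omega>)) 0 t x y)) \<partial>M)"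
    by (rule expectation_shift) measurable
  also have "\<dots> = (\<integral>\<^sup>+\<omega>. ennreal (p \<omega> 0 t (x + z) (y + z)) \<partial>M)"
    by (rule nn_integral_cong_AE, use AE_good in eventually_elim) (simp add: p_shift)
  finally have "ennreal (\<integral>\<omega>. heat_kernel (W \<omega>) 0 t x y \<partial>M) = ennreal (\<integral>\<omega>. heat_kernel (W \<omega>) 0 t (x + z) (y + z) \<partial>M)"
    unfolding eq p_def .
  moreover have "0 \<le> (\<integral>\<omega>. heat_kernel (W \<omega>) 0 t x y \<partial>M)" for x y
    by (intro Bochner_Integration.integral_nonneg_AE AE_I2 heat_kernel_bounds assms)
  ultimately show ?thesis by simp
qed

text \<open>
  Translation invariance of the averaged kernel turns the increment \<open>x\<close> of the end point into the
  increment \<open>- x\<close> of the starting point. The second derivative in the end point is thus the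
  expectation of the mixed derivative.
\<close>

theorem mixed_grad_estimate:
  "\<exists>C\<ge>0. \<forall>x x' y y' t. nbr 0 x \<and> nbr 0 x' \<and> t \<ge> 1 \<longrightarrow>
     \<bar>grad2 x (grad2 x' (\<lambda>y y'. \<integral>\<omega>. heat_kernel (W \<omega>) 0 t y y' \<partial>M)) y y'\<bar> \<le> C * t powr (- (real CARD('d) + 2) / 2) \<and>
     integrable M (\<lambda>\<omega>. \<bar>grad1 (- x) (grad2 x' (heat_kernel (W \<omega>) 0 t)) y y'\<bar>) \<and>
     (\<integral>\<omega>. \<bar>grad1 (- x) (grad2 x' (heat_kernel (W \<omega>) 0 t)) y y'\<bar> \<partial>M) \<le> C * t powr (- (real CARD('d) + 2) / 2)"
proof -
  obtain C where C: "0 \<le> C"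
    and b: "\<And>e e' t y y'. nbr 0 e \<and> nbr 0 e' \<and> 0 < t \<Longrightarrow>
      (\<integral>\<^sup>+\<omega>. ennreal \<bar>p \<omega> 0 t (y + e) (y' + e') - p \<omega> 0 t y (y' + e') - p \<omega> 0 t (y + e) y' + p \<omega> 0 t y y'\<bar> \<partial>M)
        \<le> ennreal (C * t powr (- 1 - real CARD('d) / 2))"
    using mixed_grad_decay by blast
  have "\<bar>grad2 x (grad2 x' (\<lambda>y y'. \<integral>\<omega>. heat_kernel (W \<omega>) 0 t y y' \<partial>M)) y y'\<bar> \<le> C * t powr (- (real CARD('d) + 2) / 2) \<and>
     integrable M (\<lambda>\<omega>. \<bar>grad1 (- x) (grad2 x' (heat_kernel (W \<omega>) 0 t)) y y'\<bar>) \<and>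
     (\<integral>\<omega>. \<bar>grad1 (- x) (grad2 x' (heat_kernel (W \<omega>) 0 t)) y y'\<bar> \<partial>M) \<le> C * t powr (- (real CARD('d) + 2) / 2)"
    if a: "nbr 0 x \<and> nbr 0 x' \<and> t \<ge> 1" for x x' y y' t
  proof -
    have t: "0 \<le> t" using a by simp
    let ?h = "\<lambda>\<omega>. heat_kernel (W \<omega>) 0 t"
    let ?G = "\<lambda>\<omega>. grad1 (- x) (grad2 x' (?h \<omega>)) y y'"
    note int_h = integrable_heat_kernel[OF t]
    have intG: "integrable M ?G" unfolding mixed_grad_eq by (intro Bochner_Integration.integrable_add Bochner_Integration.integrable_diff int_h)
    have int: "integrable M (\<lambda>\<omega>. \<bar>?G \<omega>\<bar>)" using intG by (rule integrable_abs)
    have r: "- 1 - real CARD('d) / 2 = - (real CARD('d) + 2) / 2" by (simp add: field_simps)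
    have "(\<integral>\<^sup>+\<omega>. ennreal \<bar>?G \<omega>\<bar> \<partial>M)
      = (\<integral>\<^sup>+\<omega>. ennreal \<bar>p \<omega> 0 t (y + - x) (y' + x') - p \<omega> 0 t y (y' + x') - p \<omega> 0 t (y + - x) y' + p \<omega> 0 t y y'\<bar> \<partial>M)"
      by (rule nn_integral_cong_AE, use AE_good AE_space in eventually_elim) (simp only: mixed_grad_eq heat_kernel_good t)
    also have "\<dots> \<le> ennreal (C * t powr (- (real CARD('d) + 2) / 2))"
      using b[of "- x" x' t y y'] a nbr_uminus[of x] unfolding r by simp
    finally have bnd: "(\<integral>\<omega>. \<bar>?G \<omega>\<bar> \<partial>M) \<le> C * t powr (- (real CARD('d) + 2) / 2)"
      by (intro integral_le_of_nn_integral_le int) (use C in auto)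
    define A where "A = (\<lambda>y y'. \<integral>\<omega>. ?h \<omega> y y' \<partial>M)"
    have tr: "A y (w + x) = A (y + - x) w" for w
      unfolding A_def using annealed_translation[OF t, of "y + - x" x w] by simp
    have "grad2 x (grad2 x' A) y y' = A y ((y' + x') + x) - A y (y' + x) - A y (y' + x') + A y y'"
      by (simp add: grad2_eq algebra_simps)
    also have "\<dots> = A (y + - x) (y' + x') - A y (y' + x') - A (y + - x) y' + A y y'" unfolding tr by simp
    also have "\<dots> = (\<integral>\<omega>. ?G \<omega> \<partial>M)" unfolding mixed_grad_eq A_def
      by (simp only: Bochner_Integration.integral_add Bochner_Integration.integral_diff Bochner_Integration.integrable_add Bochner_Integration.integrable_diff int_h)
    finally have "\<bar>grad2 x (grad2 x' A) y y'\<bar> \<le> (\<integral>\<omega>. \<bar>?G \<omega>\<bar> \<partial>M)"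
      by (simp only: integral_abs_bound)
    then show ?thesis using bnd int unfolding A_def by linarith
  qed
  then show ?thesis using C by blast
qed

end

text \<open>
  The evaluations are continuous for the product topology.
\<close>

lemma borel_measurable_rate:
  fixes P :: "'d::finite env measure"
  assumes "sets P = sets (restrict_space borel (space P))"
  shows "(\<lambda>\<omega>. \<omega> t x y) \<in> borel_measurable P"
proof -
  have "continuous_on UNIV (\<lambda>\<omega>::'d env. \<omega> t x y)"
    by (rule continuous_on_product_then_coordinatewise[OF
        continuous_on_product_then_coordinatewise[OF continuous_on_product_coordinates]])
  then have "(\<lambda>\<omega>::'d env. \<omega> t x y) \<in> borel_measurable borel" by (rule borel_measurable_continuous_onI)
  then have "(\<lambda>\<omega>::'d env. \<omega> t x y) \<in> borel_measurable (restrict_space borel (space P))" by (rule measurable_restrict_space1)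
  then show ?thesis using assms by (simp cong: measurable_cong_sets)
qed

text \<open>
  Joint measurability of the rates in environment and time is not assumed directly: the rate at time
  \<open>t\<close> is the rate at time zero of the environment shifted by \<open>t\<close>, so it follows from joint measurability
  of the shifted events.
\<close>

lemma admissible_stationary_rates:
  fixes P :: "'d::finite env measure" and c0 :: real
  assumes adm: "admissible P" and c0: "c0 > 0"
    and ell: "\<And>x y t. nbr x y \<Longrightarrow> AE \<omega> in P. \<omega> t x y \<ge> c0"
  shows "stationary_rates P (\<lambda>\<omega>. \<omega>) env_shift c0"
proof -
  have prob: "prob_space P" and sp: "space P \<subseteq> Env"
    and st: "sets P = sets (restrict_space borel (space P))"
    and shift: "\<And>s z. env_shift s z \<in> measurable P P" "\<And>s z. distr P P (env_shift s z) = P"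
    and sym: "\<And>x y. nbr x y \<Longrightarrow> AE \<omega> in P. \<forall>t. \<omega> t x y = \<omega> t y x"
    and int: "\<And>x y t. nbr x y \<Longrightarrow> integrable P (\<lambda>\<omega>. \<omega> t x y)"
    and joint: "\<And>A. A \<in> sets P \<Longrightarrow> (\<lambda>(\<omega>, t, x). indicator A (env_shift t x \<omega>) :: real)
        \<in> borel_measurable (P \<Otimes>\<^sub>M (borel \<Otimes>\<^sub>M count_space UNIV))"
    using adm unfolding admissible_def by blast+
  have zero: "\<omega> t x y = 0" if "\<omega> \<in> space P" "\<not> nbr x y" for \<omega> t x y
    using sp that unfolding Env_def by auto
  interpret prob_space P by (rule prob)
  show ?thesis
  proof
    show "(\<lambda>p. fst p (snd p) x y) \<in> borel_measurable (P \<Otimes>\<^sub>M borel)" for x y :: "'d site"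
    proof (rule borel_measurableI_greater)
      fix c :: real
      \<comment> \<open>the section of this event along the time shifts is the superlevel set of the rate\<close>
      define A where "A = {\<omega> \<in> space P. c < \<omega> 0 x y}"
      have "A \<in> sets P" unfolding A_def
        using borel_measurable_rate[OF st, of 0 x y] by measurable
      note j = joint[OF this]
      define g :: "'d env \<times> real \<Rightarrow> real" where "g q = indicator A (env_shift (snd q) 0 (fst q))" for q
      have "(\<lambda>q::'d env \<times> real. (fst q, snd q, 0 :: 'd site)) \<in> P \<Otimes>\<^sub>M borel \<rightarrow>\<^sub>M P \<Otimes>\<^sub>M (borel \<Otimes>\<^sub>M count_space UNIV)"
        by measurable
      from measurable_compose[OF this j] have [measurable]: "g \<in> borel_measurable (P \<Otimes>\<^sub>M borel)"
        by (simp add: g_def[abs_def])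
      have "{q \<in> space (P \<Otimes>\<^sub>M borel). c < fst q (snd q) x y} = {q \<in> space (P \<Otimes>\<^sub>M borel). g q = 1}"
      proof (rule Collect_cong, rule conj_cong[OF refl])
        fix q :: "'d env \<times> real" assume "q \<in> space (P \<Otimes>\<^sub>M borel)"
        then have "env_shift (snd q) 0 (fst q) \<in> space P"
          using measurable_space[OF shift(1)] by (auto simp: space_pair_measure)
        then show "(c < fst q (snd q) x y) = (g q = 1)"
          by (auto simp: g_def A_def env_shift_def indicator_def)
      qed
      also have "\<dots> \<in> sets (P \<Otimes>\<^sub>M borel)" by measurable
      finally show "{q \<in> space (P \<Otimes>\<^sub>M borel). c < fst q (snd q) x y} \<in> sets (P \<Otimes>\<^sub>M borel)" .
    qed
    show "\<omega> \<in> Env" if "\<omega> \<in> space P" for \<omega> using sp that by blast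
    show "env_shift r z \<in> P \<rightarrow>\<^sub>M P" "distr P P (env_shift r z) = P" for r z by (rule shift)+
    show "AE \<omega> in P. \<forall>t x y. \<omega> t x y = \<omega> t y x"
    proof -
      have "AE \<omega> in P. \<forall>t. \<omega> t x y = \<omega> t y x" for x y
      proof (cases "nbr x y")
        case False
        then have "\<not> nbr y x" by (simp add: nbr_commute)
        then show ?thesis using False by (intro AE_I2) (simp add: zero)
      qed (rule sym)
      then have "AE \<omega> in P. \<forall>x y t. \<omega> t x y = \<omega> t y x" by (simp add: AE_all_countable)
      then show ?thesis by eventually_elim blast
    qed
    show "(\<integral>\<^sup>+\<omega>. ennreal (\<omega> 0 0 y) \<partial>P) < \<infinity>" for y
    proof (cases "nbr 0 y")
      case True
      have "(\<integral>\<^sup>+\<omega>. ennreal (\<omega> 0 0 y) \<partial>P) \<le> (\<integral>\<^sup>+\<omega>. ennreal (norm (\<omega> 0 0 y)) \<partial>P)"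
        by (intro nn_integral_mono ennreal_leI) simp
      also have "\<dots> < \<infinity>" using int[OF True, of 0] unfolding integrable_iff_bounded by blast
      finally show ?thesis .
    next
      case False
      have "(\<integral>\<^sup>+\<omega>. ennreal (\<omega> 0 0 y) \<partial>P) = (\<integral>\<^sup>+\<omega>. 0 \<partial>P)"
        by (intro nn_integral_cong) (simp add: zero False)
      then show ?thesis by simp
    qed
    show "AE \<omega> in P. c0 \<le> \<omega> t x y" if "nbr x y" for x y t by (rule ell[OF that])
  qed (rule refl, rule c0)
qed

theorem theorem1p6:
  fixes P :: "'d::finite env measure" and c0 :: real
  assumes "admissible P"
    and "c0 > 0"
    and "\<And>x y t. nbr x y \<Longrightarrow> AE \<omega> in P. \<omega> t x y \<ge> c0"
  shows
   "(\<exists>C::real. \<forall>D\<in>{grad1, grad2}. \<forall>x y y' t. nbr 0 x \<and> t \<ge> 1 \<longrightarrow>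
       integrable P (\<lambda>\<omega>. \<bar>D x (heat_kernel \<omega> 0 t) y y'\<bar>\<^sup>2) \<and>
       (\<integral>\<omega>. \<bar>D x (heat_kernel \<omega> 0 t) y y'\<bar>\<^sup>2 \<partial>P) powr (1/2) \<le> C * t powr (- (real CARD('d) + 1) / 2)) \<and>
    (\<exists>C'::real.
       (\<forall>D\<in>{grad1, grad2}. \<forall>p x y t. p \<in> {1..2} \<and> nbr 0 x \<and> t \<ge> 1 \<longrightarrow>
          (\<forall>y'. integrable P (\<lambda>\<omega>. \<bar>D x (heat_kernel \<omega> 0 t) y y'\<bar> powr p)) \<and>
          (\<lambda>y'. \<integral>\<omega>. \<bar>D x (heat_kernel \<omega> 0 t) y y'\<bar> powr p \<partial>P) summable_on UNIV \<and>
          (\<Sum>\<^sub>\<infinity>y'. \<integral>\<omega>. \<bar>D x (heat_kernel \<omega> 0 t) y y'\<bar> powr p \<partial>P) powr (1/p)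
            \<le> C' * t powr (- (1 + real CARD('d) * (1 - 1/p)) / 2)) \<and>
       (\<forall>x x' y y' t. nbr 0 x \<and> nbr 0 x' \<and> t \<ge> 1 \<longrightarrow>
          integrable P (\<lambda>\<omega>. heat_kernel \<omega> 0 t y y') \<and>
          \<bar>grad2 x (grad2 x' (annealed_kernel P 0 t)) y y'\<bar> \<le> C' * t powr (- (real CARD('d) + 2) / 2) \<and>
          integrable P (\<lambda>\<omega>. \<bar>grad1 (- x) (grad2 x' (heat_kernel \<omega> 0 t)) y y'\<bar>) \<and>
          (\<integral>\<omega>. \<bar>grad1 (- x) (grad2 x' (heat_kernel \<omega> 0 t)) y y'\<bar> \<partial>P)
            \<le> C' * t powr (- (real CARD('d) + 2) / 2)))"
proof -
  interpret stationary_rates P "\<lambda>\<omega>. \<omega>" env_shift c0 by (rule admissible_stationary_rates[OF assms])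
  obtain A where A: "\<forall>D\<in>{grad1, grad2}. \<forall>q x y t. q \<in> {1..2} \<and> nbr 0 x \<and> t \<ge> 1 \<longrightarrow>
     (\<forall>y'. integrable P (\<lambda>\<omega>. \<bar>D x (heat_kernel \<omega> 0 t) y y'\<bar> powr q)) \<and>
     (\<lambda>y'. \<integral>\<omega>. \<bar>D x (heat_kernel \<omega> 0 t) y y'\<bar> powr q \<partial>P) summable_on UNIV \<and>
     (\<Sum>\<^sub>\<infinity>y'. \<integral>\<omega>. \<bar>D x (heat_kernel \<omega> 0 t) y y'\<bar> powr q \<partial>P) powr (1/q)
       \<le> A * t powr (- (1 + real CARD('d) * (1 - 1/q)) / 2)"
    using grad_Lp_estimate by blast
  obtain B where B: "\<forall>x x' y y' t. nbr 0 x \<and> nbr 0 x' \<and> t \<ge> 1 \<longrightarrow>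
     \<bar>grad2 x (grad2 x' (annealed_kernel P 0 t)) y y'\<bar> \<le> B * t powr (- (real CARD('d) + 2) / 2) \<and>
     integrable P (\<lambda>\<omega>. \<bar>grad1 (- x) (grad2 x' (heat_kernel \<omega> 0 t)) y y'\<bar>) \<and>
     (\<integral>\<omega>. \<bar>grad1 (- x) (grad2 x' (heat_kernel \<omega> 0 t)) y y'\<bar> \<partial>P) \<le> B * t powr (- (real CARD('d) + 2) / 2)"
  proof -
    have "(\<lambda>y y'. \<integral>\<omega>. heat_kernel \<omega> 0 t y y' \<partial>P) = annealed_kernel P 0 t" for t
      by (simp add: annealed_kernel_def fun_eq_iff)
    then show ?thesis using mixed_grad_estimate that by metis
  qed
  have le: "u \<le> A * t powr r \<Longrightarrow> u \<le> max A B * t powr r" "u \<le> B * t powr r \<Longrightarrow> u \<le> max A B * t powr r" for u t r :: real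
    by (erule order_trans, rule mult_right_mono, simp, simp)+
  show ?thesis
  proof (rule conjI, rule grad_L2_estimate, rule exI[of _ "max A B"], rule conjI)
    show "\<forall>D\<in>{grad1, grad2}. \<forall>p x y t. p \<in> {1..2} \<and> nbr 0 x \<and> t \<ge> 1 \<longrightarrow>
          (\<forall>y'. integrable P (\<lambda>\<omega>. \<bar>D x (heat_kernel \<omega> 0 t) y y'\<bar> powr p)) \<and>
          (\<lambda>y'. \<integral>\<omega>. \<bar>D x (heat_kernel \<omega> 0 t) y y'\<bar> powr p \<partial>P) summable_on UNIV \<and>
          (\<Sum>\<^sub>\<infinity>y'. \<integral>\<omega>. \<bar>D x (heat_kernel \<omega> 0 t) y y'\<bar> powr p \<partial>P) powr (1/p)
            \<le> max A B * t powr (- (1 + real CARD('d) * (1 - 1/p)) / 2)"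
      using A le(1) by blast
  next
    show "\<forall>x x' y y' t. nbr 0 x \<and> nbr 0 x' \<and> t \<ge> 1 \<longrightarrow>
          integrable P (\<lambda>\<omega>. heat_kernel \<omega> 0 t y y') \<and>
          \<bar>grad2 x (grad2 x' (annealed_kernel P 0 t)) y y'\<bar> \<le> max A B * t powr (- (real CARD('d) + 2) / 2) \<and>
          integrable P (\<lambda>\<omega>. \<bar>grad1 (- x) (grad2 x' (heat_kernel \<omega> 0 t)) y y'\<bar>) \<and>
          (\<integral>\<omega>. \<bar>grad1 (- x) (grad2 x' (heat_kernel \<omega> 0 t)) y y'\<bar> \<partial>P)
            \<le> max A B * t powr (- (real CARD('d) + 2) / 2)"
    proof (intro allI impI, elim conjE, intro conjI)
      fix x x' y y' :: "'d site" and t :: real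
      assume *: "nbr 0 x" "nbr 0 x'" "t \<ge> 1"
      show "integrable P (\<lambda>\<omega>. heat_kernel \<omega> 0 t y y')" by (rule integrable_heat_kernel) (use * in simp)
    qed (use B le(2) in blast)+
  qed
qed

end
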